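(* Let $\mathbb{F}$ be a finite field and $t\in\mathbb{K}$. Let $\mathbb{F}[-]:\mathbf{Sets}^{op}\to\mathbf{Vect}_{\mathbb{F}}$ be the functor sending a finite set $X$ to the space of $\mathbb{F}$-valued functions on $X$. Then $\mathbb{F}[-]$ preserves the degree functions $\delta_t$ on $\mathbf{Sets}^{op}$ and $\delta'_t$ on $\mathbf{Vect}_{\mathbb{F}}$, the pullbacks and the terminal objects. In particular, one obtains a symmetric monoidal functor $$\overline{\mathbb{F}[-]}:\mathcal{T}(\mathbf{Sets}^{op},\delta_t)\to\mathcal{T}(\mathbf{Vect}_{\mathbb{F}},\delta'_t),$$ or, in other words, a symmetric monoidal functor $\overline{\mathbb{F}[-]}:\underline{\mathrm{Rep}}(S_t)\to\underline{\mathrm{Rep}}(GL_t(\mathbb{F}))$.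
   Context: $\mathbb{K}$ is a fixed field. $\mathbf{Sets}$ is the category of finite sets; $\mathbf{Vect}_{\mathbb{F}}$ is the category of finite-dimensional $\mathbb{F}$-vector spaces. A category $\mathcal{A}$ is regular (Knop) if it has a terminal object; all morphisms have images (epi-mono factorizations, unique up to isomorphism); the pullback $x\times_z y$ exists whenever $x\to z\leftarrow y$ can be completed to a commutative square; for any epimorphism $x\twoheadrightarrow z$ and any $y\to z$ the pullback exists; and epimorphisms are preserved under pullbacks. $\mathbf{Sets}^{op}$ and $\mathbf{Vect}_{\mathbb{F}}$ are regular. A degree function on a regular category is a map $\delta$ from its epimorphisms to $\mathbb{K}$, multiplicative under composition, equal to $1$ on identities, and invariant under pullback. A functor $F:\mathcal{A}\to\mathcal{A}'$ preserves degree functions $\delta,\delta'$ if it preserves epimorphisms and $\delta'(F(e))=\delta(e)$ for every epimorphism $e$ in $\mathcal{A}$. Degree functions: on $\mathbf{Sets}^{op}$, $\delta_t(e):=t^{|Y\setminus e(X)|}$ for an injection $e:X\hookrightarrow Y$ viewed as an epimorphism in $\mathbf{Sets}^{op}$; on $\mathbf{Vect}_{\mathbb{F}}$, $\delta'_t(e):=t^{\dim\ker e}$. For a regular category $\mathcal{A}$ with degree function $\delta$, the $\mathbb{K}$-linear category $\mathcal{T}^0(\mathcal{A},\delta)$ has objects $[x]$ for $x\in\mathcal{A}$; morphisms $[x]\to[y]$ are formal $\mathbb{K}$-linear combinations of symbols $\langle r\rangle$ with $r\subset x\times y$ a subobject; composition for $r\subset x\times y$, $s\subset y\times z$ is $\langle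 s\rangle\circ\langle r\rangle:=\delta(e)\langle r\star s\rangle$ if $r\times_y s$ exists, where $r\star s:=\mathrm{im}(r\times_y s\to x\times z)$ and $e:r\times_y s\twoheadrightarrow r\star s$, and $0$ otherwise. $\mathcal{T}(\mathcal{A},\delta)$ is its additive Karoubi completion, symmetric monoidal via $[x]\otimes[y]:=[x\times y]$. Notation: $\underline{\mathrm{Rep}}(S_t):=\mathcal{T}(\mathbf{Sets}^{op},\delta_t)$ and $\underline{\mathrm{Rep}}(GL_t(\mathbb{F})):=\mathcal{T}(\mathbf{Vect}_{\mathbb{F}},\delta'_t)$. For a functor $F$ preserving degree functions, pullbacks and terminal objects, $\overline{F}:\mathcal{T}(\mathcal{A},\delta)\to\mathcal{T}(\mathcal{A}',\delta')$ is the $\mathbb{K}$-linear extension to Karoubi completions of $[x]\mapsto[F(x)]$, $\langle r\rangle\mapsto\langle F(r)\rangle$. *)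

theory Defs
  imports
    "Jordan_Normal_Form.Missing_VectorSpace"
    "Jordan_Normal_Form.Matrix"
    "HOL-Library.Poly_Mapping"
    "HOL-Library.Infinite_Typeclass"
begin

section \<open>Categories\<close>

text \<open>In all concrete categories below an arrow is a triple consisting of a source, a target
  and the underlying datum, so that source and target are determined by the arrow.\<close>

datatype ('o, 'd) arrow = Arrow (arr_dom: 'o) (arr_cod: 'o) (arr_val: 'd)

record ('o, 'a) category =
  Obj :: "'o set"
  Arr :: "'a set"
  Dom :: "'a \<Rightarrow> 'o"
  Cod :: "'a \<Rightarrow> 'o"
  Idn :: "'o \<Rightarrow> 'a"
  Comp :: "'a \<Rightarrow> 'a \<Rightarrow> 'a"  (infixl "\<cdot>\<index>" 70)

definition Hom :: "('o, 'a, 'z) category_scheme \<Rightarrow> 'o \<Rightarrow> 'o \<Rightarrow> 'a set" where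
  "Hom C x y = {f \<in> Arr C. Dom C f = x \<and> Cod C f = y}"

locale category =
  fixes C :: "('o, 'a, 'z) category_scheme" (structure)
  assumes Dom_Obj: "f \<in> Arr C \<Longrightarrow> Dom C f \<in> Obj C"
    and Cod_Obj: "f \<in> Arr C \<Longrightarrow> Cod C f \<in> Obj C"
    and Idn_Hom: "x \<in> Obj C \<Longrightarrow> Idn C x \<in> Hom C x x"
    and Comp_Hom: "\<lbrakk>f \<in> Hom C x y; g \<in> Hom C y z\<rbrakk> \<Longrightarrow> g \<cdot> f \<in> Hom C x z"
    and Comp_Idn: "f \<in> Hom C x y \<Longrightarrow> f \<cdot> Idn C x = f"
    and Idn_Comp: "f \<in> Hom C x y \<Longrightarrow> Idn C y \<cdot> f = f"
    and Comp_assoc: "\<lbrakk>f \<in> Hom C w x; g \<in> Hom C x y; h \<in> Hom C y z\<rbrakk>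
                      \<Longrightarrow> (h \<cdot> g) \<cdot> f = h \<cdot> (g \<cdot> f)"

definition monic :: "('o, 'a, 'z) category_scheme \<Rightarrow> 'a \<Rightarrow> bool" where
  "monic C m \<longleftrightarrow> m \<in> Arr C \<and>
     (\<forall>w. \<forall>g \<in> Hom C w (Dom C m). \<forall>h \<in> Hom C w (Dom C m). m \<cdot>\<^bsub>C\<^esub> g = m \<cdot>\<^bsub>C\<^esub> h \<longrightarrow> g = h)"

definition epic :: "('o, 'a, 'z) category_scheme \<Rightarrow> 'a \<Rightarrow> bool" where
  "epic C e \<longleftrightarrow> e \<in> Arr C \<and>
     (\<forall>w. \<forall>g \<in> Hom C (Cod C e) w. \<forall>h \<in> Hom C (Cod C e) w. g \<cdot>\<^bsub>C\<^esub> e = h \<cdot>\<^bsub>C\<^esub> e \<longrightarrow> g = h)"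

definition iso_arr :: "('o, 'a, 'z) category_scheme \<Rightarrow> 'a \<Rightarrow> bool" where
  "iso_arr C i \<longleftrightarrow> i \<in> Arr C \<and>
     (\<exists>j \<in> Hom C (Cod C i) (Dom C i). j \<cdot>\<^bsub>C\<^esub> i = Idn C (Dom C i) \<and> i \<cdot>\<^bsub>C\<^esub> j = Idn C (Cod C i))"

definition terminal :: "('o, 'a, 'z) category_scheme \<Rightarrow> 'o \<Rightarrow> bool" where
  "terminal C x \<longleftrightarrow> x \<in> Obj C \<and> (\<forall>y \<in> Obj C. \<exists>!f. f \<in> Hom C y x)"

definition commuting_square :: "('o, 'a, 'z) category_scheme \<Rightarrow> 'a \<Rightarrow> 'a \<Rightarrow> 'a \<Rightarrow> 'a \<Rightarrow> bool" where
  "commuting_square C f g p q \<longleftrightarrow>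
     f \<in> Arr C \<and> g \<in> Arr C \<and> p \<in> Arr C \<and> q \<in> Arr C \<and> Cod C f = Cod C g \<and>
     Dom C p = Dom C q \<and> Cod C p = Dom C f \<and> Cod C q = Dom C g \<and> f \<cdot>\<^bsub>C\<^esub> p = g \<cdot>\<^bsub>C\<^esub> q"

definition is_pullback :: "('o, 'a, 'z) category_scheme \<Rightarrow> 'a \<Rightarrow> 'a \<Rightarrow> 'a \<Rightarrow> 'a \<Rightarrow> bool" where
  "is_pullback C f g p q \<longleftrightarrow> commuting_square C f g p q \<and>
     (\<forall>p' q'. commuting_square C f g p' q' \<longrightarrow>
        (\<exists>!u. u \<in> Hom C (Dom C p') (Dom C p) \<and> p \<cdot>\<^bsub>C\<^esub> u = p' \<and> q \<cdot>\<^bsub>C\<^esub> u = q'))"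

text \<open>\<open>image_fact C f e m\<close>: \<open>f = m \<circ> e\<close> is an epi-mono factorization.\<close>

definition image_fact :: "('o, 'a, 'z) category_scheme \<Rightarrow> 'a \<Rightarrow> 'a \<Rightarrow> 'a \<Rightarrow> bool" where
  "image_fact C f e m \<longleftrightarrow> epic C e \<and> monic C m \<and> Cod C e = Dom C m \<and> m \<cdot>\<^bsub>C\<^esub> e = f"

definition is_product :: "('o, 'a, 'z) category_scheme \<Rightarrow> 'o \<Rightarrow> 'o \<Rightarrow> 'a \<Rightarrow> 'a \<Rightarrow> bool" where
  "is_product C x y p q \<longleftrightarrow>
     p \<in> Hom C (Dom C p) x \<and> q \<in> Hom C (Dom C p) y \<and>
     (\<forall>w. \<forall>f \<in> Hom C w x. \<forall>g \<in> Hom C w y.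
        \<exists>!u. u \<in> Hom C w (Dom C p) \<and> p \<cdot>\<^bsub>C\<^esub> u = f \<and> q \<cdot>\<^bsub>C\<^esub> u = g)"


section \<open>Regular categories and degree functions\<close>

locale regular_category = category C
  for C :: "('o, 'a, 'z) category_scheme" (structure) +
  assumes ex_terminal: "\<exists>x. terminal C x"
    and ex_image: "f \<in> Arr C \<Longrightarrow> \<exists>e m. image_fact C f e m"
    and image_unique: "\<lbrakk>image_fact C f e m; image_fact C f e' m'\<rbrakk>
          \<Longrightarrow> \<exists>i \<in> Hom C (Cod C e) (Cod C e'). iso_arr C i \<and> i \<cdot> e = e' \<and> m' \<cdot> i = m"
    and ex_pullback: "commuting_square C f g p q \<Longrightarrow> \<exists>p' q'. is_pullback C f g p' q'"
    and ex_pullback_epic: "\<lbrakk>epic C f; g \<in> Arr C; Cod C f = Cod C g\<rbrakk>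
          \<Longrightarrow> \<exists>p q. is_pullback C f g p q"
    and pullback_epic: "\<lbrakk>epic C f; is_pullback C f g p q\<rbrakk> \<Longrightarrow> epic C q"

locale degree_function = regular_category C
  for C :: "('o, 'a, 'z) category_scheme" (structure) and \<delta> :: "'a \<Rightarrow> 'k::field" +
  assumes degree_Idn: "x \<in> Obj C \<Longrightarrow> \<delta> (Idn C x) = 1"
    and degree_Comp: "\<lbrakk>epic C f; epic C g; Cod C f = Dom C g\<rbrakk> \<Longrightarrow> \<delta> (g \<cdot> f) = \<delta> g * \<delta> f"
    and degree_pullback: "\<lbrakk>epic C f; is_pullback C f g p q\<rbrakk> \<Longrightarrow> \<delta> q = \<delta> f"

locale cat_functor = C: category C + D: category D
  for C :: "('o1, 'a1, 'z1) category_scheme"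
    and D :: "('o2, 'a2, 'z2) category_scheme" +
  fixes Fo :: "'o1 \<Rightarrow> 'o2" and Fa :: "'a1 \<Rightarrow> 'a2"
  assumes Fo_Obj: "x \<in> Obj C \<Longrightarrow> Fo x \<in> Obj D"
    and Fa_Hom: "f \<in> Hom C x y \<Longrightarrow> Fa f \<in> Hom D (Fo x) (Fo y)"
    and Fa_Idn: "x \<in> Obj C \<Longrightarrow> Fa (Idn C x) = Idn D (Fo x)"
    and Fa_Comp: "\<lbrakk>f \<in> Hom C x y; g \<in> Hom C y z\<rbrakk> \<Longrightarrow> Fa (g \<cdot>\<^bsub>C\<^esub> f) = Fa g \<cdot>\<^bsub>D\<^esub> Fa f"

locale degree_preserving_functor =
  cat_functor C D Fo Fa + C: degree_function C \<delta> + D: degree_function D \<delta>'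
  for C :: "('o1, 'a1, 'z1) category_scheme" and \<delta> :: "'a1 \<Rightarrow> 'k::field"
    and D :: "('o2, 'a2, 'z2) category_scheme" and \<delta>' :: "'a2 \<Rightarrow> 'k"
    and Fo :: "'o1 \<Rightarrow> 'o2" and Fa :: "'a1 \<Rightarrow> 'a2" +
  assumes Fa_epic: "epic C e \<Longrightarrow> epic D (Fa e)"
    and Fa_degree: "epic C e \<Longrightarrow> \<delta>' (Fa e) = \<delta> e"

definition preserves_pullbacks ::
  "('o1, 'a1, 'z1) category_scheme \<Rightarrow> ('o2, 'a2, 'z2) category_scheme \<Rightarrow> ('a1 \<Rightarrow> 'a2) \<Rightarrow> bool" where
  "preserves_pullbacks C D Fa \<longleftrightarrow>
     (\<forall>f g p q. is_pullback C f g p q \<longrightarrow> is_pullback D (Fa f) (Fa g) (Fa p) (Fa q))"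

definition preserves_terminal ::
  "('o1, 'a1, 'z1) category_scheme \<Rightarrow> ('o2, 'a2, 'z2) category_scheme \<Rightarrow> ('o1 \<Rightarrow> 'o2) \<Rightarrow> bool" where
  "preserves_terminal C D Fo \<longleftrightarrow> (\<forall>x. terminal C x \<longrightarrow> terminal D (Fo x))"


section \<open>Symmetric monoidal and linear categories\<close>

record ('o, 'a) smcat = "('o, 'a) category" +
  TenO :: "'o \<Rightarrow> 'o \<Rightarrow> 'o"
  TenA :: "'a \<Rightarrow> 'a \<Rightarrow> 'a"
  UnitO :: "'o"
  Assoc :: "'o \<Rightarrow> 'o \<Rightarrow> 'o \<Rightarrow> 'a"
  LUnit :: "'o \<Rightarrow> 'a"
  RUnit :: "'o \<Rightarrow> 'a"
  Braid :: "'o \<Rightarrow> 'o \<Rightarrow> 'a"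

locale symmetric_monoidal_category = category C
  for C :: "('o, 'a, 'z) smcat_scheme" (structure) +
  assumes TenO_Obj: "\<lbrakk>x \<in> Obj C; y \<in> Obj C\<rbrakk> \<Longrightarrow> TenO C x y \<in> Obj C"
    and TenA_Hom: "\<lbrakk>f \<in> Hom C x y; g \<in> Hom C x' y'\<rbrakk>
          \<Longrightarrow> TenA C f g \<in> Hom C (TenO C x x') (TenO C y y')"
    and TenA_Idn: "\<lbrakk>x \<in> Obj C; y \<in> Obj C\<rbrakk>
          \<Longrightarrow> TenA C (Idn C x) (Idn C y) = Idn C (TenO C x y)"
    and TenA_Comp: "\<lbrakk>f \<in> Hom C x y; g \<in> Hom C y z; f' \<in> Hom C x' y'; g' \<in> Hom C y' z'\<rbrakk>
          \<Longrightarrow> TenA C (g \<cdot> f) (g' \<cdot> f') = TenA C g g' \<cdot> TenA C f f'"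
    and UnitO_Obj: "UnitO C \<in> Obj C"
    and Assoc_Hom: "\<lbrakk>x \<in> Obj C; y \<in> Obj C; z \<in> Obj C\<rbrakk>
          \<Longrightarrow> Assoc C x y z \<in> Hom C (TenO C (TenO C x y) z) (TenO C x (TenO C y z))"
    and Assoc_iso: "\<lbrakk>x \<in> Obj C; y \<in> Obj C; z \<in> Obj C\<rbrakk> \<Longrightarrow> iso_arr C (Assoc C x y z)"
    and Assoc_natural: "\<lbrakk>f \<in> Hom C x x'; g \<in> Hom C y y'; h \<in> Hom C z z'\<rbrakk>
          \<Longrightarrow> Assoc C x' y' z' \<cdot> TenA C (TenA C f g) h = TenA C f (TenA C g h) \<cdot> Assoc C x y z"
    and LUnit_Hom: "x \<in> Obj C \<Longrightarrow> LUnit C x \<in> Hom C (TenO C (UnitO C) x) x"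
    and LUnit_iso: "x \<in> Obj C \<Longrightarrow> iso_arr C (LUnit C x)"
    and LUnit_natural: "f \<in> Hom C x y
          \<Longrightarrow> LUnit C y \<cdot> TenA C (Idn C (UnitO C)) f = f \<cdot> LUnit C x"
    and RUnit_Hom: "x \<in> Obj C \<Longrightarrow> RUnit C x \<in> Hom C (TenO C x (UnitO C)) x"
    and RUnit_iso: "x \<in> Obj C \<Longrightarrow> iso_arr C (RUnit C x)"
    and RUnit_natural: "f \<in> Hom C x y
          \<Longrightarrow> RUnit C y \<cdot> TenA C f (Idn C (UnitO C)) = f \<cdot> RUnit C x"
    and Braid_Hom: "\<lbrakk>x \<in> Obj C; y \<in> Obj C\<rbrakk> \<Longrightarrow> Braid C x y \<in> Hom C (TenO C x y) (TenO C y x)"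
    and Braid_natural: "\<lbrakk>f \<in> Hom C x x'; g \<in> Hom C y y'\<rbrakk>
          \<Longrightarrow> Braid C x' y' \<cdot> TenA C f g = TenA C g f \<cdot> Braid C x y"
    and Braid_symmetric: "\<lbrakk>x \<in> Obj C; y \<in> Obj C\<rbrakk>
          \<Longrightarrow> Braid C y x \<cdot> Braid C x y = Idn C (TenO C x y)"
    and pentagon: "\<lbrakk>w \<in> Obj C; x \<in> Obj C; y \<in> Obj C; z \<in> Obj C\<rbrakk>
          \<Longrightarrow> TenA C (Idn C w) (Assoc C x y z) \<cdot> Assoc C w (TenO C x y) z
                \<cdot> TenA C (Assoc C w x y) (Idn C z)
              = Assoc C w x (TenO C y z) \<cdot> Assoc C (TenO C w x) y z"
    and triangle: "\<lbrakk>x \<in> Obj C; y \<in> Obj C\<rbrakk>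
          \<Longrightarrow> TenA C (Idn C x) (LUnit C y) \<cdot> Assoc C x (UnitO C) y = TenA C (RUnit C x) (Idn C y)"
    and hexagon: "\<lbrakk>x \<in> Obj C; y \<in> Obj C; z \<in> Obj C\<rbrakk>
          \<Longrightarrow> Assoc C y z x \<cdot> Braid C x (TenO C y z) \<cdot> Assoc C x y z
              = TenA C (Idn C y) (Braid C x z) \<cdot> Assoc C y x z \<cdot> TenA C (Braid C x y) (Idn C z)"

text \<open>Strong symmetric monoidal functors, with coherence isomorphisms
  \<open>\<mu> x y : F x \<otimes> F y \<rightarrow> F (x \<otimes> y)\<close> and \<open>\<eta> : 1 \<rightarrow> F 1\<close>.\<close>

locale symmetric_monoidal_functor =
  cat_functor C D Fo Fa + C: symmetric_monoidal_category C + D: symmetric_monoidal_category D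
  for C :: "('o1, 'a1, 'z1) smcat_scheme"
    and D :: "('o2, 'a2, 'z2) smcat_scheme"
    and Fo :: "'o1 \<Rightarrow> 'o2" and Fa :: "'a1 \<Rightarrow> 'a2" +
  fixes \<mu> :: "'o1 \<Rightarrow> 'o1 \<Rightarrow> 'a2" and \<eta> :: "'a2"
  assumes mu_Hom: "\<lbrakk>x \<in> Obj C; y \<in> Obj C\<rbrakk>
            \<Longrightarrow> \<mu> x y \<in> Hom D (TenO D (Fo x) (Fo y)) (Fo (TenO C x y))"
    and mu_iso: "\<lbrakk>x \<in> Obj C; y \<in> Obj C\<rbrakk> \<Longrightarrow> iso_arr D (\<mu> x y)"
    and mu_natural: "\<lbrakk>f \<in> Hom C x x'; g \<in> Hom C y y'\<rbrakk>
            \<Longrightarrow> \<mu> x' y' \<cdot>\<^bsub>D\<^esub> TenA D (Fa f) (Fa g) = Fa (TenA C f g) \<cdot>\<^bsub>D\<^esub> \<mu> x y"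
    and eta_Hom: "\<eta> \<in> Hom D (UnitO D) (Fo (UnitO C))"
    and eta_iso: "iso_arr D \<eta>"
    and mu_assoc: "\<lbrakk>x \<in> Obj C; y \<in> Obj C; z \<in> Obj C\<rbrakk>
            \<Longrightarrow> Fa (Assoc C x y z) \<cdot>\<^bsub>D\<^esub> \<mu> (TenO C x y) z \<cdot>\<^bsub>D\<^esub> TenA D (\<mu> x y) (Idn D (Fo z))
                = \<mu> x (TenO C y z) \<cdot>\<^bsub>D\<^esub> TenA D (Idn D (Fo x)) (\<mu> y z) \<cdot>\<^bsub>D\<^esub> Assoc D (Fo x) (Fo y) (Fo z)"
    and mu_lunit: "x \<in> Obj C
            \<Longrightarrow> Fa (LUnit C x) \<cdot>\<^bsub>D\<^esub> \<mu> (UnitO C) x \<cdot>\<^bsub>D\<^esub> TenA D \<eta> (Idn D (Fo x)) = LUnit D (Fo x)"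
    and mu_runit: "x \<in> Obj C
            \<Longrightarrow> Fa (RUnit C x) \<cdot>\<^bsub>D\<^esub> \<mu> x (UnitO C) \<cdot>\<^bsub>D\<^esub> TenA D (Idn D (Fo x)) \<eta> = RUnit D (Fo x)"
    and mu_braid: "\<lbrakk>x \<in> Obj C; y \<in> Obj C\<rbrakk>
            \<Longrightarrow> Fa (Braid C x y) \<cdot>\<^bsub>D\<^esub> \<mu> x y = \<mu> y x \<cdot>\<^bsub>D\<^esub> Braid D (Fo x) (Fo y)"

record ('o, 'a, 'k) lsmcat = "('o, 'a) smcat" +
  ZeroA :: "'o \<Rightarrow> 'o \<Rightarrow> 'a"
  AddA :: "'a \<Rightarrow> 'a \<Rightarrow> 'a"
  SmultA :: "'k \<Rightarrow> 'a \<Rightarrow> 'a"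

locale linear_category = category C
  for C :: "('o, 'a, 'k::field, 'z) lsmcat_scheme" (structure) +
  assumes ZeroA_Hom: "\<lbrakk>x \<in> Obj C; y \<in> Obj C\<rbrakk> \<Longrightarrow> ZeroA C x y \<in> Hom C x y"
    and AddA_Hom: "\<lbrakk>f \<in> Hom C x y; g \<in> Hom C x y\<rbrakk> \<Longrightarrow> AddA C f g \<in> Hom C x y"
    and SmultA_Hom: "f \<in> Hom C x y \<Longrightarrow> SmultA C c f \<in> Hom C x y"
    and AddA_assoc: "\<lbrakk>f \<in> Hom C x y; g \<in> Hom C x y; h \<in> Hom C x y\<rbrakk>
          \<Longrightarrow> AddA C (AddA C f g) h = AddA C f (AddA C g h)"
    and AddA_commute: "\<lbrakk>f \<in> Hom C x y; g \<in> Hom C x y\<rbrakk> \<Longrightarrow> AddA C f g = AddA C g f"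
    and AddA_ZeroA: "f \<in> Hom C x y \<Longrightarrow> AddA C (ZeroA C x y) f = f"
    and AddA_inverse: "f \<in> Hom C x y \<Longrightarrow> AddA C f (SmultA C (- 1) f) = ZeroA C x y"
    and SmultA_one: "f \<in> Hom C x y \<Longrightarrow> SmultA C 1 f = f"
    and SmultA_SmultA: "f \<in> Hom C x y \<Longrightarrow> SmultA C c (SmultA C d f) = SmultA C (c * d) f"
    and SmultA_add: "f \<in> Hom C x y \<Longrightarrow> SmultA C (c + d) f = AddA C (SmultA C c f) (SmultA C d f)"
    and SmultA_AddA: "\<lbrakk>f \<in> Hom C x y; g \<in> Hom C x y\<rbrakk>
          \<Longrightarrow> SmultA C c (AddA C f g) = AddA C (SmultA C c f) (SmultA C c g)"
    and Comp_AddA: "\<lbrakk>f \<in> Hom C x y; f' \<in> Hom C x y; g \<in> Hom C y z\<rbrakk>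
          \<Longrightarrow> g \<cdot> AddA C f f' = AddA C (g \<cdot> f) (g \<cdot> f')"
    and AddA_Comp: "\<lbrakk>f \<in> Hom C x y; g \<in> Hom C y z; g' \<in> Hom C y z\<rbrakk>
          \<Longrightarrow> AddA C g g' \<cdot> f = AddA C (g \<cdot> f) (g' \<cdot> f)"
    and Comp_SmultA: "\<lbrakk>f \<in> Hom C x y; g \<in> Hom C y z\<rbrakk> \<Longrightarrow> g \<cdot> SmultA C c f = SmultA C c (g \<cdot> f)"
    and SmultA_Comp: "\<lbrakk>f \<in> Hom C x y; g \<in> Hom C y z\<rbrakk> \<Longrightarrow> SmultA C c g \<cdot> f = SmultA C c (g \<cdot> f)"

locale linear_functor =
  cat_functor C D Fo Fa + C: linear_category C + D: linear_category D
  for C :: "('o1, 'a1, 'k::field, 'z1) lsmcat_scheme"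
    and D :: "('o2, 'a2, 'k, 'z2) lsmcat_scheme"
    and Fo :: "'o1 \<Rightarrow> 'o2" and Fa :: "'a1 \<Rightarrow> 'a2" +
  assumes Fa_AddA: "\<lbrakk>f \<in> Hom C x y; g \<in> Hom C x y\<rbrakk> \<Longrightarrow> Fa (AddA C f g) = AddA D (Fa f) (Fa g)"
    and Fa_SmultA: "f \<in> Hom C x y \<Longrightarrow> Fa (SmultA C c f) = SmultA D c (Fa f)"


section \<open>Chosen products, subobjects and relations\<close>

text \<open>Only meaningful when the product in question exists.\<close>

definition prod_cone :: "('o, 'a, 'z) category_scheme \<Rightarrow> 'o \<Rightarrow> 'o \<Rightarrow> 'a \<times> 'a" where
  "prod_cone C x y = (SOME (p, q). is_product C x y p q)"

definition pr1 :: "('o, 'a, 'z) category_scheme \<Rightarrow> 'o \<Rightarrow> 'o \<Rightarrow> 'a" where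
  "pr1 C x y = fst (prod_cone C x y)"

definition pr2 :: "('o, 'a, 'z) category_scheme \<Rightarrow> 'o \<Rightarrow> 'o \<Rightarrow> 'a" where
  "pr2 C x y = snd (prod_cone C x y)"

definition prod_obj :: "('o, 'a, 'z) category_scheme \<Rightarrow> 'o \<Rightarrow> 'o \<Rightarrow> 'o" where
  "prod_obj C x y = Dom C (pr1 C x y)"

definition pair :: "('o, 'a, 'z) category_scheme \<Rightarrow> 'a \<Rightarrow> 'a \<Rightarrow> 'a" where
  "pair C f g = (THE u. u \<in> Hom C (Dom C f) (prod_obj C (Cod C f) (Cod C g)) \<and>
     pr1 C (Cod C f) (Cod C g) \<cdot>\<^bsub>C\<^esub> u = f \<and> pr2 C (Cod C f) (Cod C g) \<cdot>\<^bsub>C\<^esub> u = g)"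

definition terminal_obj :: "('o, 'a, 'z) category_scheme \<Rightarrow> 'o" where
  "terminal_obj C = (SOME x. terminal C x)"

definition to_terminal :: "('o, 'a, 'z) category_scheme \<Rightarrow> 'o \<Rightarrow> 'a" where
  "to_terminal C x = (THE f. f \<in> Hom C x (terminal_obj C))"

text \<open>A subobject is an isomorphism class of monomorphisms, represented by the set of its members.\<close>

definition subobj :: "('o, 'a, 'z) category_scheme \<Rightarrow> 'a \<Rightarrow> 'a set" where
  "subobj C m = {m \<cdot>\<^bsub>C\<^esub> i | i. iso_arr C i \<and> Cod C i = Dom C m}"

definition Sub :: "('o, 'a, 'z) category_scheme \<Rightarrow> 'o \<Rightarrow> 'a set set" where
  "Sub C x = {subobj C m | m. monic C m \<and> Cod C m = x}"

definition rep :: "'a set \<Rightarrow> 'a" where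
  "rep r = (SOME m. m \<in> r)"

definition scale :: "'k::field \<Rightarrow> ('b \<Rightarrow>\<^sub>0 'k) \<Rightarrow> ('b \<Rightarrow>\<^sub>0 'k)" where
  "scale c f = Poly_Mapping.map (\<lambda>a. c * a) f"

text \<open>\<open>rel_comp C \<delta> x y z s r\<close> is the composite of the basis elements given by
  \<open>r \<subseteq> x \<times> y\<close> and \<open>s \<subseteq> y \<times> z\<close>.\<close>

definition rel_comp ::
  "('o, 'a, 'z) category_scheme \<Rightarrow> ('a \<Rightarrow> 'k::field) \<Rightarrow> 'o \<Rightarrow> 'o \<Rightarrow> 'o \<Rightarrow> 'a set \<Rightarrow> 'a set
     \<Rightarrow> ('a set \<Rightarrow>\<^sub>0 'k)" where
  "rel_comp C \<delta> x y z s r =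
     (let f = pr2 C x y \<cdot>\<^bsub>C\<^esub> rep r;
          g = pr1 C y z \<cdot>\<^bsub>C\<^esub> rep s
      in if \<exists>p q. is_pullback C f g p q
         then let (p, q) = (SOME (p, q). is_pullback C f g p q);
                  h = pair C (pr1 C x y \<cdot>\<^bsub>C\<^esub> rep r \<cdot>\<^bsub>C\<^esub> p) (pr2 C y z \<cdot>\<^bsub>C\<^esub> rep s \<cdot>\<^bsub>C\<^esub> q);
                  (e, m) = (SOME (e, m). image_fact C h e m)
              in Poly_Mapping.single (subobj C m) (\<delta> e)
         else 0)"

text \<open>For \<open>r \<subseteq> x \<times> y\<close> and \<open>s \<subseteq> x' \<times> y'\<close> this is \<open>r \<times> s\<close>, regarded as a subobject of
  \<open>(x \<times> x') \<times> (y \<times> y')\<close>.\<close>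

definition rel_prod ::
  "('o, 'a, 'z) category_scheme \<Rightarrow> 'o \<Rightarrow> 'o \<Rightarrow> 'o \<Rightarrow> 'o \<Rightarrow> 'a set \<Rightarrow> 'a set \<Rightarrow> 'a set" where
  "rel_prod C x y x' y' r s =
     (let p = rep r \<cdot>\<^bsub>C\<^esub> pr1 C (Dom C (rep r)) (Dom C (rep s));
          q = rep s \<cdot>\<^bsub>C\<^esub> pr2 C (Dom C (rep r)) (Dom C (rep s))
      in subobj C (pair C (pair C (pr1 C x y \<cdot>\<^bsub>C\<^esub> p) (pr1 C x' y' \<cdot>\<^bsub>C\<^esub> q))
                          (pair C (pr2 C x y \<cdot>\<^bsub>C\<^esub> p) (pr2 C x' y' \<cdot>\<^bsub>C\<^esub> q))))"

text \<open>The graph \<open>(id, f) : x \<rightarrow> x \<times> y\<close> of \<open>f : x \<rightarrow> y\<close> and its converse \<open>(f, id) : x \<rightarrow> y \<times> x\<close>,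
  as relations from \<open>x\<close> to \<open>y\<close> and from \<open>y\<close> to \<open>x\<close>, respectively.\<close>

definition graph :: "('o, 'a, 'z) category_scheme \<Rightarrow> 'a \<Rightarrow> ('o, 'a set \<Rightarrow>\<^sub>0 'k::field) arrow" where
  "graph C f = Arrow (Dom C f) (Cod C f)
     (Poly_Mapping.single (subobj C (pair C (Idn C (Dom C f)) f)) 1)"

definition cograph :: "('o, 'a, 'z) category_scheme \<Rightarrow> 'a \<Rightarrow> ('o, 'a set \<Rightarrow>\<^sub>0 'k::field) arrow" where
  "cograph C f = Arrow (Cod C f) (Dom C f)
     (Poly_Mapping.single (subobj C (pair C f (Idn C (Dom C f)))) 1)"


section \<open>The category of relations\<close>

definition relation_category ::
  "('o, 'a, 'z) category_scheme \<Rightarrow> ('a \<Rightarrow> 'k::field)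
     \<Rightarrow> ('o, ('o, 'a set \<Rightarrow>\<^sub>0 'k) arrow, 'k) lsmcat" where
  "relation_category C \<delta> =
     \<lparr> Obj = Obj C,
       Arr = {Arrow x y f | x y f. x \<in> Obj C \<and> y \<in> Obj C \<and>
                Poly_Mapping.keys f \<subseteq> Sub C (prod_obj C x y)},
       Dom = arr_dom,
       Cod = arr_cod,
       Idn = (\<lambda>x. graph C (Idn C x)),
       Comp = (\<lambda>g f. Arrow (arr_dom f) (arr_cod g)
         (\<Sum>r \<in> Poly_Mapping.keys (arr_val f). \<Sum>s \<in> Poly_Mapping.keys (arr_val g).
            scale (Poly_Mapping.lookup (arr_val g) s * Poly_Mapping.lookup (arr_val f) r)
              (rel_comp C \<delta> (arr_dom f) (arr_cod f) (arr_cod g) s r))),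
       TenO = prod_obj C,
       TenA = (\<lambda>f g. Arrow (prod_obj C (arr_dom f) (arr_dom g)) (prod_obj C (arr_cod f) (arr_cod g))
         (\<Sum>r \<in> Poly_Mapping.keys (arr_val f). \<Sum>s \<in> Poly_Mapping.keys (arr_val g).
            Poly_Mapping.single
              (rel_prod C (arr_dom f) (arr_cod f) (arr_dom g) (arr_cod g) r s)
              (Poly_Mapping.lookup (arr_val f) r * Poly_Mapping.lookup (arr_val g) s))),
       UnitO = terminal_obj C,
       Assoc = (\<lambda>x y z. let p = pr1 C (prod_obj C x y) z in
         graph C (pair C (pr1 C x y \<cdot>\<^bsub>C\<^esub> p) (pair C (pr2 C x y \<cdot>\<^bsub>C\<^esub> p) (pr2 C (prod_obj C x y) z)))),
       LUnit = (\<lambda>x. graph C (pr2 C (terminal_obj C) x)),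
       RUnit = (\<lambda>x. graph C (pr1 C x (terminal_obj C))),
       Braid = (\<lambda>x y. graph C (pair C (pr2 C x y) (pr1 C x y))),
       ZeroA = (\<lambda>x y. Arrow x y 0),
       AddA = (\<lambda>f g. Arrow (arr_dom f) (arr_cod f) (arr_val f + arr_val g)),
       SmultA = (\<lambda>c f. Arrow (arr_dom f) (arr_cod f) (scale c (arr_val f))) \<rparr>"


section \<open>Additive and Karoubi completion\<close>

text \<open>Objects of the additive completion are finite lists of objects (formal direct sums).
  An arrow from \<open>xs\<close> to \<open>ys\<close> is a matrix with an entry from \<open>xs ! j\<close> to \<open>ys ! i\<close> in row \<open>i\<close> and
  column \<open>j\<close>.  In \<open>xs \<otimes> ys\<close> the summand \<open>xs ! i \<otimes> ys ! j\<close> has index \<open>i * length ys + j\<close>.\<close>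

definition hom_sum :: "('o, 'a, 'k, 'z) lsmcat_scheme \<Rightarrow> 'o \<Rightarrow> 'o \<Rightarrow> 'a list \<Rightarrow> 'a" where
  "hom_sum C x y fs = foldr (AddA C) fs (ZeroA C x y)"

definition list_tensor :: "('o, 'a, 'z) smcat_scheme \<Rightarrow> 'o list \<Rightarrow> 'o list \<Rightarrow> 'o list" where
  "list_tensor C xs ys = map (\<lambda>(x, y). TenO C x y) (List.product xs ys)"

definition matrix_arrow :: "'o list \<Rightarrow> 'o list \<Rightarrow> (nat \<Rightarrow> nat \<Rightarrow> 'a) \<Rightarrow> ('o list, 'a mat) arrow" where
  "matrix_arrow xs ys m = Arrow xs ys (mat (length ys) (length xs) (\<lambda>(i, j). m i j))"

text \<open>The matrix whose only nonzero entry in column \<open>j\<close> is \<open>f j\<close>, in row \<open>\<pi> j\<close>.\<close>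

definition monomial_arrow ::
  "('o, 'a, 'k, 'z) lsmcat_scheme \<Rightarrow> 'o list \<Rightarrow> 'o list \<Rightarrow> (nat \<Rightarrow> nat) \<Rightarrow> (nat \<Rightarrow> 'a)
     \<Rightarrow> ('o list, 'a mat) arrow" where
  "monomial_arrow C xs ys \<pi> f =
     matrix_arrow xs ys (\<lambda>i j. if i = \<pi> j then f j else ZeroA C (xs ! j) (ys ! i))"

definition additive_completion ::
  "('o, 'a, 'k) lsmcat \<Rightarrow> ('o list, ('o list, 'a mat) arrow, 'k) lsmcat" where
  "additive_completion C =
     \<lparr> Obj = {xs. set xs \<subseteq> Obj C},
       Arr = {Arrow xs ys m | xs ys m. set xs \<subseteq> Obj C \<and> set ys \<subseteq> Obj C \<and>
                m \<in> carrier_mat (length ys) (length xs) \<and>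
                (\<forall>i < length ys. \<forall>j < length xs. m $$ (i, j) \<in> Hom C (xs ! j) (ys ! i))},
       Dom = arr_dom,
       Cod = arr_cod,
       Idn = (\<lambda>xs. monomial_arrow C xs xs id (\<lambda>j. Idn C (xs ! j))),
       Comp = (\<lambda>g f. matrix_arrow (arr_dom f) (arr_cod g)
         (\<lambda>i j. hom_sum C (arr_dom f ! j) (arr_cod g ! i)
            (map (\<lambda>k. arr_val g $$ (i, k) \<cdot>\<^bsub>C\<^esub> arr_val f $$ (k, j)) [0..<length (arr_cod f)]))),
       TenO = list_tensor C,
       TenA = (\<lambda>f g. matrix_arrow
         (list_tensor C (arr_dom f) (arr_dom g)) (list_tensor C (arr_cod f) (arr_cod g))
         (\<lambda>i j. let m = length (arr_cod g); n = length (arr_dom g) in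
            TenA C (arr_val f $$ (i div m, j div n)) (arr_val g $$ (i mod m, j mod n)))),
       UnitO = [UnitO C],
       Assoc = (\<lambda>xs ys zs. let m = length ys; n = length zs in
         monomial_arrow C
           (list_tensor C (list_tensor C xs ys) zs) (list_tensor C xs (list_tensor C ys zs)) id
           (\<lambda>j. Assoc C (xs ! (j div n div m)) (ys ! (j div n mod m)) (zs ! (j mod n)))),
       LUnit = (\<lambda>xs. monomial_arrow C (list_tensor C [UnitO C] xs) xs id (\<lambda>j. LUnit C (xs ! j))),
       RUnit = (\<lambda>xs. monomial_arrow C (list_tensor C xs [UnitO C]) xs id (\<lambda>j. RUnit C (xs ! j))),
       Braid = (\<lambda>xs ys. let m = length xs; n = length ys in
         monomial_arrow C (list_tensor C xs ys) (list_tensor C ys xs)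
           (\<lambda>j. (j mod n) * m + j div n)
           (\<lambda>j. Braid C (xs ! (j div n)) (ys ! (j mod n)))),
       ZeroA = (\<lambda>xs ys. matrix_arrow xs ys (\<lambda>i j. ZeroA C (xs ! j) (ys ! i))),
       AddA = (\<lambda>f g. matrix_arrow (arr_dom f) (arr_cod f)
         (\<lambda>i j. AddA C (arr_val f $$ (i, j)) (arr_val g $$ (i, j)))),
       SmultA = (\<lambda>c f. matrix_arrow (arr_dom f) (arr_cod f)
         (\<lambda>i j. SmultA C c (arr_val f $$ (i, j)))) \<rparr>"

text \<open>Objects of the Karoubi completion are pairs \<open>(x, e)\<close> with \<open>e\<close> an idempotent of \<open>x\<close>;
  an arrow \<open>(x, e) \<rightarrow> (y, d)\<close> is an arrow \<open>f : x \<rightarrow> y\<close> with \<open>d \<circ> f \<circ> e = f\<close>.\<close>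

definition karoubi_obj :: "('o, 'a, 'z) category_scheme \<Rightarrow> ('o \<times> 'a) set" where
  "karoubi_obj C = {(x, e). x \<in> Obj C \<and> e \<in> Hom C x x \<and> e \<cdot>\<^bsub>C\<^esub> e = e}"

definition karoubi_tensor :: "('o, 'a, 'z) smcat_scheme \<Rightarrow> 'o \<times> 'a \<Rightarrow> 'o \<times> 'a \<Rightarrow> 'o \<times> 'a" where
  "karoubi_tensor C X Y = (TenO C (fst X) (fst Y), TenA C (snd X) (snd Y))"

definition karoubi_unit :: "('o, 'a, 'z) smcat_scheme \<Rightarrow> 'o \<times> 'a" where
  "karoubi_unit C = (UnitO C, Idn C (UnitO C))"

definition karoubi_completion ::
  "('o, 'a, 'k) lsmcat \<Rightarrow> ('o \<times> 'a, ('o \<times> 'a, 'a) arrow, 'k) lsmcat" where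
  "karoubi_completion C =
     \<lparr> Obj = karoubi_obj C,
       Arr = {Arrow X Y f | X Y f. X \<in> karoubi_obj C \<and> Y \<in> karoubi_obj C \<and>
                f \<in> Hom C (fst X) (fst Y) \<and> snd Y \<cdot>\<^bsub>C\<^esub> f \<cdot>\<^bsub>C\<^esub> snd X = f},
       Dom = arr_dom,
       Cod = arr_cod,
       Idn = (\<lambda>X. Arrow X X (snd X)),
       Comp = (\<lambda>g f. Arrow (arr_dom f) (arr_cod g) (arr_val g \<cdot>\<^bsub>C\<^esub> arr_val f)),
       TenO = karoubi_tensor C,
       TenA = (\<lambda>f g. Arrow (karoubi_tensor C (arr_dom f) (arr_dom g))
         (karoubi_tensor C (arr_cod f) (arr_cod g)) (TenA C (arr_val f) (arr_val g))),
       UnitO = karoubi_unit C,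
       Assoc = (\<lambda>X Y Z. Arrow
         (karoubi_tensor C (karoubi_tensor C X Y) Z) (karoubi_tensor C X (karoubi_tensor C Y Z))
         (Assoc C (fst X) (fst Y) (fst Z) \<cdot>\<^bsub>C\<^esub> TenA C (TenA C (snd X) (snd Y)) (snd Z))),
       LUnit = (\<lambda>X. Arrow (karoubi_tensor C (karoubi_unit C) X) X
         (LUnit C (fst X) \<cdot>\<^bsub>C\<^esub> TenA C (Idn C (UnitO C)) (snd X))),
       RUnit = (\<lambda>X. Arrow (karoubi_tensor C X (karoubi_unit C)) X
         (RUnit C (fst X) \<cdot>\<^bsub>C\<^esub> TenA C (snd X) (Idn C (UnitO C)))),
       Braid = (\<lambda>X Y. Arrow (karoubi_tensor C X Y) (karoubi_tensor C Y X)
         (Braid C (fst X) (fst Y) \<cdot>\<^bsub>C\<^esub> TenA C (snd X) (snd Y))),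
       ZeroA = (\<lambda>X Y. Arrow X Y (ZeroA C (fst X) (fst Y))),
       AddA = (\<lambda>f g. Arrow (arr_dom f) (arr_cod f) (AddA C (arr_val f) (arr_val g))),
       SmultA = (\<lambda>c f. Arrow (arr_dom f) (arr_cod f) (SmultA C c (arr_val f))) \<rparr>"

type_synonym ('o, 'a, 'k) rel_arrow = "('o, 'a set \<Rightarrow>\<^sub>0 'k) arrow"
type_synonym ('o, 'a, 'k) add_arrow = "('o list, ('o, 'a, 'k) rel_arrow mat) arrow"
type_synonym ('o, 'a, 'k) env_obj = "'o list \<times> ('o, 'a, 'k) add_arrow"
type_synonym ('o, 'a, 'k) env_arrow = "(('o, 'a, 'k) env_obj, ('o, 'a, 'k) add_arrow) arrow"

definition tensor_envelope ::
  "('o, 'a, 'z) category_scheme \<Rightarrow> ('a \<Rightarrow> 'k::field)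
     \<Rightarrow> (('o, 'a, 'k) env_obj, ('o, 'a, 'k) env_arrow, 'k) lsmcat" where
  "tensor_envelope C \<delta> = karoubi_completion (additive_completion (relation_category C \<delta>))"


section \<open>The induced functor between tensor envelopes\<close>

text \<open>\<open>F (r)\<close> as a subobject of \<open>F x \<times> F y \<cong> F (x \<times> y)\<close>, for \<open>r \<subseteq> x \<times> y\<close>.\<close>

definition rel_map ::
  "('o1, 'a1, 'z1) category_scheme \<Rightarrow> ('o2, 'a2, 'z2) category_scheme \<Rightarrow> ('a1 \<Rightarrow> 'a2)
     \<Rightarrow> 'o1 \<Rightarrow> 'o1 \<Rightarrow> 'a1 set \<Rightarrow> 'a2 set" where
  "rel_map C D Fa x y r =
     subobj D (pair D (Fa (pr1 C x y \<cdot>\<^bsub>C\<^esub> rep r)) (Fa (pr2 C x y \<cdot>\<^bsub>C\<^esub> rep r)))"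

definition rel_functor ::
  "('o1, 'a1, 'z1) category_scheme \<Rightarrow> ('o2, 'a2, 'z2) category_scheme
     \<Rightarrow> ('o1 \<Rightarrow> 'o2) \<Rightarrow> ('a1 \<Rightarrow> 'a2) \<Rightarrow> ('o1, 'a1, 'k::field) rel_arrow \<Rightarrow> ('o2, 'a2, 'k) rel_arrow" where
  "rel_functor C D Fo Fa f = Arrow (Fo (arr_dom f)) (Fo (arr_cod f))
     (\<Sum>r \<in> Poly_Mapping.keys (arr_val f).
        Poly_Mapping.single (rel_map C D Fa (arr_dom f) (arr_cod f) r)
          (Poly_Mapping.lookup (arr_val f) r))"

definition add_functor ::
  "('o1 \<Rightarrow> 'o2) \<Rightarrow> ('a1 \<Rightarrow> 'a2) \<Rightarrow> ('o1 list, 'a1 mat) arrow \<Rightarrow> ('o2 list, 'a2 mat) arrow" where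
  "add_functor Fo Fa f =
     Arrow (map Fo (arr_dom f)) (map Fo (arr_cod f)) (map_mat Fa (arr_val f))"

definition env_functor_obj ::
  "('o1, 'a1, 'z1) category_scheme \<Rightarrow> ('o2, 'a2, 'z2) category_scheme
     \<Rightarrow> ('o1 \<Rightarrow> 'o2) \<Rightarrow> ('a1 \<Rightarrow> 'a2) \<Rightarrow> ('o1, 'a1, 'k::field) env_obj \<Rightarrow> ('o2, 'a2, 'k) env_obj" where
  "env_functor_obj C D Fo Fa X =
     (map Fo (fst X), add_functor Fo (rel_functor C D Fo Fa) (snd X))"

definition env_functor ::
  "('o1, 'a1, 'z1) category_scheme \<Rightarrow> ('o2, 'a2, 'z2) category_scheme
     \<Rightarrow> ('o1 \<Rightarrow> 'o2) \<Rightarrow> ('a1 \<Rightarrow> 'a2) \<Rightarrow> ('o1, 'a1, 'k::field) env_arrow \<Rightarrow> ('o2, 'a2, 'k) env_arrow" where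
  "env_functor C D Fo Fa f =
     Arrow (env_functor_obj C D Fo Fa (arr_dom f)) (env_functor_obj C D Fo Fa (arr_cod f))
       (add_functor Fo (rel_functor C D Fo Fa) (arr_val f))"

text \<open>The coherence isomorphisms are induced by the comparison maps
  \<open>F (x \<times> y) \<rightarrow> F x \<times> F y\<close> and \<open>F 1 \<rightarrow> 1\<close>, which point in the opposite direction.\<close>

definition rel_mu ::
  "('o1, 'a1, 'z1) category_scheme \<Rightarrow> ('o2, 'a2, 'z2) category_scheme
     \<Rightarrow> ('a1 \<Rightarrow> 'a2) \<Rightarrow> 'o1 \<Rightarrow> 'o1 \<Rightarrow> ('o2, 'a2, 'k::field) rel_arrow" where
  "rel_mu C D Fa x y = cograph D (pair D (Fa (pr1 C x y)) (Fa (pr2 C x y)))"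

definition rel_eta ::
  "('o1, 'a1, 'z1) category_scheme \<Rightarrow> ('o2, 'a2, 'z2) category_scheme
     \<Rightarrow> ('o1 \<Rightarrow> 'o2) \<Rightarrow> ('o2, 'a2, 'k::field) rel_arrow" where
  "rel_eta C D Fo = cograph D (to_terminal D (Fo (terminal_obj C)))"

definition add_mu ::
  "('o1, 'a1, 'z1) category_scheme \<Rightarrow> ('o2, 'a2, 'z2) category_scheme \<Rightarrow> ('a2 \<Rightarrow> 'k::field)
     \<Rightarrow> ('o1 \<Rightarrow> 'o2) \<Rightarrow> ('a1 \<Rightarrow> 'a2) \<Rightarrow> 'o1 list \<Rightarrow> 'o1 list \<Rightarrow> ('o2, 'a2, 'k) add_arrow" where
  "add_mu C D \<delta>' Fo Fa xs ys =
     monomial_arrow (relation_category D \<delta>')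
       (map (\<lambda>(x, y). prod_obj D (Fo x) (Fo y)) (List.product xs ys))
       (map (\<lambda>(x, y). Fo (prod_obj C x y)) (List.product xs ys)) id
       (\<lambda>j. rel_mu C D Fa (xs ! (j div length ys)) (ys ! (j mod length ys)))"

definition env_mu ::
  "('o1, 'a1, 'z1) category_scheme \<Rightarrow> ('a1 \<Rightarrow> 'k::field)
     \<Rightarrow> ('o2, 'a2, 'z2) category_scheme \<Rightarrow> ('a2 \<Rightarrow> 'k)
     \<Rightarrow> ('o1 \<Rightarrow> 'o2) \<Rightarrow> ('a1 \<Rightarrow> 'a2)
     \<Rightarrow> ('o1, 'a1, 'k) env_obj \<Rightarrow> ('o1, 'a1, 'k) env_obj \<Rightarrow> ('o2, 'a2, 'k) env_arrow" where
  "env_mu C \<delta> D \<delta>' Fo Fa X Y =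
     (let A = additive_completion (relation_category D \<delta>');
          F = env_functor_obj C D Fo Fa;
          T = TenO (tensor_envelope C \<delta>);
          T' = TenO (tensor_envelope D \<delta>')
      in Arrow (T' (F X) (F Y)) (F (T X Y))
           (add_mu C D \<delta>' Fo Fa (fst X) (fst Y) \<cdot>\<^bsub>A\<^esub> TenA A (snd (F X)) (snd (F Y))))"

definition env_eta ::
  "('o1, 'a1, 'z1) category_scheme \<Rightarrow> ('a1 \<Rightarrow> 'k::field)
     \<Rightarrow> ('o2, 'a2, 'z2) category_scheme \<Rightarrow> ('a2 \<Rightarrow> 'k)
     \<Rightarrow> ('o1 \<Rightarrow> 'o2) \<Rightarrow> ('a1 \<Rightarrow> 'a2) \<Rightarrow> ('o2, 'a2, 'k) env_arrow" where
  "env_eta C \<delta> D \<delta>' Fo Fa =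
     Arrow (UnitO (tensor_envelope D \<delta>'))
       (env_functor_obj C D Fo Fa (UnitO (tensor_envelope C \<delta>)))
       (matrix_arrow [terminal_obj D] [Fo (terminal_obj C)] (\<lambda>_ _. rel_eta C D Fo))"


section \<open>Finite sets and finite-dimensional vector spaces\<close>

text \<open>Finite sets are taken inside an arbitrary infinite type, so that every finite set occurs up
  to bijection.  An arrow \<open>X \<rightarrow> Y\<close> of the opposite category is a function from \<open>Y\<close> to \<open>X\<close>.\<close>

definition FinSet_op :: "('u::infinite set, ('u set, 'u \<Rightarrow> 'u) arrow) category" where
  "FinSet_op =
     \<lparr> Obj = {X. finite X},
       Arr = {Arrow X Y f | X Y f. finite X \<and> finite Y \<and> f \<in> Y \<rightarrow>\<^sub>E X},
       Dom = arr_dom,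
       Cod = arr_cod,
       Idn = (\<lambda>X. Arrow X X (\<lambda>x\<in>X. x)),
       Comp = (\<lambda>g f. Arrow (arr_dom f) (arr_cod g)
                 (compose (arr_cod g) (arr_val f) (arr_val g))) \<rparr>"

definition set_degree :: "'k::field \<Rightarrow> ('u set, 'u \<Rightarrow> 'u) arrow \<Rightarrow> 'k" where
  "set_degree t e = t ^ card (arr_dom e - arr_val e ` arr_cod e)"

text \<open>Finite-dimensional vector spaces with carrier inside the type \<open>'v\<close>.\<close>

definition FinVect ::
  "('f, 'r) ring_scheme
     \<Rightarrow> (('f, 'v) module, (('f, 'v) module, 'v \<Rightarrow> 'v) arrow) category" where
  "FinVect K =
     \<lparr> Obj = {V. vectorspace K V \<and> vectorspace.fin_dim K V},
       Arr = {Arrow V W T | V W T. vectorspace.fin_dim K V \<and> vectorspace.fin_dim K W \<and>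
                linear_map K V W T \<and> T \<in> extensional (carrier V)},
       Dom = arr_dom,
       Cod = arr_cod,
       Idn = (\<lambda>V. Arrow V V (\<lambda>v\<in>carrier V. v)),
       Comp = (\<lambda>g f. Arrow (arr_dom f) (arr_cod g)
                 (compose (carrier (arr_dom f)) (arr_val g) (arr_val f))) \<rparr>"

definition vect_degree ::
  "('f, 'r) ring_scheme \<Rightarrow> 'k::field \<Rightarrow> (('f, 'v) module, 'v \<Rightarrow> 'v) arrow \<Rightarrow> 'k" where
  "vect_degree K t e = t ^ vectorspace.dim K
     ((arr_dom e)\<lparr>carrier := mod_hom.ker (arr_dom e) (arr_cod e) (arr_val e)\<rparr>)"

text \<open>The functor \<open>X \<mapsto> \<F>[X]\<close>; on arrows it is precomposition with the underlying function.\<close>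

definition fun_obj :: "('f, 'r) ring_scheme \<Rightarrow> 'u set \<Rightarrow> ('f, 'u \<Rightarrow> 'f) module" where
  "fun_obj K X = ring.func_space K X"

definition fun_arr ::
  "('f, 'r) ring_scheme \<Rightarrow> ('u set, 'u \<Rightarrow> 'u) arrow
     \<Rightarrow> (('f, 'u \<Rightarrow> 'f) module, ('u \<Rightarrow> 'f) \<Rightarrow> ('u \<Rightarrow> 'f)) arrow" where
  "fun_arr K a = Arrow (fun_obj K (arr_dom a)) (fun_obj K (arr_cod a))
     (\<lambda>\<phi> \<in> carrier (fun_obj K (arr_dom a)). compose (arr_cod a) \<phi> (arr_val a))"

abbreviation Rep_S ::
  "'k::field \<Rightarrow> (('u::infinite set, ('u set, 'u \<Rightarrow> 'u) arrow, 'k) env_obj,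
                 ('u set, ('u set, 'u \<Rightarrow> 'u) arrow, 'k) env_arrow, 'k) lsmcat" where
  "Rep_S t \<equiv> tensor_envelope FinSet_op (set_degree t)"

abbreviation Rep_GL ::
  "('f, 'r) ring_scheme \<Rightarrow> 'k::field
     \<Rightarrow> ((('f, 'v) module, (('f, 'v) module, 'v \<Rightarrow> 'v) arrow, 'k) env_obj,
         (('f, 'v) module, (('f, 'v) module, 'v \<Rightarrow> 'v) arrow, 'k) env_arrow, 'k) lsmcat" where
  "Rep_GL K t \<equiv> tensor_envelope (FinVect K) (vect_degree K t)"

end

theory Submission
  imports Defs
begin

text \<open>In both categories all pullbacks exist, so a relation from \<open>x\<close> to \<open>y\<close> may be presented by an
  arbitrary span \<open>x \<leftarrow> w \<rightarrow> y\<close>: it stands for the image of \<open>w \<rightarrow> x \<times> y\<close>, weighted by the degree of the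
  epimorphism onto this image.  Precomposing both legs with an epimorphism \<open>e\<close> multiplies the weighted
  relation by \<open>\<delta> e\<close>, and composition of weighted relations is pullback of spans.  A functor that
  preserves degrees, pullbacks and the terminal object therefore respects composition and products of
  weighted spans and induces a linear monoidal functor on relations, which extends to the additive and
  the Karoubi completion.

  For \<open>\<F>[-]\<close>, a pullback in the opposite category of sets is a pushout of sets; functions on its two
  sides that agree on the common part glue uniquely, so pullbacks are preserved.  Restriction along an
  injection \<open>Y \<rightarrow> X\<close> is surjective and, by rank-nullity, its kernel has dimension \<open>|X| - |Y|\<close>.  Over a
  finite field the dimension is determined by the number of elements, which shows that the degree in
  vector spaces is invariant under pullback.\<close>

section \<open>Categories with pullbacks\<close>

text \<open>Three obstacles shape the development. Representatives of subobjects, pullbacks, images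
  and products are all Hilbert choices, so a composite of relations cannot be computed by unfolding.
  Weighted spans absorb the choices: changing one reparametrises a span by an isomorphism, and
  isomorphisms have degree 1. Next, all objects must live in prescribed types. Pushouts of sets and
  fibre products of vector spaces are finite, so they are built freely and then coded injectively
  into an infinite type; quotients stay in their type through coset representatives. Last, the image
  of a product is only isomorphic to the product of the images, and the comparison map points
  against the coherence arrow; identities are proved for the comparison map and then inverted.
  Coherence itself is never checked on relations: forming graphs is functorial and turns products
  into tensor products, the structure matrices of the additive completion have at most one nonzero
  entry per column, and in the Karoubi completion the structure arrows come from arrows that commute
  with the idempotents.\<close>

lemma Hom_iff: "f \<in> Hom C x y \<longleftrightarrow> f \<in> Arr C \<and> Dom C f = x \<and> Cod C f = y"
  by (auto simp: Hom_def)

context category begin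

declare Dom_Obj [simp] Cod_Obj [simp]

lemma Idn_simps [simp]:
  assumes "x \<in> Obj C"
  shows "Idn C x \<in> Arr C" "Dom C (Idn C x) = x" "Cod C (Idn C x) = x"
  using Idn_Hom [OF assms] by (auto simp: Hom_iff)

lemma Comp_simps [simp]:
  assumes "f \<in> Arr C" "g \<in> Arr C" "Cod C f = Dom C g"
  shows "g \<cdot> f \<in> Arr C" "Dom C (g \<cdot> f) = Dom C f" "Cod C (g \<cdot> f) = Cod C g"
  using Comp_Hom [of f "Dom C f" "Dom C g" g "Cod C g"] assms by (auto simp: Hom_iff)

lemma Comp_Idn_simp [simp]: "\<lbrakk>f \<in> Arr C; Dom C f = x\<rbrakk> \<Longrightarrow> f \<cdot> Idn C x = f"
  using Comp_Idn by (auto simp: Hom_iff)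

lemma Idn_Comp_simp [simp]: "\<lbrakk>f \<in> Arr C; Cod C f = x\<rbrakk> \<Longrightarrow> Idn C x \<cdot> f = f"
  using Idn_Comp by (auto simp: Hom_iff)

lemma Comp_assoc_simp [simp]:
  "\<lbrakk>f \<in> Arr C; g \<in> Arr C; h \<in> Arr C; Cod C f = Dom C g; Cod C g = Dom C h\<rbrakk>
    \<Longrightarrow> (h \<cdot> g) \<cdot> f = h \<cdot> (g \<cdot> f)"
  by (rule Comp_assoc [of f "Dom C f" "Dom C g" g "Dom C h" h "Cod C h"]) (auto simp: Hom_iff)

text \<open>Composites are normalised to right-nested form, where \<open>g \<cdot> f\<close> is no
  longer a subterm once something is composed on the right. This is the shape in which an equation
  for \<open>g \<cdot> f\<close> still matches there.\<close>

lemma Comp_eq_extend: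
  assumes "g \<cdot> f = h" "f \<in> Arr C" "g \<in> Arr C" "Cod C f = Dom C g" "k \<in> Arr C" "Cod C k = Dom C f"
  shows "g \<cdot> (f \<cdot> k) = h \<cdot> k"
  using assms Comp_assoc_simp by metis

lemma monicD:
  assumes "monic C m" "m \<cdot> g = m \<cdot> h" "g \<in> Arr C" "h \<in> Arr C" "Dom C g = Dom C h"
    "Cod C g = Dom C m" "Cod C h = Dom C m"
  shows "g = h"
  using assms unfolding monic_def by (metis Hom_iff)

lemma epicD:
  assumes "epic C e" "g \<cdot> e = h \<cdot> e" "g \<in> Arr C" "h \<in> Arr C" "Cod C g = Cod C h"
    "Dom C g = Cod C e" "Dom C h = Cod C e"
  shows "g = h"
  using assms unfolding epic_def by (metis Hom_iff)

lemma monic_arr [simp]: "monic C m \<Longrightarrow> m \<in> Arr C"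
  by (simp add: monic_def)

lemma epic_arr [simp]: "epic C e \<Longrightarrow> e \<in> Arr C"
  by (simp add: epic_def)

lemma monicI:
  assumes "m \<in> Arr C"
    "\<And>g h. \<lbrakk>g \<in> Arr C; h \<in> Arr C; Dom C g = Dom C h; Cod C g = Dom C m; Cod C h = Dom C m;
      m \<cdot> g = m \<cdot> h\<rbrakk> \<Longrightarrow> g = h"
  shows "monic C m"
  using assms unfolding monic_def by (simp add: Hom_iff)

lemma epicI:
  assumes "e \<in> Arr C"
    "\<And>g h. \<lbrakk>g \<in> Arr C; h \<in> Arr C; Cod C g = Cod C h; Dom C g = Cod C e; Dom C h = Cod C e;
      g \<cdot> e = h \<cdot> e\<rbrakk> \<Longrightarrow> g = h"
  shows "epic C e"
  using assms unfolding epic_def by (simp add: Hom_iff)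

lemma monic_Comp:
  assumes "monic C m" "monic C n" "Cod C n = Dom C m"
  shows "monic C (m \<cdot> n)"
proof (rule monicI)
  fix g h assume *: "g \<in> Arr C" "h \<in> Arr C" "Dom C g = Dom C h" "Cod C g = Dom C (m \<cdot> n)"
    "Cod C h = Dom C (m \<cdot> n)" "(m \<cdot> n) \<cdot> g = (m \<cdot> n) \<cdot> h"
  have "n \<cdot> g = n \<cdot> h" by (rule monicD [OF assms(1)]) (use * assms in auto)
  with * show "g = h" by (metis monicD [OF assms(2)] assms Comp_simps monic_arr)
qed (use assms in auto)

lemma monic_cancel:
  assumes "monic C (m \<cdot> n)" "m \<in> Arr C" "n \<in> Arr C" "Cod C n = Dom C m"
  shows "monic C n"
proof (rule monicI)
  fix g h assume *: "g \<in> Arr C" "h \<in> Arr C" "Dom C g = Dom C h" "Cod C g = Dom C n"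
    "Cod C h = Dom C n" "n \<cdot> g = n \<cdot> h"
  show "g = h" by (rule monicD [OF assms(1)]) (use * assms in auto)
qed (use assms in auto)

lemma epic_Comp:
  assumes "epic C e" "epic C f" "Cod C f = Dom C e"
  shows "epic C (e \<cdot> f)"
proof (rule epicI)
  fix g h assume *: "g \<in> Arr C" "h \<in> Arr C" "Cod C g = Cod C h" "Dom C g = Cod C (e \<cdot> f)"
    "Dom C h = Cod C (e \<cdot> f)" "g \<cdot> (e \<cdot> f) = h \<cdot> (e \<cdot> f)"
  have "g \<cdot> e = h \<cdot> e" by (rule epicD [OF assms(2)]) (use * assms in auto)
  with * show "g = h" by (metis epicD [OF assms(1)] assms Comp_simps epic_arr)
qed (use assms in auto)

text \<open>Chosen as a function so that inverses can be written inside statements; meaningful for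
  isomorphisms only, where the inverse is unique.\<close>

definition inv_arr :: "'a \<Rightarrow> 'a" where
  "inv_arr i = (SOME j. j \<in> Hom C (Cod C i) (Dom C i) \<and> j \<cdot> i = Idn C (Dom C i) \<and> i \<cdot> j = Idn C (Cod C i))"

lemma iso_arr_arr [simp]: "iso_arr C i \<Longrightarrow> i \<in> Arr C"
  by (simp add: iso_arr_def)

lemma inv_arr_simps [simp]:
  assumes "iso_arr C i"
  shows "inv_arr i \<in> Arr C" "Dom C (inv_arr i) = Cod C i" "Cod C (inv_arr i) = Dom C i"
    "inv_arr i \<cdot> i = Idn C (Dom C i)" "i \<cdot> inv_arr i = Idn C (Cod C i)"
proof -
  have "\<exists>j. j \<in> Hom C (Cod C i) (Dom C i) \<and> j \<cdot> i = Idn C (Dom C i) \<and> i \<cdot> j = Idn C (Cod C i)"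
    using assms unfolding iso_arr_def by blast
  from someI_ex [OF this]
  show "inv_arr i \<in> Arr C" "Dom C (inv_arr i) = Cod C i" "Cod C (inv_arr i) = Dom C i"
    "inv_arr i \<cdot> i = Idn C (Dom C i)" "i \<cdot> inv_arr i = Idn C (Cod C i)"
    unfolding inv_arr_def Hom_iff by blast+
qed

lemma inv_arr_cancel [simp]:
  assumes "iso_arr C i" "h \<in> Arr C"
  shows "Cod C h = Dom C i \<Longrightarrow> inv_arr i \<cdot> (i \<cdot> h) = h"
    "Cod C h = Cod C i \<Longrightarrow> i \<cdot> (inv_arr i \<cdot> h) = h"
  using Comp_eq_extend [of "inv_arr i" i _ h] Comp_eq_extend [of i "inv_arr i" _ h] assms by simp_all

lemma iso_arrI:
  assumes "j \<cdot> i = Idn C (Dom C i)" "i \<cdot> j = Idn C (Cod C i)"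
    "i \<in> Arr C" "j \<in> Arr C" "Dom C j = Cod C i" "Cod C j = Dom C i"
  shows "iso_arr C i"
  using assms unfolding iso_arr_def by (auto simp: Hom_iff)

lemma iso_inv_arr [simp]: "iso_arr C i \<Longrightarrow> iso_arr C (inv_arr i)"
  by (rule iso_arrI [of i]) simp_all

lemma iso_monic:
  assumes "iso_arr C i" shows "monic C i"
proof (rule monicI)
  fix g h assume *: "g \<in> Arr C" "h \<in> Arr C" "Dom C g = Dom C h" "Cod C g = Dom C i" "Cod C h = Dom C i"
    "i \<cdot> g = i \<cdot> h"
  have "inv_arr i \<cdot> (i \<cdot> g) = inv_arr i \<cdot> (i \<cdot> h)" using *(6) by (rule arg_cong)
  then show "g = h" using *(1-5) assms by simp
qed (use assms in auto)

lemma iso_epic: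
  assumes "iso_arr C i" shows "epic C i"
proof (rule epicI)
  fix g h assume *: "g \<in> Arr C" "h \<in> Arr C" "Cod C g = Cod C h" "Dom C g = Cod C i" "Dom C h = Cod C i"
    "g \<cdot> i = h \<cdot> i"
  have "(g \<cdot> i) \<cdot> inv_arr i = (h \<cdot> i) \<cdot> inv_arr i" using *(6) by (rule arg_cong)
  then show "g = h" using *(1-5) assms by simp
qed (use assms in auto)

lemma iso_Comp:
  assumes "iso_arr C i" "iso_arr C j" "Cod C j = Dom C i"
  shows "iso_arr C (i \<cdot> j)"
  by (rule iso_arrI [of "inv_arr j \<cdot> inv_arr i"]) (use assms in simp_all)

lemma iso_Idn [simp]: "x \<in> Obj C \<Longrightarrow> iso_arr C (Idn C x)"
  by (rule iso_arrI [of "Idn C x"]) auto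

section \<open>Pullbacks: joint monicity of the legs, pasting, kernel pairs\<close>

lemma pullback_arr:
  assumes "is_pullback C f g p q"
  shows "f \<in> Arr C" "g \<in> Arr C" "p \<in> Arr C" "q \<in> Arr C" "Cod C g = Cod C f" "Dom C q = Dom C p"
    "Cod C p = Dom C f" "Cod C q = Dom C g" "f \<cdot> p = g \<cdot> q"
  using assms unfolding is_pullback_def commuting_square_def by auto

lemma pullback_ex:
  assumes "is_pullback C f g p q" "p' \<in> Arr C" "q' \<in> Arr C" "Dom C p' = Dom C q'"
    "Cod C p' = Dom C f" "Cod C q' = Dom C g" "f \<cdot> p' = g \<cdot> q'"
  obtains u where "u \<in> Arr C" "Dom C u = Dom C p'" "Cod C u = Dom C p" "p \<cdot> u = p'" "q \<cdot> u = q'"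
proof -
  have "commuting_square C f g p' q'"
    using assms pullback_arr [OF assms(1)] unfolding commuting_square_def by auto
  then have "\<exists>!u. u \<in> Hom C (Dom C p') (Dom C p) \<and> p \<cdot> u = p' \<and> q \<cdot> u = q'"
    using assms(1) unfolding is_pullback_def by blast
  then show thesis using that by (metis Hom_iff)
qed

lemma pullback_unique:
  assumes "is_pullback C f g p q" "u \<in> Arr C" "v \<in> Arr C" "Dom C u = Dom C v"
    "Cod C u = Dom C p" "Cod C v = Dom C p" "p \<cdot> u = p \<cdot> v" "q \<cdot> u = q \<cdot> v"
  shows "u = v"
proof -
  note pb = pullback_arr [OF assms(1)]
  \<comment> \<open>The composites of the legs with \<open>u\<close> themselves form a commuting
    square over the cospan. Both \<open>u\<close> and \<open>v\<close> mediate it, so uniqueness in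
    the universal property applies.\<close>
  have "f \<cdot> (p \<cdot> u) = g \<cdot> (q \<cdot> u)"
    using Comp_eq_extend [OF pb(9), of u] pb assms(2-6) by simp
  then have "commuting_square C f g (p \<cdot> u) (q \<cdot> u)"
    using assms pb unfolding commuting_square_def by auto
  then have "\<exists>!w. w \<in> Hom C (Dom C (p \<cdot> u)) (Dom C p) \<and> p \<cdot> w = p \<cdot> u \<and> q \<cdot> w = q \<cdot> u"
    using assms(1) unfolding is_pullback_def by blast
  moreover have "Dom C (p \<cdot> u) = Dom C v" using assms pb by simp
  ultimately show ?thesis using assms unfolding Hom_iff by metis
qed

text \<open>Uniqueness of the mediating arrow is asked for as joint monicity of the two legs,
  without reference to a second commuting square; existence and uniqueness can then be verified
  independently.\<close>

lemma is_pullbackI: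
  assumes "f \<in> Arr C" "g \<in> Arr C" "p \<in> Arr C" "q \<in> Arr C" "Cod C g = Cod C f" "Dom C q = Dom C p"
    "Cod C p = Dom C f" "Cod C q = Dom C g" "f \<cdot> p = g \<cdot> q"
  and ex: "\<And>p' q'. \<lbrakk>p' \<in> Arr C; q' \<in> Arr C; Dom C q' = Dom C p'; Cod C p' = Dom C f;
      Cod C q' = Dom C g; f \<cdot> p' = g \<cdot> q'\<rbrakk>
      \<Longrightarrow> \<exists>u. u \<in> Arr C \<and> Dom C u = Dom C p' \<and> Cod C u = Dom C p \<and> p \<cdot> u = p' \<and> q \<cdot> u = q'"
  and uniq: "\<And>u v. \<lbrakk>u \<in> Arr C; v \<in> Arr C; Dom C u = Dom C v; Cod C u = Dom C p; Cod C v = Dom C p;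
      p \<cdot> u = p \<cdot> v; q \<cdot> u = q \<cdot> v\<rbrakk> \<Longrightarrow> u = v"
  shows "is_pullback C f g p q"
  unfolding is_pullback_def
proof (intro conjI allI impI)
  show "commuting_square C f g p q" using assms(1-9) unfolding commuting_square_def by auto
  fix p' q' assume "commuting_square C f g p' q'"
  then have *: "p' \<in> Arr C" "q' \<in> Arr C" "Dom C q' = Dom C p'" "Cod C p' = Dom C f"
      "Cod C q' = Dom C g" "f \<cdot> p' = g \<cdot> q'"
    unfolding commuting_square_def by auto
  obtain u where u: "u \<in> Arr C" "Dom C u = Dom C p'" "Cod C u = Dom C p" "p \<cdot> u = p'" "q \<cdot> u = q'"
    using ex [OF *] by auto
  show "\<exists>!u. u \<in> Hom C (Dom C p') (Dom C p) \<and> p \<cdot> u = p' \<and> q \<cdot> u = q'"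
  proof (rule ex1I [of _ u])
    show "u \<in> Hom C (Dom C p') (Dom C p) \<and> p \<cdot> u = p' \<and> q \<cdot> u = q'" using u by (auto simp: Hom_iff)
    show "v = u" if "v \<in> Hom C (Dom C p') (Dom C p) \<and> p \<cdot> v = p' \<and> q \<cdot> v = q'" for v
      by (rule uniq) (use that u in \<open>auto simp: Hom_iff\<close>)
  qed
qed

lemma pullback_sym:
  assumes "is_pullback C f g p q" shows "is_pullback C g f q p"
proof -
  note pb = pullback_arr [OF assms]
  show ?thesis
  proof (rule is_pullbackI)
    fix p' q' assume *: "p' \<in> Arr C" "q' \<in> Arr C" "Dom C q' = Dom C p'" "Cod C p' = Dom C g"
      "Cod C q' = Dom C f" "g \<cdot> p' = f \<cdot> q'"
    obtain u where "u \<in> Arr C" "Dom C u = Dom C q'" "Cod C u = Dom C p" "p \<cdot> u = q'" "q \<cdot> u = p'"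
      using pullback_ex [OF assms *(2,1,3,5,4) *(6) [symmetric]] by blast
    then show "\<exists>u. u \<in> Arr C \<and> Dom C u = Dom C p' \<and> Cod C u = Dom C q \<and> q \<cdot> u = p' \<and> p \<cdot> u = q'"
      using * pb by auto
  next
    fix u v assume "u \<in> Arr C" "v \<in> Arr C" "Dom C u = Dom C v" "Cod C u = Dom C q" "Cod C v = Dom C q"
      "q \<cdot> u = q \<cdot> v" "p \<cdot> u = p \<cdot> v"
    then show "u = v" using pullback_unique [OF assms] pb by auto
  qed (use pb in auto)
qed

text \<open>The mediating arrows in both directions compose to endomorphisms that preserve both
  legs, and joint monicity forces these to be identities.\<close>

lemma pullback_iso:
  assumes "is_pullback C f g p q" "is_pullback C f g p' q'"
  obtains i where "iso_arr C i" "Dom C i = Dom C p'" "Cod C i = Dom C p" "p \<cdot> i = p'" "q \<cdot> i = q'"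
proof -
  note pb = pullback_arr [OF assms(1)] and pb' = pullback_arr [OF assms(2)]
  obtain i where i: "i \<in> Arr C" "Dom C i = Dom C p'" "Cod C i = Dom C p" "p \<cdot> i = p'" "q \<cdot> i = q'"
    using pullback_ex [OF assms(1), of p' q'] pb pb' by (metis Comp_simps Comp_assoc_simp)
  obtain j where j: "j \<in> Arr C" "Dom C j = Dom C p" "Cod C j = Dom C p'" "p' \<cdot> j = p" "q' \<cdot> j = q"
    using pullback_ex [OF assms(2), of p q] pb pb' by (metis Comp_simps Comp_assoc_simp)
  have x1: "p \<cdot> (i \<cdot> j) = p" "q \<cdot> (i \<cdot> j) = q"
    using Comp_eq_extend [OF i(4), of j] Comp_eq_extend [OF i(5), of j] i j pb by simp_all
  have ij: "i \<cdot> j = Idn C (Dom C p)"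
    by (rule pullback_unique [OF assms(1)]) (use x1 i j pb in auto)
  have x2: "p' \<cdot> (j \<cdot> i) = p'" "q' \<cdot> (j \<cdot> i) = q'"
    using Comp_eq_extend [OF j(4), of i] Comp_eq_extend [OF j(5), of i] i j pb' by simp_all
  have ji: "j \<cdot> i = Idn C (Dom C p')"
    by (rule pullback_unique [OF assms(2)]) (use x2 i j pb' in auto)
  have "iso_arr C i"
    by (rule iso_arrI [of j]) (use i j ij ji in auto)
  with i show thesis using that by blast
qed

text \<open>The pasting law for two adjacent squares. It serves to trade an arrow \<open>e\<close>
  composed in front of a leg of the cospan for its pullback \<open>e1\<close>, which maps to the
  apex of the old square.\<close>

lemma pullback_paste:
  assumes "is_pullback C b c p q" "is_pullback C e p p1 e1"
  shows "is_pullback C (b \<cdot> e) c p1 (q \<cdot> e1)"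
proof -
  note pb = pullback_arr [OF assms(1)] and pb' = pullback_arr [OF assms(2)]
  show ?thesis
  proof (rule is_pullbackI)
    show "(b \<cdot> e) \<cdot> p1 = c \<cdot> (q \<cdot> e1)"
      using Comp_eq_extend [OF pb(9), of e1] pb pb' by simp
  next
    fix p' q' assume *: "p' \<in> Arr C" "q' \<in> Arr C" "Dom C q' = Dom C p'" "Cod C p' = Dom C (b \<cdot> e)"
      "Cod C q' = Dom C c" "b \<cdot> e \<cdot> p' = c \<cdot> q'"
    obtain v where v: "v \<in> Arr C" "Dom C v = Dom C p'" "Cod C v = Dom C p" "p \<cdot> v = e \<cdot> p'" "q \<cdot> v = q'"
      using pullback_ex [OF assms(1), of "e \<cdot> p'" q'] * pb pb' by (metis Comp_simps Comp_assoc_simp)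
    obtain u where u: "u \<in> Arr C" "Dom C u = Dom C p'" "Cod C u = Dom C p1" "p1 \<cdot> u = p'" "e1 \<cdot> u = v"
      using pullback_ex [OF assms(2), of p' v] * v pb pb' by (metis Comp_simps Comp_assoc_simp)
    then show "\<exists>u. u \<in> Arr C \<and> Dom C u = Dom C p' \<and> Cod C u = Dom C p1 \<and> p1 \<cdot> u = p' \<and> q \<cdot> e1 \<cdot> u = q'"
      using v pb pb' by auto
  next
    fix u v assume *: "u \<in> Arr C" "v \<in> Arr C" "Dom C u = Dom C v" "Cod C u = Dom C p1" "Cod C v = Dom C p1"
      "p1 \<cdot> u = p1 \<cdot> v" "q \<cdot> e1 \<cdot> u = q \<cdot> e1 \<cdot> v"
    have pe: "p \<cdot> (e1 \<cdot> u) = p \<cdot> (e1 \<cdot> v)"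
      using Comp_eq_extend [OF pb'(9), of u] Comp_eq_extend [OF pb'(9), of v] * pb pb' by simp
    have e1: "e1 \<cdot> u = e1 \<cdot> v"
      by (rule pullback_unique [OF assms(1)]) (use * pe pb pb' in auto)
    show "u = v"
      by (rule pullback_unique [OF assms(2)]) (use * e1 pb pb' in auto)
  qed (use pb pb' in auto)
qed

lemma pullback_Idn: "f \<in> Arr C \<Longrightarrow> Cod C f = y \<Longrightarrow> Dom C f = x \<Longrightarrow> is_pullback C f (Idn C y) (Idn C x) f"
  by (rule is_pullbackI) auto

text \<open>Pulling back along an isomorphism is composing with its inverse. This keeps composition
  with the graph of an isomorphism explicit.\<close>

lemma pullback_iso_arr:
  assumes "iso_arr C f" "g \<in> Arr C" "Cod C g = Cod C f"
  shows "is_pullback C f g (inv_arr f \<cdot> g) (Idn C (Dom C g))"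
proof (rule is_pullbackI)
  fix p' q' assume *: "p' \<in> Arr C" "q' \<in> Arr C" "Dom C q' = Dom C p'" "Cod C p' = Dom C f"
      "Cod C q' = Dom C g" "f \<cdot> p' = g \<cdot> q'"
  have "inv_arr f \<cdot> (g \<cdot> q') = p'"
    unfolding *(6) [symmetric] using *(1-5) assms by simp
  then show "\<exists>u. u \<in> Arr C \<and> Dom C u = Dom C p' \<and> Cod C u = Dom C (inv_arr f \<cdot> g) \<and> (inv_arr f \<cdot> g) \<cdot> u = p' \<and> Idn C (Dom C g) \<cdot> u = q'"
    by (intro exI [of _ q']) (use * assms in auto)
qed (use assms in auto)

text \<open>Monomorphisms are the arrows with trivial kernel pair. Hence a functor that preserves
  pullbacks preserves them, and the same square later shows that isomorphisms have degree 1.\<close>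

lemma monic_iff_pullback:
  assumes "m \<in> Arr C"
  shows "monic C m \<longleftrightarrow> is_pullback C m m (Idn C (Dom C m)) (Idn C (Dom C m))"
proof
  assume m: "monic C m"
  show "is_pullback C m m (Idn C (Dom C m)) (Idn C (Dom C m))"
  proof (rule is_pullbackI)
    fix p' q' assume *: "p' \<in> Arr C" "q' \<in> Arr C" "Dom C q' = Dom C p'" "Cod C p' = Dom C m"
      "Cod C q' = Dom C m" "m \<cdot> p' = m \<cdot> q'"
    have "p' = q'" by (rule monicD [OF m]) (use * in auto)
    then show "\<exists>u. u \<in> Arr C \<and> Dom C u = Dom C p' \<and> Cod C u = Dom C (Idn C (Dom C m)) \<and>
         Idn C (Dom C m) \<cdot> u = p' \<and> Idn C (Dom C m) \<cdot> u = q'"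
      by (intro exI [of _ q']) (use * assms in auto)
  qed (use assms in auto)
next
  assume pb: "is_pullback C m m (Idn C (Dom C m)) (Idn C (Dom C m))"
  show "monic C m"
  proof (rule monicI [OF assms])
    fix g h assume *: "g \<in> Arr C" "h \<in> Arr C" "Dom C g = Dom C h" "Cod C g = Dom C m" "Cod C h = Dom C m"
      "m \<cdot> g = m \<cdot> h"
    obtain u where "u \<in> Arr C" "Cod C u = Dom C m" "Idn C (Dom C m) \<cdot> u = g" "Idn C (Dom C m) \<cdot> u = h"
      using pullback_ex [OF pb *] assms by (metis Idn_simps(2) Dom_Obj)
    then show "g = h" by simp
  qed
qed

end

section \<open>Finite products\<close>

text \<open>Over a terminal object any two arrows with a common source complete to a commuting
  square, so the universal property of the pullback becomes that of the product.\<close>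

lemma (in category) pullback_terminal_product:
  assumes pb: "is_pullback C f g p q" and t: "terminal C (Cod C f)"
  shows "is_product C (Dom C f) (Dom C g) p q"
  unfolding is_product_def
proof (intro conjI ballI allI)
  note arr = pullback_arr [OF pb]
  show "p \<in> Hom C (Dom C p) (Dom C f)" "q \<in> Hom C (Dom C p) (Dom C g)"
    using arr by (auto simp: Hom_iff)
  fix w h k assume *: "h \<in> Hom C w (Dom C f)" "k \<in> Hom C w (Dom C g)"
  have "f \<cdot> h \<in> Hom C w (Cod C f)" "g \<cdot> k \<in> Hom C w (Cod C f)" "w \<in> Obj C"
    using * arr by (auto simp: Hom_iff)
  then have "f \<cdot> h = g \<cdot> k" using t unfolding terminal_def by blast
  then obtain u where u: "u \<in> Arr C" "Dom C u = w" "Cod C u = Dom C p" "p \<cdot> u = h" "q \<cdot> u = k"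
    using pullback_ex [OF pb, of h k] * unfolding Hom_iff by metis
  show "\<exists>!u. u \<in> Hom C w (Dom C p) \<and> p \<cdot> u = h \<and> q \<cdot> u = k"
  proof (rule ex1I [of _ u])
    show "u \<in> Hom C w (Dom C p) \<and> p \<cdot> u = h \<and> q \<cdot> u = k" using u by (simp add: Hom_iff)
    show "v = u" if "v \<in> Hom C w (Dom C p) \<and> p \<cdot> v = h \<and> q \<cdot> v = k" for v
      by (rule pullback_unique [OF pb]) (use that u in \<open>simp_all add: Hom_iff\<close>)
  qed
qed

text \<open>Chosen projections, pairings and terminal arrows are bare choice terms in the
  definitions; the two existence assumptions are what give them their properties.\<close>

locale cartesian_category = category C for C :: "('o, 'a, 'z) category_scheme" (structure) +
  assumes has_terminal: "\<exists>x. terminal C x"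
    and has_product: "\<lbrakk>x \<in> Obj C; y \<in> Obj C\<rbrakk> \<Longrightarrow> \<exists>p q. is_product C x y p q"
begin

abbreviation one where "one \<equiv> terminal_obj C"

lemma terminal_one: "terminal C one"
  using has_terminal unfolding terminal_obj_def by (rule someI_ex)

lemma one_Obj [simp]: "one \<in> Obj C"
  using terminal_one by (simp add: terminal_def)

lemma to_terminal_simps [simp]:
  assumes "x \<in> Obj C"
  shows "to_terminal C x \<in> Arr C" "Dom C (to_terminal C x) = x" "Cod C (to_terminal C x) = one"
proof -
  have "\<exists>!f. f \<in> Hom C x one" using terminal_one assms by (simp add: terminal_def)
  from theI' [OF this] show "to_terminal C x \<in> Arr C" "Dom C (to_terminal C x) = x"
    "Cod C (to_terminal C x) = one"
    unfolding to_terminal_def [symmetric] unfolding Hom_iff by auto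
qed

lemma one_unique:
  assumes "f \<in> Arr C" "g \<in> Arr C" "Dom C f = Dom C g" "Cod C f = one" "Cod C g = one"
  shows "f = g"
proof -
  have "\<exists>!h. h \<in> Hom C (Dom C f) one" using terminal_one assms by (simp add: terminal_def)
  then show ?thesis using assms unfolding Hom_iff by metis
qed

lemma to_terminal_Comp [simp]:
  "\<lbrakk>f \<in> Arr C; Cod C f = x\<rbrakk> \<Longrightarrow> to_terminal C x \<cdot> f = to_terminal C (Dom C f)"
  by (rule one_unique) auto

lemma is_product_pr:
  assumes "x \<in> Obj C" "y \<in> Obj C" shows "is_product C x y (pr1 C x y) (pr2 C x y)"
proof -
  have "\<exists>z. case z of (p, q) \<Rightarrow> is_product C x y p q" using has_product [OF assms] by auto
  then have "case prod_cone C x y of (p, q) \<Rightarrow> is_product C x y p q"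
    unfolding prod_cone_def by (rule someI_ex)
  then show ?thesis unfolding pr1_def pr2_def by (cases "prod_cone C x y") simp
qed

lemma pr_simps [simp]:
  assumes "x \<in> Obj C" "y \<in> Obj C"
  shows "pr1 C x y \<in> Arr C" "Dom C (pr1 C x y) = prod_obj C x y" "Cod C (pr1 C x y) = x"
    "pr2 C x y \<in> Arr C" "Dom C (pr2 C x y) = prod_obj C x y" "Cod C (pr2 C x y) = y"
    "prod_obj C x y \<in> Obj C"
  using is_product_pr [OF assms] unfolding is_product_def prod_obj_def Hom_iff by auto

lemma pair_ex1:
  assumes "f \<in> Arr C" "g \<in> Arr C" "Dom C f = Dom C g"
  shows "\<exists>!u. u \<in> Hom C (Dom C f) (prod_obj C (Cod C f) (Cod C g)) \<and>
     pr1 C (Cod C f) (Cod C g) \<cdot> u = f \<and> pr2 C (Cod C f) (Cod C g) \<cdot> u = g"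
proof -
  have "f \<in> Hom C (Dom C f) (Cod C f)" "g \<in> Hom C (Dom C f) (Cod C g)"
    using assms by (auto simp: Hom_iff)
  then show ?thesis
    using is_product_pr [of "Cod C f" "Cod C g"] assms unfolding is_product_def prod_obj_def by auto
qed

lemma pair_simps [simp]:
  assumes "f \<in> Arr C" "g \<in> Arr C" "Dom C f = Dom C g"
  shows "pair C f g \<in> Arr C" "Dom C (pair C f g) = Dom C f"
    "Cod C (pair C f g) = prod_obj C (Cod C f) (Cod C g)"
    "\<lbrakk>x = Cod C f; y = Cod C g\<rbrakk> \<Longrightarrow> pr1 C x y \<cdot> pair C f g = f"
    "\<lbrakk>x = Cod C f; y = Cod C g\<rbrakk> \<Longrightarrow> pr2 C x y \<cdot> pair C f g = g"
  using theI' [OF pair_ex1 [OF assms]] unfolding pair_def [symmetric] unfolding Hom_iff by auto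

lemma prod_eqI:
  assumes "pr1 C x y \<cdot> u = pr1 C x y \<cdot> v" "pr2 C x y \<cdot> u = pr2 C x y \<cdot> v"
    "x \<in> Obj C" "y \<in> Obj C" "u \<in> Arr C" "v \<in> Arr C" "Dom C u = Dom C v"
    "Cod C u = prod_obj C x y" "Cod C v = prod_obj C x y"
  shows "u = v"
proof -
  have "\<exists>!w. w \<in> Hom C (Dom C v) (prod_obj C x y) \<and> pr1 C x y \<cdot> w = pr1 C x y \<cdot> v \<and> pr2 C x y \<cdot> w = pr2 C x y \<cdot> v"
    using pair_ex1 [of "pr1 C x y \<cdot> v" "pr2 C x y \<cdot> v"] assms by simp
  then show ?thesis using assms unfolding Hom_iff by metis
qed

lemma pair_Comp [simp]:
  assumes "f \<in> Arr C" "g \<in> Arr C" "Dom C f = Dom C g" "h \<in> Arr C" "Cod C h = Dom C f"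
  shows "pair C f g \<cdot> h = pair C (f \<cdot> h) (g \<cdot> h)"
proof -
  have "pr1 C (Cod C f) (Cod C g) \<cdot> (pair C f g \<cdot> h) = f \<cdot> h"
    "pr2 C (Cod C f) (Cod C g) \<cdot> (pair C f g \<cdot> h) = g \<cdot> h"
    using assms by (simp_all flip: Comp_assoc_simp)
  then show ?thesis
    by (intro prod_eqI [of "Cod C f" "Cod C g" "pair C f g \<cdot> h"]) (use assms in simp_all)
qed

text \<open>Surjective pairing. Together with \<open>pair_Comp\<close> and the projection rules it
  lets the simplifier bring arrows built from projections and pairings into the form of tuples of
  projections, which settles the coherence equations below.\<close>

lemma pair_eta [simp]:
  assumes "x \<in> Obj C" "y \<in> Obj C"
  shows "pair C (pr1 C x y) (pr2 C x y) = Idn C (prod_obj C x y)"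
    "\<lbrakk>h \<in> Arr C; Cod C h = prod_obj C x y\<rbrakk> \<Longrightarrow> pair C (pr1 C x y \<cdot> h) (pr2 C x y \<cdot> h) = h"
  by (rule prod_eqI [of x y]; use assms in simp)+

lemma pair_eq_iff [simp]:
  assumes "f \<in> Arr C" "g \<in> Arr C" "Dom C f = Dom C g" "f' \<in> Arr C" "g' \<in> Arr C" "Dom C f' = Dom C g'"
    "Cod C f = Cod C f'" "Cod C g = Cod C g'"
  shows "pair C f g = pair C f' g' \<longleftrightarrow> f = f' \<and> g = g'"
  using assms by (metis pair_simps(4,5))

definition prod_map :: "'a \<Rightarrow> 'a \<Rightarrow> 'a" where
  "prod_map f g = pair C (f \<cdot> pr1 C (Dom C f) (Dom C g)) (g \<cdot> pr2 C (Dom C f) (Dom C g))"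

lemma prod_map_simps [simp]:
  assumes "f \<in> Arr C" "g \<in> Arr C"
  shows "prod_map f g \<in> Arr C" "Dom C (prod_map f g) = prod_obj C (Dom C f) (Dom C g)"
    "Cod C (prod_map f g) = prod_obj C (Cod C f) (Cod C g)"
    "\<lbrakk>x = Cod C f; y = Cod C g\<rbrakk> \<Longrightarrow> pr1 C x y \<cdot> prod_map f g = f \<cdot> pr1 C (Dom C f) (Dom C g)"
    "\<lbrakk>x = Cod C f; y = Cod C g\<rbrakk> \<Longrightarrow> pr2 C x y \<cdot> prod_map f g = g \<cdot> pr2 C (Dom C f) (Dom C g)"
  using assms by (simp_all add: prod_map_def)

lemma prod_map_Idn [simp]:
  "\<lbrakk>x \<in> Obj C; y \<in> Obj C\<rbrakk> \<Longrightarrow> prod_map (Idn C x) (Idn C y) = Idn C (prod_obj C x y)"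
  by (simp add: prod_map_def)

lemma prod_map_pair [simp]:
  "\<lbrakk>f \<in> Arr C; g \<in> Arr C; h \<in> Arr C; k \<in> Arr C; Dom C h = Dom C k; Cod C h = Dom C f; Cod C k = Dom C g\<rbrakk>
   \<Longrightarrow> prod_map f g \<cdot> pair C h k = pair C (f \<cdot> h) (g \<cdot> k)"
  by (simp add: prod_map_def)

lemma prod_map_Comp [simp]:
  "\<lbrakk>f \<in> Arr C; g \<in> Arr C; h \<in> Arr C; k \<in> Arr C; Cod C h = Dom C f; Cod C k = Dom C g\<rbrakk>
   \<Longrightarrow> prod_map f g \<cdot> prod_map h k = prod_map (f \<cdot> h) (g \<cdot> k)"
  by (simp add: prod_map_def)

lemma prod_map_iso:
  assumes "iso_arr C f" "iso_arr C g" shows "iso_arr C (prod_map f g)"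
  by (rule iso_arrI [of "prod_map (inv_arr f) (inv_arr g)"]) (use assms in simp_all)

text \<open>The body repeats the one used for the associator in \<open>relation_category\<close>, so
  that the latter is literally the graph of this arrow.\<close>

definition assoc_arr :: "'o \<Rightarrow> 'o \<Rightarrow> 'o \<Rightarrow> 'a" where
  "assoc_arr x y z = (let p = pr1 C (prod_obj C x y) z in
     pair C (pr1 C x y \<cdot> p) (pair C (pr2 C x y \<cdot> p) (pr2 C (prod_obj C x y) z)))"

definition braid_arr :: "'o \<Rightarrow> 'o \<Rightarrow> 'a" where
  "braid_arr x y = pair C (pr2 C x y) (pr1 C x y)"

lemma assoc_arr_simps [simp]:
  assumes "x \<in> Obj C" "y \<in> Obj C" "z \<in> Obj C"
  shows "assoc_arr x y z \<in> Arr C" "Dom C (assoc_arr x y z) = prod_obj C (prod_obj C x y) z"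
    "Cod C (assoc_arr x y z) = prod_obj C x (prod_obj C y z)"
  using assms by (simp_all add: assoc_arr_def Let_def)

lemma braid_arr_simps [simp]:
  assumes "x \<in> Obj C" "y \<in> Obj C"
  shows "braid_arr x y \<in> Arr C" "Dom C (braid_arr x y) = prod_obj C x y"
    "Cod C (braid_arr x y) = prod_obj C y x"
  using assms by (simp_all add: braid_arr_def)

section \<open>Coherence of the cartesian structure\<close>

lemma assoc_arr_natural:
  assumes "f \<in> Arr C" "g \<in> Arr C" "h \<in> Arr C"
  shows "assoc_arr (Cod C f) (Cod C g) (Cod C h) \<cdot> prod_map (prod_map f g) h
    = prod_map f (prod_map g h) \<cdot> assoc_arr (Dom C f) (Dom C g) (Dom C h)"
  using assms by (simp add: assoc_arr_def Let_def prod_map_def)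

lemma braid_arr_natural:
  assumes "f \<in> Arr C" "g \<in> Arr C"
  shows "braid_arr (Cod C f) (Cod C g) \<cdot> prod_map f g = prod_map g f \<cdot> braid_arr (Dom C f) (Dom C g)"
  using assms by (simp add: braid_arr_def prod_map_def)

lemma braid_arr_symmetric:
  assumes "x \<in> Obj C" "y \<in> Obj C"
  shows "braid_arr y x \<cdot> braid_arr x y = Idn C (prod_obj C x y)"
  using assms by (simp add: braid_arr_def)

lemma braid_arr_iso:
  assumes "x \<in> Obj C" "y \<in> Obj C"
  shows "iso_arr C (braid_arr x y)"
  by (rule iso_arrI [of "braid_arr y x"]) (use assms in \<open>simp_all add: braid_arr_symmetric\<close>)

lemma assoc_arr_iso:
  assumes "x \<in> Obj C" "y \<in> Obj C" "z \<in> Obj C"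
  shows "iso_arr C (assoc_arr x y z)"
proof (rule iso_arrI)
  let ?q = "pr2 C x (prod_obj C y z)"
  let ?j = "pair C (pair C (pr1 C x (prod_obj C y z)) (pr1 C y z \<cdot> ?q)) (pr2 C y z \<cdot> ?q)"
  show "?j \<cdot> assoc_arr x y z = Idn C (Dom C (assoc_arr x y z))"
    "assoc_arr x y z \<cdot> ?j = Idn C (Cod C (assoc_arr x y z))"
    "?j \<in> Arr C" "Dom C ?j = Cod C (assoc_arr x y z)" "Cod C ?j = Dom C (assoc_arr x y z)"
    using assms by (simp_all add: assoc_arr_def Let_def)
qed (use assms in simp)

lemma pr2_one_iso: "x \<in> Obj C \<Longrightarrow> iso_arr C (pr2 C one x)"
  apply (rule iso_arrI [of "pair C (to_terminal C x) (Idn C x)"])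
       apply simp_all
  \<comment> \<open>Only the composite on the product remains; its component in \<open>one\<close>
    is forced by terminality.\<close>
  apply (rule prod_eqI [of one x])
          apply simp_all
  apply (rule one_unique)
      apply simp_all
  done

lemma pr1_one_iso: "x \<in> Obj C \<Longrightarrow> iso_arr C (pr1 C x one)"
  apply (rule iso_arrI [of "pair C (Idn C x) (to_terminal C x)"])
       apply simp_all
  apply (rule prod_eqI [of x one])
          apply simp_all
  apply (rule one_unique)
      apply simp_all
  done

lemma pentagon_arr:
  assumes "w \<in> Obj C" "x \<in> Obj C" "y \<in> Obj C" "z \<in> Obj C"
  shows "prod_map (Idn C w) (assoc_arr x y z) \<cdot> (assoc_arr w (prod_obj C x y) z
      \<cdot> prod_map (assoc_arr w x y) (Idn C z))
    = assoc_arr w x (prod_obj C y z) \<cdot> assoc_arr (prod_obj C w x) y z"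
  using assms by (simp add: assoc_arr_def Let_def prod_map_def)

lemma triangle_arr:
  assumes "x \<in> Obj C" "y \<in> Obj C"
  shows "prod_map (Idn C x) (pr2 C one y) \<cdot> assoc_arr x one y = prod_map (pr1 C x one) (Idn C y)"
  using assms by (simp add: assoc_arr_def Let_def prod_map_def)

lemma hexagon_arr:
  assumes "x \<in> Obj C" "y \<in> Obj C" "z \<in> Obj C"
  shows "assoc_arr y z x \<cdot> (braid_arr x (prod_obj C y z) \<cdot> assoc_arr x y z)
    = prod_map (Idn C y) (braid_arr x z) \<cdot> (assoc_arr y x z \<cdot> prod_map (braid_arr x y) (Idn C z))"
  using assms by (simp add: assoc_arr_def braid_arr_def Let_def prod_map_def)

text \<open>A cone over the product cospan splits into one cone over each factor. This is the reason
  why the tensor product of relations is compatible with composition.\<close>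

lemma prod_map_pullback:
  assumes "is_pullback C b c p q" "is_pullback C b' c' p' q'"
  shows "is_pullback C (prod_map b b') (prod_map c c') (prod_map p p') (prod_map q q')"
proof -
  note pb = pullback_arr [OF assms(1)] and pb' = pullback_arr [OF assms(2)]
  have D: "Dom C p \<in> Obj C" "Dom C p' \<in> Obj C" "Dom C b \<in> Obj C" "Dom C b' \<in> Obj C"
    "Dom C c \<in> Obj C" "Dom C c' \<in> Obj C"
    using pb pb' by auto
  show ?thesis
  proof (rule is_pullbackI)
    show "prod_map b b' \<cdot> prod_map p p' = prod_map c c' \<cdot> prod_map q q'"
      using pb pb' by simp
  next
    fix r s assume *: "r \<in> Arr C" "s \<in> Arr C" "Dom C s = Dom C r" "Cod C r = Dom C (prod_map b b')"
      "Cod C s = Dom C (prod_map c c')" "prod_map b b' \<cdot> r = prod_map c c' \<cdot> s"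
    \<comment> \<open>Passing to components turns the single equation over the product into one
      equation over each of the given squares.\<close>
    define r1 r2 s1 s2 where rs: "r1 = pr1 C (Dom C b) (Dom C b') \<cdot> r" "r2 = pr2 C (Dom C b) (Dom C b') \<cdot> r"
      "s1 = pr1 C (Dom C c) (Dom C c') \<cdot> s" "s2 = pr2 C (Dom C c) (Dom C c') \<cdot> s"
    have rs_arr: "r1 \<in> Arr C" "Dom C r1 = Dom C r" "Cod C r1 = Dom C b"
      "r2 \<in> Arr C" "Dom C r2 = Dom C r" "Cod C r2 = Dom C b'"
      "s1 \<in> Arr C" "Dom C s1 = Dom C r" "Cod C s1 = Dom C c"
      "s2 \<in> Arr C" "Dom C s2 = Dom C r" "Cod C s2 = Dom C c'"
      using *(1-5) pb(1-8) pb'(1-8) by (simp_all add: rs)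
    have r: "r = pair C r1 r2" and s: "s = pair C s1 s2"
      using *(1-5) pb(1-8) pb'(1-8) by (simp_all add: rs)
    have "pair C (b \<cdot> r1) (b' \<cdot> r2) = pair C (c \<cdot> s1) (c' \<cdot> s2)"
      using *(6) [unfolded r s] rs_arr pb(1-8) pb'(1-8) by simp
    then have e: "b \<cdot> r1 = c \<cdot> s1" "b' \<cdot> r2 = c' \<cdot> s2"
      using rs_arr pb pb' by simp_all
    obtain u where u: "u \<in> Arr C" "Dom C u = Dom C r" "Cod C u = Dom C p" "p \<cdot> u = r1" "q \<cdot> u = s1"
      using pullback_ex [OF assms(1), of r1 s1] rs_arr e by metis
    obtain v where v: "v \<in> Arr C" "Dom C v = Dom C r" "Cod C v = Dom C p'" "p' \<cdot> v = r2" "q' \<cdot> v = s2"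
      using pullback_ex [OF assms(2), of r2 s2] rs_arr e by metis
    show "\<exists>u. u \<in> Arr C \<and> Dom C u = Dom C r \<and> Cod C u = Dom C (prod_map p p') \<and>
        prod_map p p' \<cdot> u = r \<and> prod_map q q' \<cdot> u = s"
      by (rule exI [of _ "pair C u v"]) (use u v pb pb' r s in simp)
  next
    fix u v assume *: "u \<in> Arr C" "v \<in> Arr C" "Dom C u = Dom C v" "Cod C u = Dom C (prod_map p p')"
      "Cod C v = Dom C (prod_map p p')" "prod_map p p' \<cdot> u = prod_map p p' \<cdot> v"
      "prod_map q q' \<cdot> u = prod_map q q' \<cdot> v"
    define u1 u2 v1 v2 where uv: "u1 = pr1 C (Dom C p) (Dom C p') \<cdot> u" "u2 = pr2 C (Dom C p) (Dom C p') \<cdot> u"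
      "v1 = pr1 C (Dom C p) (Dom C p') \<cdot> v" "v2 = pr2 C (Dom C p) (Dom C p') \<cdot> v"
    have arr: "u1 \<in> Arr C" "Dom C u1 = Dom C v" "Cod C u1 = Dom C p"
      "u2 \<in> Arr C" "Dom C u2 = Dom C v" "Cod C u2 = Dom C p'"
      "v1 \<in> Arr C" "Dom C v1 = Dom C v" "Cod C v1 = Dom C p"
      "v2 \<in> Arr C" "Dom C v2 = Dom C v" "Cod C v2 = Dom C p'"
      using *(1-5) pb(1-8) pb'(1-8) by (simp_all add: uv)
    have u: "u = pair C u1 u2" and v: "v = pair C v1 v2"
      using *(1-5) pb(1-8) pb'(1-8) by (simp_all add: uv)
    have 1: "pair C (p \<cdot> u1) (p' \<cdot> u2) = pair C (p \<cdot> v1) (p' \<cdot> v2)"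
      using *(6) [unfolded u v] arr pb(1-8) pb'(1-8) by simp
    have 2: "pair C (q \<cdot> u1) (q' \<cdot> u2) = pair C (q \<cdot> v1) (q' \<cdot> v2)"
      using *(7) [unfolded u v] arr pb(1-8) pb'(1-8) by simp
    have e: "p \<cdot> u1 = p \<cdot> v1" "p' \<cdot> u2 = p' \<cdot> v2" "q \<cdot> u1 = q \<cdot> v1" "q' \<cdot> u2 = q' \<cdot> v2"
      using 1 2 arr pb pb' by simp_all
    have "u1 = v1" by (rule pullback_unique [OF assms(1)]) (use e arr in simp_all)
    moreover have "u2 = v2" by (rule pullback_unique [OF assms(2)]) (use e arr in simp_all)
    ultimately show "u = v" using u v by simp
  qed (use pb pb' in simp_all)
qed

text \<open>The reverse reading of \<open>pullback_terminal_product\<close>, for the chosen product.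
  A functor that preserves pullbacks and terminal objects therefore preserves binary
  products.\<close>

lemma product_terminal_pullback:
  assumes "x \<in> Obj C" "y \<in> Obj C"
  shows "is_pullback C (to_terminal C x) (to_terminal C y) (pr1 C x y) (pr2 C x y)"
proof (rule is_pullbackI)
  fix p q assume "p \<in> Arr C" "q \<in> Arr C" "Dom C q = Dom C p" "Cod C p = Dom C (to_terminal C x)"
      "Cod C q = Dom C (to_terminal C y)"
  then show "\<exists>u. u \<in> Arr C \<and> Dom C u = Dom C p \<and> Cod C u = Dom C (pr1 C x y) \<and> pr1 C x y \<cdot> u = p \<and> pr2 C x y \<cdot> u = q"
    by (intro exI [of _ "pair C p q"]) (use assms in simp)
next
  fix u v assume *: "u \<in> Arr C" "v \<in> Arr C" "Dom C u = Dom C v" "Cod C u = Dom C (pr1 C x y)"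
      "Cod C v = Dom C (pr1 C x y)" "pr1 C x y \<cdot> u = pr1 C x y \<cdot> v" "pr2 C x y \<cdot> u = pr2 C x y \<cdot> v"
  show "u = v" by (rule prod_eqI [of x y]) (use * assms in simp_all)
qed (use assms in simp_all)

text \<open>The comparison with the chosen product is inverted by the mediating arrow of the given
  cone: one composite is the identity by uniqueness in that cone, the other by the
  projections.\<close>

lemma pair_monic_iso:
  assumes "is_product C x y p q" "x \<in> Obj C" "y \<in> Obj C" "p \<in> Arr C" "q \<in> Arr C"
    "Dom C p = Dom C q" "Cod C p = x" "Cod C q = y"
  shows "iso_arr C (pair C p q)"
proof -
  have "\<exists>!u. u \<in> Hom C (prod_obj C x y) (Dom C p) \<and> p \<cdot> u = pr1 C x y \<and> q \<cdot> u = pr2 C x y"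
  proof -
    have "pr1 C x y \<in> Hom C (prod_obj C x y) x" "pr2 C x y \<in> Hom C (prod_obj C x y) y"
      using assms(2,3) by (simp_all add: Hom_iff)
    then show ?thesis using assms(1) unfolding is_product_def by blast
  qed
  then obtain u where u: "u \<in> Arr C" "Dom C u = prod_obj C x y" "Cod C u = Dom C p"
     "p \<cdot> u = pr1 C x y" "q \<cdot> u = pr2 C x y"
    by (auto simp: Hom_iff)
  have "\<exists>!v. v \<in> Hom C (Dom C p) (Dom C p) \<and> p \<cdot> v = p \<and> q \<cdot> v = q"
  proof -
    have "p \<in> Hom C (Dom C p) x" "q \<in> Hom C (Dom C p) y"
      using assms(4-) by (simp_all add: Hom_iff)
    then show ?thesis using assms(1) unfolding is_product_def by blast
  qed
  moreover have "u \<cdot> pair C p q \<in> Hom C (Dom C p) (Dom C p)"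
    "p \<cdot> (u \<cdot> pair C p q) = p" "q \<cdot> (u \<cdot> pair C p q) = q"
    using Comp_eq_extend [OF u(4), of "pair C p q"] Comp_eq_extend [OF u(5), of "pair C p q"] u assms(2-)
    by (simp_all add: Hom_iff)
  moreover have "Idn C (Dom C p) \<in> Hom C (Dom C p) (Dom C p)" "p \<cdot> Idn C (Dom C p) = p" "q \<cdot> Idn C (Dom C p) = q"
    using assms(2-) by (simp_all add: Hom_iff)
  ultimately have "u \<cdot> pair C p q = Idn C (Dom C p)" by blast
  then show ?thesis
    by (intro iso_arrI [of u]) (use u assms(2-) in simp_all)
qed

end

section \<open>Composition of relations as composition of spans\<close>

lemma lookup_scale [simp]: "Poly_Mapping.lookup (scale c f) k = c * Poly_Mapping.lookup f k"
  by (simp add: scale_def Poly_Mapping.map.rep_eq when_def)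

lemma scale_simps [simp]:
  "scale c (Poly_Mapping.single k v) = Poly_Mapping.single k (c * v)"
  "scale c 0 = 0" "scale 0 f = 0" "scale 1 f = f" "scale c (scale d f) = scale (c * d) f"
  by (rule poly_mapping_eqI; simp add: lookup_single when_def)+

lemma scale_add: "scale c (f + g) = scale c f + scale c g" "scale (c + d) f = scale c f + scale d f"
  by (rule poly_mapping_eqI; simp add: lookup_add algebra_simps)+

lemma scale_sum: "scale c (sum f A) = (\<Sum>x\<in>A. scale c (f x))"
  by (induct A rule: infinite_finite_induct) (auto simp: scale_add)

lemma keys_scale: "Poly_Mapping.keys (scale c f) \<subseteq> Poly_Mapping.keys f"
  by (auto simp: in_keys_iff)

text \<open>Linear extension from basis elements. The double sums over keys in
  \<open>relation_category\<close> become two nested instances, so bilinearity is inherited from the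
  lemmas on \<open>lin\<close> instead of being proved for each sum.\<close>

definition lin :: "('b \<Rightarrow> 'c \<Rightarrow>\<^sub>0 'k) \<Rightarrow> ('b \<Rightarrow>\<^sub>0 'k) \<Rightarrow> ('c \<Rightarrow>\<^sub>0 'k::field)" where
  "lin L f = (\<Sum>r\<in>Poly_Mapping.keys f. scale (Poly_Mapping.lookup f r) (L r))"

lemma lin_add [simp]: "lin L (f + g) = lin L f + lin L g"
  unfolding lin_def by (rule setsum_keys_plus_distrib) (simp_all add: scale_add)

lemma lin_zero [simp]: "lin L 0 = 0"
  by (simp add: lin_def)

lemma lin_scale [simp]: "lin L (scale c f) = scale c (lin L f)"
\<comment> \<open>A nonzero factor leaves the support unchanged; the factor 0 empties it, and both
  sides vanish.\<close>
proof (cases "c = 0")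
  case False
  then have "Poly_Mapping.keys (scale c f) = Poly_Mapping.keys f" by (auto simp: in_keys_iff)
  then show ?thesis by (simp add: lin_def scale_sum)
qed simp

lemma lin_single [simp]: "lin L (Poly_Mapping.single r a) = scale a (L r)"
  by (cases "a = 0") (simp_all add: lin_def)

lemma lin_fun_add [simp]: "lin (\<lambda>r. L r + M r) f = lin L f + lin M f"
  by (simp add: lin_def scale_add sum.distrib)

lemma lin_fun_zero [simp]: "lin (\<lambda>r. 0) f = 0"
  by (simp add: lin_def)

lemma lin_fun_scale [simp]: "lin (\<lambda>r. scale c (L r)) f = scale c (lin L f)"
  by (simp add: lin_def scale_sum mult.commute)

lemma sum_singles: "(\<Sum>k\<in>Poly_Mapping.keys f. Poly_Mapping.single k (Poly_Mapping.lookup f k)) = f"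
  by (rule poly_mapping_eqI) (simp add: lookup_sum lookup_single when_def in_keys_iff)

text \<open>Reduces identities between linear operations to basis elements with coefficient 1; the
  set \<open>A\<close> keeps track of which basis elements may occur in the support.\<close>

lemma poly_mapping_lin_induct [consumes 1, case_names zero add scale single]:
  fixes f :: "'b \<Rightarrow>\<^sub>0 'k::field"
  assumes "Poly_Mapping.keys f \<subseteq> A" "P 0" "\<And>f g. P f \<Longrightarrow> P g \<Longrightarrow> P (f + g)" "\<And>c f. P f \<Longrightarrow> P (scale c f)"
    "\<And>r. r \<in> A \<Longrightarrow> P (Poly_Mapping.single r 1)"
  shows "P f"
proof -
  have "P (\<Sum>k\<in>B. Poly_Mapping.single k (Poly_Mapping.lookup f k))" if "finite B" "B \<subseteq> A" for B
    using that
  proof (induct B rule: finite_induct)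
    case (insert k B)
    have "P (scale (Poly_Mapping.lookup f k) (Poly_Mapping.single k 1))"
      using insert by (intro assms(4,5)) auto
    then show ?case using insert by (simp add: assms(3))
  qed (simp add: assms(2))
  from this [of "Poly_Mapping.keys f"] show ?thesis
    using assms(1) by (simp add: sum_singles)
qed

text \<open>With all pullbacks present, a composite of relations is always given by an actual
  pullback. This is stronger than regularity, and both categories of the theorem satisfy it.\<close>

locale complete_degree_function = degree_function C \<delta>
  for C :: "('o, 'a, 'z) category_scheme" (structure) and \<delta> :: "'a \<Rightarrow> 'k::field" +
  assumes all_pullbacks: "\<lbrakk>f \<in> Arr C; g \<in> Arr C; Cod C f = Cod C g\<rbrakk> \<Longrightarrow> \<exists>p q. is_pullback C f g p q"

text \<open>Binary products are pullbacks over a terminal object.\<close>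

sublocale complete_degree_function \<subseteq> cartesian_category C
proof
  show "\<exists>x. terminal C x" by (rule ex_terminal)
  then obtain t where t: "terminal C t" by auto
  fix x y assume "x \<in> Obj C" "y \<in> Obj C"
  then obtain f g where "f \<in> Hom C x t" "g \<in> Hom C y t" using t unfolding terminal_def by blast
  then have fg: "f \<in> Arr C" "g \<in> Arr C" "Dom C f = x" "Dom C g = y" "Cod C f = t" "Cod C g = t"
    by (auto simp: Hom_iff)
  then obtain p q where "is_pullback C f g p q" using all_pullbacks by metis
  then show "\<exists>p q. is_product C x y p q" using pullback_terminal_product t fg by metis
qed

section \<open>Subobjects and image factorizations up to isomorphism\<close>

context regular_category begin

lemma image_fact_simps:
  assumes "image_fact C f e m"
  shows "epic C e" "monic C m" "Cod C e = Dom C m" "m \<cdot> e = f" "Dom C e = Dom C f" "Cod C m = Cod C f"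
proof -
  show *: "epic C e" "monic C m" "Cod C e = Dom C m" "m \<cdot> e = f"
    using assms unfolding image_fact_def by auto
  show "Dom C e = Dom C f" "Cod C m = Cod C f" using *(1-3) unfolding *(4) [symmetric] by simp_all
qed

lemma subobj_comp_iso:
  assumes "iso_arr C i" "m \<in> Arr C" "Cod C i = Dom C m"
  shows "subobj C (m \<cdot> i) = subobj C m"
proof -
  have "\<exists>k. m \<cdot> i \<cdot> j = m \<cdot> k \<and> iso_arr C k \<and> Cod C k = Dom C m"
    if "iso_arr C j" "Cod C j = Dom C (m \<cdot> i)" for j
    by (rule exI [of _ "i \<cdot> j"]) (use that assms in \<open>simp add: iso_Comp\<close>)
  moreover have "\<exists>k. m \<cdot> j = m \<cdot> i \<cdot> k \<and> iso_arr C k \<and> Cod C k = Dom C (m \<cdot> i)"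
    if "iso_arr C j" "Cod C j = Dom C m" for j
    by (rule exI [of _ "inv_arr i \<cdot> j"]) (use that assms in \<open>simp add: iso_Comp\<close>)
  ultimately show ?thesis unfolding subobj_def by fast
qed

text \<open>The representative picked from a class is known only up to an isomorphism of its source;
  the class is inhabited because identities are isomorphisms.\<close>

lemma rep_subobj:
  assumes "m \<in> Arr C"
  obtains i where "iso_arr C i" "Cod C i = Dom C m" "rep (subobj C m) = m \<cdot> i"
proof -
  have "m \<cdot> Idn C (Dom C m) \<in> subobj C m" unfolding subobj_def using assms
    by (intro CollectI exI [of _ "Idn C (Dom C m)"]) simp
  then have "rep (subobj C m) \<in> subobj C m" unfolding rep_def by (rule someI)
  then show thesis using that unfolding subobj_def by auto
qed

lemma Sub_rep:
  assumes "r \<in> Sub C x"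
  shows "monic C (rep r)" "Cod C (rep r) = x" "subobj C (rep r) = r"
proof -
  obtain m where m: "monic C m" "Cod C m = x" "r = subobj C m" using assms by (auto simp: Sub_def)
  obtain i where i: "iso_arr C i" "Cod C i = Dom C m" "rep r = m \<cdot> i"
    using rep_subobj [of m] m by auto
  show "monic C (rep r)" "Cod C (rep r) = x" "subobj C (rep r) = r"
    using i m by (simp_all add: monic_Comp iso_monic subobj_comp_iso)
qed

lemma image_fact_subobj:
  assumes "image_fact C f e m" "image_fact C f e' m'"
  obtains i where "iso_arr C i" "Dom C i = Cod C e" "Cod C i = Cod C e'" "i \<cdot> e = e'" "m' \<cdot> i = m"
    "subobj C m' = subobj C m"
proof -
  obtain i where i: "iso_arr C i" "Dom C i = Cod C e" "Cod C i = Cod C e'" "i \<cdot> e = e'" "m' \<cdot> i = m"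
    using image_unique [OF assms] by (auto simp: Hom_iff)
  moreover have "subobj C m' = subobj C m"
    using subobj_comp_iso [OF i(1), of m'] i assms unfolding image_fact_def by auto
  ultimately show thesis using that by blast
qed

text \<open>An epimorphism composed in front enlarges the epi part and leaves the image alone.
  Multiplicativity of the degree then produces the scalar in \<open>span_comp_epic\<close>.\<close>

lemma image_fact_comp_epic:
  assumes "image_fact C f e m" "epic C k" "Cod C k = Dom C f"
  shows "image_fact C (f \<cdot> k) (e \<cdot> k) m"
  using assms unfolding image_fact_def by (auto intro!: epic_Comp)

end

context degree_function begin

text \<open>An isomorphism is monic and has a trivial kernel pair: the identity is the pullback of
  \<open>i\<close> along itself, hence has the same degree.\<close>

lemma degree_iso: assumes "iso_arr C i" shows "\<delta> i = 1"
proof -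
  have "is_pullback C i i (Idn C (Dom C i)) (Idn C (Dom C i))"
    using iso_monic [OF assms] assms by (simp add: monic_iff_pullback)
  then have "\<delta> (Idn C (Dom C i)) = \<delta> i" by (rule degree_pullback [OF iso_epic [OF assms]])
  then show ?thesis using assms by (simp add: degree_Idn)
qed

end

section \<open>Relations presented by weighted spans\<close>

context complete_degree_function begin

text \<open>The factorization is selected by the same choice term as in \<open>rel_comp\<close>, so
  that unfolding the two definitions makes them meet syntactically.\<close>

definition span :: "'a \<Rightarrow> 'a \<Rightarrow> ('a set \<Rightarrow>\<^sub>0 'k)" where
  "span a b = (let (e, m) = SOME (e, m). image_fact C (pair C a b) e m
     in Poly_Mapping.single (subobj C m) (\<delta> e))"

text \<open>Two factorizations differ by an isomorphism between the images. It changes neither the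
  subobject nor, having degree 1, the weight.\<close>

lemma span_image:
  assumes "image_fact C (pair C a b) e m"
  shows "span a b = Poly_Mapping.single (subobj C m) (\<delta> e)"
proof -
  obtain e' m' where em: "(SOME (e, m). image_fact C (pair C a b) e m) = (e', m')" by fastforce
  have "case (SOME (e, m). image_fact C (pair C a b) e m) of (e, m) \<Rightarrow> image_fact C (pair C a b) e m"
    by (rule someI [of _ "(e, m)"]) (use assms in simp)
  then have em': "image_fact C (pair C a b) e' m'" unfolding em by simp
  from image_fact_subobj [OF assms em'] obtain i where i: "iso_arr C i" "Dom C i = Cod C e" "i \<cdot> e = e'"
    "subobj C m' = subobj C m" by metis
  have "\<delta> e' = \<delta> e"
    using degree_Comp [of e i] i assms unfolding image_fact_def by (auto simp: iso_epic degree_iso)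
  then show ?thesis unfolding span_def em using i by simp
qed

lemma span_monic:
  assumes "monic C (pair C a b)"
  shows "span a b = Poly_Mapping.single (subobj C (pair C a b)) 1"
proof -
  have "image_fact C (pair C a b) (Idn C (Dom C (pair C a b))) (pair C a b)"
    unfolding image_fact_def using assms by (simp add: iso_epic)
  from span_image [OF this] show ?thesis using assms by (simp add: degree_Idn)
qed

lemma span_comp_epic:
  assumes "epic C e" "a \<in> Arr C" "b \<in> Arr C" "Dom C a = Dom C b" "Cod C e = Dom C b"
  shows "span (a \<cdot> e) (b \<cdot> e) = scale (\<delta> e) (span a b)"
proof -
  obtain f m where fm: "image_fact C (pair C a b) f m" using ex_image [of "pair C a b"] assms by auto
  have f: "epic C f" "Dom C f = Dom C b"
    using image_fact_simps [OF fm] assms by simp_all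
  have "image_fact C (pair C a b \<cdot> e) (f \<cdot> e) m"
    by (rule image_fact_comp_epic [OF fm]) (use assms in simp_all)
  then have "image_fact C (pair C (a \<cdot> e) (b \<cdot> e)) (f \<cdot> e) m" using assms by simp
  from span_image [OF this] span_image [OF fm] show ?thesis
    using degree_Comp [of e f] f assms by (simp add: mult.commute)
qed

lemma span_comp_iso:
  assumes "iso_arr C e" "a \<in> Arr C" "b \<in> Arr C" "Dom C a = Dom C b" "Cod C e = Dom C b"
  shows "span (a \<cdot> e) (b \<cdot> e) = span a b"
  using span_comp_epic [of e a b] assms by (simp add: iso_epic degree_iso)

text \<open>The factorization is normalised so that its mono part is exactly the representative
  chosen by \<open>rep\<close>; \<open>rel_comp\<close> and \<open>rel_prod\<close> refer to
  subobjects only through that representative.\<close>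

lemma span_decompose:
  assumes "a \<in> Arr C" "b \<in> Arr C" "Dom C a = Dom C b"
  obtains e m r where "epic C e" "monic C m" "Cod C e = Dom C m" "Cod C m = prod_obj C (Cod C a) (Cod C b)"
    "a = pr1 C (Cod C a) (Cod C b) \<cdot> (m \<cdot> e)" "b = pr2 C (Cod C a) (Cod C b) \<cdot> (m \<cdot> e)" "Dom C e = Dom C b"
    "r \<in> Sub C (prod_obj C (Cod C a) (Cod C b))" "m = rep r" "span a b = scale (\<delta> e) (Poly_Mapping.single r 1)"
proof -
  obtain f n where fn: "image_fact C (pair C a b) f n" using ex_image [of "pair C a b"] assms by auto
  then have f: "epic C f" "monic C n" "Cod C f = Dom C n" "n \<cdot> f = pair C a b"
    and f': "Dom C f = Dom C b" "Cod C n = prod_obj C (Cod C a) (Cod C b)"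
    using image_fact_simps [OF fn] assms by simp_all
  obtain i where i: "iso_arr C i" "Cod C i = Dom C n" "rep (subobj C n) = n \<cdot> i"
    using rep_subobj [of n] f by auto
  \<comment> \<open>Moving the isomorphism \<open>i\<close> from the mono part to the epi part does
    not affect the degree.\<close>
  have "\<delta> (inv_arr i \<cdot> f) = \<delta> f" using i f by (simp add: degree_Comp iso_epic degree_iso)
  show thesis
  proof (rule that [of "inv_arr i \<cdot> f" "n \<cdot> i" "subobj C n"])
    show "epic C (inv_arr i \<cdot> f)" using f i by (simp add: epic_Comp iso_epic)
    show "monic C (n \<cdot> i)" using f i by (simp add: monic_Comp iso_monic)
    show "subobj C n \<in> Sub C (prod_obj C (Cod C a) (Cod C b))" using f f' by (auto simp: Sub_def)
    show "a = pr1 C (Cod C a) (Cod C b) \<cdot> (n \<cdot> i \<cdot> (inv_arr i \<cdot> f))"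
      "b = pr2 C (Cod C a) (Cod C b) \<cdot> (n \<cdot> i \<cdot> (inv_arr i \<cdot> f))"
      using i f f' assms by simp_all
    show "span a b = scale (\<delta> (inv_arr i \<cdot> f)) (Poly_Mapping.single (subobj C n) 1)"
      using span_image [OF fn] i f by (simp add: degree_Comp iso_epic degree_iso)
  qed (use f f' i in simp_all)
qed

lemma span_Sub:
  assumes "r \<in> Sub C (prod_obj C x y)" "x \<in> Obj C" "y \<in> Obj C"
  shows "span (pr1 C x y \<cdot> rep r) (pr2 C x y \<cdot> rep r) = Poly_Mapping.single r 1"
  using span_monic [of "pr1 C x y \<cdot> rep r" "pr2 C x y \<cdot> rep r"] Sub_rep [OF assms(1)] assms(2,3)
  by simp

lemma keys_span:
  assumes "a \<in> Arr C" "b \<in> Arr C" "Dom C a = Dom C b" "Cod C a = x" "Cod C b = y"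
  shows "Poly_Mapping.keys (span a b) \<subseteq> Sub C (prod_obj C x y)"
  using span_decompose [OF assms(1-3)] assms(4,5)
  by (metis keys_scale keys_single empty_subsetI insert_subset order_trans)

text \<open>A basis relation is the span of the two legs of its representative. Linear statements
  may thus be checked on arbitrary spans, which is more convenient than on basis elements because
  spans are closed under composition by pullback.\<close>

lemma relation_induct [consumes 3, case_names zero add scale span]:
  assumes "Poly_Mapping.keys f \<subseteq> Sub C (prod_obj C x y)" "x \<in> Obj C" "y \<in> Obj C"
    "P 0" "\<And>f g. P f \<Longrightarrow> P g \<Longrightarrow> P (f + g)" "\<And>c f. P f \<Longrightarrow> P (scale c f)"
    "\<And>a b. \<lbrakk>a \<in> Arr C; b \<in> Arr C; Dom C a = Dom C b; Cod C a = x; Cod C b = y\<rbrakk> \<Longrightarrow> P (span a b)"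
  shows "P f"
  using assms(1)
proof (induct f rule: poly_mapping_lin_induct)
  case (single r)
  from Sub_rep [OF single] have "monic C (rep r)" "Cod C (rep r) = prod_obj C x y" by auto
  then have "P (span (pr1 C x y \<cdot> rep r) (pr2 C x y \<cdot> rep r))"
    by (intro assms(7)) (use assms(2,3) in simp_all)
  then show ?case using span_Sub [OF single] assms(2,3) by simp
qed (use assms in auto)

lemma span_pullback_eq:
  assumes "is_pullback C b c p q" "is_pullback C b c p' q'" "a \<in> Arr C" "d \<in> Arr C"
    "Dom C a = Dom C b" "Dom C d = Dom C c"
  shows "span (a \<cdot> p') (d \<cdot> q') = span (a \<cdot> p) (d \<cdot> q)"
proof -
  obtain i where i: "iso_arr C i" "Dom C i = Dom C p'" "Cod C i = Dom C p" "p \<cdot> i = p'" "q \<cdot> i = q'"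
    using pullback_iso [OF assms(1,2)] by metis
  have "span ((a \<cdot> p) \<cdot> i) ((d \<cdot> q) \<cdot> i) = span (a \<cdot> p) (d \<cdot> q)"
    by (rule span_comp_iso) (use i assms pullback_arr [OF assms(1)] in simp_all)
  then show ?thesis using i assms pullback_arr [OF assms(1)] by simp
qed

text \<open>Here invariance of the degree under pullback enters: the epimorphism \<open>e\<close> in
  front of the leg \<open>b\<close> is pulled back along \<open>p\<close> to an epimorphism of the
  same degree onto the apex, where it can be split off as a scalar.\<close>

lemma span_pullback_epic:
  assumes e: "epic C e" "Cod C e = Dom C b"
    and pb: "is_pullback C b c p q" "is_pullback C (b \<cdot> e) c p' q'" and ad: "a \<in> Arr C" "d \<in> Arr C"
    "Dom C a = Dom C b" "Dom C d = Dom C c"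
  shows "span (a \<cdot> e \<cdot> p') (d \<cdot> q') = scale (\<delta> e) (span (a \<cdot> p) (d \<cdot> q))"
proof -
  note arr = pullback_arr [OF pb(1)]
  obtain p1 e1 where pe: "is_pullback C e p p1 e1"
    using ex_pullback_epic [OF e(1), of p] arr e by auto
  note arr1 = pullback_arr [OF pe]
  \<comment> \<open>The pasted square replaces the given pullback of the composite cospan, so that
    \<open>e1\<close> becomes visible as a common right factor of both legs.\<close>
  have "is_pullback C (b \<cdot> e) c p1 (q \<cdot> e1)" by (rule pullback_paste [OF pb(1) pe])
  from span_pullback_eq [OF this pb(2), of "a \<cdot> e" d]
  have "span (a \<cdot> e \<cdot> p') (d \<cdot> q') = span (a \<cdot> e \<cdot> p1) (d \<cdot> (q \<cdot> e1))"
    using ad e arr by simp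
  also have "\<dots> = span ((a \<cdot> p) \<cdot> e1) ((d \<cdot> q) \<cdot> e1)"
    using ad e arr arr1 by simp
  also have "\<dots> = scale (\<delta> e1) (span (a \<cdot> p) (d \<cdot> q))"
    by (rule span_comp_epic) (use ad arr arr1 pullback_epic [OF e(1) pe] in simp_all)
  also have "\<delta> e1 = \<delta> e" by (rule degree_pullback [OF e(1) pe])
  finally show ?thesis .
qed

text \<open>The mirror image of the preceding argument, with the epimorphism in front of the other
  leg.\<close>

lemma span_swap_pullback_epic:
  assumes e: "epic C e" "Cod C e = Dom C c"
    and pb: "is_pullback C b c p q" "is_pullback C b (c \<cdot> e) p' q'" and ad: "a \<in> Arr C" "d \<in> Arr C"
    "Dom C a = Dom C b" "Dom C d = Dom C c"
  shows "span (a \<cdot> p') (d \<cdot> e \<cdot> q') = scale (\<delta> e) (span (a \<cdot> p) (d \<cdot> q))"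
proof -
  note arr = pullback_arr [OF pb(1)]
  obtain q1 e1 where pe: "is_pullback C e q q1 e1"
    using ex_pullback_epic [OF e(1), of q] arr e by auto
  note arr1 = pullback_arr [OF pe]
  have "is_pullback C b (c \<cdot> e) (p \<cdot> e1) q1"
    by (rule pullback_sym [OF pullback_paste [OF pullback_sym [OF pb(1)] pe]])
  from span_pullback_eq [OF this pb(2), of a "d \<cdot> e"]
  have "span (a \<cdot> p') (d \<cdot> e \<cdot> q') = span (a \<cdot> (p \<cdot> e1)) (d \<cdot> e \<cdot> q1)"
    using ad e arr by simp
  also have "\<dots> = span ((a \<cdot> p) \<cdot> e1) ((d \<cdot> q) \<cdot> e1)"
    using ad e arr arr1 by simp
  also have "\<dots> = scale (\<delta> e1) (span (a \<cdot> p) (d \<cdot> q))"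
    by (rule span_comp_epic) (use ad arr arr1 pullback_epic [OF e(1) pe] in simp_all)
  also have "\<delta> e1 = \<delta> e" by (rule degree_pullback [OF e(1) pe])
  finally show ?thesis .
qed

text \<open>Eliminates the choices hidden in \<open>rel_comp\<close>: the chosen pullback may be
  exchanged for any other, since the two apexes are isomorphic over the legs.\<close>

lemma rel_comp_span:
  assumes r: "r \<in> Sub C (prod_obj C x y)" and s: "s \<in> Sub C (prod_obj C y z)"
    and obj: "x \<in> Obj C" "y \<in> Obj C" "z \<in> Obj C"
    and pb: "is_pullback C (pr2 C x y \<cdot> rep r) (pr1 C y z \<cdot> rep s) p q"
  shows "rel_comp C \<delta> x y z s r = span (pr1 C x y \<cdot> rep r \<cdot> p) (pr2 C y z \<cdot> rep s \<cdot> q)"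
proof -
  let ?f = "pr2 C x y \<cdot> rep r" and ?g = "pr1 C y z \<cdot> rep s"
  obtain p' q' where pq: "(SOME (p, q). is_pullback C ?f ?g p q) = (p', q')" by fastforce
  have "case (SOME (p, q). is_pullback C ?f ?g p q) of (p, q) \<Rightarrow> is_pullback C ?f ?g p q"
    by (rule someI [of _ "(p, q)"]) (use pb in simp)
  then have pb': "is_pullback C ?f ?g p' q'" unfolding pq by simp
  note rep = Sub_rep [OF r] Sub_rep [OF s]
  have "rel_comp C \<delta> x y z s r = span (pr1 C x y \<cdot> rep r \<cdot> p') (pr2 C y z \<cdot> rep s \<cdot> q')"
    unfolding rel_comp_def Let_def using pb' unfolding pq span_def by auto
  also have "\<dots> = span (pr1 C x y \<cdot> rep r \<cdot> p) (pr2 C y z \<cdot> rep s \<cdot> q)"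
    using span_pullback_eq [OF pb pb', of "pr1 C x y \<cdot> rep r" "pr2 C y z \<cdot> rep s"] rep obj by simp
  finally show ?thesis .
qed

definition cmp :: "'o \<Rightarrow> 'o \<Rightarrow> 'o \<Rightarrow> ('a set \<Rightarrow>\<^sub>0 'k) \<Rightarrow> ('a set \<Rightarrow>\<^sub>0 'k) \<Rightarrow> ('a set \<Rightarrow>\<^sub>0 'k)" where
  "cmp x y z g f = lin (\<lambda>r. lin (\<lambda>s. rel_comp C \<delta> x y z s r) g) f"

definition ten :: "'o \<Rightarrow> 'o \<Rightarrow> 'o \<Rightarrow> 'o \<Rightarrow> ('a set \<Rightarrow>\<^sub>0 'k) \<Rightarrow> ('a set \<Rightarrow>\<^sub>0 'k) \<Rightarrow> ('a set \<Rightarrow>\<^sub>0 'k)" where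
  "ten x y x' y' f g = lin (\<lambda>r. lin (\<lambda>s. Poly_Mapping.single (rel_prod C x y x' y' r s) 1) g) f"

lemma cmp_linear [simp]:
  "cmp x y z (g + g') f = cmp x y z g f + cmp x y z g' f" "cmp x y z g (f + f') = cmp x y z g f + cmp x y z g f'"
  "cmp x y z (scale c g) f = scale c (cmp x y z g f)" "cmp x y z g (scale c f) = scale c (cmp x y z g f)"
  "cmp x y z 0 f = 0" "cmp x y z g 0 = 0"
  unfolding cmp_def by simp_all

lemma ten_linear [simp]:
  "ten x y x' y' (g + g') f = ten x y x' y' g f + ten x y x' y' g' f"
  "ten x y x' y' g (f + f') = ten x y x' y' g f + ten x y x' y' g f'"
  "ten x y x' y' (scale c g) f = scale c (ten x y x' y' g f)"
  "ten x y x' y' g (scale c f) = scale c (ten x y x' y' g f)"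
  "ten x y x' y' 0 f = 0" "ten x y x' y' g 0 = 0"
  unfolding ten_def by simp_all

text \<open>Both spans are compressed to their images, where the definition of the composite
  applies; then the two epimorphisms are put back one after the other. Each of them contributes its
  degree to the weight of its span and, after pulling back, the same factor to the
  composite.\<close>

lemma cmp_span:
  assumes pb: "is_pullback C b c p q" and ad: "a \<in> Arr C" "d \<in> Arr C" "Dom C a = Dom C b" "Dom C d = Dom C c"
    and xyz: "Cod C a = x" "Cod C b = y" "Cod C d = z"
  shows "cmp x y z (span c d) (span a b) = span (a \<cdot> p) (d \<cdot> q)"
proof -
  note arr = pullback_arr [OF pb]
  have obj: "x \<in> Obj C" "y \<in> Obj C" "z \<in> Obj C" using ad xyz arr by auto
  obtain e m r where em: "epic C e" "monic C m" "Cod C e = Dom C m" "Cod C m = prod_obj C x y"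
    "a = pr1 C x y \<cdot> (m \<cdot> e)" "b = pr2 C x y \<cdot> (m \<cdot> e)" "Dom C e = Dom C b"
    "r \<in> Sub C (prod_obj C x y)" "m = rep r" "span a b = scale (\<delta> e) (Poly_Mapping.single r 1)"
    using span_decompose [of a b] ad xyz arr by metis
  obtain k n s where kn: "epic C k" "monic C n" "Cod C k = Dom C n" "Cod C n = prod_obj C y z"
    "c = pr1 C y z \<cdot> (n \<cdot> k)" "d = pr2 C y z \<cdot> (n \<cdot> k)" "Dom C k = Dom C d"
    "s \<in> Sub C (prod_obj C y z)" "n = rep s" "span c d = scale (\<delta> k) (Poly_Mapping.single s 1)"
    using span_decompose [of c d] ad xyz arr by metis
  define a1 b1 c1 d1 where a1: "a1 = pr1 C x y \<cdot> m" and b1: "b1 = pr2 C x y \<cdot> m"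
    and c1: "c1 = pr1 C y z \<cdot> n" and d1: "d1 = pr2 C y z \<cdot> n"
  have A: "a1 \<in> Arr C" "b1 \<in> Arr C" "c1 \<in> Arr C" "d1 \<in> Arr C" "Dom C a1 = Dom C m" "Dom C b1 = Dom C m"
    "Dom C c1 = Dom C n" "Dom C d1 = Dom C n" "Cod C b1 = y" "Cod C c1 = y" "Cod C a1 = x" "Cod C d1 = z"
    using obj em(1-4) kn(1-4) by (simp_all add: a1 b1 c1 d1)
  have B: "a = a1 \<cdot> e" "b = b1 \<cdot> e" "c = c1 \<cdot> k" "d = d1 \<cdot> k"
    unfolding em(5,6) kn(5,6) a1 b1 c1 d1 using obj em(1-4) kn(1-4) by simp_all
  obtain p1 q1 where pb1: "is_pullback C b1 c1 p1 q1" using all_pullbacks [of b1 c1] A by auto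
  note arr1 = pullback_arr [OF pb1]
  \<comment> \<open>An intermediate square in which only the left span has got its epimorphism
    back.\<close>
  obtain p2 q2 where pb2: "is_pullback C (b1 \<cdot> e) c1 p2 q2" using all_pullbacks [of "b1 \<cdot> e" c1] A em by auto
  note arr2 = pullback_arr [OF pb2]
  have pb3: "is_pullback C (b1 \<cdot> e) (c1 \<cdot> k) p q" using pb B by simp
  have "cmp x y z (span c d) (span a b) = scale (\<delta> k) (scale (\<delta> e) (rel_comp C \<delta> x y z s r))"
    unfolding em(10) kn(10) cmp_linear by (simp add: cmp_def mult.commute)
  also have "rel_comp C \<delta> x y z s r = span (a1 \<cdot> p1) (d1 \<cdot> q1)"
    using rel_comp_span [OF em(8) kn(8) obj, of p1 q1] pb1 unfolding a1 b1 c1 d1 em(9) kn(9) by simp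
  also have "scale (\<delta> e) (span (a1 \<cdot> p1) (d1 \<cdot> q1)) = span (a1 \<cdot> e \<cdot> p2) (d1 \<cdot> q2)"
    by (rule span_pullback_epic [symmetric, OF em(1) _ pb1 pb2]) (use A em(3) in simp_all)
  also have "scale (\<delta> k) \<dots> = span ((a1 \<cdot> e) \<cdot> p) (d1 \<cdot> k \<cdot> q)"
    by (rule span_swap_pullback_epic [symmetric, OF kn(1) _ pb2 pb3]) (use A em(1,3) kn(3) in simp_all)
  finally show ?thesis using B A em(1,3) kn(1,3) by simp
qed

text \<open>The product of \<open>e\<close> with an identity is the pullback of \<open>e\<close>
  along a projection. It therefore inherits epimorphy and degree from \<open>e\<close>.\<close>

lemma pullback_pr1:
  assumes "e \<in> Arr C" "y \<in> Obj C"
  shows "is_pullback C e (pr1 C (Cod C e) y) (pr1 C (Dom C e) y) (prod_map e (Idn C y))"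
proof (rule is_pullbackI)
  fix p q assume *: "p \<in> Arr C" "q \<in> Arr C" "Dom C q = Dom C p" "Cod C p = Dom C e"
    "Cod C q = Dom C (pr1 C (Cod C e) y)" "e \<cdot> p = pr1 C (Cod C e) y \<cdot> q"
  show "\<exists>u. u \<in> Arr C \<and> Dom C u = Dom C p \<and> Cod C u = Dom C (pr1 C (Dom C e) y)
      \<and> pr1 C (Dom C e) y \<cdot> u = p \<and> prod_map e (Idn C y) \<cdot> u = q"
    by (rule exI [of _ "pair C p (pr2 C (Cod C e) y \<cdot> q)"]) (use * assms in simp)
next
  fix u v assume *: "u \<in> Arr C" "v \<in> Arr C" "Dom C u = Dom C v" "Cod C u = Dom C (pr1 C (Dom C e) y)"
    "Cod C v = Dom C (pr1 C (Dom C e) y)" "pr1 C (Dom C e) y \<cdot> u = pr1 C (Dom C e) y \<cdot> v"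
    "prod_map e (Idn C y) \<cdot> u = prod_map e (Idn C y) \<cdot> v"
  \<comment> \<open>The second component is untouched by \<open>e\<close>, so it can be recovered by
    projecting.\<close>
  have "pr2 C (Cod C e) y \<cdot> (prod_map e (Idn C y) \<cdot> u) = pr2 C (Cod C e) y \<cdot> (prod_map e (Idn C y) \<cdot> v)"
    by (simp only: *(7))
  then have "pr2 C (Dom C e) y \<cdot> u = pr2 C (Dom C e) y \<cdot> v"
    using *(1-5) assms by (simp add: prod_map_def)
  with *(6) show "u = v" by (rule prod_eqI) (use *(1-5) assms in simp_all)
qed (use assms in simp_all)

lemma pullback_pr2:
  assumes "e \<in> Arr C" "y \<in> Obj C"
  shows "is_pullback C e (pr2 C y (Cod C e)) (pr2 C y (Dom C e)) (prod_map (Idn C y) e)"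
proof (rule is_pullbackI)
  fix p q assume *: "p \<in> Arr C" "q \<in> Arr C" "Dom C q = Dom C p" "Cod C p = Dom C e"
    "Cod C q = Dom C (pr2 C y (Cod C e))" "e \<cdot> p = pr2 C y (Cod C e) \<cdot> q"
  show "\<exists>u. u \<in> Arr C \<and> Dom C u = Dom C p \<and> Cod C u = Dom C (pr2 C y (Dom C e))
      \<and> pr2 C y (Dom C e) \<cdot> u = p \<and> prod_map (Idn C y) e \<cdot> u = q"
    by (rule exI [of _ "pair C (pr1 C y (Cod C e) \<cdot> q) p"]) (use * assms in simp)
next
  fix u v assume *: "u \<in> Arr C" "v \<in> Arr C" "Dom C u = Dom C v" "Cod C u = Dom C (pr2 C y (Dom C e))"
    "Cod C v = Dom C (pr2 C y (Dom C e))" "pr2 C y (Dom C e) \<cdot> u = pr2 C y (Dom C e) \<cdot> v"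
    "prod_map (Idn C y) e \<cdot> u = prod_map (Idn C y) e \<cdot> v"
  have "pr1 C y (Cod C e) \<cdot> (prod_map (Idn C y) e \<cdot> u) = pr1 C y (Cod C e) \<cdot> (prod_map (Idn C y) e \<cdot> v)"
    by (simp only: *(7))
  then have "pr1 C y (Dom C e) \<cdot> u = pr1 C y (Dom C e) \<cdot> v"
    using *(1-5) assms by (simp add: prod_map_def)
  from this *(6) show "u = v" by (rule prod_eqI) (use *(1-5) assms in simp_all)
qed (use assms in simp_all)

text \<open>The product map factors into two maps that change one component each, and both are
  pullbacks along projections.\<close>

lemma prod_map_epic:
  assumes "epic C e" "epic C e'"
  shows "epic C (prod_map e e')" "\<delta> (prod_map e e') = \<delta> e * \<delta> e'"
proof -
  have arr [simp]: "e \<in> Arr C" "e' \<in> Arr C" using assms by auto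
  note pb1 = pullback_pr1 [OF arr(1), of "Cod C e'"] and pb2 = pullback_pr2 [OF arr(2), of "Dom C e"]
  have *: "epic C (prod_map e (Idn C (Cod C e')))" "\<delta> (prod_map e (Idn C (Cod C e'))) = \<delta> e"
    using pullback_epic [OF assms(1) pb1] degree_pullback [OF assms(1) pb1] by simp_all
  have **: "epic C (prod_map (Idn C (Dom C e)) e')" "\<delta> (prod_map (Idn C (Dom C e)) e') = \<delta> e'"
    using pullback_epic [OF assms(2) pb2] degree_pullback [OF assms(2) pb2] by simp_all
  have eq: "prod_map e e' = prod_map e (Idn C (Cod C e')) \<cdot> prod_map (Idn C (Dom C e)) e'"
    by simp
  show "epic C (prod_map e e')" unfolding eq by (rule epic_Comp) (use * ** in simp_all)
  show "\<delta> (prod_map e e') = \<delta> e * \<delta> e'" unfolding eq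
    by (subst degree_Comp) (use * ** in simp_all)
qed

text \<open>The four legs together determine both components of an arrow into the product of the two
  sources, because each representative is monic. So the pairing is monic and the span has weight
  1.\<close>

lemma rel_prod_span:
  assumes r: "r \<in> Sub C (prod_obj C x y)" and s: "s \<in> Sub C (prod_obj C x' y')"
    and obj: "x \<in> Obj C" "y \<in> Obj C" "x' \<in> Obj C" "y' \<in> Obj C"
  shows "Poly_Mapping.single (rel_prod C x y x' y' r s) 1
    = span (prod_map (pr1 C x y \<cdot> rep r) (pr1 C x' y' \<cdot> rep s)) (prod_map (pr2 C x y \<cdot> rep r) (pr2 C x' y' \<cdot> rep s))"
proof -
  note m = Sub_rep [OF r] and n = Sub_rep [OF s]
  let ?a = "pr1 C x y \<cdot> rep r" and ?b = "pr2 C x y \<cdot> rep r" and ?c = "pr1 C x' y' \<cdot> rep s" and ?d = "pr2 C x' y' \<cdot> rep s"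
  let ?M = "Dom C (rep r)" and ?N = "Dom C (rep s)"
  let ?t = "pair C (prod_map ?a ?c) (prod_map ?b ?d)"
  have M: "?M \<in> Obj C" "?N \<in> Obj C" using m n by auto
  have "rel_prod C x y x' y' r s = subobj C ?t"
    unfolding rel_prod_def Let_def prod_map_def using m n obj M by simp
  moreover have "monic C ?t"
  proof (rule monicI)
    fix g h assume *: "g \<in> Arr C" "h \<in> Arr C" "Dom C g = Dom C h" "Cod C g = Dom C ?t" "Cod C h = Dom C ?t"
      "?t \<cdot> g = ?t \<cdot> h"
    have gh: "Cod C g = prod_obj C ?M ?N" "Cod C h = prod_obj C ?M ?N" using * m n obj by simp_all
    define g1 g2 h1 h2 where d: "g1 = pr1 C ?M ?N \<cdot> g" "g2 = pr2 C ?M ?N \<cdot> g" "h1 = pr1 C ?M ?N \<cdot> h" "h2 = pr2 C ?M ?N \<cdot> h"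
    have A: "g1 \<in> Arr C" "Dom C g1 = Dom C h" "Cod C g1 = ?M" "g2 \<in> Arr C" "Dom C g2 = Dom C h" "Cod C g2 = ?N"
      "h1 \<in> Arr C" "Dom C h1 = Dom C h" "Cod C h1 = ?M" "h2 \<in> Arr C" "Dom C h2 = Dom C h" "Cod C h2 = ?N"
      unfolding d using *(1-3) gh M by simp_all
    have g: "g = pair C g1 g2" and h: "h = pair C h1 h2" unfolding d using *(1-3) gh M by simp_all
    have "?t \<cdot> pair C g1 g2 = ?t \<cdot> pair C h1 h2" using *(6) g h by metis
    then have e: "pr1 C x y \<cdot> (rep r \<cdot> g1) = pr1 C x y \<cdot> (rep r \<cdot> h1)" "pr2 C x y \<cdot> (rep r \<cdot> g1) = pr2 C x y \<cdot> (rep r \<cdot> h1)"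
      "pr1 C x' y' \<cdot> (rep s \<cdot> g2) = pr1 C x' y' \<cdot> (rep s \<cdot> h2)" "pr2 C x' y' \<cdot> (rep s \<cdot> g2) = pr2 C x' y' \<cdot> (rep s \<cdot> h2)"
      using A m n obj M by simp_all
    have "rep r \<cdot> g1 = rep r \<cdot> h1" by (rule prod_eqI [of x y]) (use e A m obj in simp_all)
    then have "g1 = h1" by (rule monicD [OF m(1)]) (use A in simp_all)
    moreover have "rep s \<cdot> g2 = rep s \<cdot> h2" by (rule prod_eqI [of x' y']) (use e A n obj in simp_all)
    then have "g2 = h2" by (rule monicD [OF n(1)]) (use A in simp_all)
    ultimately show "g = h" using g h by simp
  qed (use m n obj in simp)
  ultimately show ?thesis by (simp add: span_monic)
qed

text \<open>As for composition, the definition is evaluated on the images; the weight is restored by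
  \<open>prod_map_epic\<close>, which multiplies the degrees of the two epi parts.\<close>

lemma ten_span:
  assumes "a \<in> Arr C" "b \<in> Arr C" "Dom C a = Dom C b" "a' \<in> Arr C" "b' \<in> Arr C" "Dom C a' = Dom C b'"
    "Cod C a = x" "Cod C b = y" "Cod C a' = x'" "Cod C b' = y'"
  shows "ten x y x' y' (span a b) (span a' b') = span (prod_map a a') (prod_map b b')"
proof -
  have obj: "x \<in> Obj C" "y \<in> Obj C" "x' \<in> Obj C" "y' \<in> Obj C" using assms by auto
  obtain e m r where em: "epic C e" "monic C m" "Cod C e = Dom C m" "Cod C m = prod_obj C x y"
    "a = pr1 C x y \<cdot> (m \<cdot> e)" "b = pr2 C x y \<cdot> (m \<cdot> e)" "Dom C e = Dom C b"
    "r \<in> Sub C (prod_obj C x y)" "m = rep r" "span a b = scale (\<delta> e) (Poly_Mapping.single r 1)"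
    using span_decompose [of a b] assms by metis
  obtain k n s where kn: "epic C k" "monic C n" "Cod C k = Dom C n" "Cod C n = prod_obj C x' y'"
    "a' = pr1 C x' y' \<cdot> (n \<cdot> k)" "b' = pr2 C x' y' \<cdot> (n \<cdot> k)" "Dom C k = Dom C b'"
    "s \<in> Sub C (prod_obj C x' y')" "n = rep s" "span a' b' = scale (\<delta> k) (Poly_Mapping.single s 1)"
    using span_decompose [of a' b'] assms by metis
  define a1 b1 c1 d1 where a1: "a1 = pr1 C x y \<cdot> m" and b1: "b1 = pr2 C x y \<cdot> m"
    and c1: "c1 = pr1 C x' y' \<cdot> n" and d1: "d1 = pr2 C x' y' \<cdot> n"
  have A: "a1 \<in> Arr C" "b1 \<in> Arr C" "c1 \<in> Arr C" "d1 \<in> Arr C" "Dom C a1 = Dom C m" "Dom C b1 = Dom C m"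
    "Dom C c1 = Dom C n" "Dom C d1 = Dom C n" "Cod C b1 = y" "Cod C c1 = x'" "Cod C a1 = x" "Cod C d1 = y'"
    using obj em(1-4) kn(1-4) by (simp_all add: a1 b1 c1 d1)
  have B: "a = a1 \<cdot> e" "b = b1 \<cdot> e" "a' = c1 \<cdot> k" "b' = d1 \<cdot> k"
    unfolding em(5,6) kn(5,6) a1 b1 c1 d1 using obj em(1-4) kn(1-4) by simp_all
  have "ten x y x' y' (span a b) (span a' b') = scale (\<delta> e * \<delta> k) (Poly_Mapping.single (rel_prod C x y x' y' r s) 1)"
    unfolding em(10) kn(10) ten_linear by (simp add: ten_def mult.commute)
  also have "\<dots> = scale (\<delta> (prod_map e k)) (span (prod_map a1 c1) (prod_map b1 d1))"
    using rel_prod_span [OF em(8) kn(8) obj] prod_map_epic [OF em(1) kn(1)]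
    unfolding a1 b1 c1 d1 em(9) kn(9) by simp
  also have "\<dots> = span (prod_map a1 c1 \<cdot> prod_map e k) (prod_map b1 d1 \<cdot> prod_map e k)"
    by (rule span_comp_epic [symmetric, OF prod_map_epic(1) [OF em(1) kn(1)]]) (use A em(1,3) kn(1,3) in simp_all)
  also have "\<dots> = span (prod_map a a') (prod_map b b')"
    using A em(1,3) kn(1,3) unfolding B by simp
  finally show ?thesis .
qed

end

section \<open>The monoidal structure on relations\<close>

text \<open>Bilinearity of the tensor product on arrows is what allows it to be extended from
  entries to matrices; the notion of symmetric monoidal category used for the final statement does
  not include it.\<close>

locale linear_symmetric_monoidal_category = linear_category C + symmetric_monoidal_category C
  for C :: "('o, 'a, 'k::field, 'z) lsmcat_scheme" (structure) +
  assumes TenA_AddA_left: "\<lbrakk>f \<in> Hom C x y; f' \<in> Hom C x y; g \<in> Hom C x' y'\<rbrakk>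
        \<Longrightarrow> TenA C (AddA C f f') g = AddA C (TenA C f g) (TenA C f' g)"
    and TenA_AddA_right: "\<lbrakk>f \<in> Hom C x y; g \<in> Hom C x' y'; g' \<in> Hom C x' y'\<rbrakk>
        \<Longrightarrow> TenA C f (AddA C g g') = AddA C (TenA C f g) (TenA C f g')"
    and TenA_SmultA_left: "\<lbrakk>f \<in> Hom C x y; g \<in> Hom C x' y'\<rbrakk>
        \<Longrightarrow> TenA C (SmultA C c f) g = SmultA C c (TenA C f g)"
    and TenA_SmultA_right: "\<lbrakk>f \<in> Hom C x y; g \<in> Hom C x' y'\<rbrakk>
        \<Longrightarrow> TenA C f (SmultA C c g) = SmultA C c (TenA C f g)"

section \<open>Graphs of arrows and the linear category of relations\<close>

context complete_degree_function begin

definition rel :: "'o \<Rightarrow> 'o \<Rightarrow> ('a set \<Rightarrow>\<^sub>0 'k) \<Rightarrow> bool" where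
  "rel x y v \<longleftrightarrow> x \<in> Obj C \<and> y \<in> Obj C \<and> Poly_Mapping.keys v \<subseteq> Sub C (prod_obj C x y)"

lemma rel_Obj: "rel x y v \<Longrightarrow> x \<in> Obj C \<and> y \<in> Obj C"
  by (simp add: rel_def)

lemma rel_induct [consumes 1, case_names zero add scale span]:
  assumes "rel x y f" "P 0" "\<And>f g. P f \<Longrightarrow> P g \<Longrightarrow> P (f + g)" "\<And>c f. P f \<Longrightarrow> P (scale c f)"
    "\<And>a b. \<lbrakk>a \<in> Arr C; b \<in> Arr C; Dom C a = Dom C b; Cod C a = x; Cod C b = y\<rbrakk> \<Longrightarrow> P (span a b)"
  shows "P f"
  by (rule relation_induct [of f x y]) (use assms in \<open>auto simp: rel_def\<close>)

lemma rel_zero [simp]: "\<lbrakk>x \<in> Obj C; y \<in> Obj C\<rbrakk> \<Longrightarrow> rel x y 0"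
  by (simp add: rel_def)

lemma rel_add: "\<lbrakk>rel x y f; rel x y g\<rbrakk> \<Longrightarrow> rel x y (f + g)"
  unfolding rel_def using keys_add [of f g] by blast

lemma rel_scale: "rel x y f \<Longrightarrow> rel x y (scale c f)"
  unfolding rel_def using keys_scale [of c f] by blast

lemma rel_span:
  "\<lbrakk>a \<in> Arr C; b \<in> Arr C; Dom C a = Dom C b; Cod C a = x; Cod C b = y\<rbrakk> \<Longrightarrow> rel x y (span a b)"
  unfolding rel_def using keys_span by auto

lemma rel_cmp:
  assumes "rel x y f" "rel y z g" shows "rel x z (cmp x y z g f)"
  using assms(1)
proof (induct f rule: rel_induct)
  case (span a b)
  note ab = span
  show ?case using assms(2)
  proof (induct g rule: rel_induct)
    case (span c d)
    obtain p q where pb: "is_pullback C b c p q" using all_pullbacks [of b c] ab span by auto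
    note arr = pullback_arr [OF pb]
    show ?case
      by (subst cmp_span [OF pb]) (use ab span arr in \<open>auto intro!: rel_span\<close>)
  qed (use assms in \<open>auto simp: rel_Obj intro: rel_add rel_scale dest: rel_Obj\<close>)
qed (use assms in \<open>auto simp: rel_Obj intro: rel_add rel_scale dest: rel_Obj\<close>)

lemma rel_ten:
  assumes "rel x y f" "rel x' y' g" shows "rel (prod_obj C x x') (prod_obj C y y') (ten x y x' y' f g)"
  using assms(1)
proof (induct f rule: rel_induct)
  case (span a b)
  note ab = span
  show ?case using assms(2)
  proof (induct g rule: rel_induct)
    case (span c d)
    show ?case
      by (subst ten_span) (use ab span in \<open>auto intro!: rel_span\<close>)
  qed (use assms in \<open>auto simp: rel_Obj intro: rel_add rel_scale dest: rel_Obj\<close>)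
qed (use assms in \<open>auto simp: rel_Obj intro: rel_add rel_scale dest: rel_Obj\<close>)

text \<open>The graph in span form: the identity leg makes pullbacks against it computable.
  \<open>graph_gr\<close> identifies it with \<open>graph\<close>, whose weight is 1 because a
  pairing with an identity is monic.\<close>

definition gr :: "'a \<Rightarrow> ('a set \<Rightarrow>\<^sub>0 'k)" where
  "gr f = span (Idn C (Dom C f)) f"

lemma rel_gr: "\<lbrakk>f \<in> Arr C; Dom C f = x; Cod C f = y\<rbrakk> \<Longrightarrow> rel x y (gr f)"
  unfolding gr_def by (rule rel_span) auto

lemma monic_pair:
  assumes "a \<in> Arr C" "b \<in> Arr C" "Dom C a = Dom C b" "monic C a \<or> monic C b"
  shows "monic C (pair C a b)"
  using assms(4)
proof
  assume "monic C a"
  then have "monic C (pr1 C (Cod C a) (Cod C b) \<cdot> pair C a b)" using assms by simp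
  then show ?thesis by (rule monic_cancel) (use assms in simp_all)
next
  assume "monic C b"
  then have "monic C (pr2 C (Cod C a) (Cod C b) \<cdot> pair C a b)" using assms by simp
  then show ?thesis by (rule monic_cancel) (use assms in simp_all)
qed

lemma graph_gr: "f \<in> Arr C \<Longrightarrow> graph C f = Arrow (Dom C f) (Cod C f) (gr f)"
  unfolding graph_def gr_def by (subst span_monic) (simp_all add: monic_pair iso_monic)

lemma cograph_span: "f \<in> Arr C \<Longrightarrow> cograph C f = Arrow (Cod C f) (Dom C f) (span f (Idn C (Dom C f)))"
  unfolding cograph_def by (subst span_monic) (simp_all add: monic_pair iso_monic)

text \<open>Moving the apex along \<open>f\<close> turns the converse of a graph into the graph of
  the inverse. The coherence maps of the induced functor are such converses.\<close>

lemma span_iso_gr: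
  assumes "iso_arr C f" shows "span f (Idn C (Dom C f)) = gr (inv_arr f)"
proof -
  have "span (Idn C (Cod C f) \<cdot> f) (inv_arr f \<cdot> f) = span (Idn C (Cod C f)) (inv_arr f)"
    by (rule span_comp_iso) (use assms in simp_all)
  then show ?thesis using assms by (simp add: gr_def)
qed

lemma cmp_gr_span:
  assumes "a \<in> Arr C" "b \<in> Arr C" "Dom C a = Dom C b" "g \<in> Arr C" "Dom C g = Cod C b"
    "Cod C a = x" "Cod C b = y" "Cod C g = z"
  shows "cmp x y z (gr g) (span a b) = span a (g \<cdot> b)"
proof -
  have pb: "is_pullback C b (Idn C y) (Idn C (Dom C b)) b"
    by (rule pullback_Idn) (use assms in auto)
  show ?thesis unfolding gr_def assms(5,7)
    by (subst cmp_span [OF pb]) (use assms in auto)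
qed

text \<open>Precomposition with a graph is a pullback along \<open>f\<close>, and along an
  isomorphism that amounts to composing one leg with the inverse.\<close>

lemma cmp_span_iso:
  assumes "a \<in> Arr C" "b \<in> Arr C" "Dom C a = Dom C b" "iso_arr C f" "Cod C f = Cod C a"
    "Dom C f = x" "Cod C a = y" "Cod C b = z"
  shows "cmp x y z (span a b) (gr f) = span (inv_arr f \<cdot> a) b"
proof -
  have pb: "is_pullback C f a (inv_arr f \<cdot> a) (Idn C (Dom C a))"
    by (rule pullback_iso_arr) (use assms in auto)
  show ?thesis unfolding gr_def
    by (subst cmp_span [OF pb]) (use assms in auto)
qed

lemma cmp_gr:
  assumes "f \<in> Arr C" "g \<in> Arr C" "Dom C g = Cod C f" "Dom C f = x" "Cod C f = y" "Cod C g = z"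
  shows "cmp x y z (gr g) (gr f) = gr (g \<cdot> f)"
proof -
  have "cmp x y z (gr g) (span (Idn C (Dom C f)) f) = span (Idn C (Dom C f)) (g \<cdot> f)"
    by (rule cmp_gr_span) (use assms in auto)
  then show ?thesis using assms by (simp add: gr_def)
qed

lemma ten_gr:
  assumes "f \<in> Arr C" "g \<in> Arr C" "Dom C f = x" "Cod C f = y" "Dom C g = x'" "Cod C g = y'"
  shows "ten x y x' y' (gr f) (gr g) = gr (prod_map f g)"
  unfolding gr_def by (subst ten_span) (use assms in auto)

lemma cmp_Idn_left:
  assumes "rel x y f" shows "cmp x y y (gr (Idn C y)) f = f"
  using assms
proof (induct f rule: rel_induct)
  case (span a b)
  have "cmp x y y (gr (Idn C y)) (span a b) = span a (Idn C y \<cdot> b)"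
    by (rule cmp_gr_span) (use span in auto)
  then show ?case using span by simp
qed simp_all

lemma cmp_Idn_right:
  assumes "rel x y f" shows "cmp x x y f (gr (Idn C x)) = f"
  using assms
proof (induct f rule: rel_induct)
  case (span a b)
  then have x: "x \<in> Obj C" by auto
  have "is_pullback C (Idn C x) a a (Idn C (Dom C a))"
    by (rule pullback_sym [OF pullback_Idn]) (use span in auto)
  then have "cmp x x y (span a b) (span (Idn C x) (Idn C x)) = span (Idn C x \<cdot> a) (b \<cdot> Idn C (Dom C a))"
    by (rule cmp_span) (use span x in simp_all)
  then show ?case using span x by (simp add: gr_def)
qed simp_all

text \<open>Both bracketings are presented by the same span, whose apex is the pullback of
  \<open>q\<close> and \<open>r\<close> on top of the two given squares; by pasting, this one square
  completes the computation on either side.\<close>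

lemma cmp_assoc:
  assumes "rel w x f" "rel x y g" "rel y z h"
  shows "cmp w x z (cmp x y z h g) f = cmp w y z h (cmp w x y g f)"
  using assms(1)
proof (induct f rule: rel_induct)
  case f: (span a b)
  show ?case using assms(2)
  proof (induct g rule: rel_induct)
    case g: (span c d)
    show ?case using assms(3)
    proof (induct h rule: rel_induct)
      case h: (span i j)
      obtain p q where pb1: "is_pullback C b c p q" using all_pullbacks [of b c] f g by auto
      obtain r s where pb2: "is_pullback C d i r s" using all_pullbacks [of d i] g h by auto
      note arr = pullback_arr [OF pb1] pullback_arr [OF pb2]
      obtain u v where pb3: "is_pullback C q r u v" using all_pullbacks [of q r] arr g by auto
      note arr3 = pullback_arr [OF pb3]
      have A: "is_pullback C (d \<cdot> q) i u (s \<cdot> v)"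
        by (rule pullback_paste [OF pb2 pullback_sym [OF pullback_sym [OF pb3]]])
      have B: "is_pullback C b (c \<cdot> r) (p \<cdot> u) v"
        by (rule pullback_sym [OF pullback_paste [OF pullback_sym [OF pb1] pullback_sym [OF pb3]]])
      have "cmp w x z (cmp x y z (span i j) (span c d)) (span a b) = cmp w x z (span (c \<cdot> r) (j \<cdot> s)) (span a b)"
        by (subst cmp_span [OF pb2]) (use g h in auto)
      also have "\<dots> = span (a \<cdot> (p \<cdot> u)) ((j \<cdot> s) \<cdot> v)"
        by (subst cmp_span [OF B]) (use f g h arr in auto)
      also have "\<dots> = span ((a \<cdot> p) \<cdot> u) (j \<cdot> (s \<cdot> v))"
        using f g h arr arr3 by simp
      also have "\<dots> = cmp w y z (span i j) (span (a \<cdot> p) (d \<cdot> q))"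
        by (subst cmp_span [OF A]) (use f g h arr in auto)
      also have "\<dots> = cmp w y z (span i j) (cmp w x y (span c d) (span a b))"
        by (subst cmp_span [OF pb1]) (use f g h in auto)
      finally show ?case .
    qed simp_all
  qed simp_all
qed simp_all

text \<open>On spans both sides are computed by the product of the two pullback squares.\<close>

lemma ten_cmp:
  assumes "rel x y f" "rel y z g" "rel x' y' f'" "rel y' z' g'"
  shows "ten x z x' z' (cmp x y z g f) (cmp x' y' z' g' f')
    = cmp (prod_obj C x x') (prod_obj C y y') (prod_obj C z z') (ten y z y' z' g g') (ten x y x' y' f f')"
  using assms(1)
proof (induct f rule: rel_induct)
  case f: (span a b)
  show ?case using assms(2)
  proof (induct g rule: rel_induct)
    case g: (span c d)
    show ?case using assms(3)
    proof (induct f' rule: rel_induct)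
      case f': (span a' b')
      show ?case using assms(4)
      proof (induct g' rule: rel_induct)
        case g': (span c' d')
        obtain p q where pb1: "is_pullback C b c p q" using all_pullbacks [of b c] f g by auto
        obtain p' q' where pb2: "is_pullback C b' c' p' q'" using all_pullbacks [of b' c'] f' g' by auto
        note arr = pullback_arr [OF pb1] pullback_arr [OF pb2]
        note pb3 = prod_map_pullback [OF pb1 pb2]
        have "ten x z x' z' (cmp x y z (span c d) (span a b)) (cmp x' y' z' (span c' d') (span a' b'))
          = ten x z x' z' (span (a \<cdot> p) (d \<cdot> q)) (span (a' \<cdot> p') (d' \<cdot> q'))"
          using f g f' g' by (simp add: cmp_span [OF pb1] cmp_span [OF pb2])
        also have "\<dots> = span (prod_map (a \<cdot> p) (a' \<cdot> p')) (prod_map (d \<cdot> q) (d' \<cdot> q'))"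
          by (rule ten_span) (use f g f' g' arr in auto)
        also have "\<dots> = span (prod_map a a' \<cdot> prod_map p p') (prod_map d d' \<cdot> prod_map q q')"
          using f g f' g' arr by simp
        also have "\<dots> = cmp (prod_obj C x x') (prod_obj C y y') (prod_obj C z z')
            (span (prod_map c c') (prod_map d d')) (span (prod_map a a') (prod_map b b'))"
          by (rule cmp_span [OF pb3, symmetric]) (use f g f' g' arr in auto)
        also have "\<dots> = cmp (prod_obj C x x') (prod_obj C y y') (prod_obj C z z')
            (ten y z y' z' (span c d) (span c' d')) (ten x y x' y' (span a b) (span a' b'))"
          using f g f' g' by (simp add: ten_span)
        finally show ?case .
      qed simp_all
    qed simp_all
  qed simp_all
qed simp_all

text \<open>The common scheme of all naturality proofs for relations. The arrows \<open>i\<close>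
  and \<open>j\<close> act on source and target, \<open>k\<close> acts on the apexes, and the
  squares over the two legs say that \<open>k\<close> reparametrises one span into the other.
  Inverses are required of \<open>i\<close> and \<open>k\<close> only.\<close>

lemma cmp_natural_iso:
  assumes "a \<in> Arr C" "b \<in> Arr C" "Dom C a = Dom C b" "a' \<in> Arr C" "b' \<in> Arr C" "Dom C a' = Dom C b'"
    "iso_arr C i" "j \<in> Arr C" "iso_arr C k" "a' \<cdot> k = i \<cdot> a" "b' \<cdot> k = j \<cdot> b"
    "Dom C k = Dom C b" "Cod C k = Dom C b'" "Dom C i = Cod C a" "Cod C i = Cod C a'" "Dom C j = Cod C b"
    "Cod C j = Cod C b'" "x = Cod C a" "y = Cod C b" "x' = Cod C a'" "y' = Cod C b'"
  shows "cmp x y y' (gr j) (span a b) = cmp x x' y' (span a' b') (gr i)"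
proof -
  have "cmp x x' y' (span a' b') (gr i) = span (inv_arr i \<cdot> a') b'"
    by (rule cmp_span_iso) (use assms in auto)
  also have "\<dots> = span ((inv_arr i \<cdot> a') \<cdot> k) (b' \<cdot> k)"
    by (rule span_comp_iso [symmetric]) (use assms in auto)
  also have "\<dots> = span a (j \<cdot> b)"
    using assms by simp
  also have "\<dots> = cmp x y y' (gr j) (span a b)"
    by (rule cmp_gr_span [symmetric]) (use assms in auto)
  finally show ?thesis by simp
qed

abbreviation T where "T \<equiv> relation_category C \<delta>"

lemma relation_category_simps:
  "Obj T = Obj C" "Dom T = arr_dom" "Cod T = arr_cod" "TenO T = prod_obj C" "UnitO T = one"
  "Idn T x = graph C (Idn C x)"
  "ZeroA T x y = Arrow x y 0" "AddA T (Arrow x y f) (Arrow x y g) = Arrow x y (f + g)"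
  "SmultA T c (Arrow x y f) = Arrow x y (scale c f)"
  "Comp T (Arrow y z g) (Arrow x y f) = Arrow x z (cmp x y z g f)"
  "TenA T (Arrow x y f) (Arrow x' y' g) = Arrow (prod_obj C x x') (prod_obj C y y') (ten x y x' y' f g)"
  "Assoc T x y z = graph C (assoc_arr x y z)" "LUnit T x = graph C (pr2 C one x)"
  "RUnit T x = graph C (pr1 C x one)" "Braid T x y = graph C (braid_arr x y)"
  unfolding relation_category_def cmp_def ten_def lin_def
  by (simp_all add: scale_sum mult.commute assoc_arr_def braid_arr_def Let_def)

lemma Hom_relation_category: "Hom T x y = Arrow x y ` {f. x \<in> Obj C \<and> y \<in> Obj C \<and> rel x y f}"
  unfolding Hom_def by (auto simp: relation_category_simps(2,3)) (auto simp: relation_category_def rel_def)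

lemma Arr_relation_category: "Arrow x y f \<in> Arr T \<longleftrightarrow> rel x y f"
  by (auto simp: relation_category_def rel_def)

lemma iso_graph:
  assumes "iso_arr C i" shows "iso_arr T (Arrow (Dom C i) (Cod C i) (gr i))"
  unfolding iso_arr_def
proof (intro conjI bexI)
  let ?j = "Arrow (Cod C i) (Dom C i) (gr (inv_arr i))"
  show "Arrow (Dom C i) (Cod C i) (gr i) \<in> Arr T" using assms by (simp add: Arr_relation_category rel_gr)
  show "?j \<in> Hom T (Cod T (Arrow (Dom C i) (Cod C i) (gr i))) (Dom T (Arrow (Dom C i) (Cod C i) (gr i)))"
    using assms by (simp add: Hom_relation_category relation_category_simps rel_gr)
  show "?j \<cdot>\<^bsub>T\<^esub> Arrow (Dom C i) (Cod C i) (gr i) = Idn T (Dom T (Arrow (Dom C i) (Cod C i) (gr i)))"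
    "Arrow (Dom C i) (Cod C i) (gr i) \<cdot>\<^bsub>T\<^esub> ?j = Idn T (Cod T (Arrow (Dom C i) (Cod C i) (gr i)))"
    using assms by (simp_all add: relation_category_simps graph_gr cmp_gr)
qed

sublocale T: category T
proof
  show "f \<in> Arr T \<Longrightarrow> Dom T f \<in> Obj T" "f \<in> Arr T \<Longrightarrow> Cod T f \<in> Obj T" for f
    by (cases f; simp add: Arr_relation_category relation_category_simps rel_def)+
  show "x \<in> Obj T \<Longrightarrow> Idn T x \<in> Hom T x x" for x
    by (simp add: Hom_relation_category relation_category_simps graph_gr rel_gr)
  show "g \<cdot>\<^bsub>T\<^esub> f \<in> Hom T x z" if "f \<in> Hom T x y" "g \<in> Hom T y z" for f g x y z
    using that by (auto simp: Hom_relation_category relation_category_simps rel_cmp)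
  show "f \<cdot>\<^bsub>T\<^esub> Idn T x = f" "Idn T y \<cdot>\<^bsub>T\<^esub> f = f" if "f \<in> Hom T x y" for f x y
    using that by (auto simp: Hom_relation_category relation_category_simps graph_gr cmp_Idn_left cmp_Idn_right dest: rel_Obj)
  show "(h \<cdot>\<^bsub>T\<^esub> g) \<cdot>\<^bsub>T\<^esub> f = h \<cdot>\<^bsub>T\<^esub> (g \<cdot>\<^bsub>T\<^esub> f)"
    if "f \<in> Hom T w x" "g \<in> Hom T x y" "h \<in> Hom T y z" for f g h w x y z
    using that by (auto simp: Hom_relation_category relation_category_simps cmp_assoc)
qed

sublocale T: linear_category T
proof
  show "ZeroA T x y \<in> Hom T x y" if "x \<in> Obj T" "y \<in> Obj T" for x y
    using that by (simp add: Hom_relation_category relation_category_simps)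
  show "AddA T f g \<in> Hom T x y" if "f \<in> Hom T x y" "g \<in> Hom T x y" for f g x y
    using that by (auto simp: Hom_relation_category relation_category_simps rel_add)
  show "SmultA T c f \<in> Hom T x y" if "f \<in> Hom T x y" for c f x y
    using that by (auto simp: Hom_relation_category relation_category_simps rel_scale)
  show "AddA T (AddA T f g) h = AddA T f (AddA T g h)"
    if "f \<in> Hom T x y" "g \<in> Hom T x y" "h \<in> Hom T x y" for f g h x y
    using that by (auto simp: Hom_relation_category relation_category_simps add.assoc)
  show "AddA T f g = AddA T g f" if "f \<in> Hom T x y" "g \<in> Hom T x y" for f g x y
    using that by (auto simp: Hom_relation_category relation_category_simps add.commute)
  show "AddA T (ZeroA T x y) f = f" if "f \<in> Hom T x y" for f x y
    using that by (auto simp: Hom_relation_category relation_category_simps)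
  show "AddA T f (SmultA T (- 1) f) = ZeroA T x y" if "f \<in> Hom T x y" for f x y
    using that scale_add(2) [of 1 "- 1 :: 'k"] by (auto simp: Hom_relation_category relation_category_simps)
  show "SmultA T 1 f = f" if "f \<in> Hom T x y" for f x y
    using that by (auto simp: Hom_relation_category relation_category_simps)
  show "SmultA T c (SmultA T d f) = SmultA T (c * d) f" if "f \<in> Hom T x y" for c d f x y
    using that by (auto simp: Hom_relation_category relation_category_simps)
  show "SmultA T (c + d) f = AddA T (SmultA T c f) (SmultA T d f)" if "f \<in> Hom T x y" for c d f x y
    using that by (auto simp: Hom_relation_category relation_category_simps scale_add)
  show "SmultA T c (AddA T f g) = AddA T (SmultA T c f) (SmultA T c g)"
    if "f \<in> Hom T x y" "g \<in> Hom T x y" for c f g x y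
    using that by (auto simp: Hom_relation_category relation_category_simps scale_add)
  show "g \<cdot>\<^bsub>T\<^esub> AddA T f f' = AddA T (g \<cdot>\<^bsub>T\<^esub> f) (g \<cdot>\<^bsub>T\<^esub> f')"
    if "f \<in> Hom T x y" "f' \<in> Hom T x y" "g \<in> Hom T y z" for f f' g x y z
    using that by (auto simp: Hom_relation_category relation_category_simps)
  show "AddA T g g' \<cdot>\<^bsub>T\<^esub> f = AddA T (g \<cdot>\<^bsub>T\<^esub> f) (g' \<cdot>\<^bsub>T\<^esub> f)"
    if "f \<in> Hom T x y" "g \<in> Hom T y z" "g' \<in> Hom T y z" for f g g' x y z
    using that by (auto simp: Hom_relation_category relation_category_simps)
  show "g \<cdot>\<^bsub>T\<^esub> SmultA T c f = SmultA T c (g \<cdot>\<^bsub>T\<^esub> f)" "SmultA T c g \<cdot>\<^bsub>T\<^esub> f = SmultA T c (g \<cdot>\<^bsub>T\<^esub> f)"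
    if "f \<in> Hom T x y" "g \<in> Hom T y z" for c f g x y z
    using that by (auto simp: Hom_relation_category relation_category_simps)
qed

text \<open>By trilinearity the three relations may be taken to be spans; the associator of their
  apexes then relates the two triple products, as the scheme \<open>cmp_natural_iso\<close>
  demands.\<close>

lemma assoc_gr_natural:
  assumes "rel x x' f" "rel y y' g" "rel z z' h"
  shows "cmp (prod_obj C (prod_obj C x y) z) (prod_obj C (prod_obj C x' y') z') (prod_obj C x' (prod_obj C y' z'))
      (gr (assoc_arr x' y' z')) (ten (prod_obj C x y) (prod_obj C x' y') z z' (ten x x' y y' f g) h)
    = cmp (prod_obj C (prod_obj C x y) z) (prod_obj C x (prod_obj C y z)) (prod_obj C x' (prod_obj C y' z'))
      (ten x x' (prod_obj C y z) (prod_obj C y' z') f (ten y y' z z' g h)) (gr (assoc_arr x y z))"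
  using assms(1)
proof (induct f rule: rel_induct)
  case f: (span a a')
  show ?case using assms(2)
  proof (induct g rule: rel_induct)
    case g: (span b b')
    show ?case using assms(3)
    proof (induct h rule: rel_induct)
      case h: (span c c')
      have nat: "assoc_arr x y z \<cdot> prod_map (prod_map a b) c = prod_map a (prod_map b c) \<cdot> assoc_arr (Dom C a) (Dom C b) (Dom C c)"
        "assoc_arr x' y' z' \<cdot> prod_map (prod_map a' b') c' = prod_map a' (prod_map b' c') \<cdot> assoc_arr (Dom C a) (Dom C b) (Dom C c)"
        using assoc_arr_natural [of a b c] assoc_arr_natural [of a' b' c'] f g h by simp_all
      have "cmp (prod_obj C (prod_obj C x y) z) (prod_obj C (prod_obj C x' y') z') (prod_obj C x' (prod_obj C y' z'))
          (gr (assoc_arr x' y' z')) (span (prod_map (prod_map a b) c) (prod_map (prod_map a' b') c'))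
        = cmp (prod_obj C (prod_obj C x y) z) (prod_obj C x (prod_obj C y z)) (prod_obj C x' (prod_obj C y' z'))
          (span (prod_map a (prod_map b c)) (prod_map a' (prod_map b' c'))) (gr (assoc_arr x y z))"
        by (rule cmp_natural_iso [where k = "assoc_arr (Dom C a) (Dom C b) (Dom C c)"])
          (use f g h nat in \<open>auto intro: assoc_arr_iso\<close>)
      then show ?case using f g h by (simp add: ten_span)
    qed simp_all
  qed simp_all
qed simp_all

lemma braid_gr_natural:
  assumes "rel x x' f" "rel y y' g"
  shows "cmp (prod_obj C x y) (prod_obj C x' y') (prod_obj C y' x') (gr (braid_arr x' y')) (ten x x' y y' f g)
    = cmp (prod_obj C x y) (prod_obj C y x) (prod_obj C y' x') (ten y y' x x' g f) (gr (braid_arr x y))"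
  using assms(1)
proof (induct f rule: rel_induct)
  case f: (span a a')
  show ?case using assms(2)
  proof (induct g rule: rel_induct)
    case g: (span b b')
    have nat: "braid_arr x y \<cdot> prod_map a b = prod_map b a \<cdot> braid_arr (Dom C a) (Dom C b)"
      "braid_arr x' y' \<cdot> prod_map a' b' = prod_map b' a' \<cdot> braid_arr (Dom C a) (Dom C b)"
      using braid_arr_natural [of a b] braid_arr_natural [of a' b'] f g by simp_all
    have "cmp (prod_obj C x y) (prod_obj C x' y') (prod_obj C y' x') (gr (braid_arr x' y')) (span (prod_map a b) (prod_map a' b'))
      = cmp (prod_obj C x y) (prod_obj C y x) (prod_obj C y' x') (span (prod_map b a) (prod_map b' a')) (gr (braid_arr x y))"
      by (rule cmp_natural_iso [where k = "braid_arr (Dom C a) (Dom C b)"])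
        (use f g nat in \<open>auto intro: braid_arr_iso\<close>)
    then show ?case using f g by (simp add: ten_span)
  qed simp_all
qed simp_all

lemma unit_gr_natural:
  assumes "rel x y f"
  shows "cmp (prod_obj C one x) (prod_obj C one y) y (gr (pr2 C one y)) (ten one one x y (gr (Idn C one)) f)
      = cmp (prod_obj C one x) x y f (gr (pr2 C one x))"
    "cmp (prod_obj C x one) (prod_obj C y one) y (gr (pr1 C y one)) (ten x y one one f (gr (Idn C one)))
      = cmp (prod_obj C x one) x y f (gr (pr1 C x one))"
  using assms
proof (induct f rule: rel_induct)
  case (span a b)
  have "cmp (prod_obj C one x) (prod_obj C one y) y (gr (pr2 C one y)) (span (prod_map (Idn C one) a) (prod_map (Idn C one) b))
      = cmp (prod_obj C one x) x y (span a b) (gr (pr2 C one x))"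
    by (rule cmp_natural_iso [where k = "pr2 C one (Dom C a)"]) (use span in \<open>auto intro: pr2_one_iso\<close>)
  then show "cmp (prod_obj C one x) (prod_obj C one y) y (gr (pr2 C one y)) (ten one one x y (gr (Idn C one)) (span a b))
      = cmp (prod_obj C one x) x y (span a b) (gr (pr2 C one x))"
    unfolding gr_def using span by (simp add: ten_span)
  have "cmp (prod_obj C x one) (prod_obj C y one) y (gr (pr1 C y one)) (span (prod_map a (Idn C one)) (prod_map b (Idn C one)))
      = cmp (prod_obj C x one) x y (span a b) (gr (pr1 C x one))"
    by (rule cmp_natural_iso [where k = "pr1 C (Dom C a) one"]) (use span in \<open>auto intro: pr1_one_iso\<close>)
  then show "cmp (prod_obj C x one) (prod_obj C y one) y (gr (pr1 C y one)) (ten x y one one (span a b) (gr (Idn C one)))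
      = cmp (prod_obj C x one) x y (span a b) (gr (pr1 C x one))"
    unfolding gr_def using span by (simp add: ten_span)
qed simp_all

text \<open>Coherence is transported from the cartesian structure: \<open>cmp_gr\<close> and
  \<open>ten_gr\<close> turn composites and products of arrows into composites and tensor products
  of graphs, so pentagon, triangle and hexagon are the graphs of equations already known for
  arrows.\<close>

sublocale T: symmetric_monoidal_category T
proof
  show "TenO T x y \<in> Obj T" if "x \<in> Obj T" "y \<in> Obj T" for x y
    using that by (simp add: relation_category_simps)
  show "TenA T f g \<in> Hom T (TenO T x x') (TenO T y y')" if "f \<in> Hom T x y" "g \<in> Hom T x' y'" for f g x y x' y'
    using that by (auto simp: Hom_relation_category relation_category_simps rel_ten)
  show "TenA T (Idn T x) (Idn T y) = Idn T (TenO T x y)" if "x \<in> Obj T" "y \<in> Obj T" for x y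
    using that by (simp add: relation_category_simps graph_gr ten_gr)
  show "TenA T (g \<cdot>\<^bsub>T\<^esub> f) (g' \<cdot>\<^bsub>T\<^esub> f') = TenA T g g' \<cdot>\<^bsub>T\<^esub> TenA T f f'"
    if "f \<in> Hom T x y" "g \<in> Hom T y z" "f' \<in> Hom T x' y'" "g' \<in> Hom T y' z'" for f g f' g' x y z x' y' z'
    using that by (auto simp: Hom_relation_category relation_category_simps ten_cmp)
  show "UnitO T \<in> Obj T" by (simp add: relation_category_simps)
  show "Assoc T x y z \<in> Hom T (TenO T (TenO T x y) z) (TenO T x (TenO T y z))" "iso_arr T (Assoc T x y z)"
    if "x \<in> Obj T" "y \<in> Obj T" "z \<in> Obj T" for x y z
    using that iso_graph [OF assoc_arr_iso [of x y z]]
    by (auto simp: Hom_relation_category relation_category_simps graph_gr rel_gr)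
  show "Assoc T x' y' z' \<cdot>\<^bsub>T\<^esub> TenA T (TenA T f g) h = TenA T f (TenA T g h) \<cdot>\<^bsub>T\<^esub> Assoc T x y z"
    if "f \<in> Hom T x x'" "g \<in> Hom T y y'" "h \<in> Hom T z z'" for f g h x y z x' y' z'
    using that by (auto simp: Hom_relation_category relation_category_simps graph_gr assoc_gr_natural)
  show "LUnit T x \<in> Hom T (TenO T (UnitO T) x) x" "iso_arr T (LUnit T x)" if "x \<in> Obj T" for x
    using that iso_graph [OF pr2_one_iso [of x]]
    by (auto simp: Hom_relation_category relation_category_simps graph_gr rel_gr)
  show "RUnit T x \<in> Hom T (TenO T x (UnitO T)) x" "iso_arr T (RUnit T x)" if "x \<in> Obj T" for x
    using that iso_graph [OF pr1_one_iso [of x]]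
    by (auto simp: Hom_relation_category relation_category_simps graph_gr rel_gr)
  show "LUnit T y \<cdot>\<^bsub>T\<^esub> TenA T (Idn T (UnitO T)) f = f \<cdot>\<^bsub>T\<^esub> LUnit T x"
    "RUnit T y \<cdot>\<^bsub>T\<^esub> TenA T f (Idn T (UnitO T)) = f \<cdot>\<^bsub>T\<^esub> RUnit T x" if "f \<in> Hom T x y" for f x y
    using that by (auto simp: Hom_relation_category relation_category_simps graph_gr unit_gr_natural rel_Obj)
  show "Braid T x y \<in> Hom T (TenO T x y) (TenO T y x)" "Braid T y x \<cdot>\<^bsub>T\<^esub> Braid T x y = Idn T (TenO T x y)"
    if "x \<in> Obj T" "y \<in> Obj T" for x y
    using that by (auto simp: Hom_relation_category relation_category_simps graph_gr rel_gr cmp_gr braid_arr_symmetric)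
  show "Braid T x' y' \<cdot>\<^bsub>T\<^esub> TenA T f g = TenA T g f \<cdot>\<^bsub>T\<^esub> Braid T x y"
    if "f \<in> Hom T x x'" "g \<in> Hom T y y'" for f g x x' y y'
    using that by (auto simp: Hom_relation_category relation_category_simps graph_gr braid_gr_natural rel_Obj)
  show "TenA T (Idn T w) (Assoc T x y z) \<cdot>\<^bsub>T\<^esub> Assoc T w (TenO T x y) z \<cdot>\<^bsub>T\<^esub> TenA T (Assoc T w x y) (Idn T z)
      = Assoc T w x (TenO T y z) \<cdot>\<^bsub>T\<^esub> Assoc T (TenO T w x) y z"
    if "w \<in> Obj T" "x \<in> Obj T" "y \<in> Obj T" "z \<in> Obj T" for w x y z
    using that pentagon_arr [of w x y z] by (simp add: relation_category_simps graph_gr ten_gr cmp_gr)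
  show "TenA T (Idn T x) (LUnit T y) \<cdot>\<^bsub>T\<^esub> Assoc T x (UnitO T) y = TenA T (RUnit T x) (Idn T y)"
    if "x \<in> Obj T" "y \<in> Obj T" for x y
    using that triangle_arr [of x y] by (simp add: relation_category_simps graph_gr ten_gr cmp_gr)
  show "Assoc T y z x \<cdot>\<^bsub>T\<^esub> Braid T x (TenO T y z) \<cdot>\<^bsub>T\<^esub> Assoc T x y z
      = TenA T (Idn T y) (Braid T x z) \<cdot>\<^bsub>T\<^esub> Assoc T y x z \<cdot>\<^bsub>T\<^esub> TenA T (Braid T x y) (Idn T z)"
    if "x \<in> Obj T" "y \<in> Obj T" "z \<in> Obj T" for x y z
    using that hexagon_arr [of x y z] by (simp add: relation_category_simps graph_gr ten_gr cmp_gr)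
qed

sublocale T: linear_symmetric_monoidal_category T
proof
  show "TenA T (AddA T f f') g = AddA T (TenA T f g) (TenA T f' g)"
    if "f \<in> Hom T x y" "f' \<in> Hom T x y" "g \<in> Hom T x' y'" for f f' g x y x' y'
    using that by (auto simp: Hom_relation_category relation_category_simps)
  show "TenA T f (AddA T g g') = AddA T (TenA T f g) (TenA T f g')"
    if "f \<in> Hom T x y" "g \<in> Hom T x' y'" "g' \<in> Hom T x' y'" for f g g' x y x' y'
    using that by (auto simp: Hom_relation_category relation_category_simps)
  show "TenA T (SmultA T c f) g = SmultA T c (TenA T f g)" "TenA T f (SmultA T c g) = SmultA T c (TenA T f g)"
    if "f \<in> Hom T x y" "g \<in> Hom T x' y'" for c f g x y x' y'
    using that by (auto simp: Hom_relation_category relation_category_simps)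
qed

end

section \<open>The additive completion\<close>

context linear_category begin

lemma Comp_HomI: "\<lbrakk>f \<in> Hom C x y; g \<in> Hom C y z\<rbrakk> \<Longrightarrow> g \<cdot> f \<in> Hom C x z"
  by (rule Comp_Hom)

lemma Hom_Obj: "f \<in> Hom C x y \<Longrightarrow> x \<in> Obj C \<and> y \<in> Obj C"
  by (auto simp: Hom_iff)

text \<open>Writing the scalar 0 as 1 + (- 1) brings in the axiom on additive inverses.\<close>

lemma SmultA_zero:
  assumes "f \<in> Hom C x y" shows "SmultA C 0 f = ZeroA C x y"
  using SmultA_add [OF assms, of 1 "- 1"] SmultA_one [OF assms] AddA_inverse [OF assms] by simp

lemma Comp_ZeroA:
  assumes "g \<in> Hom C y z" "x \<in> Obj C"
  shows "g \<cdot> ZeroA C x y = ZeroA C x z"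
proof -
  have z: "ZeroA C x y \<in> Hom C x y" using assms Hom_Obj by (blast intro: ZeroA_Hom)
  have "g \<cdot> SmultA C 0 (ZeroA C x y) = SmultA C 0 (g \<cdot> ZeroA C x y)"
    by (rule Comp_SmultA [OF z assms(1)])
  then show ?thesis using SmultA_zero [OF z] SmultA_zero [OF Comp_Hom [OF z assms(1)]] by simp
qed

lemma ZeroA_Comp:
  assumes "f \<in> Hom C x y" "z \<in> Obj C"
  shows "ZeroA C y z \<cdot> f = ZeroA C x z"
proof -
  have z: "ZeroA C y z \<in> Hom C y z" using assms Hom_Obj by (blast intro: ZeroA_Hom)
  have "SmultA C 0 (ZeroA C y z) \<cdot> f = SmultA C 0 (ZeroA C y z \<cdot> f)"
    by (rule SmultA_Comp [OF assms(1) z])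
  then show ?thesis using SmultA_zero [OF z] SmultA_zero [OF Comp_Hom [OF assms(1) z]] by simp
qed

text \<open>Matrix products are defined by folding over a list; summing a function over an initial
  segment of the naturals instead permits induction on the number of terms.\<close>

definition hsum :: "'o \<Rightarrow> 'o \<Rightarrow> nat \<Rightarrow> (nat \<Rightarrow> 'a) \<Rightarrow> 'a" where
  "hsum x y n f = hom_sum C x y (map f [0..<n])"

lemma hom_sum_Hom:
  assumes "x \<in> Obj C" "y \<in> Obj C" "set fs \<subseteq> Hom C x y" shows "hom_sum C x y fs \<in> Hom C x y"
  using assms(3) unfolding hom_sum_def by (induct fs) (auto intro: ZeroA_Hom AddA_Hom assms(1,2))

lemma hsum_Hom [intro]:
  assumes "x \<in> Obj C" "y \<in> Obj C" "\<And>k. k < n \<Longrightarrow> f k \<in> Hom C x y"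
  shows "hsum x y n f \<in> Hom C x y"
  unfolding hsum_def by (rule hom_sum_Hom) (use assms in auto)

lemma hsum_cong:
  assumes "\<And>k. k < n \<Longrightarrow> f k = g k" shows "hsum x y n f = hsum x y n g"
  unfolding hsum_def using assms by (metis (mono_tags, lifting) atLeastLessThan_iff map_cong set_upt)

lemma hsum_0 [simp]: "hsum x y 0 f = ZeroA C x y"
  by (simp add: hsum_def hom_sum_def)

lemma AddA_ZeroA_right:
  assumes "f \<in> Hom C x y" shows "AddA C f (ZeroA C x y) = f"
  using assms AddA_commute [OF assms ZeroA_Hom] AddA_ZeroA Hom_Obj by metis

text \<open>\<open>foldr\<close> peels off the first summand, while induction on the length needs
  the last one. Associativity moves the start value of the fold to the outside.\<close>

lemma hsum_Suc:
  assumes "\<And>k. k < Suc n \<Longrightarrow> f k \<in> Hom C x y"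
  shows "hsum x y (Suc n) f = AddA C (hsum x y n f) (f n)"
proof -
  have xy: "x \<in> Obj C" "y \<in> Obj C" using assms [of 0] Hom_Obj by auto
  have "foldr (AddA C) fs h = AddA C (foldr (AddA C) fs (ZeroA C x y)) h"
    if "set fs \<subseteq> Hom C x y" "h \<in> Hom C x y" for fs h
    using that
  proof (induct fs)
    case Nil
    then show ?case by (simp add: AddA_ZeroA)
  next
    case (Cons g fs)
    have "foldr (AddA C) fs (ZeroA C x y) \<in> Hom C x y"
      using hom_sum_Hom [OF xy, of fs] Cons by (simp add: hom_sum_def)
    then show ?case using Cons AddA_assoc [of g x y "foldr (AddA C) fs (ZeroA C x y)" h] by simp
  qed
  moreover have "set (map f [0..<n]) \<subseteq> Hom C x y" "f n \<in> Hom C x y" using assms by auto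
  ultimately have "foldr (AddA C) (map f [0..<n]) (f n) = AddA C (foldr (AddA C) (map f [0..<n]) (ZeroA C x y)) (f n)"
    by blast
  then show ?thesis
    unfolding hsum_def hom_sum_def using AddA_ZeroA_right [OF \<open>f n \<in> Hom C x y\<close>] by simp
qed

lemma AddA_swap:
  assumes "a \<in> Hom C x y" "b \<in> Hom C x y" "c \<in> Hom C x y" "d \<in> Hom C x y"
  shows "AddA C (AddA C a b) (AddA C c d) = AddA C (AddA C a c) (AddA C b d)"
proof -
  have "AddA C (AddA C a b) (AddA C c d) = AddA C a (AddA C (AddA C b c) d)"
    using AddA_assoc [OF assms(1,2) AddA_Hom [OF assms(3,4)]] AddA_assoc [OF assms(2-4)] by simp
  also have "\<dots> = AddA C (AddA C a c) (AddA C b d)"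
    using AddA_commute [OF assms(2,3)] AddA_assoc [OF assms(3,2,4)]
      AddA_assoc [OF assms(1,3) AddA_Hom [OF assms(2,4)]] by simp
  finally show ?thesis .
qed

lemma hsum_zero:
  assumes "x \<in> Obj C" "y \<in> Obj C" "\<And>k. k < n \<Longrightarrow> f k = ZeroA C x y"
  shows "hsum x y n f = ZeroA C x y"
  using assms(3)
proof (induct n)
  case (Suc n)
  then have "hsum x y (Suc n) f = AddA C (hsum x y n f) (f n)"
    by (intro hsum_Suc) (simp add: ZeroA_Hom assms)
  then show ?case using Suc by (simp add: AddA_ZeroA ZeroA_Hom assms)
qed simp

lemma hsum_add:
  assumes "x \<in> Obj C" "y \<in> Obj C" "\<And>k. k < n \<Longrightarrow> f k \<in> Hom C x y" "\<And>k. k < n \<Longrightarrow> g k \<in> Hom C x y"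
  shows "hsum x y n (\<lambda>k. AddA C (f k) (g k)) = AddA C (hsum x y n f) (hsum x y n g)"
  using assms(3,4)
proof (induct n)
  case (Suc n)
  have "hsum x y (Suc n) (\<lambda>k. AddA C (f k) (g k)) = AddA C (hsum x y n (\<lambda>k. AddA C (f k) (g k))) (AddA C (f n) (g n))"
    using Suc.prems by (intro hsum_Suc AddA_Hom) auto
  also have "\<dots> = AddA C (AddA C (hsum x y n f) (hsum x y n g)) (AddA C (f n) (g n))"
    using Suc by simp
  also have "\<dots> = AddA C (AddA C (hsum x y n f) (f n)) (AddA C (hsum x y n g) (g n))"
    using Suc.prems by (intro AddA_swap hsum_Hom) (auto simp: assms(1,2))
  finally show ?case using Suc.prems by (simp add: hsum_Suc)
qed (simp add: AddA_ZeroA ZeroA_Hom assms)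

lemma hsum_swap:
  assumes "x \<in> Obj C" "y \<in> Obj C" "\<And>i j. i < n \<Longrightarrow> j < m \<Longrightarrow> f i j \<in> Hom C x y"
  shows "hsum x y n (\<lambda>i. hsum x y m (f i)) = hsum x y m (\<lambda>j. hsum x y n (\<lambda>i. f i j))"
  using assms(3)
proof (induct n)
  case (Suc n)
  have "hsum x y (Suc n) (\<lambda>i. hsum x y m (f i)) = AddA C (hsum x y n (\<lambda>i. hsum x y m (f i))) (hsum x y m (f n))"
    using Suc.prems by (intro hsum_Suc hsum_Hom) (auto simp: assms(1,2))
  also have "\<dots> = AddA C (hsum x y m (\<lambda>j. hsum x y n (\<lambda>i. f i j))) (hsum x y m (f n))"
    using Suc by simp
  also have "\<dots> = hsum x y m (\<lambda>j. AddA C (hsum x y n (\<lambda>i. f i j)) (f n j))"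
    using Suc.prems by (intro hsum_add [symmetric] hsum_Hom) (auto simp: assms(1,2))
  also have "\<dots> = hsum x y m (\<lambda>j. hsum x y (Suc n) (\<lambda>i. f i j))"
    using Suc.prems by (intro hsum_cong hsum_Suc [symmetric]) auto
  finally show ?case .
qed (simp add: hsum_zero assms)

lemma hsum_delta:
  assumes "k < n" "f k \<in> Hom C x y" "\<And>i. i < n \<Longrightarrow> i \<noteq> k \<Longrightarrow> f i = ZeroA C x y"
  shows "hsum x y n f = f k"
proof -
  have xy: "x \<in> Obj C" "y \<in> Obj C" using assms(2) Hom_Obj by auto
  \<comment> \<open>Generalised to all shorter sums, so that the induction can pass the index
    \<open>k\<close>.\<close>
  have "m \<le> n \<Longrightarrow> hsum x y m f = (if k < m then f k else ZeroA C x y)" for m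
  proof (induct m)
    case (Suc m)
    have *: "f i \<in> Hom C x y" if "i < n" for i using assms that xy by (cases "i = k") (auto simp: ZeroA_Hom)
    then have "hsum x y (Suc m) f = AddA C (hsum x y m f) (f m)" using Suc by (intro hsum_Suc) auto
    then show ?case using Suc assms xy
      by (cases "m = k") (auto simp: AddA_ZeroA AddA_ZeroA_right ZeroA_Hom less_Suc_eq)
  qed simp
  then show ?thesis using assms(1) by simp
qed

lemma hsum_Comp:
  assumes "x \<in> Obj C" "y \<in> Obj C" "\<And>k. k < n \<Longrightarrow> f k \<in> Hom C x y" "g \<in> Hom C y z"
  shows "g \<cdot> hsum x y n f = hsum x z n (\<lambda>k. g \<cdot> f k)"
  using assms(3)
proof (induct n)
  case (Suc n)
  have "hsum x z (Suc n) (\<lambda>k. g \<cdot> f k) = AddA C (hsum x z n (\<lambda>k. g \<cdot> f k)) (g \<cdot> f n)"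
    using Suc.prems assms(4) by (intro hsum_Suc Comp_HomI)
  moreover have "g \<cdot> hsum x y (Suc n) f = AddA C (g \<cdot> hsum x y n f) (g \<cdot> f n)"
    using Suc.prems assms(4) Comp_AddA [of "hsum x y n f" x y "f n" g z]
    by (simp add: hsum_Suc hsum_Hom assms(1,2))
  ultimately show ?case using Suc by simp
qed (simp add: Comp_ZeroA assms)

lemma Comp_hsum:
  assumes "y \<in> Obj C" "z \<in> Obj C" "\<And>k. k < n \<Longrightarrow> g k \<in> Hom C y z" "f \<in> Hom C x y"
  shows "hsum y z n g \<cdot> f = hsum x z n (\<lambda>k. g k \<cdot> f)"
  using assms(3)
proof (induct n)
  case (Suc n)
  have "hsum x z (Suc n) (\<lambda>k. g k \<cdot> f) = AddA C (hsum x z n (\<lambda>k. g k \<cdot> f)) (g n \<cdot> f)"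
    using Suc.prems assms(4) by (intro hsum_Suc Comp_HomI)
  moreover have "hsum y z (Suc n) g \<cdot> f = AddA C (hsum y z n g \<cdot> f) (g n \<cdot> f)"
    using Suc.prems assms(4) AddA_Comp [of f x y "hsum y z n g" z "g n"]
    by (simp add: hsum_Suc hsum_Hom assms(1,2))
  ultimately show ?case using Suc by simp
qed (simp add: ZeroA_Comp assms)

lemma SmultA_hsum:
  assumes "x \<in> Obj C" "y \<in> Obj C" "\<And>k. k < n \<Longrightarrow> f k \<in> Hom C x y"
  shows "SmultA C c (hsum x y n f) = hsum x y n (\<lambda>k. SmultA C c (f k))"
  using assms(3)
proof (induct n)
  case 0
  have "ZeroA C x y \<in> Hom C x y" using assms by (simp add: ZeroA_Hom)
  from SmultA_SmultA [OF this, of c 0] SmultA_zero [OF this] show ?case by simp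
next
  case (Suc n)
  then show ?case using SmultA_AddA [of "hsum x y n f" x y "f n" c]
    by (simp add: hsum_Suc SmultA_Hom hsum_Hom assms(1,2))
qed

text \<open>Row-major numbering of pairs. It converts the double sum obtained from a tensor product
  of two matrix products into the single sum of a matrix product of tensor products.\<close>

lemma hsum_times:
  assumes "x \<in> Obj C" "y \<in> Obj C" "\<And>i j. i < n \<Longrightarrow> j < m \<Longrightarrow> f i j \<in> Hom C x y"
  shows "hsum x y (n * m) (\<lambda>k. f (k div m) (k mod m)) = hsum x y n (\<lambda>i. hsum x y m (f i))"
  using assms(3)
proof (induct n)
  case (Suc n)
  \<comment> \<open>The bound on \<open>k\<close> can hold only for positive \<open>m\<close>, which
    is what makes the remainder a valid column index.\<close>
  have f: "f (k div m) (k mod m) \<in> Hom C x y" if "k < Suc n * m" for k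
    using that by (intro Suc.prems) (auto simp: less_mult_imp_div_less intro!: mod_less_divisor gr0I)
  \<comment> \<open>An inner induction over an unfinished last row of length
    \<open>l\<close>.\<close>
  have "l \<le> m \<Longrightarrow> hsum x y (n * m + l) (\<lambda>k. f (k div m) (k mod m))
      = AddA C (hsum x y (n * m) (\<lambda>k. f (k div m) (k mod m))) (hsum x y l (f n))" for l
  proof (induct l)
    case 0
    show ?case using f by (simp add: AddA_ZeroA_right hsum_Hom assms(1,2))
  next
    case (Suc l)
    have "hsum x y (n * m + Suc l) (\<lambda>k. f (k div m) (k mod m))
      = AddA C (hsum x y (n * m + l) (\<lambda>k. f (k div m) (k mod m))) (f n l)"
      using hsum_Suc [of "n * m + l" "\<lambda>k. f (k div m) (k mod m)" x y] f Suc.prems by simp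
    also have "\<dots> = AddA C (AddA C (hsum x y (n * m) (\<lambda>k. f (k div m) (k mod m))) (hsum x y l (f n))) (f n l)"
      using Suc by simp
    also have "\<dots> = AddA C (hsum x y (n * m) (\<lambda>k. f (k div m) (k mod m))) (AddA C (hsum x y l (f n)) (f n l))"
      by (rule AddA_assoc [of _ x y]) (use f Suc.prems \<open>\<And>i j. i < Suc n \<Longrightarrow> j < m \<Longrightarrow> f i j \<in> Hom C x y\<close> in \<open>auto simp: assms(1,2)\<close>)
    also have "AddA C (hsum x y l (f n)) (f n l) = hsum x y (Suc l) (f n)"
      using Suc.prems \<open>\<And>i j. i < Suc n \<Longrightarrow> j < m \<Longrightarrow> f i j \<in> Hom C x y\<close> by (intro hsum_Suc [symmetric]) auto
    finally show ?case .
  qed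
  from this [of m] have "hsum x y (Suc n * m) (\<lambda>k. f (k div m) (k mod m))
    = AddA C (hsum x y (n * m) (\<lambda>k. f (k div m) (k mod m))) (hsum x y m (f n))" by (simp add: add.commute)
  also have "\<dots> = AddA C (hsum x y n (\<lambda>i. hsum x y m (f i))) (hsum x y m (f n))"
    using Suc by simp
  also have "\<dots> = hsum x y (Suc n) (\<lambda>i. hsum x y m (f i))"
    using Suc.prems by (intro hsum_Suc [symmetric] hsum_Hom) (auto simp: assms(1,2))
  finally show ?case .
qed simp

end

context linear_symmetric_monoidal_category begin

text \<open>A zero arrow is a multiple by the scalar 0, and bilinearity moves the scalar out of the
  tensor product.\<close>

lemma TenA_ZeroA_left:
  assumes "g \<in> Hom C x' y'" "x \<in> Obj C" "y \<in> Obj C"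
  shows "TenA C (ZeroA C x y) g = ZeroA C (TenO C x x') (TenO C y y')"
proof -
  have z: "ZeroA C x y \<in> Hom C x y" using assms by (simp add: ZeroA_Hom)
  show ?thesis using TenA_SmultA_left [OF z assms(1), of 0] SmultA_zero [OF z] SmultA_zero [OF TenA_Hom [OF z assms(1)]]
    by simp
qed

lemma TenA_ZeroA_right:
  assumes "f \<in> Hom C x y" "x' \<in> Obj C" "y' \<in> Obj C"
  shows "TenA C f (ZeroA C x' y') = ZeroA C (TenO C x x') (TenO C y y')"
proof -
  have z: "ZeroA C x' y' \<in> Hom C x' y'" using assms by (simp add: ZeroA_Hom)
  show ?thesis using TenA_SmultA_right [OF assms(1) z, of 0] SmultA_zero [OF z] SmultA_zero [OF TenA_Hom [OF assms(1) z]]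
    by simp
qed

lemma TenA_hsum_left:
  assumes "x \<in> Obj C" "y \<in> Obj C" "\<And>k. k < n \<Longrightarrow> f k \<in> Hom C x y" "g \<in> Hom C x' y'"
  shows "TenA C (hsum x y n f) g = hsum (TenO C x x') (TenO C y y') n (\<lambda>k. TenA C (f k) g)"
  using assms(3)
proof (induct n)
  case (Suc n)
  have "hsum (TenO C x x') (TenO C y y') (Suc n) (\<lambda>k. TenA C (f k) g)
      = AddA C (hsum (TenO C x x') (TenO C y y') n (\<lambda>k. TenA C (f k) g)) (TenA C (f n) g)"
    using Suc.prems assms(4) by (intro hsum_Suc TenA_Hom)
  moreover have "TenA C (hsum x y (Suc n) f) g = AddA C (TenA C (hsum x y n f) g) (TenA C (f n) g)"
    using Suc.prems assms(4) TenA_AddA_left [of "hsum x y n f" x y "f n" g x' y']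
    by (simp add: hsum_Suc hsum_Hom assms(1,2))
  ultimately show ?case using Suc by simp
qed (simp add: TenA_ZeroA_left assms)

lemma TenA_hsum_right:
  assumes "x' \<in> Obj C" "y' \<in> Obj C" "\<And>k. k < n \<Longrightarrow> g k \<in> Hom C x' y'" "f \<in> Hom C x y"
  shows "TenA C f (hsum x' y' n g) = hsum (TenO C x x') (TenO C y y') n (\<lambda>k. TenA C f (g k))"
  using assms(3)
proof (induct n)
  case (Suc n)
  have "hsum (TenO C x x') (TenO C y y') (Suc n) (\<lambda>k. TenA C f (g k))
      = AddA C (hsum (TenO C x x') (TenO C y y') n (\<lambda>k. TenA C f (g k))) (TenA C f (g n))"
    using Suc.prems assms(4) by (intro hsum_Suc TenA_Hom)
  moreover have "TenA C f (hsum x' y' (Suc n) g) = AddA C (TenA C f (hsum x' y' n g)) (TenA C f (g n))"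
    using Suc.prems assms(4) TenA_AddA_right [of f x y "hsum x' y' n g" x' y' "g n"]
    by (simp add: hsum_Suc hsum_Hom assms(1,2))
  ultimately show ?case using Suc by simp
qed (simp add: TenA_ZeroA_right assms)

end

section \<open>Flat indices and matrices of arrows\<close>

lemma mult_add_div_mod [simp]:
  fixes q n b :: nat
  assumes "b < n" shows "(q * n + b) div n = q" "(q * n + b) mod n = b"
  using assms by auto

lemma mult_add_less:
  fixes q n b :: nat
  assumes "b < n" "q < m" shows "q * n + b < m * n"
proof -
  have "q * n + b < Suc q * n" using assms by simp
  also have "\<dots> \<le> m * n" using assms by (intro mult_le_mono1) simp
  finally show ?thesis .
qed

text \<open>The mere existence of an index below the product forces \<open>n\<close> to be positive,
  on which the bound for the remainder relies.\<close>

lemma less_mult_div_mod: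
  fixes m n k :: nat
  assumes "k < m * n" shows "k div n < m" "k mod n < n"
  using assms by (auto simp: less_mult_imp_div_less intro!: mod_less_divisor gr0I)

lemma length_list_tensor [simp]: "length (list_tensor C xs ys) = length xs * length ys"
  by (simp add: list_tensor_def)

lemma nth_list_tensor [simp]:
  "k < length xs * length ys \<Longrightarrow> list_tensor C xs ys ! k = TenO C (xs ! (k div length ys)) (ys ! (k mod length ys))"
  by (simp add: list_tensor_def product_nth)

text \<open>The record has no extension fields because the completion is defined for such records
  only.\<close>

locale additive_context = linear_symmetric_monoidal_category C
  for C :: "('o, 'a, 'k::field) lsmcat" (structure)
begin

abbreviation A where "A \<equiv> additive_completion C"

text \<open>Matrices are treated as functions of two indices; by \<open>matrix_arrow_eq\<close> only
  values inside the index range matter, so typing is demanded there alone.\<close>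

definition entries :: "'o list \<Rightarrow> 'o list \<Rightarrow> (nat \<Rightarrow> nat \<Rightarrow> 'a) \<Rightarrow> bool" where
  "entries xs ys m \<longleftrightarrow> (\<forall>i < length ys. \<forall>j < length xs. m i j \<in> Hom C (xs ! j) (ys ! i))"

lemma A_simps:
  "Obj A = {xs. set xs \<subseteq> Obj C}" "Dom A = arr_dom" "Cod A = arr_cod" "TenO A = list_tensor C"
  "UnitO A = [UnitO C]"
  by (simp_all add: additive_completion_def)

lemma nth_Obj: "\<lbrakk>set xs \<subseteq> Obj C; i < length xs\<rbrakk> \<Longrightarrow> xs ! i \<in> Obj C"
  using nth_mem by blast

lemma list_tensor_Obj: "\<lbrakk>set xs \<subseteq> Obj C; set ys \<subseteq> Obj C\<rbrakk> \<Longrightarrow> set (list_tensor C xs ys) \<subseteq> Obj C"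
  by (auto simp: list_tensor_def intro!: TenO_Obj)

lemma entriesD: "\<lbrakk>entries xs ys m; i < length ys; j < length xs; x = xs ! j; y = ys ! i\<rbrakk> \<Longrightarrow> m i j \<in> Hom C x y"
  by (simp add: entries_def)

lemma Hom_A: "f \<in> Hom A xs ys \<longleftrightarrow>
  (\<exists>m. f = matrix_arrow xs ys m \<and> set xs \<subseteq> Obj C \<and> set ys \<subseteq> Obj C \<and> entries xs ys m)"
proof
  assume "f \<in> Hom A xs ys"
  then obtain M where M: "f = Arrow xs ys M" "set xs \<subseteq> Obj C" "set ys \<subseteq> Obj C"
    "M \<in> carrier_mat (length ys) (length xs)"
    "\<forall>i < length ys. \<forall>j < length xs. M $$ (i, j) \<in> Hom C (xs ! j) (ys ! i)"
    unfolding Hom_def additive_completion_def by auto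
  then have "M = mat (length ys) (length xs) (\<lambda>(i, j). M $$ (i, j))" by (intro eq_matI) auto
  then have "f = matrix_arrow xs ys (\<lambda>i j. M $$ (i, j))" using M by (simp add: matrix_arrow_def)
  then show "\<exists>m. f = matrix_arrow xs ys m \<and> set xs \<subseteq> Obj C \<and> set ys \<subseteq> Obj C \<and> entries xs ys m"
    using M unfolding entries_def by blast
next
  assume "\<exists>m. f = matrix_arrow xs ys m \<and> set xs \<subseteq> Obj C \<and> set ys \<subseteq> Obj C \<and> entries xs ys m"
  then show "f \<in> Hom A xs ys"
    unfolding Hom_def additive_completion_def entries_def matrix_arrow_def by auto
qed

lemma matrix_Hom:
  "\<lbrakk>set xs \<subseteq> Obj C; set ys \<subseteq> Obj C; entries xs ys m\<rbrakk> \<Longrightarrow> matrix_arrow xs ys m \<in> Hom A xs ys"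
  unfolding Hom_A by blast

lemma Hom_AE:
  assumes "f \<in> Hom A xs ys"
  obtains m where "f = matrix_arrow xs ys m" "set xs \<subseteq> Obj C" "set ys \<subseteq> Obj C" "entries xs ys m"
  using assms unfolding Hom_A by blast

lemma matrix_arrow_eq:
  "matrix_arrow xs ys m = matrix_arrow xs ys m' \<longleftrightarrow> (\<forall>i < length ys. \<forall>j < length xs. m i j = m' i j)"
proof
  assume "matrix_arrow xs ys m = matrix_arrow xs ys m'"
  then have "mat (length ys) (length xs) (\<lambda>(i, j). m i j) = mat (length ys) (length xs) (\<lambda>(i, j). m' i j)"
    by (simp add: matrix_arrow_def)
  then show "\<forall>i < length ys. \<forall>j < length xs. m i j = m' i j"
    by (metis (mono_tags, lifting) index_mat(1) old.prod.case)
qed (auto simp: matrix_arrow_def intro!: eq_matI)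

lemma matrix_Comp:
  "matrix_arrow ys zs g \<cdot>\<^bsub>A\<^esub> matrix_arrow xs ys f
    = matrix_arrow xs zs (\<lambda>i j. hsum (xs ! j) (zs ! i) (length ys) (\<lambda>k. g i k \<cdot> f k j))"
proof -
  have "matrix_arrow ys zs g \<cdot>\<^bsub>A\<^esub> matrix_arrow xs ys f
    = matrix_arrow xs zs (\<lambda>i j. hsum (xs ! j) (zs ! i) (length ys)
        (\<lambda>k. arr_val (matrix_arrow ys zs g) $$ (i, k) \<cdot> arr_val (matrix_arrow xs ys f) $$ (k, j)))"
    by (simp add: additive_completion_def hsum_def matrix_arrow_def)
  also have "\<dots> = matrix_arrow xs zs (\<lambda>i j. hsum (xs ! j) (zs ! i) (length ys) (\<lambda>k. g i k \<cdot> f k j))"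
    unfolding matrix_arrow_eq by (intro allI impI hsum_cong) (simp add: matrix_arrow_def)
  finally show ?thesis .
qed

lemma matrix_TenA:
  "TenA A (matrix_arrow xs ys f) (matrix_arrow xs' ys' g)
    = matrix_arrow (list_tensor C xs xs') (list_tensor C ys ys')
      (\<lambda>i j. TenA C (f (i div length ys') (j div length xs')) (g (i mod length ys') (j mod length xs')))"
proof -
  have "TenA A (matrix_arrow xs ys f) (matrix_arrow xs' ys' g)
    = matrix_arrow (list_tensor C xs xs') (list_tensor C ys ys')
      (\<lambda>i j. TenA C (arr_val (matrix_arrow xs ys f) $$ (i div length ys', j div length xs'))
        (arr_val (matrix_arrow xs' ys' g) $$ (i mod length ys', j mod length xs')))"
    by (simp add: additive_completion_def matrix_arrow_def Let_def)
  also have "\<dots> = matrix_arrow (list_tensor C xs xs') (list_tensor C ys ys')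
      (\<lambda>i j. TenA C (f (i div length ys') (j div length xs')) (g (i mod length ys') (j mod length xs')))"
    unfolding matrix_arrow_eq by (intro allI impI) (simp add: matrix_arrow_def less_mult_div_mod)
  finally show ?thesis .
qed

lemma matrix_AddA:
  "AddA A (matrix_arrow xs ys f) (matrix_arrow xs ys g) = matrix_arrow xs ys (\<lambda>i j. AddA C (f i j) (g i j))"
proof -
  have "AddA A (matrix_arrow xs ys f) (matrix_arrow xs ys g) = matrix_arrow xs ys
      (\<lambda>i j. AddA C (arr_val (matrix_arrow xs ys f) $$ (i, j)) (arr_val (matrix_arrow xs ys g) $$ (i, j)))"
    by (simp add: additive_completion_def matrix_arrow_def)
  also have "\<dots> = matrix_arrow xs ys (\<lambda>i j. AddA C (f i j) (g i j))"
    unfolding matrix_arrow_eq by (intro allI impI) (simp add: matrix_arrow_def)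
  finally show ?thesis .
qed

lemma matrix_SmultA:
  "SmultA A c (matrix_arrow xs ys f) = matrix_arrow xs ys (\<lambda>i j. SmultA C c (f i j))"
proof -
  have "SmultA A c (matrix_arrow xs ys f) = matrix_arrow xs ys
      (\<lambda>i j. SmultA C c (arr_val (matrix_arrow xs ys f) $$ (i, j)))"
    by (simp add: additive_completion_def matrix_arrow_def)
  also have "\<dots> = matrix_arrow xs ys (\<lambda>i j. SmultA C c (f i j))"
    unfolding matrix_arrow_eq by (intro allI impI) (simp add: matrix_arrow_def)
  finally show ?thesis .
qed

lemma matrix_ZeroA: "ZeroA A xs ys = matrix_arrow xs ys (\<lambda>i j. ZeroA C (xs ! j) (ys ! i))"
  by (simp add: additive_completion_def)

lemma A_structure:
  "Idn A xs = monomial_arrow C xs xs id (\<lambda>j. Idn C (xs ! j))"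
  "Assoc A xs ys zs = monomial_arrow C (list_tensor C (list_tensor C xs ys) zs) (list_tensor C xs (list_tensor C ys zs)) id
     (\<lambda>j. Assoc C (xs ! (j div length zs div length ys)) (ys ! (j div length zs mod length ys)) (zs ! (j mod length zs)))"
  "LUnit A xs = monomial_arrow C (list_tensor C [UnitO C] xs) xs id (\<lambda>j. LUnit C (xs ! j))"
  "RUnit A xs = monomial_arrow C (list_tensor C xs [UnitO C]) xs id (\<lambda>j. RUnit C (xs ! j))"
  "Braid A xs ys = monomial_arrow C (list_tensor C xs ys) (list_tensor C ys xs)
     (\<lambda>j. (j mod length ys) * length xs + j div length ys)
     (\<lambda>j. Braid C (xs ! (j div length ys)) (ys ! (j mod length ys)))"
  by (simp_all add: additive_completion_def Let_def)

text \<open>Well-typed monomial matrices. Injectivity of \<open>\<pi>\<close> is left open: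
  composition and tensor product use only that a column has at most one nonzero entry.\<close>

definition mono_entries :: "'o list \<Rightarrow> 'o list \<Rightarrow> (nat \<Rightarrow> nat) \<Rightarrow> (nat \<Rightarrow> 'a) \<Rightarrow> bool" where
  "mono_entries xs ys \<pi> f \<longleftrightarrow> set xs \<subseteq> Obj C \<and> set ys \<subseteq> Obj C \<and>
     (\<forall>j < length xs. \<pi> j < length ys \<and> f j \<in> Hom C (xs ! j) (ys ! \<pi> j))"

lemma mono_Hom: "mono_entries xs ys \<pi> f \<Longrightarrow> monomial_arrow C xs ys \<pi> f \<in> Hom A xs ys"
  unfolding Hom_A monomial_arrow_def mono_entries_def entries_def
  by (intro exI conjI, rule refl) (auto intro!: ZeroA_Hom nth_Obj)

lemma mono_eqI:
  assumes "\<And>j. j < length xs \<Longrightarrow> \<pi> j = \<pi>' j" "\<And>j. j < length xs \<Longrightarrow> f j = f' j"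
  shows "monomial_arrow C xs ys \<pi> f = monomial_arrow C xs ys \<pi>' f'"
  unfolding monomial_arrow_def matrix_arrow_eq using assms by auto

text \<open>In column \<open>j\<close> the right factor is supported in row \<open>\<pi> j\<close>,
  so a single summand of each entry survives.\<close>

lemma mono_Comp:
  assumes f: "mono_entries xs ys \<pi> f" and g: "mono_entries ys zs \<sigma> g"
  shows "monomial_arrow C ys zs \<sigma> g \<cdot>\<^bsub>A\<^esub> monomial_arrow C xs ys \<pi> f
    = monomial_arrow C xs zs (\<lambda>j. \<sigma> (\<pi> j)) (\<lambda>j. g (\<pi> j) \<cdot> f j)"
  unfolding monomial_arrow_def matrix_Comp matrix_arrow_eq
proof (intro allI impI)
  fix i j assume i: "i < length zs" and j: "j < length xs"
  have fj: "\<pi> j < length ys" "f j \<in> Hom C (xs ! j) (ys ! \<pi> j)" using f j by (auto simp: mono_entries_def)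
  have gj: "\<sigma> (\<pi> j) < length zs" "g (\<pi> j) \<in> Hom C (ys ! \<pi> j) (zs ! \<sigma> (\<pi> j))" using g fj by (auto simp: mono_entries_def)
  have obj: "xs ! j \<in> Obj C" "zs ! i \<in> Obj C" using f g i j by (auto simp: mono_entries_def nth_Obj)
  let ?t = "\<lambda>k. (if i = \<sigma> k then g k else ZeroA C (ys ! k) (zs ! i)) \<cdot> (if k = \<pi> j then f j else ZeroA C (xs ! j) (ys ! k))"
  have t: "?t (\<pi> j) = (if i = \<sigma> (\<pi> j) then g (\<pi> j) \<cdot> f j else ZeroA C (xs ! j) (zs ! i))"
    using fj obj by (simp add: ZeroA_Comp)
  have "hsum (xs ! j) (zs ! i) (length ys) ?t = ?t (\<pi> j)"
  proof (rule hsum_delta [OF fj(1)])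
    show "?t (\<pi> j) \<in> Hom C (xs ! j) (zs ! i)" unfolding t using fj gj obj by (auto intro: ZeroA_Hom Comp_Hom)
    fix k assume k: "k < length ys" "k \<noteq> \<pi> j"
    have "(if i = \<sigma> k then g k else ZeroA C (ys ! k) (zs ! i)) \<in> Hom C (ys ! k) (zs ! i)"
      using g k i by (auto simp: mono_entries_def intro!: ZeroA_Hom nth_Obj)
    then show "?t k = ZeroA C (xs ! j) (zs ! i)" using k obj by (simp add: Comp_ZeroA)
  qed
  then show "hsum (xs ! j) (zs ! i) (length ys) ?t
    = (if i = \<sigma> (\<pi> j) then g (\<pi> j) \<cdot> f j else ZeroA C (xs ! j) (zs ! i))" using t by simp
qed

lemma mono_entries_Comp:
  assumes "mono_entries xs ys \<pi> f" "mono_entries ys zs \<sigma> g"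
  shows "mono_entries xs zs (\<lambda>j. \<sigma> (\<pi> j)) (\<lambda>j. g (\<pi> j) \<cdot> f j)"
  using assms unfolding mono_entries_def by (blast intro: Comp_Hom)

lemma mono_entries_TenA:
  assumes f: "mono_entries xs ys \<pi> f" and g: "mono_entries xs' ys' \<pi>' f'"
  shows "mono_entries (list_tensor C xs xs') (list_tensor C ys ys')
      (\<lambda>j. \<pi> (j div length xs') * length ys' + \<pi>' (j mod length xs'))
      (\<lambda>j. TenA C (f (j div length xs')) (f' (j mod length xs')))"
  unfolding mono_entries_def
proof (intro conjI allI impI)
  fix j assume "j < length (list_tensor C xs xs')"
  then have j: "j < length xs * length xs'" by simp
  note d = less_mult_div_mod [OF j]
  have F: "\<pi> (j div length xs') < length ys" "f (j div length xs') \<in> Hom C (xs ! (j div length xs')) (ys ! \<pi> (j div length xs'))"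
    "\<pi>' (j mod length xs') < length ys'" "f' (j mod length xs') \<in> Hom C (xs' ! (j mod length xs')) (ys' ! \<pi>' (j mod length xs'))"
    using f g d by (auto simp: mono_entries_def)
  show "\<pi> (j div length xs') * length ys' + \<pi>' (j mod length xs') < length (list_tensor C ys ys')"
    using mult_add_less [OF F(3,1)] by simp
  show "TenA C (f (j div length xs')) (f' (j mod length xs')) \<in> Hom C (list_tensor C xs xs' ! j)
     (list_tensor C ys ys' ! (\<pi> (j div length xs') * length ys' + \<pi>' (j mod length xs')))"
    using TenA_Hom [OF F(2,4)] mult_add_less [OF F(3,1)] j F(3) by simp
qed (use assms list_tensor_Obj in \<open>auto simp: mono_entries_def\<close>)

lemma mono_TenA:
  assumes f: "mono_entries xs ys \<pi> f" and g: "mono_entries xs' ys' \<pi>' f'"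
  shows "TenA A (monomial_arrow C xs ys \<pi> f) (monomial_arrow C xs' ys' \<pi>' f')
    = monomial_arrow C (list_tensor C xs xs') (list_tensor C ys ys')
      (\<lambda>j. \<pi> (j div length xs') * length ys' + \<pi>' (j mod length xs'))
      (\<lambda>j. TenA C (f (j div length xs')) (f' (j mod length xs')))"
  unfolding monomial_arrow_def matrix_TenA matrix_arrow_eq
proof (intro allI impI)
  fix i j assume "i < length (list_tensor C ys ys')" "j < length (list_tensor C xs xs')"
  then have i: "i < length ys * length ys'" and j: "j < length xs * length xs'" by simp_all
  note d = less_mult_div_mod [OF i] less_mult_div_mod [OF j]
  let ?m = "length ys'" and ?n = "length xs'"
  have F: "\<pi> (j div ?n) < length ys" "f (j div ?n) \<in> Hom C (xs ! (j div ?n)) (ys ! \<pi> (j div ?n))"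
    "\<pi>' (j mod ?n) < length ys'" "f' (j mod ?n) \<in> Hom C (xs' ! (j mod ?n)) (ys' ! \<pi>' (j mod ?n))"
    using f g d by (auto simp: mono_entries_def)
  have O: "xs ! (j div ?n) \<in> Obj C" "xs' ! (j mod ?n) \<in> Obj C" "ys ! (i div ?m) \<in> Obj C" "ys' ! (i mod ?m) \<in> Obj C"
    using f g d by (auto simp: mono_entries_def nth_Obj)
  \<comment> \<open>Quotient and remainder separate the flat index into its two coordinates; the
    bound on \<open>\<pi>'\<close> makes this an equivalence.\<close>
  have eq: "i = \<pi> (j div ?n) * ?m + \<pi>' (j mod ?n) \<longleftrightarrow> i div ?m = \<pi> (j div ?n) \<and> i mod ?m = \<pi>' (j mod ?n)"
    using F(3) by (metis div_mult_mod_eq mult_add_div_mod)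
  show "TenA C (if i div ?m = \<pi> (j div ?n) then f (j div ?n) else ZeroA C (xs ! (j div ?n)) (ys ! (i div ?m)))
      (if i mod ?m = \<pi>' (j mod ?n) then f' (j mod ?n) else ZeroA C (xs' ! (j mod ?n)) (ys' ! (i mod ?m)))
    = (if i = \<pi> (j div ?n) * ?m + \<pi>' (j mod ?n) then TenA C (f (j div ?n)) (f' (j mod ?n))
       else ZeroA C (list_tensor C xs xs' ! j) (list_tensor C ys ys' ! i))"
  proof (cases "i div ?m = \<pi> (j div ?n)")
    case True
    then show ?thesis unfolding eq using F O i j by (auto simp: TenA_ZeroA_right)
  next
    case False
    have "(if i mod ?m = \<pi>' (j mod ?n) then f' (j mod ?n) else ZeroA C (xs' ! (j mod ?n)) (ys' ! (i mod ?m)))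
      \<in> Hom C (xs' ! (j mod ?n)) (ys' ! (i mod ?m))" using F O by (auto simp: ZeroA_Hom)
    then show ?thesis unfolding eq using F O i j False by (simp add: TenA_ZeroA_left)
  qed
qed

lemma matrix_mono_Comp:
  assumes f: "entries ys zs f" and h: "mono_entries xs ys \<pi> h" and zs: "set zs \<subseteq> Obj C"
  shows "matrix_arrow ys zs f \<cdot>\<^bsub>A\<^esub> monomial_arrow C xs ys \<pi> h = matrix_arrow xs zs (\<lambda>i j. f i (\<pi> j) \<cdot> h j)"
  unfolding monomial_arrow_def matrix_Comp matrix_arrow_eq
proof (intro allI impI)
  fix i j assume i: "i < length zs" and j: "j < length xs"
  have obj: "xs ! j \<in> Obj C" "zs ! i \<in> Obj C" using zs h i j by (auto simp: mono_entries_def nth_Obj)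
  have h': "\<pi> j < length ys" "h j \<in> Hom C (xs ! j) (ys ! \<pi> j)" using h j by (auto simp: mono_entries_def)
  have "hsum (xs ! j) (zs ! i) (length ys) (\<lambda>k. f i k \<cdot> (if k = \<pi> j then h j else ZeroA C (xs ! j) (ys ! k)))
    = f i (\<pi> j) \<cdot> (if \<pi> j = \<pi> j then h j else ZeroA C (xs ! j) (ys ! \<pi> j))"
  proof (rule hsum_delta [OF h'(1)])
    show "f i (\<pi> j) \<cdot> (if \<pi> j = \<pi> j then h j else ZeroA C (xs ! j) (ys ! \<pi> j)) \<in> Hom C (xs ! j) (zs ! i)"
      using h' entriesD [OF f i h'(1)] by (auto intro: Comp_Hom)
    show "f i l \<cdot> (if l = \<pi> j then h j else ZeroA C (xs ! j) (ys ! l)) = ZeroA C (xs ! j) (zs ! i)"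
      if "l < length ys" "l \<noteq> \<pi> j" for l
      using that Comp_ZeroA [OF entriesD [OF f i that(1) refl refl] obj(1)] by simp
  qed
  then show "hsum (xs ! j) (zs ! i) (length ys) (\<lambda>k. f i k \<cdot> (if k = \<pi> j then h j else ZeroA C (xs ! j) (ys ! k)))
    = f i (\<pi> j) \<cdot> h j" by simp
qed

text \<open>With the monomial factor on the right, one entry per column collapses the sum. With it
  on the left, one entry per row is needed, hence the bijection \<open>\<sigma>\<close>. All
  naturality axioms of the completion are obtained from this, the square being checked entry by
  entry.\<close>

lemma mono_natural:
  assumes m: "entries xs ys f" "entries xs' ys' f'" "mono_entries ys ys' \<sigma> g" "mono_entries xs xs' \<pi> h"
    and \<sigma>: "bij_betw \<sigma> {..<length ys} {..<length ys'}"
    and eq: "\<And>k j. \<lbrakk>k < length ys; j < length xs\<rbrakk> \<Longrightarrow> g k \<cdot> f k j = f' (\<sigma> k) (\<pi> j) \<cdot> h j"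
  shows "monomial_arrow C ys ys' \<sigma> g \<cdot>\<^bsub>A\<^esub> matrix_arrow xs ys f = matrix_arrow xs' ys' f' \<cdot>\<^bsub>A\<^esub> monomial_arrow C xs xs' \<pi> h"
proof -
  have ys': "set ys' \<subseteq> Obj C" using m by (simp add: mono_entries_def)
  show ?thesis
    unfolding matrix_mono_Comp [OF m(2,4) ys'] unfolding monomial_arrow_def matrix_Comp matrix_arrow_eq
  proof (intro allI impI)
    fix i j assume i: "i < length ys'" and j: "j < length xs"
    obtain k where k: "k < length ys" "i = \<sigma> k" using \<sigma> i unfolding bij_betw_def by (metis imageE lessThan_iff)
    have obj: "xs ! j \<in> Obj C" "ys' ! i \<in> Obj C" using m i j by (auto simp: mono_entries_def nth_Obj)
    have g: "g k \<in> Hom C (ys ! k) (ys' ! i)" using m(3) k by (auto simp: mono_entries_def)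
    have "hsum (xs ! j) (ys' ! i) (length ys) (\<lambda>k. (if i = \<sigma> k then g k else ZeroA C (ys ! k) (ys' ! i)) \<cdot> f k j)
      = (if i = \<sigma> k then g k else ZeroA C (ys ! k) (ys' ! i)) \<cdot> f k j"
    proof (rule hsum_delta [OF k(1)])
      show "(if i = \<sigma> k then g k else ZeroA C (ys ! k) (ys' ! i)) \<cdot> f k j \<in> Hom C (xs ! j) (ys' ! i)"
        using k g entriesD [OF m(1) k(1) j] by (auto intro: Comp_Hom)
      fix l assume l: "l < length ys" "l \<noteq> k"
      then have "\<sigma> l \<noteq> i" using \<sigma> k unfolding bij_betw_def inj_on_def by auto
      then show "(if i = \<sigma> l then g l else ZeroA C (ys ! l) (ys' ! i)) \<cdot> f l j = ZeroA C (xs ! j) (ys' ! i)"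
        using ZeroA_Comp [OF entriesD [OF m(1) l(1) j refl refl] obj(2)] by auto
    qed
    also have "\<dots> = f' i (\<pi> j) \<cdot> h j" using k eq [OF k(1) j] by simp
    finally show "hsum (xs ! j) (ys' ! i) (length ys) (\<lambda>k. (if i = \<sigma> k then g k else ZeroA C (ys ! k) (ys' ! i)) \<cdot> f k j)
       = f' i (\<pi> j) \<cdot> h j" .
  qed
qed

lemma mono_entries_Idn: "set xs \<subseteq> Obj C \<Longrightarrow> mono_entries xs xs id (\<lambda>j. Idn C (xs ! j))"
  by (simp add: mono_entries_def nth_Obj Idn_Hom)

lemma entries_Comp:
  assumes "entries xs ys f" "entries ys zs g" "set xs \<subseteq> Obj C" "set zs \<subseteq> Obj C"
  shows "entries xs zs (\<lambda>i j. hsum (xs ! j) (zs ! i) (length ys) (\<lambda>k. g i k \<cdot> f k j))"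
  unfolding entries_def
proof (intro allI impI hsum_Hom nth_Obj [OF assms(3)] nth_Obj [OF assms(4)])
  fix i j k assume "i < length zs" "j < length xs" "k < length ys"
  then show "g i k \<cdot> f k j \<in> Hom C (xs ! j) (zs ! i)"
    using assms unfolding entries_def by (blast intro: Comp_Hom)
qed

sublocale A: category A
proof
  show "f \<in> Arr A \<Longrightarrow> Dom A f \<in> Obj A" "f \<in> Arr A \<Longrightarrow> Cod A f \<in> Obj A" for f
    by (auto simp: additive_completion_def)
  show "xs \<in> Obj A \<Longrightarrow> Idn A xs \<in> Hom A xs xs" for xs
    unfolding A_structure by (rule mono_Hom) (simp add: A_simps mono_entries_Idn)
  show "g \<cdot>\<^bsub>A\<^esub> f \<in> Hom A xs zs" if "f \<in> Hom A xs ys" "g \<in> Hom A ys zs" for f g xs ys zs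
    using that by (auto elim!: Hom_AE simp: matrix_Comp intro!: matrix_Hom entries_Comp)
  have right: "f \<cdot>\<^bsub>A\<^esub> Idn A xs = f" if "f \<in> Hom A xs ys" for f xs ys
  proof -
    obtain m where m: "f = matrix_arrow xs ys m" "set xs \<subseteq> Obj C" "set ys \<subseteq> Obj C" "entries xs ys m"
      using \<open>f \<in> Hom A xs ys\<close> unfolding Hom_A by blast
    show ?thesis unfolding m(1) A_structure matrix_mono_Comp [OF m(4) mono_entries_Idn [OF m(2)] m(3)]
      matrix_arrow_eq using m(4) unfolding entries_def by simp (blast intro: Comp_Idn)
  qed
  then show "\<And>f xs ys. f \<in> Hom A xs ys \<Longrightarrow> f \<cdot>\<^bsub>A\<^esub> Idn A xs = f" .
  show "Idn A ys \<cdot>\<^bsub>A\<^esub> f = f" if "f \<in> Hom A xs ys" for f xs ys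
  proof -
    obtain m where m: "f = matrix_arrow xs ys m" "set xs \<subseteq> Obj C" "set ys \<subseteq> Obj C" "entries xs ys m"
      using \<open>f \<in> Hom A xs ys\<close> unfolding Hom_A by blast
    have i: "Idn C (ys ! k) \<cdot> m k j = m k j \<cdot> Idn C (xs ! j)" if "k < length ys" "j < length xs" for k j
      using entriesD [OF m(4) that refl refl] by (metis Comp_Idn Idn_Comp)
    \<comment> \<open>Identity matrices commute with every matrix, which reduces the left unit law
      to the right one.\<close>
    have "Idn A ys \<cdot>\<^bsub>A\<^esub> f = f \<cdot>\<^bsub>A\<^esub> Idn A xs"
      unfolding m(1) A_structure
      by (rule mono_natural [OF m(4,4) mono_entries_Idn mono_entries_Idn])
        (use m(2,3) i in \<open>auto simp: bij_betw_def\<close>)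
    then show ?thesis using right \<open>f \<in> Hom A xs ys\<close> by simp
  qed
  show "(h \<cdot>\<^bsub>A\<^esub> g) \<cdot>\<^bsub>A\<^esub> f = h \<cdot>\<^bsub>A\<^esub> (g \<cdot>\<^bsub>A\<^esub> f)"
    if hom: "f \<in> Hom A ws xs" "g \<in> Hom A xs ys" "h \<in> Hom A ys zs" for f g h ws xs ys zs
  proof -
    obtain f' where f: "f = matrix_arrow ws xs f'" "set ws \<subseteq> Obj C" "set xs \<subseteq> Obj C" "entries ws xs f'"
      using hom unfolding Hom_A by blast
    obtain g' where g: "g = matrix_arrow xs ys g'" "set ys \<subseteq> Obj C" "entries xs ys g'"
      using hom unfolding Hom_A by blast
    obtain h' where h: "h = matrix_arrow ys zs h'" "set zs \<subseteq> Obj C" "entries ys zs h'"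
      using hom unfolding Hom_A by blast
    show ?thesis unfolding f(1) g(1) h(1) matrix_Comp matrix_arrow_eq
    proof (intro allI impI)
      fix i j assume i: "i < length zs" and j: "j < length ws"
      note O = nth_Obj [OF f(2) j] nth_Obj [OF h(2) i]
      have gf: "g' l k \<cdot> f' k j \<in> Hom C (ws ! j) (ys ! l)" if "k < length xs" "l < length ys" for k l
        using f(4) g(3) that j unfolding entries_def by (blast intro: Comp_Hom)
      have hg: "h' i l \<cdot> g' l k \<in> Hom C (xs ! k) (zs ! i)" if "k < length xs" "l < length ys" for k l
        using h(3) g(3) that i unfolding entries_def by (blast intro: Comp_Hom)
      have hgf: "h' i l \<cdot> (g' l k \<cdot> f' k j) \<in> Hom C (ws ! j) (zs ! i)"
        "(h' i l \<cdot> g' l k) \<cdot> f' k j = h' i l \<cdot> (g' l k \<cdot> f' k j)" if "k < length xs" "l < length ys" for k l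
      proof -
        have "h' i l \<in> Hom C (ys ! l) (zs ! i)" "g' l k \<in> Hom C (xs ! k) (ys ! l)" "f' k j \<in> Hom C (ws ! j) (xs ! k)"
          using f(4) g(3) h(3) that i j unfolding entries_def by auto
        then show "h' i l \<cdot> (g' l k \<cdot> f' k j) \<in> Hom C (ws ! j) (zs ! i)"
          "(h' i l \<cdot> g' l k) \<cdot> f' k j = h' i l \<cdot> (g' l k \<cdot> f' k j)"
          by (blast intro: Comp_Hom Comp_assoc)+
      qed
      \<comment> \<open>Both bracketings are expanded to a double sum over \<open>k\<close> and
        \<open>l\<close>; interchanging the two summations connects them.\<close>
      have "hsum (ws ! j) (zs ! i) (length xs) (\<lambda>k. hsum (xs ! k) (zs ! i) (length ys) (\<lambda>l. h' i l \<cdot> g' l k) \<cdot> f' k j)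
        = hsum (ws ! j) (zs ! i) (length xs) (\<lambda>k. hsum (ws ! j) (zs ! i) (length ys) (\<lambda>l. h' i l \<cdot> (g' l k \<cdot> f' k j)))"
      proof (rule hsum_cong)
        fix k assume k: "k < length xs"
        have "hsum (xs ! k) (zs ! i) (length ys) (\<lambda>l. h' i l \<cdot> g' l k) \<cdot> f' k j
          = hsum (ws ! j) (zs ! i) (length ys) (\<lambda>l. (h' i l \<cdot> g' l k) \<cdot> f' k j)"
          using hg k by (intro Comp_hsum nth_Obj [OF f(3)] O) (auto intro: entriesD [OF f(4) k j])
        also have "\<dots> = hsum (ws ! j) (zs ! i) (length ys) (\<lambda>l. h' i l \<cdot> (g' l k \<cdot> f' k j))"
          using hgf k by (intro hsum_cong) simp
        finally show "hsum (xs ! k) (zs ! i) (length ys) (\<lambda>l. h' i l \<cdot> g' l k) \<cdot> f' k j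
          = hsum (ws ! j) (zs ! i) (length ys) (\<lambda>l. h' i l \<cdot> (g' l k \<cdot> f' k j))" .
      qed
      also have "\<dots> = hsum (ws ! j) (zs ! i) (length ys) (\<lambda>l. hsum (ws ! j) (zs ! i) (length xs) (\<lambda>k. h' i l \<cdot> (g' l k \<cdot> f' k j)))"
        using hgf by (intro hsum_swap O)
      also have "\<dots> = hsum (ws ! j) (zs ! i) (length ys) (\<lambda>l. h' i l \<cdot> hsum (ws ! j) (ys ! l) (length xs) (\<lambda>k. g' l k \<cdot> f' k j))"
        using gf by (intro hsum_cong hsum_Comp [symmetric] O nth_Obj [OF g(2)]) (auto intro: entriesD [OF h(3) i])
      finally show "hsum (ws ! j) (zs ! i) (length xs) (\<lambda>k. hsum (xs ! k) (zs ! i) (length ys) (\<lambda>l. h' i l \<cdot> g' l k) \<cdot> f' k j)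
        = hsum (ws ! j) (zs ! i) (length ys) (\<lambda>l. h' i l \<cdot> hsum (ws ! j) (ys ! l) (length xs) (\<lambda>k. g' l k \<cdot> f' k j))" .
    qed
  qed
qed

sublocale A: linear_category A
proof
  show "ZeroA A xs ys \<in> Hom A xs ys" if "xs \<in> Obj A" "ys \<in> Obj A" for xs ys
    using that unfolding Hom_A matrix_ZeroA by (auto simp: A_simps entries_def intro!: exI ZeroA_Hom nth_Obj)
  show "AddA A f g \<in> Hom A xs ys" if "f \<in> Hom A xs ys" "g \<in> Hom A xs ys" for f g xs ys
    using that by (auto elim!: Hom_AE simp: matrix_AddA entries_def intro!: matrix_Hom AddA_Hom)
  show "SmultA A c f \<in> Hom A xs ys" if "f \<in> Hom A xs ys" for c f xs ys
    using that by (auto elim!: Hom_AE simp: matrix_SmultA entries_def intro!: matrix_Hom SmultA_Hom)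
  show "AddA A (AddA A f g) h = AddA A f (AddA A g h)"
    if "f \<in> Hom A xs ys" "g \<in> Hom A xs ys" "h \<in> Hom A xs ys" for f g h xs ys
    using that unfolding Hom_A by (auto simp: matrix_AddA matrix_arrow_eq entries_def) (blast intro: AddA_assoc)
  show "AddA A f g = AddA A g f" if "f \<in> Hom A xs ys" "g \<in> Hom A xs ys" for f g xs ys
    using that unfolding Hom_A by (auto simp: matrix_AddA matrix_arrow_eq entries_def) (blast intro: AddA_commute)
  show "AddA A (ZeroA A xs ys) f = f" if "f \<in> Hom A xs ys" for f xs ys
    using that unfolding Hom_A by (auto simp: matrix_AddA matrix_ZeroA matrix_arrow_eq entries_def) (blast intro: AddA_ZeroA)
  show "AddA A f (SmultA A (- 1) f) = ZeroA A xs ys" if "f \<in> Hom A xs ys" for f xs ys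
    using that unfolding Hom_A
    by (auto simp: matrix_AddA matrix_SmultA matrix_ZeroA matrix_arrow_eq entries_def) (blast intro: AddA_inverse)
  show "SmultA A 1 f = f" if "f \<in> Hom A xs ys" for f xs ys
    using that unfolding Hom_A by (auto simp: matrix_SmultA matrix_arrow_eq entries_def) (blast intro: SmultA_one)
  show "SmultA A c (SmultA A d f) = SmultA A (c * d) f" if "f \<in> Hom A xs ys" for c d f xs ys
    using that unfolding Hom_A by (auto simp: matrix_SmultA matrix_arrow_eq entries_def) (blast intro: SmultA_SmultA)
  show "SmultA A (c + d) f = AddA A (SmultA A c f) (SmultA A d f)" if "f \<in> Hom A xs ys" for c d f xs ys
    using that unfolding Hom_A by (auto simp: matrix_SmultA matrix_AddA matrix_arrow_eq entries_def) (blast intro: SmultA_add)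
  show "SmultA A c (AddA A f g) = AddA A (SmultA A c f) (SmultA A c g)"
    if "f \<in> Hom A xs ys" "g \<in> Hom A xs ys" for c f g xs ys
    using that unfolding Hom_A by (auto simp: matrix_SmultA matrix_AddA matrix_arrow_eq entries_def) (blast intro: SmultA_AddA)
  show "g \<cdot>\<^bsub>A\<^esub> AddA A f f' = AddA A (g \<cdot>\<^bsub>A\<^esub> f) (g \<cdot>\<^bsub>A\<^esub> f')"
    if hom: "f \<in> Hom A xs ys" "f' \<in> Hom A xs ys" "g \<in> Hom A ys zs" for f f' g xs ys zs
  proof -
    obtain m m' where m: "f = matrix_arrow xs ys m" "set xs \<subseteq> Obj C" "entries xs ys m"
      "f' = matrix_arrow xs ys m'" "entries xs ys m'" using hom unfolding Hom_A by blast
    obtain n where n: "g = matrix_arrow ys zs n" "set zs \<subseteq> Obj C" "entries ys zs n" using hom unfolding Hom_A by blast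
    have "hsum (xs ! j) (zs ! i) (length ys) (\<lambda>k. n i k \<cdot> AddA C (m k j) (m' k j))
      = AddA C (hsum (xs ! j) (zs ! i) (length ys) (\<lambda>k. n i k \<cdot> m k j)) (hsum (xs ! j) (zs ! i) (length ys) (\<lambda>k. n i k \<cdot> m' k j))"
      if ij: "i < length zs" "j < length xs" for i j
    proof -
      have "hsum (xs ! j) (zs ! i) (length ys) (\<lambda>k. n i k \<cdot> AddA C (m k j) (m' k j))
        = hsum (xs ! j) (zs ! i) (length ys) (\<lambda>k. AddA C (n i k \<cdot> m k j) (n i k \<cdot> m' k j))"
        using m n ij unfolding entries_def by (intro hsum_cong Comp_AddA) auto
      also have "\<dots> = AddA C (hsum (xs ! j) (zs ! i) (length ys) (\<lambda>k. n i k \<cdot> m k j)) (hsum (xs ! j) (zs ! i) (length ys) (\<lambda>k. n i k \<cdot> m' k j))"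
      proof (rule hsum_add)
        show "n i k \<cdot> m k j \<in> Hom C (xs ! j) (zs ! i)" "n i k \<cdot> m' k j \<in> Hom C (xs ! j) (zs ! i)" if "k < length ys" for k
          using m n ij that unfolding entries_def by (blast intro: Comp_Hom)+
      qed (use m n ij nth_Obj in auto)
      finally show ?thesis .
    qed
    then show ?thesis unfolding m n by (simp add: matrix_AddA matrix_Comp matrix_arrow_eq)
  qed
  show "AddA A g g' \<cdot>\<^bsub>A\<^esub> f = AddA A (g \<cdot>\<^bsub>A\<^esub> f) (g' \<cdot>\<^bsub>A\<^esub> f)"
    if hom: "f \<in> Hom A xs ys" "g \<in> Hom A ys zs" "g' \<in> Hom A ys zs" for f g g' xs ys zs
  proof -
    obtain m where m: "f = matrix_arrow xs ys m" "set xs \<subseteq> Obj C" "entries xs ys m" using hom unfolding Hom_A by blast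
    obtain n n' where n: "g = matrix_arrow ys zs n" "set zs \<subseteq> Obj C" "entries ys zs n"
       "g' = matrix_arrow ys zs n'" "entries ys zs n'" using hom unfolding Hom_A by blast
    have "hsum (xs ! j) (zs ! i) (length ys) (\<lambda>k. AddA C (n i k) (n' i k) \<cdot> m k j)
      = AddA C (hsum (xs ! j) (zs ! i) (length ys) (\<lambda>k. n i k \<cdot> m k j)) (hsum (xs ! j) (zs ! i) (length ys) (\<lambda>k. n' i k \<cdot> m k j))"
      if ij: "i < length zs" "j < length xs" for i j
    proof -
      have "hsum (xs ! j) (zs ! i) (length ys) (\<lambda>k. AddA C (n i k) (n' i k) \<cdot> m k j)
        = hsum (xs ! j) (zs ! i) (length ys) (\<lambda>k. AddA C (n i k \<cdot> m k j) (n' i k \<cdot> m k j))"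
        using m n ij unfolding entries_def by (intro hsum_cong AddA_Comp) auto
      also have "\<dots> = AddA C (hsum (xs ! j) (zs ! i) (length ys) (\<lambda>k. n i k \<cdot> m k j)) (hsum (xs ! j) (zs ! i) (length ys) (\<lambda>k. n' i k \<cdot> m k j))"
      proof (rule hsum_add)
        show "n i k \<cdot> m k j \<in> Hom C (xs ! j) (zs ! i)" "n' i k \<cdot> m k j \<in> Hom C (xs ! j) (zs ! i)" if "k < length ys" for k
          using m n ij that unfolding entries_def by (blast intro: Comp_Hom)+
      qed (use m n ij nth_Obj in auto)
      finally show ?thesis .
    qed
    then show ?thesis unfolding m n by (simp add: matrix_AddA matrix_Comp matrix_arrow_eq)
  qed
  show "g \<cdot>\<^bsub>A\<^esub> SmultA A c f = SmultA A c (g \<cdot>\<^bsub>A\<^esub> f)" "SmultA A c g \<cdot>\<^bsub>A\<^esub> f = SmultA A c (g \<cdot>\<^bsub>A\<^esub> f)"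
    if hom: "f \<in> Hom A xs ys" "g \<in> Hom A ys zs" for c f g xs ys zs
  proof -
    obtain m where m: "f = matrix_arrow xs ys m" "set xs \<subseteq> Obj C" "entries xs ys m" using hom unfolding Hom_A by blast
    obtain n where n: "g = matrix_arrow ys zs n" "set zs \<subseteq> Obj C" "entries ys zs n" using hom unfolding Hom_A by blast
    have *: "hsum (xs ! j) (zs ! i) (length ys) (\<lambda>k. n i k \<cdot> SmultA C c (m k j)) = SmultA C c (hsum (xs ! j) (zs ! i) (length ys) (\<lambda>k. n i k \<cdot> m k j))"
      "hsum (xs ! j) (zs ! i) (length ys) (\<lambda>k. SmultA C c (n i k) \<cdot> m k j) = SmultA C c (hsum (xs ! j) (zs ! i) (length ys) (\<lambda>k. n i k \<cdot> m k j))"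
      if ij: "i < length zs" "j < length xs" for i j
    proof -
      have "SmultA C c (hsum (xs ! j) (zs ! i) (length ys) (\<lambda>k. n i k \<cdot> m k j))
        = hsum (xs ! j) (zs ! i) (length ys) (\<lambda>k. SmultA C c (n i k \<cdot> m k j))"
      proof (rule SmultA_hsum)
        show "n i k \<cdot> m k j \<in> Hom C (xs ! j) (zs ! i)" if "k < length ys" for k
          using m n ij that unfolding entries_def by (blast intro: Comp_Hom)+
      qed (use m n ij nth_Obj in auto)
      moreover have "hsum (xs ! j) (zs ! i) (length ys) (\<lambda>k. n i k \<cdot> SmultA C c (m k j)) = hsum (xs ! j) (zs ! i) (length ys) (\<lambda>k. SmultA C c (n i k \<cdot> m k j))"
        using m n ij unfolding entries_def by (intro hsum_cong Comp_SmultA) auto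
      moreover have "hsum (xs ! j) (zs ! i) (length ys) (\<lambda>k. SmultA C c (n i k) \<cdot> m k j) = hsum (xs ! j) (zs ! i) (length ys) (\<lambda>k. SmultA C c (n i k \<cdot> m k j))"
        using m n ij unfolding entries_def by (intro hsum_cong SmultA_Comp) auto
      ultimately show "hsum (xs ! j) (zs ! i) (length ys) (\<lambda>k. n i k \<cdot> SmultA C c (m k j)) = SmultA C c (hsum (xs ! j) (zs ! i) (length ys) (\<lambda>k. n i k \<cdot> m k j))"
      "hsum (xs ! j) (zs ! i) (length ys) (\<lambda>k. SmultA C c (n i k) \<cdot> m k j) = SmultA C c (hsum (xs ! j) (zs ! i) (length ys) (\<lambda>k. n i k \<cdot> m k j))"
        by simp_all
    qed
    show "g \<cdot>\<^bsub>A\<^esub> SmultA A c f = SmultA A c (g \<cdot>\<^bsub>A\<^esub> f)" "SmultA A c g \<cdot>\<^bsub>A\<^esub> f = SmultA A c (g \<cdot>\<^bsub>A\<^esub> f)"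
      unfolding m n using * by (simp_all add: matrix_SmultA matrix_Comp matrix_arrow_eq)
  qed
qed

end

section \<open>The tensor product of matrices and its coherence\<close>

context additive_context begin

text \<open>Mixed-radix digits of an index into a triple tensor product. Once an index is written in
  digits, the coherence conditions become statements about single entries.\<close>

lemma list_tensor_index:
  fixes j :: nat assumes "j < l * m * n"
  obtains i a b where "i < l" "a < m" "b < n" "j = (i * m + a) * n + b"
proof
  show "j div n div m < l" "j div n mod m < m" "j mod n < n"
    using less_mult_div_mod [OF assms] less_mult_div_mod [of "j div n" l m] by auto
  show "j = (j div n div m * m + j div n mod m) * n + j mod n" by simp
qed

text \<open>Rebracketing the expansion as \<open>i * (m * n) + (a * n + b)\<close> exposes the
  leading digit, since the remaining part is smaller than the product.\<close>

lemma index_div_mod [simp]: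
  fixes i a b m n :: nat assumes "a < m" "b < n"
  shows "((i * m + a) * n + b) div (m * n) = i" "((i * m + a) * n + b) mod (m * n) = a * n + b"
    "((i * m + a) * n + b) div (n * m) = i" "((i * m + a) * n + b) mod (n * m) = a * n + b"
proof -
  have eq: "(i * m + a) * n + b = i * (m * n) + (a * n + b)" by (simp add: algebra_simps)
  have "a * n + b < m * n" using assms by (rule mult_add_less [rotated])
  then show "((i * m + a) * n + b) div (m * n) = i" "((i * m + a) * n + b) mod (m * n) = a * n + b"
    unfolding eq by (simp_all only: mult_add_div_mod)
  then show "((i * m + a) * n + b) div (n * m) = i" "((i * m + a) * n + b) mod (n * m) = a * n + b"
    by (simp_all add: mult.commute)
qed

lemma entries_TenA:
  assumes "entries xs ys f" "entries xs' ys' g"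
  shows "entries (list_tensor C xs xs') (list_tensor C ys ys')
      (\<lambda>i j. TenA C (f (i div length ys') (j div length xs')) (g (i mod length ys') (j mod length xs')))"
  unfolding entries_def
proof (intro allI impI)
  fix i j assume "i < length (list_tensor C ys ys')" "j < length (list_tensor C xs xs')"
  then have i: "i < length ys * length ys'" and j: "j < length xs * length xs'" by simp_all
  show "TenA C (f (i div length ys') (j div length xs')) (g (i mod length ys') (j mod length xs'))
    \<in> Hom C (list_tensor C xs xs' ! j) (list_tensor C ys ys' ! i)"
    using TenA_Hom entriesD [OF assms(1) less_mult_div_mod(1) [OF i] less_mult_div_mod(1) [OF j] refl refl]
      entriesD [OF assms(2) less_mult_div_mod(2) [OF i] less_mult_div_mod(2) [OF j] refl refl] i j by simp
qed

text \<open>The associator is diagonal: row-major numbering assigns the same flat index to a triple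
  under both bracketings, hence the index map \<open>id\<close>.\<close>

lemma mono_entries_Assoc:
  assumes "set xs \<subseteq> Obj C" "set ys \<subseteq> Obj C" "set zs \<subseteq> Obj C"
  shows "mono_entries (list_tensor C (list_tensor C xs ys) zs) (list_tensor C xs (list_tensor C ys zs)) id
     (\<lambda>j. Assoc C (xs ! (j div length zs div length ys)) (ys ! (j div length zs mod length ys)) (zs ! (j mod length zs)))"
  unfolding mono_entries_def
proof (intro conjI allI impI)
  fix j assume "j < length (list_tensor C (list_tensor C xs ys) zs)"
  then have "j < length xs * length ys * length zs" by simp
  then obtain i a b where *: "i < length xs" "a < length ys" "b < length zs" "j = (i * length ys + a) * length zs + b"
    by (rule list_tensor_index)
  have lt: "i * length ys + a < length xs * length ys" "a * length zs + b < length ys * length zs"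
    "j < length xs * length ys * length zs" "j < length xs * (length ys * length zs)"
    using mult_add_less [OF *(2,1)] mult_add_less [OF *(3,2)] \<open>j < length xs * length ys * length zs\<close>
    by (simp_all add: mult.assoc)
  then show "id j < length (list_tensor C xs (list_tensor C ys zs))" by simp
  have "Assoc C (xs ! i) (ys ! a) (zs ! b) \<in> Hom C (TenO C (TenO C (xs ! i) (ys ! a)) (zs ! b)) (TenO C (xs ! i) (TenO C (ys ! a) (zs ! b)))"
    using assms * by (intro Assoc_Hom nth_Obj)
  moreover have "list_tensor C (list_tensor C xs ys) zs ! j = TenO C (TenO C (xs ! i) (ys ! a)) (zs ! b)"
    using lt * by simp
  moreover have "list_tensor C xs (list_tensor C ys zs) ! j = TenO C (xs ! i) (TenO C (ys ! a) (zs ! b))"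
    using lt * by simp
  ultimately show "Assoc C (xs ! (j div length zs div length ys)) (ys ! (j div length zs mod length ys)) (zs ! (j mod length zs))
    \<in> Hom C (list_tensor C (list_tensor C xs ys) zs ! j) (list_tensor C xs (list_tensor C ys zs) ! id j)"
    using * by simp
qed (use assms list_tensor_Obj in blast)+

lemma mono_entries_LUnit:
  assumes "set xs \<subseteq> Obj C"
  shows "mono_entries (list_tensor C [UnitO C] xs) xs id (\<lambda>j. LUnit C (xs ! j))"
  using assms list_tensor_Obj [of "[UnitO C]" xs] by (auto simp: mono_entries_def UnitO_Obj nth_Obj LUnit_Hom)

lemma mono_entries_RUnit:
  assumes "set xs \<subseteq> Obj C"
  shows "mono_entries (list_tensor C xs [UnitO C]) xs id (\<lambda>j. RUnit C (xs ! j))"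
  using assms list_tensor_Obj [of xs "[UnitO C]"] by (auto simp: mono_entries_def UnitO_Obj nth_Obj RUnit_Hom)

text \<open>Here the index map is a genuine permutation. Exchanging the coordinates of a pair sends
  its row-major index to the index of the transposed pair.\<close>

lemma mono_entries_Braid:
  assumes "set xs \<subseteq> Obj C" "set ys \<subseteq> Obj C"
  shows "mono_entries (list_tensor C xs ys) (list_tensor C ys xs)
     (\<lambda>j. (j mod length ys) * length xs + j div length ys)
     (\<lambda>j. Braid C (xs ! (j div length ys)) (ys ! (j mod length ys)))"
  unfolding mono_entries_def
proof (intro conjI allI impI)
  fix j assume "j < length (list_tensor C xs ys)"
  then have j: "j < length xs * length ys" by simp
  note d = less_mult_div_mod [OF j]
  have lt: "(j mod length ys) * length xs + j div length ys < length ys * length xs" by (rule mult_add_less [OF d])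
  then show "(j mod length ys) * length xs + j div length ys < length (list_tensor C ys xs)" by simp
  show "Braid C (xs ! (j div length ys)) (ys ! (j mod length ys)) \<in> Hom C (list_tensor C xs ys ! j)
    (list_tensor C ys xs ! ((j mod length ys) * length xs + j div length ys))"
    using lt j d assms by (simp add: Braid_Hom nth_Obj)
qed (use assms list_tensor_Obj in blast)+

text \<open>A diagonal matrix is inverted entry by entry.\<close>

lemma mono_id_iso:
  assumes f: "mono_entries xs ys id f" and len: "length xs = length ys" and iso: "\<And>j. j < length xs \<Longrightarrow> iso_arr C (f j)"
  shows "iso_arr A (monomial_arrow C xs ys id f)"
proof -
  have g: "mono_entries ys xs id (\<lambda>j. inv_arr (f j))"
    using f len iso unfolding mono_entries_def by (auto simp: Hom_iff)
  have "monomial_arrow C xs ys id f \<in> Hom A xs ys" "monomial_arrow C ys xs id (\<lambda>j. inv_arr (f j)) \<in> Hom A ys xs"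
    using mono_Hom f g by auto
  then show ?thesis
    by (intro A.iso_arrI [of "monomial_arrow C ys xs id (\<lambda>j. inv_arr (f j))"])
      (use f len iso in \<open>auto simp: Hom_iff mono_Comp [OF f g] mono_Comp [OF g f] A_structure mono_entries_def intro!: mono_eqI\<close>)
qed

text \<open>A tensor product of two sums is a double sum over pairs of inner indices. Row-major
  numbering makes it a single sum of the length required by the matrix product, and the interchange
  law of the base category is applied to each summand.\<close>

lemma TenA_Comp_A:
  assumes hom: "f \<in> Hom A xs ys" "g \<in> Hom A ys zs" "f' \<in> Hom A xs' ys'" "g' \<in> Hom A ys' zs'"
  shows "TenA A (g \<cdot>\<^bsub>A\<^esub> f) (g' \<cdot>\<^bsub>A\<^esub> f') = TenA A g g' \<cdot>\<^bsub>A\<^esub> TenA A f f'"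
proof -
  obtain m where m: "f = matrix_arrow xs ys m" "set xs \<subseteq> Obj C" "set ys \<subseteq> Obj C" "entries xs ys m"
    using hom(1) by (rule Hom_AE)
  obtain n where n: "g = matrix_arrow ys zs n" "set zs \<subseteq> Obj C" "entries ys zs n"
    using hom(2) by (rule Hom_AE)
  obtain m' where m': "f' = matrix_arrow xs' ys' m'" "set xs' \<subseteq> Obj C" "set ys' \<subseteq> Obj C" "entries xs' ys' m'"
    using hom(3) by (rule Hom_AE)
  obtain n' where n': "g' = matrix_arrow ys' zs' n'" "set zs' \<subseteq> Obj C" "entries ys' zs' n'"
    using hom(4) by (rule Hom_AE)
  show ?thesis unfolding m(1) n(1) m'(1) n'(1) matrix_Comp matrix_TenA matrix_arrow_eq length_list_tensor
  proof (intro allI impI)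
    fix i j assume i: "i < length zs * length zs'" and j: "j < length xs * length xs'"
    let ?i = "i div length zs'" and ?i' = "i mod length zs'" and ?j = "j div length xs'" and ?j' = "j mod length xs'"
    note di = less_mult_div_mod [OF i] and dj = less_mult_div_mod [OF j]
    note O = nth_Obj [OF m(2) dj(1)] nth_Obj [OF m'(2) dj(2)] nth_Obj [OF n(2) di(1)] nth_Obj [OF n'(2) di(2)]
    have h: "n ?i k \<cdot> m k ?j \<in> Hom C (xs ! ?j) (zs ! ?i)" if "k < length ys" for k
      using m(4) n(3) di dj that unfolding entries_def by (blast intro: Comp_Hom)
    have h': "n' ?i' k \<cdot> m' k ?j' \<in> Hom C (xs' ! ?j') (zs' ! ?i')" if "k < length ys'" for k
      using m'(4) n'(3) di dj that unfolding entries_def by (blast intro: Comp_Hom)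
    let ?h = "hsum (TenO C (xs ! ?j) (xs' ! ?j')) (TenO C (zs ! ?i) (zs' ! ?i'))"
    have "TenA C (hsum (xs ! ?j) (zs ! ?i) (length ys) (\<lambda>k. n ?i k \<cdot> m k ?j))
        (hsum (xs' ! ?j') (zs' ! ?i') (length ys') (\<lambda>k. n' ?i' k \<cdot> m' k ?j'))
      = ?h (length ys) (\<lambda>k. TenA C (n ?i k \<cdot> m k ?j) (hsum (xs' ! ?j') (zs' ! ?i') (length ys') (\<lambda>k. n' ?i' k \<cdot> m' k ?j')))"
      by (rule TenA_hsum_left) (use O h h' in auto)
    also have "\<dots> = ?h (length ys) (\<lambda>k. ?h (length ys') (\<lambda>k'. TenA C (n ?i k \<cdot> m k ?j) (n' ?i' k' \<cdot> m' k' ?j')))"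
      by (intro hsum_cong TenA_hsum_right) (use O h h' in auto)
    also have "\<dots> = ?h (length ys * length ys') (\<lambda>K. TenA C (n ?i (K div length ys') \<cdot> m (K div length ys') ?j) (n' ?i' (K mod length ys') \<cdot> m' (K mod length ys') ?j'))"
      by (rule hsum_times [symmetric]) (use O h h' in \<open>auto intro: TenO_Obj TenA_Hom\<close>)
    also have "\<dots> = ?h (length ys * length ys') (\<lambda>K. TenA C (n ?i (K div length ys')) (n' ?i' (K mod length ys'))
      \<cdot> TenA C (m (K div length ys') ?j) (m' (K mod length ys') ?j'))"
    proof (rule hsum_cong)
      fix K assume "K < length ys * length ys'"
      note d = less_mult_div_mod [OF this]
      show "TenA C (n ?i (K div length ys') \<cdot> m (K div length ys') ?j) (n' ?i' (K mod length ys') \<cdot> m' (K mod length ys') ?j')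
        = TenA C (n ?i (K div length ys')) (n' ?i' (K mod length ys')) \<cdot> TenA C (m (K div length ys') ?j) (m' (K mod length ys') ?j')"
        using entriesD [OF m(4) d(1) dj(1) refl refl] entriesD [OF m'(4) d(2) dj(2) refl refl]
          entriesD [OF n(3) di(1) d(1) refl refl] entriesD [OF n'(3) di(2) d(2) refl refl]
        by (intro TenA_Comp)
    qed
    finally show "TenA C (hsum (xs ! ?j) (zs ! ?i) (length ys) (\<lambda>k. n ?i k \<cdot> m k ?j))
        (hsum (xs' ! ?j') (zs' ! ?i') (length ys') (\<lambda>k. n' ?i' k \<cdot> m' k ?j'))
      = hsum (list_tensor C xs xs' ! j) (list_tensor C zs zs' ! i) (length ys * length ys')
        (\<lambda>K. TenA C (n ?i (K div length ys')) (n' ?i' (K mod length ys')) \<cdot> TenA C (m (K div length ys') ?j) (m' (K mod length ys') ?j'))"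
      using i j by simp
  qed
qed

lemma Assoc_natural_A:
  assumes hom: "f \<in> Hom A xs xs'" "g \<in> Hom A ys ys'" "h \<in> Hom A zs zs'"
  shows "Assoc A xs' ys' zs' \<cdot>\<^bsub>A\<^esub> TenA A (TenA A f g) h = TenA A f (TenA A g h) \<cdot>\<^bsub>A\<^esub> Assoc A xs ys zs"
proof -
  obtain m where m: "f = matrix_arrow xs xs' m" "set xs \<subseteq> Obj C" "set xs' \<subseteq> Obj C" "entries xs xs' m"
    using hom(1) by (rule Hom_AE)
  obtain n where n: "g = matrix_arrow ys ys' n" "set ys \<subseteq> Obj C" "set ys' \<subseteq> Obj C" "entries ys ys' n"
    using hom(2) by (rule Hom_AE)
  obtain p where p: "h = matrix_arrow zs zs' p" "set zs \<subseteq> Obj C" "set zs' \<subseteq> Obj C" "entries zs zs' p"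
    using hom(3) by (rule Hom_AE)
  show ?thesis unfolding m(1) n(1) p(1) matrix_TenA A_structure
  proof (rule mono_natural [OF entries_TenA [OF entries_TenA [OF m(4) n(4)] p(4)]
        entries_TenA [OF m(4) entries_TenA [OF n(4) p(4)]] mono_entries_Assoc [OF m(3) n(3) p(3)] mono_entries_Assoc [OF m(2) n(2) p(2)]])
    fix k j assume "k < length (list_tensor C (list_tensor C xs' ys') zs')" "j < length (list_tensor C (list_tensor C xs ys) zs)"
    then have kj: "k < length xs' * length ys' * length zs'" "j < length xs * length ys * length zs" by simp_all
    obtain i a b where k: "i < length xs'" "a < length ys'" "b < length zs'" "k = (i * length ys' + a) * length zs' + b"
      using kj(1) by (rule list_tensor_index)
    obtain i' a' b' where j: "i' < length xs" "a' < length ys" "b' < length zs" "j = (i' * length ys + a') * length zs + b'"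
      using kj(2) by (rule list_tensor_index)
    have "Assoc C (xs' ! i) (ys' ! a) (zs' ! b) \<cdot> TenA C (TenA C (m i i') (n a a')) (p b b')
      = TenA C (m i i') (TenA C (n a a') (p b b')) \<cdot> Assoc C (xs ! i') (ys ! a') (zs ! b')"
      by (rule Assoc_natural) (use k j m(4) n(4) p(4) in \<open>auto simp: entries_def\<close>)
    then show "Assoc C (xs' ! (k div length zs' div length ys')) (ys' ! (k div length zs' mod length ys')) (zs' ! (k mod length zs'))
       \<cdot> TenA C (TenA C (m (k div length zs' div length ys') (j div length zs div length ys))
            (n (k div length zs' mod length ys') (j div length zs mod length ys))) (p (k mod length zs') (j mod length zs))
     = TenA C (m (id k div length (list_tensor C ys' zs')) (id j div length (list_tensor C ys zs)))
         (TenA C (n (id k mod length (list_tensor C ys' zs') div length zs') (id j mod length (list_tensor C ys zs) div length zs))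
           (p (id k mod length (list_tensor C ys' zs') mod length zs') (id j mod length (list_tensor C ys zs) mod length zs)))
       \<cdot> Assoc C (xs ! (j div length zs div length ys)) (ys ! (j div length zs mod length ys)) (zs ! (j mod length zs))"
      using k j by simp
  qed (simp add: mult.assoc)
qed

lemma LUnit_natural_A:
  assumes hom: "f \<in> Hom A xs ys"
  shows "LUnit A ys \<cdot>\<^bsub>A\<^esub> TenA A (Idn A [UnitO C]) f = f \<cdot>\<^bsub>A\<^esub> LUnit A xs"
proof -
  obtain m where m: "f = matrix_arrow xs ys m" "set xs \<subseteq> Obj C" "set ys \<subseteq> Obj C" "entries xs ys m"
    using hom(1) by (rule Hom_AE)
  \<comment> \<open>The identity of the unit is written out as a one by one matrix, so that its
    tensor product with \<open>f\<close> falls under the general formula for matrices.\<close>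
  have u: "entries [UnitO C] [UnitO C] (\<lambda>i j. if i = id j then Idn C ([UnitO C] ! j) else ZeroA C ([UnitO C] ! j) ([UnitO C] ! i))"
    by (simp add: entries_def Idn_Hom UnitO_Obj)
  show ?thesis unfolding m(1) A_structure unfolding monomial_arrow_def [of C "[UnitO C]" "[UnitO C]"] matrix_TenA
  proof (rule mono_natural [OF entries_TenA [OF u m(4)] m(4) mono_entries_LUnit [OF m(3)] mono_entries_LUnit [OF m(2)]])
    fix k j assume kj: "k < length (list_tensor C [UnitO C] ys)" "j < length (list_tensor C [UnitO C] xs)"
    then show "LUnit C (ys ! k) \<cdot> TenA C (if k div length ys = id (j div length xs) then Idn C ([UnitO C] ! (j div length xs))
         else ZeroA C ([UnitO C] ! (j div length xs)) ([UnitO C] ! (k div length ys))) (m (k mod length ys) (j mod length xs))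
      = m (id k) (id j) \<cdot> LUnit C (xs ! j)"
      using m(4) by (auto simp: entries_def intro!: LUnit_natural)
  qed simp
qed

lemma RUnit_natural_A:
  assumes hom: "f \<in> Hom A xs ys"
  shows "RUnit A ys \<cdot>\<^bsub>A\<^esub> TenA A f (Idn A [UnitO C]) = f \<cdot>\<^bsub>A\<^esub> RUnit A xs"
proof -
  obtain m where m: "f = matrix_arrow xs ys m" "set xs \<subseteq> Obj C" "set ys \<subseteq> Obj C" "entries xs ys m"
    using hom(1) by (rule Hom_AE)
  have u: "entries [UnitO C] [UnitO C] (\<lambda>i j. if i = id j then Idn C ([UnitO C] ! j) else ZeroA C ([UnitO C] ! j) ([UnitO C] ! i))"
    by (simp add: entries_def Idn_Hom UnitO_Obj)
  show ?thesis unfolding m(1) A_structure unfolding monomial_arrow_def [of C "[UnitO C]" "[UnitO C]"] matrix_TenA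
  proof (rule mono_natural [OF entries_TenA [OF m(4) u] m(4) mono_entries_RUnit [OF m(3)] mono_entries_RUnit [OF m(2)]])
    fix k j assume kj: "k < length (list_tensor C ys [UnitO C])" "j < length (list_tensor C xs [UnitO C])"
    then show "RUnit C (ys ! k) \<cdot> TenA C (m (k div length [UnitO C]) (j div length [UnitO C]))
       (if k mod length [UnitO C] = id (j mod length [UnitO C]) then Idn C ([UnitO C] ! (j mod length [UnitO C]))
         else ZeroA C ([UnitO C] ! (j mod length [UnitO C])) ([UnitO C] ! (k mod length [UnitO C])))
      = m (id k) (id j) \<cdot> RUnit C (xs ! j)"
      using m(4) by (auto simp: entries_def intro!: RUnit_natural)
  qed simp
qed

text \<open>Transposition of row-major indices; it is undone by the transposition with the two
  dimensions exchanged.\<close>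

lemma bij_betw_transpose_index:
  fixes m n :: nat
  shows "bij_betw (\<lambda>j. (j mod n) * m + j div n) {..<m * n} {..<n * m}"
proof (rule bij_betw_byWitness [where f' = "\<lambda>j. (j mod m) * n + j div m"])
  show "\<forall>j\<in>{..<m * n}. (((j mod n) * m + j div n) mod m) * n + ((j mod n) * m + j div n) div m = j"
    using less_mult_div_mod by auto
  show "\<forall>j\<in>{..<n * m}. (((j mod m) * n + j div m) mod n) * m + ((j mod m) * n + j div m) div n = j"
    using less_mult_div_mod by auto
  show "(\<lambda>j. (j mod n) * m + j div n) ` {..<m * n} \<subseteq> {..<n * m}" "(\<lambda>j. (j mod m) * n + j div m) ` {..<n * m} \<subseteq> {..<m * n}"
    using less_mult_div_mod by (auto intro!: mult_add_less)
qed

lemma Braid_natural_A: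
  assumes hom: "f \<in> Hom A xs xs'" "g \<in> Hom A ys ys'"
  shows "Braid A xs' ys' \<cdot>\<^bsub>A\<^esub> TenA A f g = TenA A g f \<cdot>\<^bsub>A\<^esub> Braid A xs ys"
proof -
  obtain m where m: "f = matrix_arrow xs xs' m" "set xs \<subseteq> Obj C" "set xs' \<subseteq> Obj C" "entries xs xs' m"
    using hom(1) by (rule Hom_AE)
  obtain n where n: "g = matrix_arrow ys ys' n" "set ys \<subseteq> Obj C" "set ys' \<subseteq> Obj C" "entries ys ys' n"
    using hom(2) by (rule Hom_AE)
  show ?thesis unfolding m(1) n(1) matrix_TenA A_structure
  proof (rule mono_natural [OF entries_TenA [OF m(4) n(4)] entries_TenA [OF n(4) m(4)] mono_entries_Braid [OF m(3) n(3)] mono_entries_Braid [OF m(2) n(2)]])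
    fix k j assume "k < length (list_tensor C xs' ys')" "j < length (list_tensor C xs ys)"
    then have k: "k < length xs' * length ys'" and j: "j < length xs * length ys" by simp_all
    note d = less_mult_div_mod [OF k] less_mult_div_mod [OF j]
    show "Braid C (xs' ! (k div length ys')) (ys' ! (k mod length ys')) \<cdot>
      TenA C (m (k div length ys') (j div length ys)) (n (k mod length ys') (j mod length ys))
     = TenA C (n ((k mod length ys' * length xs' + k div length ys') div length xs') ((j mod length ys * length xs + j div length ys) div length xs))
        (m ((k mod length ys' * length xs' + k div length ys') mod length xs') ((j mod length ys * length xs + j div length ys) mod length xs)) \<cdot>
       Braid C (xs ! (j div length ys)) (ys ! (j mod length ys))"
      using d m(4) n(4) by (auto simp: entries_def intro!: Braid_natural)
  qed (simp add: bij_betw_transpose_index)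
qed

lemma mono_Idn_TenA:
  assumes "set xs \<subseteq> Obj C" "set ys \<subseteq> Obj C"
  shows "TenA A (Idn A xs) (Idn A ys) = Idn A (list_tensor C xs ys)"
  unfolding A_structure mono_TenA [OF mono_entries_Idn [OF assms(1)] mono_entries_Idn [OF assms(2)]]
  using assms less_mult_div_mod by (intro mono_eqI) (auto simp: TenA_Idn nth_Obj)

text \<open>All five factors are monomial, so each side is one monomial matrix. It remains to
  compare the index maps and to apply the pentagon of the base category to each entry.\<close>

lemma pentagon_A:
  assumes W: "set ws \<subseteq> Obj C" and X: "set xs \<subseteq> Obj C" and Y: "set ys \<subseteq> Obj C" and Z: "set zs \<subseteq> Obj C"
  shows "TenA A (Idn A ws) (Assoc A xs ys zs) \<cdot>\<^bsub>A\<^esub> Assoc A ws (list_tensor C xs ys) zs \<cdot>\<^bsub>A\<^esub> TenA A (Assoc A ws xs ys) (Idn A zs)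
    = Assoc A ws xs (list_tensor C ys zs) \<cdot>\<^bsub>A\<^esub> Assoc A (list_tensor C ws xs) ys zs"
proof -
  note T = list_tensor_Obj
  note 1 = mono_entries_TenA [OF mono_entries_Idn [OF W] mono_entries_Assoc [OF X Y Z]]
  note 2 = mono_entries_Assoc [OF W T [OF X Y] Z]
  note 3 = mono_entries_TenA [OF mono_entries_Assoc [OF W X Y] mono_entries_Idn [OF Z]]
  note 4 = mono_entries_Assoc [OF W X T [OF Y Z]] and 5 = mono_entries_Assoc [OF T [OF W X] Y Z]
  show ?thesis
    unfolding A_structure mono_TenA [OF mono_entries_Idn [OF W] mono_entries_Assoc [OF X Y Z]]
      mono_TenA [OF mono_entries_Assoc [OF W X Y] mono_entries_Idn [OF Z]]
      mono_Comp [OF 2 1] mono_Comp [OF 3 mono_entries_Comp [OF 2 1]] mono_Comp [OF 5 4]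
  proof (rule mono_eqI, goal_cases)
    \<comment> \<open>Index maps: all factors are diagonal, up to writing \<open>J\<close> by
      quotient and remainder.\<close>
    case (1 J)
    show ?case using div_mult_mod_eq [of J "length xs * (length ys * length zs)"]
      by (simp add: mult.assoc del: div_mult_mod_eq)
  next
    case (2 J)
    then have J: "J < (length ws * length xs) * length ys * length zs" by simp
    then obtain q b c where q: "q < length ws * length xs" "b < length ys" "c < length zs" "J = (q * length ys + b) * length zs + c"
      by (rule list_tensor_index)
    \<comment> \<open>The digit \<open>q\<close> still combines the two outermost positions;
      splitting it yields the four digits of the index.\<close>
    define i a where "i = q div length xs" and "a = q mod length xs"
    then have ia: "i < length ws" "a < length xs" "q = i * length xs + a" using less_mult_div_mod [OF q(1)] by simp_all
    have lt: "(a * length ys + b) * length zs + c < length xs * length ys * length zs"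
      "a * length ys + b < length xs * length ys" "b * length zs + c < length ys * length zs"
      "i * (length xs * length ys) + (a * length ys + b) < length ws * (length xs * length ys)"
      using mult_add_less [OF q(2) ia(2)] mult_add_less [OF q(3,2)]
        mult_add_less [OF q(3) mult_add_less [OF q(2) ia(2)]] mult_add_less [OF mult_add_less [OF q(2) ia(2)] ia(1)] by simp_all
    \<comment> \<open>Two groupings of the same digits, one for each modulus by which the left-hand
      side divides \<open>J\<close>.\<close>
    have J': "J = i * (length xs * length ys * length zs) + ((a * length ys + b) * length zs + c)"
      "J = (i * (length xs * length ys) + (a * length ys + b)) * length zs + c"
      unfolding q ia by (simp_all add: algebra_simps)
    have D: "J div (length xs * length ys * length zs) = i" "J mod (length xs * length ys * length zs) = (a * length ys + b) * length zs + c"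
      using mult_add_div_mod [OF lt(1), of i] unfolding J'(1) [symmetric] by simp_all
    have D2: "J div length zs = i * (length xs * length ys) + (a * length ys + b)" "J mod length zs = c"
      "(i * (length xs * length ys) + (a * length ys + b)) div length ys = q" "(i * (length xs * length ys) + (a * length ys + b)) mod length ys = b"
    proof -
      show "J div length zs = i * (length xs * length ys) + (a * length ys + b)" "J mod length zs = c"
        unfolding J'(2) using q by simp_all
      have *: "i * (length xs * length ys) + (a * length ys + b) = q * length ys + b" unfolding ia by (simp add: algebra_simps)
      show "(i * (length xs * length ys) + (a * length ys + b)) div length ys = q" "(i * (length xs * length ys) + (a * length ys + b)) mod length ys = b"
        unfolding * using q by simp_all
    qed
    have D3: "J div (length ys * length zs) = q" "J mod (length ys * length zs) = b * length zs + c" "q div length xs = i" "q mod length xs = a"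
      using q(2-4) ia(2,3) by simp_all
    have "TenA C (Idn C (ws ! i)) (Assoc C (xs ! a) (ys ! b) (zs ! c)) \<cdot> Assoc C (ws ! i) (TenO C (xs ! a) (ys ! b)) (zs ! c)
        \<cdot> TenA C (Assoc C (ws ! i) (xs ! a) (ys ! b)) (Idn C (zs ! c))
      = Assoc C (ws ! i) (xs ! a) (TenO C (ys ! b) (zs ! c)) \<cdot> Assoc C (TenO C (ws ! i) (xs ! a)) (ys ! b) (zs ! c)"
      by (rule pentagon) (use W X Y Z ia q nth_Obj in auto)
    then show ?case using lt q(1-3) ia(1,2) by (simp add: D D2 D3)
  qed
qed

lemma triangle_A:
  assumes X: "set xs \<subseteq> Obj C" and Y: "set ys \<subseteq> Obj C"
  shows "TenA A (Idn A xs) (LUnit A ys) \<cdot>\<^bsub>A\<^esub> Assoc A xs [UnitO C] ys = TenA A (RUnit A xs) (Idn A ys)"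
proof -
  have U: "set [UnitO C] \<subseteq> Obj C" by (simp add: UnitO_Obj)
  show ?thesis
    unfolding A_structure mono_TenA [OF mono_entries_Idn [OF X] mono_entries_LUnit [OF Y]]
      mono_TenA [OF mono_entries_RUnit [OF X] mono_entries_Idn [OF Y]]
      mono_Comp [OF mono_entries_Assoc [OF X U Y] mono_entries_TenA [OF mono_entries_Idn [OF X] mono_entries_LUnit [OF Y]]]
  proof (rule mono_eqI, goal_cases)
    case (1 j)
    then show ?case by simp
  next
    case (2 j)
    then have "j < length xs * length ys" by simp
    from less_mult_div_mod [OF this] triangle [of "xs ! (j div length ys)" "ys ! (j mod length ys)"] X Y
    show ?case by (simp add: nth_Obj)
  qed
qed

text \<open>Again both sides are monomial, now with nontrivial permutations as index maps; their
  agreement and the hexagon of the base category at each entry are what has to be shown.\<close>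

lemma hexagon_A:
  assumes X: "set xs \<subseteq> Obj C" and Y: "set ys \<subseteq> Obj C" and Z: "set zs \<subseteq> Obj C"
  shows "Assoc A ys zs xs \<cdot>\<^bsub>A\<^esub> Braid A xs (list_tensor C ys zs) \<cdot>\<^bsub>A\<^esub> Assoc A xs ys zs
    = TenA A (Idn A ys) (Braid A xs zs) \<cdot>\<^bsub>A\<^esub> Assoc A ys xs zs \<cdot>\<^bsub>A\<^esub> TenA A (Braid A xs ys) (Idn A zs)"
proof -
  note T = list_tensor_Obj
  note a1 = mono_entries_Assoc [OF X Y Z] and b1 = mono_entries_Braid [OF X T [OF Y Z]] and a2 = mono_entries_Assoc [OF Y Z X]
  note c1 = mono_entries_TenA [OF mono_entries_Braid [OF X Y] mono_entries_Idn [OF Z]]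
    and a3 = mono_entries_Assoc [OF Y X Z] and c2 = mono_entries_TenA [OF mono_entries_Idn [OF Y] mono_entries_Braid [OF X Z]]
  show ?thesis
    unfolding A_structure mono_TenA [OF mono_entries_Braid [OF X Y] mono_entries_Idn [OF Z]]
      mono_TenA [OF mono_entries_Idn [OF Y] mono_entries_Braid [OF X Z]]
      mono_Comp [OF b1 a2] mono_Comp [OF a1 mono_entries_Comp [OF b1 a2]]
      mono_Comp [OF a3 c2] mono_Comp [OF c1 mono_entries_Comp [OF a3 c2]]
  proof (rule mono_eqI, goal_cases)
    case (1 j)
    then have "j < length xs * length ys * length zs" by simp
    then obtain i a b where *: "i < length xs" "a < length ys" "b < length zs" "j = (i * length ys + a) * length zs + b"
      by (rule list_tensor_index)
    \<comment> \<open>On the left the index into \<open>xs\<close> passes the pair from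
      \<open>ys\<close> and \<open>zs\<close> at once, on the right it passes one after the other;
      the resulting digits differ only in their bracketing.\<close>
    have "(a * length zs + b) * length xs + i = a * (length zs * length xs) + (b * length xs + i)"
      by (simp add: algebra_simps)
    then show ?case using * mult_add_less [OF *(3,2)] mult_add_less [OF *(2,1)] by simp
  next
    case (2 j)
    then have "j < length xs * length ys * length zs" by simp
    then obtain i a b where *: "i < length xs" "a < length ys" "b < length zs" "j = (i * length ys + a) * length zs + b"
      by (rule list_tensor_index)
    have lt: "a * length zs + b < length ys * length zs" "i * length ys + a < length xs * length ys" "a * length xs + i < length ys * length xs"
      "i * length zs + b < length xs * length zs"
      using mult_add_less [OF *(3,2)] mult_add_less [OF *(2,1)] mult_add_less [OF *(1,2)] mult_add_less [OF *(3,1)] by simp_all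
    have "Assoc C (ys ! a) (zs ! b) (xs ! i) \<cdot> Braid C (xs ! i) (TenO C (ys ! a) (zs ! b)) \<cdot> Assoc C (xs ! i) (ys ! a) (zs ! b)
      = TenA C (Idn C (ys ! a)) (Braid C (xs ! i) (zs ! b)) \<cdot> Assoc C (ys ! a) (xs ! i) (zs ! b) \<cdot> TenA C (Braid C (xs ! i) (ys ! a)) (Idn C (zs ! b))"
      by (rule hexagon) (use X Y Z * nth_Obj in auto)
    then show ?case using * lt by simp
  qed
qed

sublocale A: symmetric_monoidal_category A
proof
  show "TenO A xs ys \<in> Obj A" if "xs \<in> Obj A" "ys \<in> Obj A" for xs ys
    using that list_tensor_Obj by (simp add: A_simps)
  show "TenA A f g \<in> Hom A (TenO A xs xs') (TenO A ys ys')"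
    if "f \<in> Hom A xs ys" "g \<in> Hom A xs' ys'" for f g xs ys xs' ys'
    using that by (auto elim!: Hom_AE simp: matrix_TenA A_simps matrix_Hom entries_TenA list_tensor_Obj)
  show "TenA A (Idn A xs) (Idn A ys) = Idn A (TenO A xs ys)" if "xs \<in> Obj A" "ys \<in> Obj A" for xs ys
    using that by (simp add: A_simps mono_Idn_TenA)
  show "TenA A (g \<cdot>\<^bsub>A\<^esub> f) (g' \<cdot>\<^bsub>A\<^esub> f') = TenA A g g' \<cdot>\<^bsub>A\<^esub> TenA A f f'"
    if "f \<in> Hom A xs ys" "g \<in> Hom A ys zs" "f' \<in> Hom A xs' ys'" "g' \<in> Hom A ys' zs'" for f g f' g' xs ys zs xs' ys' zs'
    using that by (rule TenA_Comp_A)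
  show "UnitO A \<in> Obj A" by (simp add: A_simps UnitO_Obj)
  show "Assoc A xs ys zs \<in> Hom A (TenO A (TenO A xs ys) zs) (TenO A xs (TenO A ys zs))" "iso_arr A (Assoc A xs ys zs)"
    if "xs \<in> Obj A" "ys \<in> Obj A" "zs \<in> Obj A" for xs ys zs
  proof -
    have O: "set xs \<subseteq> Obj C" "set ys \<subseteq> Obj C" "set zs \<subseteq> Obj C" using that by (simp_all add: A_simps)
    show "Assoc A xs ys zs \<in> Hom A (TenO A (TenO A xs ys) zs) (TenO A xs (TenO A ys zs))"
      unfolding A_simps A_structure by (rule mono_Hom [OF mono_entries_Assoc [OF O]])
    show "iso_arr A (Assoc A xs ys zs)" unfolding A_structure
    proof (rule mono_id_iso [OF mono_entries_Assoc [OF O]])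
      fix j assume "j < length (list_tensor C (list_tensor C xs ys) zs)"
      then have "j < length xs * length ys * length zs" by simp
      from less_mult_div_mod [OF this] less_mult_div_mod [OF less_mult_div_mod(1) [OF this]]
      show "iso_arr C (Assoc C (xs ! (j div length zs div length ys)) (ys ! (j div length zs mod length ys)) (zs ! (j mod length zs)))"
        using O by (intro Assoc_iso nth_Obj)
    qed (simp add: mult.assoc)
  qed
  show "Assoc A xs' ys' zs' \<cdot>\<^bsub>A\<^esub> TenA A (TenA A f g) h = TenA A f (TenA A g h) \<cdot>\<^bsub>A\<^esub> Assoc A xs ys zs"
    if "f \<in> Hom A xs xs'" "g \<in> Hom A ys ys'" "h \<in> Hom A zs zs'" for f g h xs ys zs xs' ys' zs'
    using that by (rule Assoc_natural_A)
  show "LUnit A xs \<in> Hom A (TenO A (UnitO A) xs) xs" "iso_arr A (LUnit A xs)" if "xs \<in> Obj A" for xs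
  proof -
    have O: "set xs \<subseteq> Obj C" using that by (simp add: A_simps)
    show "LUnit A xs \<in> Hom A (TenO A (UnitO A) xs) xs"
      unfolding A_simps A_structure by (rule mono_Hom [OF mono_entries_LUnit [OF O]])
    show "iso_arr A (LUnit A xs)" unfolding A_structure
      by (rule mono_id_iso [OF mono_entries_LUnit [OF O]]) (simp_all add: LUnit_iso nth_Obj [OF O])
  qed
  show "RUnit A xs \<in> Hom A (TenO A xs (UnitO A)) xs" "iso_arr A (RUnit A xs)" if "xs \<in> Obj A" for xs
  proof -
    have O: "set xs \<subseteq> Obj C" using that by (simp add: A_simps)
    show "RUnit A xs \<in> Hom A (TenO A xs (UnitO A)) xs"
      unfolding A_simps A_structure by (rule mono_Hom [OF mono_entries_RUnit [OF O]])
    show "iso_arr A (RUnit A xs)" unfolding A_structure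
      by (rule mono_id_iso [OF mono_entries_RUnit [OF O]]) (simp_all add: RUnit_iso nth_Obj [OF O])
  qed
  show "LUnit A ys \<cdot>\<^bsub>A\<^esub> TenA A (Idn A (UnitO A)) f = f \<cdot>\<^bsub>A\<^esub> LUnit A xs"
    "RUnit A ys \<cdot>\<^bsub>A\<^esub> TenA A f (Idn A (UnitO A)) = f \<cdot>\<^bsub>A\<^esub> RUnit A xs" if "f \<in> Hom A xs ys" for f xs ys
    using that by (simp_all add: A_simps LUnit_natural_A RUnit_natural_A)
  show "Braid A xs ys \<in> Hom A (TenO A xs ys) (TenO A ys xs)" "Braid A ys xs \<cdot>\<^bsub>A\<^esub> Braid A xs ys = Idn A (TenO A xs ys)"
    if "xs \<in> Obj A" "ys \<in> Obj A" for xs ys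
  proof -
    have O: "set xs \<subseteq> Obj C" "set ys \<subseteq> Obj C" using that by (simp_all add: A_simps)
    show "Braid A xs ys \<in> Hom A (TenO A xs ys) (TenO A ys xs)"
      unfolding A_simps A_structure by (rule mono_Hom [OF mono_entries_Braid [OF O]])
    show "Braid A ys xs \<cdot>\<^bsub>A\<^esub> Braid A xs ys = Idn A (TenO A xs ys)"
      unfolding A_simps A_structure mono_Comp [OF mono_entries_Braid [OF O] mono_entries_Braid [OF O(2,1)]]
    proof (rule mono_eqI, goal_cases)
      case (1 j)
      then have "j < length xs * length ys" by simp
      from less_mult_div_mod [OF this] show ?case by simp
    next
      case (2 j)
      then have "j < length xs * length ys" by simp
      from less_mult_div_mod [OF this] 2 O show ?case by (simp add: nth_Obj Braid_symmetric)
    qed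
  qed
  show "Braid A xs' ys' \<cdot>\<^bsub>A\<^esub> TenA A f g = TenA A g f \<cdot>\<^bsub>A\<^esub> Braid A xs ys"
    if "f \<in> Hom A xs xs'" "g \<in> Hom A ys ys'" for f g xs xs' ys ys'
    using that by (rule Braid_natural_A)
qed (simp_all add: A_simps pentagon_A triangle_A hexagon_A)

lemma TenA_linear_A:
  assumes hom: "f \<in> Hom A xs ys" "f' \<in> Hom A xs ys" "g \<in> Hom A xs' ys'" "g' \<in> Hom A xs' ys'"
  shows "TenA A (AddA A f f') g = AddA A (TenA A f g) (TenA A f' g)"
    "TenA A f (AddA A g g') = AddA A (TenA A f g) (TenA A f g')"
    "TenA A (SmultA A c f) g = SmultA A c (TenA A f g)" "TenA A f (SmultA A c g) = SmultA A c (TenA A f g)"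
proof -
  obtain m where m: "f = matrix_arrow xs ys m" "entries xs ys m" using hom(1) by (rule Hom_AE)
  obtain m' where m': "f' = matrix_arrow xs ys m'" "entries xs ys m'" using hom(2) by (rule Hom_AE)
  obtain n where n: "g = matrix_arrow xs' ys' n" "entries xs' ys' n" using hom(3) by (rule Hom_AE)
  obtain n' where n': "g' = matrix_arrow xs' ys' n'" "entries xs' ys' n'" using hom(4) by (rule Hom_AE)
  have e: "m (i div length ys') (j div length xs') \<in> Hom C (xs ! (j div length xs')) (ys ! (i div length ys'))"
    "m' (i div length ys') (j div length xs') \<in> Hom C (xs ! (j div length xs')) (ys ! (i div length ys'))"
    "n (i mod length ys') (j mod length xs') \<in> Hom C (xs' ! (j mod length xs')) (ys' ! (i mod length ys'))"
    "n' (i mod length ys') (j mod length xs') \<in> Hom C (xs' ! (j mod length xs')) (ys' ! (i mod length ys'))"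
    if "i < length ys * length ys'" "j < length xs * length xs'" for i j
    using that less_mult_div_mod m(2) m'(2) n(2) n'(2) by (auto simp: entries_def)
  show "TenA A (AddA A f f') g = AddA A (TenA A f g) (TenA A f' g)"
    unfolding m(1) m'(1) n(1) using e by (auto simp: matrix_TenA matrix_AddA matrix_arrow_eq intro!: TenA_AddA_left)
  show "TenA A f (AddA A g g') = AddA A (TenA A f g) (TenA A f g')"
    unfolding m(1) n'(1) n(1) using e by (auto simp: matrix_TenA matrix_AddA matrix_arrow_eq intro!: TenA_AddA_right)
  show "TenA A (SmultA A c f) g = SmultA A c (TenA A f g)"
    unfolding m(1) n(1) using e by (auto simp: matrix_TenA matrix_SmultA matrix_arrow_eq intro!: TenA_SmultA_left)
  show "TenA A f (SmultA A c g) = SmultA A c (TenA A f g)"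
    unfolding m(1) n(1) using e by (auto simp: matrix_TenA matrix_SmultA matrix_arrow_eq intro!: TenA_SmultA_right)
qed

sublocale A: linear_symmetric_monoidal_category A
  by standard (blast intro: TenA_linear_A)+

end

section \<open>The Karoubi completion\<close>

locale karoubi_context = linear_symmetric_monoidal_category C
  for C :: "('o, 'a, 'k::field) lsmcat" (structure)
begin

abbreviation K where "K \<equiv> karoubi_completion C"
abbreviation KO where "KO \<equiv> karoubi_obj C"
abbreviation KT where "KT \<equiv> karoubi_tensor C"
abbreviation KU where "KU \<equiv> karoubi_unit C"

lemma KO_D:
  assumes "X \<in> KO"
  shows "fst X \<in> Obj C" "snd X \<in> Hom C (fst X) (fst X)" "snd X \<cdot> snd X = snd X"
  using assms by (auto simp: karoubi_obj_def)

text \<open>Every arrow of the completion comes from an arrow commuting with the idempotents, and for such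
  arrows all the structure of the completion is computed in the original category; so the axioms
  carry over.\<close>

definition inter :: "'o \<times> 'a \<Rightarrow> 'o \<times> 'a \<Rightarrow> 'a \<Rightarrow> bool" where
  "inter X Y s \<longleftrightarrow> X \<in> KO \<and> Y \<in> KO \<and> s \<in> Hom C (fst X) (fst Y) \<and> s \<cdot> snd X = snd Y \<cdot> s"

definition res :: "'o \<times> 'a \<Rightarrow> 'o \<times> 'a \<Rightarrow> 'a \<Rightarrow> ('o \<times> 'a, 'a) arrow" where
  "res X Y s = Arrow X Y (s \<cdot> snd X)"

lemma interD:
  assumes "inter X Y s"
  shows "X \<in> KO" "Y \<in> KO" "s \<in> Hom C (fst X) (fst Y)" "s \<cdot> snd X = snd Y \<cdot> s"
  using assms by (auto simp: inter_def)

lemma inter_Comp: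
  assumes "inter X Y s" "inter Y Z t" shows "inter X Z (t \<cdot> s)"
proof -
  note s = interD [OF assms(1)] and t = interD [OF assms(2)]
  note X = KO_D [OF s(1)] and Y = KO_D [OF t(1)] and Z = KO_D [OF t(2)]
  have "(t \<cdot> s) \<cdot> snd X = t \<cdot> (s \<cdot> snd X)" by (rule Comp_assoc [OF X(2) s(3) t(3)])
  also have "\<dots> = (t \<cdot> snd Y) \<cdot> s" unfolding s(4) by (rule Comp_assoc [OF s(3) Y(2) t(3), symmetric])
  also have "\<dots> = snd Z \<cdot> (t \<cdot> s)" unfolding t(4) by (rule Comp_assoc [OF s(3) t(3) Z(2)])
  finally show ?thesis using s t Comp_Hom [OF s(3) t(3)] by (simp add: inter_def)
qed

text \<open>The idempotent in the middle is absorbed because \<open>s\<close> commutes with the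
  idempotents.\<close>

lemma res_Comp:
  assumes "inter X Y s" "inter Y Z t"
  shows "res Y Z t \<cdot>\<^bsub>K\<^esub> res X Y s = res X Z (t \<cdot> s)"
proof -
  note s = interD [OF assms(1)] and t = interD [OF assms(2)]
  note X = KO_D [OF s(1)] and Y = KO_D [OF t(1)] and Z = KO_D [OF t(2)]
  have "(t \<cdot> snd Y) \<cdot> (s \<cdot> snd X) = t \<cdot> (snd Y \<cdot> (s \<cdot> snd X))"
    by (rule Comp_assoc [OF Comp_Hom [OF X(2) s(3)] Y(2) t(3)])
  also have "snd Y \<cdot> (s \<cdot> snd X) = s \<cdot> snd X"
    using Comp_assoc [OF X(2) X(2) s(3)] Comp_assoc [OF X(2) s(3) Y(2)] s(4) X(3) by simp
  also have "t \<cdot> (s \<cdot> snd X) = (t \<cdot> s) \<cdot> snd X" by (rule Comp_assoc [OF X(2) s(3) t(3), symmetric])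
  finally show ?thesis by (simp add: res_def karoubi_completion_def)
qed

text \<open>An arrow that is fixed by the two idempotents together absorbs each of them separately.
  It therefore commutes with them and can serve as its own representative.\<close>

lemma Hom_K: "Hom K X Y = res X Y ` {s. inter X Y s}"
proof (intro equalityI subsetI)
  fix f assume "f \<in> Hom K X Y"
  then have dc: "arr_dom f = X" "arr_cod f = Y" and mem: "f \<in> {Arrow X Y f | X Y f. X \<in> KO \<and> Y \<in> KO \<and>
      f \<in> Hom C (fst X) (fst Y) \<and> snd Y \<cdot> f \<cdot> snd X = f}"
    by (simp_all add: Hom_def karoubi_completion_def)
  obtain X' Y' v where v': "f = Arrow X' Y' v \<and> X' \<in> KO \<and> Y' \<in> KO \<and> v \<in> Hom C (fst X') (fst Y') \<and> snd Y' \<cdot> v \<cdot> snd X' = v"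
    using mem unfolding mem_Collect_eq by (elim exE) (rule that)
  have "X' = X" "Y' = Y" using dc v' by simp_all
  with v' have v: "f = Arrow X Y v" "X \<in> KO" "Y \<in> KO" "v \<in> Hom C (fst X) (fst Y)" "snd Y \<cdot> v \<cdot> snd X = v"
    by (simp_all del: Comp_assoc_simp)
  note X = KO_D [OF v(2)] and Y = KO_D [OF v(3)]
  have arr: "v \<in> Arr C" "snd X \<in> Arr C" "snd Y \<in> Arr C" "Dom C v = fst X" "Cod C v = fst Y"
    "Dom C (snd X) = fst X" "Cod C (snd X) = fst X" "Dom C (snd Y) = fst Y" "Cod C (snd Y) = fst Y"
    using v(4) X(2) Y(2) by (simp_all add: Hom_iff)
  have vv: "snd Y \<cdot> (v \<cdot> snd X) = v" using Comp_assoc [OF X(2) v(4) Y(2)] v(5) by simp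
  have "v \<cdot> snd X = (snd Y \<cdot> (v \<cdot> snd X)) \<cdot> snd X" by (simp only: vv)
  also have "\<dots> = snd Y \<cdot> (v \<cdot> (snd X \<cdot> snd X))" using arr by simp
  also have "\<dots> = v" by (simp only: X(3) vv)
  finally have 1: "v \<cdot> snd X = v" .
  have "snd Y \<cdot> v = snd Y \<cdot> (snd Y \<cdot> (v \<cdot> snd X))" by (simp only: vv)
  also have "\<dots> = (snd Y \<cdot> snd Y) \<cdot> (v \<cdot> snd X)" using arr by simp
  also have "\<dots> = v" by (simp only: Y(3) vv)
  finally have 2: "snd Y \<cdot> v = v" .
  show "f \<in> res X Y ` {s. inter X Y s}"
    using v 1 2 by (intro image_eqI [of _ _ v]) (auto simp: res_def inter_def)
next
  fix f assume "f \<in> res X Y ` {s. inter X Y s}"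
  then obtain s where f: "f = res X Y s" and i: "inter X Y s" by auto
  note s = interD [OF i]
  note X = KO_D [OF s(1)] and Y = KO_D [OF s(2)]
  have h: "s \<cdot> snd X \<in> Hom C (fst X) (fst Y)" by (rule Comp_Hom [OF X(2) s(3)])
  have e: "s \<cdot> snd X \<cdot> snd X = s \<cdot> snd X" using Comp_assoc [OF X(2) X(2) s(3)] X(3) by simp
  have "snd Y \<cdot> (s \<cdot> snd X) = s \<cdot> snd X"
    using Comp_assoc [OF X(2) s(3) Y(2)] s(4) e by simp
  then have "snd Y \<cdot> (s \<cdot> snd X) \<cdot> snd X = s \<cdot> snd X" using e by simp
  then have "Arrow X Y (s \<cdot> snd X) \<in> {Arrow X Y f | X Y f. X \<in> KO \<and> Y \<in> KO \<and>
      f \<in> Hom C (fst X) (fst Y) \<and> snd Y \<cdot> f \<cdot> snd X = f}" using s h by blast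
  also have "\<dots> = Arr K" by (simp only: karoubi_completion_def category.simps)
  finally show "f \<in> Hom K X Y" unfolding Hom_iff f res_def by (simp add: karoubi_completion_def)
qed

lemma Hom_KE:
  assumes "f \<in> Hom K X Y" obtains s where "f = res X Y s" "inter X Y s"
  using assms unfolding Hom_K by auto

lemma res_Hom: "inter X Y s \<Longrightarrow> res X Y s \<in> Hom K X Y"
  unfolding Hom_K by auto

lemma KT_KO:
  assumes "X \<in> KO" "Y \<in> KO" shows "KT X Y \<in> KO"
proof -
  note X = KO_D [OF assms(1)] and Y = KO_D [OF assms(2)]
  show ?thesis unfolding karoubi_obj_def karoubi_tensor_def
    using TenO_Obj [OF X(1) Y(1)] TenA_Hom [OF X(2) Y(2)] TenA_Comp [OF X(2,2) Y(2,2)] X(3) Y(3) by simp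
qed

lemma KU_KO: "KU \<in> KO"
  using UnitO_Obj Idn_Hom [of "UnitO C"] by (simp add: karoubi_obj_def karoubi_unit_def)

lemma fst_snd_KT [simp]: "fst (KT X Y) = TenO C (fst X) (fst Y)" "snd (KT X Y) = TenA C (snd X) (snd Y)"
  "fst KU = UnitO C" "snd KU = Idn C (UnitO C)"
  by (simp_all add: karoubi_tensor_def karoubi_unit_def)

lemma inter_TenA:
  assumes "inter X Y s" "inter X' Y' t" shows "inter (KT X X') (KT Y Y') (TenA C s t)"
proof -
  note s = interD [OF assms(1)] and t = interD [OF assms(2)]
  note X = KO_D [OF s(1)] and Y = KO_D [OF s(2)] and X' = KO_D [OF t(1)] and Y' = KO_D [OF t(2)]
  show ?thesis unfolding inter_def
    using TenA_Hom [OF s(3) t(3)] TenA_Comp [OF X(2) s(3) X'(2) t(3)] TenA_Comp [OF s(3) Y(2) t(3) Y'(2)] s t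
    by (simp add: KT_KO)
qed

lemma res_TenA:
  assumes "inter X Y s" "inter X' Y' t"
  shows "TenA K (res X Y s) (res X' Y' t) = res (KT X X') (KT Y Y') (TenA C s t)"
proof -
  note s = interD [OF assms(1)] and t = interD [OF assms(2)]
  note X = KO_D [OF s(1)] and X' = KO_D [OF t(1)]
  show ?thesis using TenA_Comp [OF X(2) s(3) X'(2) t(3)] by (simp add: karoubi_completion_def res_def)
qed

lemma inter_Idn: "X \<in> KO \<Longrightarrow> inter X X (Idn C (fst X))"
  using KO_D [of X] Idn_Hom Comp_Idn Idn_Comp by (simp add: inter_def)

text \<open>The identity of \<open>(x, e)\<close> is \<open>e\<close>, but the identity of
  \<open>x\<close> represents it as well. With this representative the unit and coherence laws
  reduce to those of the original category.\<close>

lemma res_Idn: "X \<in> KO \<Longrightarrow> Idn K X = res X X (Idn C (fst X))"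
  using KO_D [of X] Idn_Comp by (simp add: res_def karoubi_completion_def)

text \<open>The commutation condition is naturality of the associator at the three idempotents; the
  other structure arrows are treated in the same way.\<close>

lemma inter_Assoc:
  assumes "X \<in> KO" "Y \<in> KO" "Z \<in> KO"
  shows "inter (KT (KT X Y) Z) (KT X (KT Y Z)) (Assoc C (fst X) (fst Y) (fst Z))"
  unfolding inter_def using assms
  by (auto intro!: KT_KO Assoc_Hom Assoc_natural KO_D(1,2))

lemma inter_LUnit: assumes "X \<in> KO" shows "inter (KT KU X) X (LUnit C (fst X))"
  unfolding inter_def using assms
  by (auto intro!: KT_KO KU_KO LUnit_Hom LUnit_natural KO_D(1,2))

lemma inter_RUnit: assumes "X \<in> KO" shows "inter (KT X KU) X (RUnit C (fst X))"
  unfolding inter_def using assms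
  by (auto intro!: KT_KO KU_KO RUnit_Hom RUnit_natural KO_D(1,2))

lemma inter_Braid: assumes "X \<in> KO" "Y \<in> KO" shows "inter (KT X Y) (KT Y X) (Braid C (fst X) (fst Y))"
  unfolding inter_def using assms
  by (auto intro!: KT_KO Braid_Hom Braid_natural KO_D(1,2))

lemma res_structure:
  "Assoc K X Y Z = res (KT (KT X Y) Z) (KT X (KT Y Z)) (Assoc C (fst X) (fst Y) (fst Z))"
  "LUnit K X = res (KT KU X) X (LUnit C (fst X))" "RUnit K X = res (KT X KU) X (RUnit C (fst X))"
  "Braid K X Y = res (KT X Y) (KT Y X) (Braid C (fst X) (fst Y))"
  by (simp_all add: karoubi_completion_def res_def)

lemma K_simps: "Obj K = KO" "Dom K = arr_dom" "Cod K = arr_cod" "TenO K = KT" "UnitO K = KU"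
  by (simp_all add: karoubi_completion_def)

lemma inter_AddA:
  assumes "inter X Y s" "inter X Y t" shows "inter X Y (AddA C s t)"
proof -
  note s = interD [OF assms(1)] and t = interD [OF assms(2)]
  note X = KO_D [OF s(1)] and Y = KO_D [OF s(2)]
  show ?thesis unfolding inter_def
    using AddA_Hom [OF s(3) t(3)] AddA_Comp [OF X(2) s(3) t(3)] Comp_AddA [OF s(3) t(3) Y(2)] s t by simp
qed

lemma res_AddA:
  assumes "inter X Y s" "inter X Y t" shows "AddA K (res X Y s) (res X Y t) = res X Y (AddA C s t)"
proof -
  note s = interD [OF assms(1)] and t = interD [OF assms(2)]
  note X = KO_D [OF s(1)]
  show ?thesis using AddA_Comp [OF X(2) s(3) t(3)] by (simp add: karoubi_completion_def res_def)
qed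

lemma inter_SmultA:
  assumes "inter X Y s" shows "inter X Y (SmultA C c s)"
proof -
  note s = interD [OF assms(1)]
  note X = KO_D [OF s(1)] and Y = KO_D [OF s(2)]
  show ?thesis unfolding inter_def
    using SmultA_Hom [OF s(3)] SmultA_Comp [OF X(2) s(3)] Comp_SmultA [OF s(3) Y(2)] s by simp
qed

lemma res_SmultA:
  assumes "inter X Y s" shows "SmultA K c (res X Y s) = res X Y (SmultA C c s)"
proof -
  note s = interD [OF assms(1)]
  note X = KO_D [OF s(1)]
  show ?thesis using SmultA_Comp [OF X(2) s(3)] by (simp add: karoubi_completion_def res_def)
qed

lemma inter_ZeroA: "\<lbrakk>X \<in> KO; Y \<in> KO\<rbrakk> \<Longrightarrow> inter X Y (ZeroA C (fst X) (fst Y))"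
  using KO_D [of X] KO_D [of Y] by (simp add: inter_def ZeroA_Hom ZeroA_Comp Comp_ZeroA)

lemma res_ZeroA: "\<lbrakk>X \<in> KO; Y \<in> KO\<rbrakk> \<Longrightarrow> ZeroA K X Y = res X Y (ZeroA C (fst X) (fst Y))"
  using KO_D [of X] KO_D [of Y] by (simp add: karoubi_completion_def res_def ZeroA_Comp)

text \<open>The inverse of an arrow commuting with the idempotents commutes with them as well, so it
  represents the inverse in the completion.\<close>

lemma res_iso:
  assumes i: "inter X Y s" and iso: "iso_arr C s" shows "iso_arr K (res X Y s)"
proof -
  note s = interD [OF i]
  note X = KO_D [OF s(1)] and Y = KO_D [OF s(2)]
  have inv: "inv_arr s \<in> Hom C (fst Y) (fst X)" using s(3) iso by (simp add: Hom_iff)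
  \<comment> \<open>Insert \<open>s\<close> followed by its inverse on the right, then carry the
    idempotent through \<open>s\<close>.\<close>
  have "inv_arr s \<cdot> snd Y = inv_arr s \<cdot> ((snd Y \<cdot> s) \<cdot> inv_arr s)"
    using X Y s(3) iso by (simp add: Hom_iff)
  also have "\<dots> = snd X \<cdot> inv_arr s"
    unfolding s(4) [symmetric] using X Y s(3) iso by (simp add: Hom_iff)
  finally have j: "inter Y X (inv_arr s)" using s inv by (simp add: inter_def)
  show ?thesis unfolding iso_arr_def
  proof (intro conjI bexI)
    show "res X Y s \<in> Arr K" using res_Hom [OF i] by (simp add: Hom_iff)
    show "res Y X (inv_arr s) \<in> Hom K (Cod K (res X Y s)) (Dom K (res X Y s))"
      using res_Hom [OF j] by (simp add: K_simps res_def)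
    show "res Y X (inv_arr s) \<cdot>\<^bsub>K\<^esub> res X Y s = Idn K (Dom K (res X Y s))"
      "res X Y s \<cdot>\<^bsub>K\<^esub> res Y X (inv_arr s) = Idn K (Cod K (res X Y s))"
      unfolding res_Comp [OF i j] res_Comp [OF j i] using s iso
      by (simp_all add: K_simps Hom_iff) (simp_all add: res_def res_Idn)
  qed
qed

sublocale K: category K
proof
  show "f \<in> Arr K \<Longrightarrow> Dom K f \<in> Obj K" "f \<in> Arr K \<Longrightarrow> Cod K f \<in> Obj K" for f
    by (auto simp: karoubi_completion_def)
  show "X \<in> Obj K \<Longrightarrow> Idn K X \<in> Hom K X X" for X
    by (simp add: K_simps res_Idn res_Hom inter_Idn)
  show "g \<cdot>\<^bsub>K\<^esub> f \<in> Hom K X Z" if "f \<in> Hom K X Y" "g \<in> Hom K Y Z" for f g X Y Z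
    using that by (auto elim!: Hom_KE simp: res_Comp intro!: res_Hom inter_Comp)
  show "f \<cdot>\<^bsub>K\<^esub> Idn K X = f" "Idn K Y \<cdot>\<^bsub>K\<^esub> f = f" if "f \<in> Hom K X Y" for f X Y
    using that by (auto elim!: Hom_KE simp: res_Idn interD(1,2) res_Comp [OF inter_Idn] res_Comp [OF _ inter_Idn] Comp_Idn [OF interD(3)] Idn_Comp [OF interD(3)])
  show "(h \<cdot>\<^bsub>K\<^esub> g) \<cdot>\<^bsub>K\<^esub> f = h \<cdot>\<^bsub>K\<^esub> (g \<cdot>\<^bsub>K\<^esub> f)"
    if hom: "f \<in> Hom K W X" "g \<in> Hom K X Y" "h \<in> Hom K Y Z" for f g h W X Y Z
  proof -
    obtain s t u where s: "f = res W X s" "inter W X s" and t: "g = res X Y t" "inter X Y t" and u: "h = res Y Z u" "inter Y Z u"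
      using hom by (auto elim!: Hom_KE)
    show ?thesis unfolding s(1) t(1) u(1) res_Comp [OF s(2) t(2)] res_Comp [OF t(2) u(2)]
        res_Comp [OF s(2) inter_Comp [OF t(2) u(2)]] res_Comp [OF inter_Comp [OF s(2) t(2)] u(2)]
        Comp_assoc [OF interD(3) [OF s(2)] interD(3) [OF t(2)] interD(3) [OF u(2)]] ..
  qed
qed

sublocale K: linear_category K
proof
  show "ZeroA K X Y \<in> Hom K X Y" if "X \<in> Obj K" "Y \<in> Obj K" for X Y
    using that by (simp add: K_simps res_ZeroA res_Hom inter_ZeroA)
  show "AddA K f g \<in> Hom K X Y" if "f \<in> Hom K X Y" "g \<in> Hom K X Y" for f g X Y
    using that by (auto elim!: Hom_KE simp: res_AddA inter_AddA res_Hom)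
  show "SmultA K c f \<in> Hom K X Y" if "f \<in> Hom K X Y" for c f X Y
    using that by (auto elim!: Hom_KE simp: res_SmultA inter_SmultA res_Hom)
  show "AddA K (AddA K f g) h = AddA K f (AddA K g h)"
    if "f \<in> Hom K X Y" "g \<in> Hom K X Y" "h \<in> Hom K X Y" for f g h X Y
    using that by (auto elim!: Hom_KE simp: res_AddA inter_AddA AddA_assoc [OF interD(3) interD(3) interD(3)])
  show "AddA K f g = AddA K g f" if "f \<in> Hom K X Y" "g \<in> Hom K X Y" for f g X Y
    using that by (auto elim!: Hom_KE simp: res_AddA AddA_commute [OF interD(3) interD(3)])
  show "AddA K (ZeroA K X Y) f = f" if "f \<in> Hom K X Y" for f X Y
    using that by (auto elim!: Hom_KE simp: res_ZeroA interD(1,2) res_AddA inter_ZeroA AddA_ZeroA [OF interD(3)])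
  show "AddA K f (SmultA K (- 1) f) = ZeroA K X Y" if "f \<in> Hom K X Y" for f X Y
    using that by (auto elim!: Hom_KE simp: res_ZeroA interD(1,2) res_AddA res_SmultA inter_SmultA AddA_inverse [OF interD(3)])
  show "SmultA K 1 f = f" if "f \<in> Hom K X Y" for f X Y
    using that by (auto elim!: Hom_KE simp: res_SmultA SmultA_one [OF interD(3)])
  show "SmultA K c (SmultA K d f) = SmultA K (c * d) f" if "f \<in> Hom K X Y" for c d f X Y
    using that by (auto elim!: Hom_KE simp: res_SmultA inter_SmultA SmultA_SmultA [OF interD(3)])
  show "SmultA K (c + d) f = AddA K (SmultA K c f) (SmultA K d f)" if "f \<in> Hom K X Y" for c d f X Y
    using that by (auto elim!: Hom_KE simp: res_SmultA inter_SmultA res_AddA SmultA_add [OF interD(3)])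
  show "SmultA K c (AddA K f g) = AddA K (SmultA K c f) (SmultA K c g)"
    if "f \<in> Hom K X Y" "g \<in> Hom K X Y" for c f g X Y
    using that by (auto elim!: Hom_KE simp: res_SmultA inter_SmultA res_AddA inter_AddA SmultA_AddA [OF interD(3) interD(3)])
  show "g \<cdot>\<^bsub>K\<^esub> AddA K f f' = AddA K (g \<cdot>\<^bsub>K\<^esub> f) (g \<cdot>\<^bsub>K\<^esub> f')"
    if hom: "f \<in> Hom K X Y" "f' \<in> Hom K X Y" "g \<in> Hom K Y Z" for f f' g X Y Z
  proof -
    obtain s s' t where s: "f = res X Y s" "inter X Y s" and s': "f' = res X Y s'" "inter X Y s'" and t: "g = res Y Z t" "inter Y Z t"
      using hom by (auto elim!: Hom_KE)
    show ?thesis unfolding s(1) s'(1) t(1) res_AddA [OF s(2) s'(2)] res_Comp [OF s(2) t(2)] res_Comp [OF s'(2) t(2)]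
        res_Comp [OF inter_AddA [OF s(2) s'(2)] t(2)] res_AddA [OF inter_Comp [OF s(2) t(2)] inter_Comp [OF s'(2) t(2)]]
        Comp_AddA [OF interD(3) [OF s(2)] interD(3) [OF s'(2)] interD(3) [OF t(2)]] ..
  qed
  show "AddA K g g' \<cdot>\<^bsub>K\<^esub> f = AddA K (g \<cdot>\<^bsub>K\<^esub> f) (g' \<cdot>\<^bsub>K\<^esub> f)"
    if hom: "f \<in> Hom K X Y" "g \<in> Hom K Y Z" "g' \<in> Hom K Y Z" for f g g' X Y Z
  proof -
    obtain s t t' where s: "f = res X Y s" "inter X Y s" and t: "g = res Y Z t" "inter Y Z t" and t': "g' = res Y Z t'" "inter Y Z t'"
      using hom by (auto elim!: Hom_KE)
    show ?thesis unfolding s(1) t(1) t'(1) res_AddA [OF t(2) t'(2)] res_Comp [OF s(2) t(2)] res_Comp [OF s(2) t'(2)]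
        res_Comp [OF s(2) inter_AddA [OF t(2) t'(2)]] res_AddA [OF inter_Comp [OF s(2) t(2)] inter_Comp [OF s(2) t'(2)]]
        AddA_Comp [OF interD(3) [OF s(2)] interD(3) [OF t(2)] interD(3) [OF t'(2)]] ..
  qed
  show "g \<cdot>\<^bsub>K\<^esub> SmultA K c f = SmultA K c (g \<cdot>\<^bsub>K\<^esub> f)" "SmultA K c g \<cdot>\<^bsub>K\<^esub> f = SmultA K c (g \<cdot>\<^bsub>K\<^esub> f)"
    if hom: "f \<in> Hom K X Y" "g \<in> Hom K Y Z" for c f g X Y Z
  proof -
    obtain s t where s: "f = res X Y s" "inter X Y s" and t: "g = res Y Z t" "inter Y Z t"
      using hom by (auto elim!: Hom_KE)
    show "g \<cdot>\<^bsub>K\<^esub> SmultA K c f = SmultA K c (g \<cdot>\<^bsub>K\<^esub> f)"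
      unfolding s(1) t(1) res_SmultA [OF s(2)] res_Comp [OF s(2) t(2)] res_Comp [OF inter_SmultA [OF s(2)] t(2)]
        res_SmultA [OF inter_Comp [OF s(2) t(2)]] Comp_SmultA [OF interD(3) [OF s(2)] interD(3) [OF t(2)]] ..
    show "SmultA K c g \<cdot>\<^bsub>K\<^esub> f = SmultA K c (g \<cdot>\<^bsub>K\<^esub> f)"
      unfolding s(1) t(1) res_SmultA [OF t(2)] res_Comp [OF s(2) t(2)] res_Comp [OF s(2) inter_SmultA [OF t(2)]]
        res_SmultA [OF inter_Comp [OF s(2) t(2)]] SmultA_Comp [OF interD(3) [OF s(2)] interD(3) [OF t(2)]] ..
  qed
qed

sublocale K: symmetric_monoidal_category K
proof
  show "TenO K X Y \<in> Obj K" if "X \<in> Obj K" "Y \<in> Obj K" for X Y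
    using that by (simp add: K_simps KT_KO)
  show "TenA K f g \<in> Hom K (TenO K X X') (TenO K Y Y')" if "f \<in> Hom K X Y" "g \<in> Hom K X' Y'" for f g X X' Y Y'
    using that by (auto elim!: Hom_KE simp: K_simps res_TenA inter_TenA res_Hom)
  show "TenA K (Idn K X) (Idn K Y) = Idn K (TenO K X Y)" if "X \<in> Obj K" "Y \<in> Obj K" for X Y
    using that by (simp add: K_simps res_Idn res_TenA inter_Idn TenA_Idn KO_D KT_KO)
  show "TenA K (g \<cdot>\<^bsub>K\<^esub> f) (g' \<cdot>\<^bsub>K\<^esub> f') = TenA K g g' \<cdot>\<^bsub>K\<^esub> TenA K f f'"
    if hom: "f \<in> Hom K X Y" "g \<in> Hom K Y Z" "f' \<in> Hom K X' Y'" "g' \<in> Hom K Y' Z'" for f g f' g' X Y Z X' Y' Z'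
  proof -
    obtain s t s' t' where s: "f = res X Y s" "inter X Y s" and t: "g = res Y Z t" "inter Y Z t"
      and s': "f' = res X' Y' s'" "inter X' Y' s'" and t': "g' = res Y' Z' t'" "inter Y' Z' t'"
      using hom by (auto elim!: Hom_KE)
    show ?thesis unfolding s(1) t(1) s'(1) t'(1) res_Comp [OF s(2) t(2)] res_Comp [OF s'(2) t'(2)]
      res_TenA [OF inter_Comp [OF s(2) t(2)] inter_Comp [OF s'(2) t'(2)]] res_TenA [OF s(2) s'(2)] res_TenA [OF t(2) t'(2)]
      res_Comp [OF inter_TenA [OF s(2) s'(2)] inter_TenA [OF t(2) t'(2)]]
      TenA_Comp [OF interD(3) [OF s(2)] interD(3) [OF t(2)] interD(3) [OF s'(2)] interD(3) [OF t'(2)]] ..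
  qed
  show "UnitO K \<in> Obj K" by (simp add: K_simps KU_KO)
  show "Assoc K X Y Z \<in> Hom K (TenO K (TenO K X Y) Z) (TenO K X (TenO K Y Z))" "iso_arr K (Assoc K X Y Z)"
    if "X \<in> Obj K" "Y \<in> Obj K" "Z \<in> Obj K" for X Y Z
    using that by (simp_all add: K_simps res_structure res_Hom inter_Assoc res_iso Assoc_iso KO_D)
  show "LUnit K X \<in> Hom K (TenO K (UnitO K) X) X" "iso_arr K (LUnit K X)"
    "RUnit K X \<in> Hom K (TenO K X (UnitO K)) X" "iso_arr K (RUnit K X)" if "X \<in> Obj K" for X
    using that by (simp_all add: K_simps res_structure res_Hom inter_LUnit inter_RUnit res_iso LUnit_iso RUnit_iso KO_D)
  show "Assoc K X' Y' Z' \<cdot>\<^bsub>K\<^esub> TenA K (TenA K f g) h = TenA K f (TenA K g h) \<cdot>\<^bsub>K\<^esub> Assoc K X Y Z"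
    if hom: "f \<in> Hom K X X'" "g \<in> Hom K Y Y'" "h \<in> Hom K Z Z'" for f g h X Y Z X' Y' Z'
  proof -
    obtain s t u where s: "f = res X X' s" "inter X X' s" and t: "g = res Y Y' t" "inter Y Y' t" and u: "h = res Z Z' u" "inter Z Z' u"
      using hom by (auto elim!: Hom_KE)
    note a = inter_Assoc [OF interD(1) [OF s(2)] interD(1) [OF t(2)] interD(1) [OF u(2)]]
    note b = inter_Assoc [OF interD(2) [OF s(2)] interD(2) [OF t(2)] interD(2) [OF u(2)]]
    note st = inter_TenA [OF s(2) t(2)] and tu = inter_TenA [OF t(2) u(2)]
    show ?thesis unfolding s(1) t(1) u(1) res_structure res_TenA [OF s(2) t(2)] res_TenA [OF t(2) u(2)] res_TenA [OF st u(2)]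
      res_TenA [OF s(2) tu] res_Comp [OF inter_TenA [OF st u(2)] b] res_Comp [OF a inter_TenA [OF s(2) tu]]
      Assoc_natural [OF interD(3) [OF s(2)] interD(3) [OF t(2)] interD(3) [OF u(2)]] ..
  qed
  show "LUnit K Y \<cdot>\<^bsub>K\<^esub> TenA K (Idn K (UnitO K)) f = f \<cdot>\<^bsub>K\<^esub> LUnit K X"
    "RUnit K Y \<cdot>\<^bsub>K\<^esub> TenA K f (Idn K (UnitO K)) = f \<cdot>\<^bsub>K\<^esub> RUnit K X" if hom: "f \<in> Hom K X Y" for f X Y
  proof -
    obtain s where s: "f = res X Y s" "inter X Y s" using hom by (auto elim!: Hom_KE)
    note X = interD(1) [OF s(2)] and Y = interD(2) [OF s(2)] and U = inter_Idn [OF KU_KO]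
    show "LUnit K Y \<cdot>\<^bsub>K\<^esub> TenA K (Idn K (UnitO K)) f = f \<cdot>\<^bsub>K\<^esub> LUnit K X"
      unfolding s(1) K_simps res_Idn [OF KU_KO] res_structure res_TenA [OF U s(2)] res_Comp [OF inter_LUnit [OF X] s(2)]
        res_Comp [OF inter_TenA [OF U s(2)] inter_LUnit [OF Y]] using LUnit_natural [OF interD(3) [OF s(2)]] by simp
    show "RUnit K Y \<cdot>\<^bsub>K\<^esub> TenA K f (Idn K (UnitO K)) = f \<cdot>\<^bsub>K\<^esub> RUnit K X"
      unfolding s(1) K_simps res_Idn [OF KU_KO] res_structure res_TenA [OF s(2) U] res_Comp [OF inter_RUnit [OF X] s(2)]
        res_Comp [OF inter_TenA [OF s(2) U] inter_RUnit [OF Y]] using RUnit_natural [OF interD(3) [OF s(2)]] by simp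
  qed
  show "Braid K X Y \<in> Hom K (TenO K X Y) (TenO K Y X)" "Braid K Y X \<cdot>\<^bsub>K\<^esub> Braid K X Y = Idn K (TenO K X Y)"
    if "X \<in> Obj K" "Y \<in> Obj K" for X Y
    using that by (simp_all add: K_simps res_structure res_Hom inter_Braid res_Comp [OF inter_Braid inter_Braid] Braid_symmetric KO_D res_Idn KT_KO)
  show "Braid K X' Y' \<cdot>\<^bsub>K\<^esub> TenA K f g = TenA K g f \<cdot>\<^bsub>K\<^esub> Braid K X Y"
    if hom: "f \<in> Hom K X X'" "g \<in> Hom K Y Y'" for f g X X' Y Y'
  proof -
    obtain s t where s: "f = res X X' s" "inter X X' s" and t: "g = res Y Y' t" "inter Y Y' t"
      using hom by (auto elim!: Hom_KE)
    note a = inter_Braid [OF interD(1) [OF s(2)] interD(1) [OF t(2)]] and b = inter_Braid [OF interD(2) [OF s(2)] interD(2) [OF t(2)]]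
    show ?thesis unfolding s(1) t(1) res_structure res_TenA [OF s(2) t(2)] res_TenA [OF t(2) s(2)]
      res_Comp [OF inter_TenA [OF s(2) t(2)] b] res_Comp [OF a inter_TenA [OF t(2) s(2)]]
      Braid_natural [OF interD(3) [OF s(2)] interD(3) [OF t(2)]] ..
  qed
  show "TenA K (Idn K W) (Assoc K X Y Z) \<cdot>\<^bsub>K\<^esub> Assoc K W (TenO K X Y) Z \<cdot>\<^bsub>K\<^esub> TenA K (Assoc K W X Y) (Idn K Z)
      = Assoc K W X (TenO K Y Z) \<cdot>\<^bsub>K\<^esub> Assoc K (TenO K W X) Y Z"
    if "W \<in> Obj K" "X \<in> Obj K" "Y \<in> Obj K" "Z \<in> Obj K" for W X Y Z
  proof -
    have O: "W \<in> KO" "X \<in> KO" "Y \<in> KO" "Z \<in> KO" using that by (simp_all add: K_simps)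
    note 1 = inter_TenA [OF inter_Idn [OF O(1)] inter_Assoc [OF O(2-4)]]
    note 2 = inter_Assoc [OF O(1) KT_KO [OF O(2,3)] O(4)]
    note 3 = inter_TenA [OF inter_Assoc [OF O(1-3)] inter_Idn [OF O(4)]]
    note 4 = inter_Assoc [OF O(1,2) KT_KO [OF O(3,4)]] and 5 = inter_Assoc [OF KT_KO [OF O(1,2)] O(3,4)]
    show ?thesis unfolding K_simps res_structure res_Idn [OF O(1)] res_Idn [OF O(4)]
        res_TenA [OF inter_Idn [OF O(1)] inter_Assoc [OF O(2-4)]] res_TenA [OF inter_Assoc [OF O(1-3)] inter_Idn [OF O(4)]]
        res_Comp [OF 2 1] res_Comp [OF 3 inter_Comp [OF 2 1]] res_Comp [OF 5 4]
      using pentagon [OF KO_D(1) [OF O(1)] KO_D(1) [OF O(2)] KO_D(1) [OF O(3)] KO_D(1) [OF O(4)]] by simp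
  qed
  show "TenA K (Idn K X) (LUnit K Y) \<cdot>\<^bsub>K\<^esub> Assoc K X (UnitO K) Y = TenA K (RUnit K X) (Idn K Y)"
    if "X \<in> Obj K" "Y \<in> Obj K" for X Y
  proof -
    have O: "X \<in> KO" "Y \<in> KO" using that by (simp_all add: K_simps)
    show ?thesis unfolding K_simps res_structure res_Idn [OF O(1)] res_Idn [OF O(2)]
        res_TenA [OF inter_Idn [OF O(1)] inter_LUnit [OF O(2)]] res_TenA [OF inter_RUnit [OF O(1)] inter_Idn [OF O(2)]]
        res_Comp [OF inter_Assoc [OF O(1) KU_KO O(2)] inter_TenA [OF inter_Idn [OF O(1)] inter_LUnit [OF O(2)]]]
      using triangle [OF KO_D(1) [OF O(1)] KO_D(1) [OF O(2)]] by simp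
  qed
  show "Assoc K Y Z X \<cdot>\<^bsub>K\<^esub> Braid K X (TenO K Y Z) \<cdot>\<^bsub>K\<^esub> Assoc K X Y Z
      = TenA K (Idn K Y) (Braid K X Z) \<cdot>\<^bsub>K\<^esub> Assoc K Y X Z \<cdot>\<^bsub>K\<^esub> TenA K (Braid K X Y) (Idn K Z)"
    if "X \<in> Obj K" "Y \<in> Obj K" "Z \<in> Obj K" for X Y Z
  proof -
    have O: "X \<in> KO" "Y \<in> KO" "Z \<in> KO" using that by (simp_all add: K_simps)
    note 1 = inter_Assoc [OF O(2,3,1)] and 2 = inter_Braid [OF O(1) KT_KO [OF O(2,3)]] and 3 = inter_Assoc [OF O]
    note 4 = inter_TenA [OF inter_Idn [OF O(2)] inter_Braid [OF O(1,3)]] and 5 = inter_Assoc [OF O(2,1,3)]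
      and 6 = inter_TenA [OF inter_Braid [OF O(1,2)] inter_Idn [OF O(3)]]
    show ?thesis unfolding K_simps res_structure res_Idn [OF O(2)] res_Idn [OF O(3)]
        res_TenA [OF inter_Idn [OF O(2)] inter_Braid [OF O(1,3)]] res_TenA [OF inter_Braid [OF O(1,2)] inter_Idn [OF O(3)]]
        res_Comp [OF 2 1] res_Comp [OF 3 inter_Comp [OF 2 1]] res_Comp [OF 5 4] res_Comp [OF 6 inter_Comp [OF 5 4]]
      using hexagon [OF KO_D(1) [OF O(1)] KO_D(1) [OF O(2)] KO_D(1) [OF O(3)]] by simp
  qed
qed

end

section \<open>Functoriality of the completions\<close>

text \<open>The two notions of functor from the final statement, over categories with bilinear
  tensor product. The additive completion of such a functor is again of this kind, so that the
  Karoubi step can be applied to it.\<close>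

locale linear_symmetric_monoidal_functor =
  symmetric_monoidal_functor C D Fo Fa \<mu> \<eta> + linear_functor C D Fo Fa +
  C: linear_symmetric_monoidal_category C + D: linear_symmetric_monoidal_category D
  for C :: "('o1, 'a1, 'k::field) lsmcat" and D :: "('o2, 'a2, 'k) lsmcat"
    and Fo :: "'o1 \<Rightarrow> 'o2" and Fa :: "'a1 \<Rightarrow> 'a2" and \<mu> :: "'o1 \<Rightarrow> 'o1 \<Rightarrow> 'a2" and \<eta> :: 'a2

sublocale linear_symmetric_monoidal_functor \<subseteq> CA: additive_context C by unfold_locales
sublocale linear_symmetric_monoidal_functor \<subseteq> DA: additive_context D by unfold_locales

context linear_symmetric_monoidal_functor begin

lemma Fa_ZeroA:
  assumes "x \<in> Obj C" "y \<in> Obj C" shows "Fa (ZeroA C x y) = ZeroA D (Fo x) (Fo y)"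
proof -
  have z: "ZeroA C x y \<in> Hom C x y" using assms by (rule C.ZeroA_Hom)
  have "Fa (SmultA C 0 (ZeroA C x y)) = SmultA D 0 (Fa (ZeroA C x y))" by (rule Fa_SmultA [OF z])
  then show ?thesis using C.SmultA_zero [OF z] D.SmultA_zero [OF Fa_Hom [OF z]] by simp
qed

lemma Fa_hsum:
  assumes "x \<in> Obj C" "y \<in> Obj C" "\<And>k. k < n \<Longrightarrow> f k \<in> Hom C x y"
  shows "Fa (C.hsum x y n f) = D.hsum (Fo x) (Fo y) n (\<lambda>k. Fa (f k))"
  using assms(3)
proof (induct n)
  case (Suc n)
  have "D.hsum (Fo x) (Fo y) (Suc n) (\<lambda>k. Fa (f k)) = AddA D (D.hsum (Fo x) (Fo y) n (\<lambda>k. Fa (f k))) (Fa (f n))"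
    using Suc.prems by (intro D.hsum_Suc Fa_Hom)
  moreover have "Fa (C.hsum x y (Suc n) f) = AddA D (Fa (C.hsum x y n f)) (Fa (f n))"
    using Suc.prems Fa_AddA [of "C.hsum x y n f" x y "f n"]
    by (simp add: C.hsum_Suc C.hsum_Hom assms(1,2))
  ultimately show ?case using Suc by simp
qed (simp add: Fa_ZeroA assms)

abbreviation AF where "AF \<equiv> add_functor Fo Fa"

lemma AF_matrix:
  "AF (matrix_arrow xs ys m) = matrix_arrow (map Fo xs) (map Fo ys) (\<lambda>i j. Fa (m i j))"
  unfolding add_functor_def matrix_arrow_def by (simp, intro eq_matI) auto

lemma entries_map:
  "CA.entries xs ys m \<Longrightarrow> DA.entries (map Fo xs) (map Fo ys) (\<lambda>i j. Fa (m i j))"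
  unfolding CA.entries_def DA.entries_def by (auto intro: Fa_Hom)

lemma set_map_Obj: "set xs \<subseteq> Obj C \<Longrightarrow> set (map Fo xs) \<subseteq> Obj D"
  using Fo_Obj by auto

lemma mono_entries_map:
  "CA.mono_entries xs ys \<pi> f \<Longrightarrow> DA.mono_entries (map Fo xs) (map Fo ys) \<pi> (\<lambda>j. Fa (f j))"
  unfolding CA.mono_entries_def DA.mono_entries_def using set_map_Obj by (auto intro: Fa_Hom)

lemma AF_mono:
  assumes "CA.mono_entries xs ys \<pi> f"
  shows "AF (monomial_arrow C xs ys \<pi> f) = monomial_arrow D (map Fo xs) (map Fo ys) \<pi> (\<lambda>j. Fa (f j))"
  unfolding monomial_arrow_def AF_matrix DA.matrix_arrow_eq
  using assms by (auto simp: CA.mono_entries_def Fa_ZeroA CA.nth_Obj)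

text \<open>The counterpart of \<open>add_mu\<close> expressed through \<open>list_tensor\<close>,
  as the axioms require; the two are identified when the envelopes are assembled.\<close>

definition amu :: "'o1 list \<Rightarrow> 'o1 list \<Rightarrow> ('o2 list, 'a2 mat) arrow" where
  "amu xs ys = monomial_arrow D (list_tensor D (map Fo xs) (map Fo ys)) (map Fo (list_tensor C xs ys)) id
     (\<lambda>j. \<mu> (xs ! (j div length ys)) (ys ! (j mod length ys)))"

definition aeta :: "('o2 list, 'a2 mat) arrow" where
  "aeta = monomial_arrow D [UnitO D] [Fo (UnitO C)] id (\<lambda>_. \<eta>)"

lemma mono_entries_amu:
  assumes "set xs \<subseteq> Obj C" "set ys \<subseteq> Obj C"
  shows "DA.mono_entries (list_tensor D (map Fo xs) (map Fo ys)) (map Fo (list_tensor C xs ys)) id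
     (\<lambda>j. \<mu> (xs ! (j div length ys)) (ys ! (j mod length ys)))"
  unfolding DA.mono_entries_def
proof (intro conjI allI impI)
  show "set (list_tensor D (map Fo xs) (map Fo ys)) \<subseteq> Obj D"
    by (intro DA.list_tensor_Obj set_map_Obj assms)
  show "set (map Fo (list_tensor C xs ys)) \<subseteq> Obj D"
    by (intro CA.list_tensor_Obj set_map_Obj assms)
  fix j assume "j < length (list_tensor D (map Fo xs) (map Fo ys))"
  then have j: "j < length xs * length ys" by simp
  note d = less_mult_div_mod [OF j]
  show "id j < length (map Fo (list_tensor C xs ys))" using j by simp
  show "\<mu> (xs ! (j div length ys)) (ys ! (j mod length ys)) \<in> Hom D
    (list_tensor D (map Fo xs) (map Fo ys) ! j) (map Fo (list_tensor C xs ys) ! id j)"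
    using mu_Hom [of "xs ! (j div length ys)" "ys ! (j mod length ys)"] j d assms by (simp add: CA.nth_Obj)
qed

lemma mono_entries_aeta: "DA.mono_entries [UnitO D] [Fo (UnitO C)] id (\<lambda>_. \<eta>)"
  using eta_Hom by (simp add: DA.mono_entries_def D.UnitO_Obj Fo_Obj C.UnitO_Obj)

text \<open>Pairs are enumerated in the same order in source and target. The matrix is therefore
  diagonal, and the square reduces to naturality of \<open>\<mu>\<close> at each pair.\<close>

lemma amu_natural:
  assumes hom: "f \<in> Hom CA.A xs xs'" "g \<in> Hom CA.A ys ys'"
  shows "amu xs' ys' \<cdot>\<^bsub>DA.A\<^esub> TenA DA.A (AF f) (AF g) = AF (TenA CA.A f g) \<cdot>\<^bsub>DA.A\<^esub> amu xs ys"
proof -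
  obtain m where m: "f = matrix_arrow xs xs' m" "set xs \<subseteq> Obj C" "set xs' \<subseteq> Obj C" "CA.entries xs xs' m"
    using hom(1) by (rule CA.Hom_AE)
  obtain n where n: "g = matrix_arrow ys ys' n" "set ys \<subseteq> Obj C" "set ys' \<subseteq> Obj C" "CA.entries ys ys' n"
    using hom(2) by (rule CA.Hom_AE)
  show ?thesis unfolding m(1) n(1) AF_matrix DA.matrix_TenA CA.matrix_TenA amu_def
  proof (rule DA.mono_natural [OF DA.entries_TenA [OF entries_map [OF m(4)] entries_map [OF n(4)]]
      entries_map [OF CA.entries_TenA [OF m(4) n(4)]] mono_entries_amu [OF m(3) n(3)] mono_entries_amu [OF m(2) n(2)]])
    fix k j assume "k < length (list_tensor D (map Fo xs') (map Fo ys'))" "j < length (list_tensor D (map Fo xs) (map Fo ys))"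
    then have k: "k < length xs' * length ys'" and j: "j < length xs * length ys" by simp_all
    note d = less_mult_div_mod [OF k] less_mult_div_mod [OF j]
    show "\<mu> (xs' ! (k div length ys')) (ys' ! (k mod length ys')) \<cdot>\<^bsub>D\<^esub>
      TenA D (Fa (m (k div length (map Fo ys')) (j div length (map Fo ys)))) (Fa (n (k mod length (map Fo ys')) (j mod length (map Fo ys))))
     = Fa (TenA C (m (id k div length ys') (id j div length ys)) (n (id k mod length ys') (id j mod length ys))) \<cdot>\<^bsub>D\<^esub>
       \<mu> (xs ! (j div length ys)) (ys ! (j mod length ys))"
      using d m(4) n(4) by (auto simp: CA.entries_def intro!: mu_natural)
  qed simp
qed

text \<open>The six factors are monomial; the index maps agree up to quotient and remainder, and the
  entries agree by the associativity axiom for \<open>\<mu>\<close>.\<close>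

lemma amu_assoc:
  assumes X: "set xs \<subseteq> Obj C" and Y: "set ys \<subseteq> Obj C" and Z: "set zs \<subseteq> Obj C"
  shows "AF (Assoc CA.A xs ys zs) \<cdot>\<^bsub>DA.A\<^esub> amu (list_tensor C xs ys) zs \<cdot>\<^bsub>DA.A\<^esub> TenA DA.A (amu xs ys) (Idn DA.A (map Fo zs))
    = amu xs (list_tensor C ys zs) \<cdot>\<^bsub>DA.A\<^esub> TenA DA.A (Idn DA.A (map Fo xs)) (amu ys zs)
      \<cdot>\<^bsub>DA.A\<^esub> Assoc DA.A (map Fo xs) (map Fo ys) (map Fo zs)"
proof -
  note T = CA.list_tensor_Obj and M = set_map_Obj
  note 1 = mono_entries_map [OF CA.mono_entries_Assoc [OF X Y Z]] and 2 = mono_entries_amu [OF T [OF X Y] Z]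
    and 3 = DA.mono_entries_TenA [OF mono_entries_amu [OF X Y] DA.mono_entries_Idn [OF M [OF Z]]]
  note 4 = mono_entries_amu [OF X T [OF Y Z]] and 5 = DA.mono_entries_TenA [OF DA.mono_entries_Idn [OF M [OF X]] mono_entries_amu [OF Y Z]]
    and 6 = DA.mono_entries_Assoc [OF M [OF X] M [OF Y] M [OF Z]]
  show ?thesis
    unfolding DA.A_structure CA.A_structure amu_def AF_mono [OF CA.mono_entries_Assoc [OF X Y Z]]
      DA.mono_TenA [OF mono_entries_amu [OF X Y] DA.mono_entries_Idn [OF M [OF Z]]]
      DA.mono_TenA [OF DA.mono_entries_Idn [OF M [OF X]] mono_entries_amu [OF Y Z]]
      DA.mono_Comp [OF 2 1] DA.mono_Comp [OF 3 DA.mono_entries_Comp [OF 2 1]]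
      DA.mono_Comp [OF 5 4] DA.mono_Comp [OF 6 DA.mono_entries_Comp [OF 5 4]]
  proof (rule DA.mono_eqI, goal_cases)
    case (1 j)
    show ?case using div_mult_mod_eq [of j "length ys * length zs"] by simp
  next
    case (2 j)
    then have "j < length xs * length ys * length zs" by simp
    then obtain i a b where *: "i < length xs" "a < length ys" "b < length zs" "j = (i * length ys + a) * length zs + b"
      by (rule CA.list_tensor_index)
    have lt: "a * length zs + b < length ys * length zs" "i * length ys + a < length xs * length ys"
      using mult_add_less [OF *(3,2)] mult_add_less [OF *(2,1)] by simp_all
    have "(i * length ys + a) * length zs + b = i * (length ys * length zs) + (a * length zs + b)" by (simp add: algebra_simps)
    then have e: "i * (length ys * length zs) + (a * length zs + b) = (i * length ys + a) * length zs + b" by simp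
    have "Fa (Assoc C (xs ! i) (ys ! a) (zs ! b)) \<cdot>\<^bsub>D\<^esub> \<mu> (TenO C (xs ! i) (ys ! a)) (zs ! b) \<cdot>\<^bsub>D\<^esub> TenA D (\<mu> (xs ! i) (ys ! a)) (Idn D (Fo (zs ! b)))
      = \<mu> (xs ! i) (TenO C (ys ! a) (zs ! b)) \<cdot>\<^bsub>D\<^esub> TenA D (Idn D (Fo (xs ! i))) (\<mu> (ys ! a) (zs ! b)) \<cdot>\<^bsub>D\<^esub> Assoc D (Fo (xs ! i)) (Fo (ys ! a)) (Fo (zs ! b))"
      by (rule mu_assoc) (use X Y Z * CA.nth_Obj in auto)
    then show ?case using *(1-3) lt unfolding *(4) by (simp add: e)
  qed
qed

lemma amu_unit:
  assumes X: "set xs \<subseteq> Obj C"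
  shows "AF (LUnit CA.A xs) \<cdot>\<^bsub>DA.A\<^esub> amu [UnitO C] xs \<cdot>\<^bsub>DA.A\<^esub> TenA DA.A aeta (Idn DA.A (map Fo xs)) = LUnit DA.A (map Fo xs)"
    "AF (RUnit CA.A xs) \<cdot>\<^bsub>DA.A\<^esub> amu xs [UnitO C] \<cdot>\<^bsub>DA.A\<^esub> TenA DA.A (Idn DA.A (map Fo xs)) aeta = RUnit DA.A (map Fo xs)"
proof -
  have U: "set [UnitO C] \<subseteq> Obj C" by (simp add: C.UnitO_Obj)
  note M = DA.mono_entries_Idn [OF set_map_Obj [OF X]]
  note 1 = mono_entries_map [OF CA.mono_entries_LUnit [OF X]] and 2 = mono_entries_amu [OF U X]
    and 3 = DA.mono_entries_TenA [OF mono_entries_aeta M]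
  \<comment> \<open>\<open>[Fo (UnitO C)]\<close> and \<open>map Fo [UnitO C]\<close> are equal but
    not the same term; restating the typing lets the rule for composing monomial matrices
    match.\<close>
  have 4: "DA.mono_entries (list_tensor D [UnitO D] (map Fo xs)) (list_tensor D (map Fo [UnitO C]) (map Fo xs))
     (\<lambda>j. id (j div length (map Fo xs)) * length (map Fo xs) + id (j mod length (map Fo xs)))
     (\<lambda>j. TenA D \<eta> (Idn D (map Fo xs ! (j mod length (map Fo xs)))))" using 3 by simp
  note 5 = mono_entries_map [OF CA.mono_entries_RUnit [OF X]] and 6 = mono_entries_amu [OF X U]
    and 7 = DA.mono_entries_TenA [OF M mono_entries_aeta]
  have 8: "DA.mono_entries (list_tensor D (map Fo xs) [UnitO D]) (list_tensor D (map Fo xs) (map Fo [UnitO C]))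
     (\<lambda>j. id (j div length [UnitO D]) * length [Fo (UnitO C)] + id (j mod length [UnitO D]))
     (\<lambda>j. TenA D (Idn D (map Fo xs ! (j div length [UnitO D]))) \<eta>)" using 7 by simp
  have "AF (LUnit CA.A xs) \<cdot>\<^bsub>DA.A\<^esub> amu [UnitO C] xs \<cdot>\<^bsub>DA.A\<^esub> TenA DA.A aeta (Idn DA.A (map Fo xs))
    = monomial_arrow D (map Fo (list_tensor C [UnitO C] xs)) (map Fo xs) id (\<lambda>j. Fa (LUnit C (xs ! j))) \<cdot>\<^bsub>DA.A\<^esub>
      monomial_arrow D (list_tensor D (map Fo [UnitO C]) (map Fo xs)) (map Fo (list_tensor C [UnitO C] xs)) id
        (\<lambda>j. \<mu> ([UnitO C] ! (j div length xs)) (xs ! (j mod length xs))) \<cdot>\<^bsub>DA.A\<^esub>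
      monomial_arrow D (list_tensor D [UnitO D] (map Fo xs)) (list_tensor D (map Fo [UnitO C]) (map Fo xs))
       (\<lambda>j. id (j div length (map Fo xs)) * length (map Fo xs) + id (j mod length (map Fo xs)))
       (\<lambda>j. TenA D \<eta> (Idn D (map Fo xs ! (j mod length (map Fo xs)))))"
    unfolding DA.A_structure CA.A_structure amu_def aeta_def AF_mono [OF CA.mono_entries_LUnit [OF X]]
      DA.mono_TenA [OF mono_entries_aeta M] by simp
  also have "\<dots> = LUnit DA.A (map Fo xs)"
    unfolding DA.mono_Comp [OF 2 1] DA.mono_Comp [OF 4 DA.mono_entries_Comp [OF 2 1]] DA.A_structure
  proof (rule DA.mono_eqI, goal_cases)
    case (2 j)
    then have j: "j < length xs" by simp
    then show ?case using mu_lunit [OF CA.nth_Obj [OF X j]] by simp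
  qed simp
  finally show "AF (LUnit CA.A xs) \<cdot>\<^bsub>DA.A\<^esub> amu [UnitO C] xs \<cdot>\<^bsub>DA.A\<^esub> TenA DA.A aeta (Idn DA.A (map Fo xs)) = LUnit DA.A (map Fo xs)" .
  have "AF (RUnit CA.A xs) \<cdot>\<^bsub>DA.A\<^esub> amu xs [UnitO C] \<cdot>\<^bsub>DA.A\<^esub> TenA DA.A (Idn DA.A (map Fo xs)) aeta
    = monomial_arrow D (map Fo (list_tensor C xs [UnitO C])) (map Fo xs) id (\<lambda>j. Fa (RUnit C (xs ! j))) \<cdot>\<^bsub>DA.A\<^esub>
      monomial_arrow D (list_tensor D (map Fo xs) (map Fo [UnitO C])) (map Fo (list_tensor C xs [UnitO C])) id
        (\<lambda>j. \<mu> (xs ! (j div length [UnitO C])) ([UnitO C] ! (j mod length [UnitO C]))) \<cdot>\<^bsub>DA.A\<^esub>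
      monomial_arrow D (list_tensor D (map Fo xs) [UnitO D]) (list_tensor D (map Fo xs) (map Fo [UnitO C]))
       (\<lambda>j. id (j div length [UnitO D]) * length [Fo (UnitO C)] + id (j mod length [UnitO D]))
       (\<lambda>j. TenA D (Idn D (map Fo xs ! (j div length [UnitO D]))) \<eta>)"
    unfolding DA.A_structure CA.A_structure amu_def aeta_def AF_mono [OF CA.mono_entries_RUnit [OF X]]
      DA.mono_TenA [OF M mono_entries_aeta] by simp
  also have "\<dots> = RUnit DA.A (map Fo xs)"
    unfolding DA.mono_Comp [OF 6 5] DA.mono_Comp [OF 8 DA.mono_entries_Comp [OF 6 5]] DA.A_structure
  proof (rule DA.mono_eqI, goal_cases)
    case (2 j)
    then have j: "j < length xs" by simp
    then show ?case using mu_runit [OF CA.nth_Obj [OF X j]] by simp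
  qed simp
  finally show "AF (RUnit CA.A xs) \<cdot>\<^bsub>DA.A\<^esub> amu xs [UnitO C] \<cdot>\<^bsub>DA.A\<^esub> TenA DA.A (Idn DA.A (map Fo xs)) aeta = RUnit DA.A (map Fo xs)" .
qed

lemma amu_braid:
  assumes X: "set xs \<subseteq> Obj C" and Y: "set ys \<subseteq> Obj C"
  shows "AF (Braid CA.A xs ys) \<cdot>\<^bsub>DA.A\<^esub> amu xs ys = amu ys xs \<cdot>\<^bsub>DA.A\<^esub> Braid DA.A (map Fo xs) (map Fo ys)"
  unfolding DA.A_structure CA.A_structure amu_def AF_mono [OF CA.mono_entries_Braid [OF X Y]]
    DA.mono_Comp [OF mono_entries_amu [OF X Y] mono_entries_map [OF CA.mono_entries_Braid [OF X Y]]]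
    DA.mono_Comp [OF DA.mono_entries_Braid [OF set_map_Obj [OF X] set_map_Obj [OF Y]] mono_entries_amu [OF Y X]]
proof (rule DA.mono_eqI, goal_cases)
  case (1 j)
  then show ?case by simp
next
  case (2 j)
  then have j: "j < length xs * length ys" by simp
  note d = less_mult_div_mod [OF j]
  show ?case using mu_braid [OF CA.nth_Obj [OF X d(1)] CA.nth_Obj [OF Y d(2)]] d by simp
qed

lemma additive_functor:
  "linear_symmetric_monoidal_functor CA.A DA.A (map Fo) AF amu aeta"
proof unfold_locales
  show "map Fo xs \<in> Obj DA.A" if "xs \<in> Obj CA.A" for xs
    using that set_map_Obj by (simp add: CA.A_simps DA.A_simps)
  show "AF f \<in> Hom DA.A (map Fo xs) (map Fo ys)" if "f \<in> Hom CA.A xs ys" for f xs ys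
    using that by (rule CA.Hom_AE) (simp add: AF_matrix DA.matrix_Hom entries_map set_map_Obj del: set_map)
  show "AF (Idn CA.A xs) = Idn DA.A (map Fo xs)" if "xs \<in> Obj CA.A" for xs
  proof -
    have X: "set xs \<subseteq> Obj C" using that by (simp add: CA.A_simps)
    show ?thesis unfolding CA.A_structure DA.A_structure AF_mono [OF CA.mono_entries_Idn [OF X]]
      by (rule DA.mono_eqI) (simp_all add: Fa_Idn CA.nth_Obj [OF X])
  qed
  show "AF (g \<cdot>\<^bsub>CA.A\<^esub> f) = AF g \<cdot>\<^bsub>DA.A\<^esub> AF f" if hom: "f \<in> Hom CA.A xs ys" "g \<in> Hom CA.A ys zs" for f g xs ys zs
  proof -
    obtain m where m: "f = matrix_arrow xs ys m" "set xs \<subseteq> Obj C" "set ys \<subseteq> Obj C" "CA.entries xs ys m"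
      using hom(1) by (rule CA.Hom_AE)
    obtain n where n: "g = matrix_arrow ys zs n" "set zs \<subseteq> Obj C" "CA.entries ys zs n"
      using hom(2) by (rule CA.Hom_AE)
    show ?thesis unfolding m(1) n(1) CA.matrix_Comp AF_matrix DA.matrix_Comp DA.matrix_arrow_eq
    proof (intro allI impI)
      fix i j assume "i < length (map Fo zs)" "j < length (map Fo xs)"
      then have i: "i < length zs" and j: "j < length xs" by simp_all
      have "Fa (C.hsum (xs ! j) (zs ! i) (length ys) (\<lambda>k. n i k \<cdot>\<^bsub>C\<^esub> m k j))
        = D.hsum (Fo (xs ! j)) (Fo (zs ! i)) (length ys) (\<lambda>k. Fa (n i k \<cdot>\<^bsub>C\<^esub> m k j))"
      proof (rule Fa_hsum)
        show "n i k \<cdot>\<^bsub>C\<^esub> m k j \<in> Hom C (xs ! j) (zs ! i)" if "k < length ys" for k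
          using m(4) n(3) i j that unfolding CA.entries_def by (blast intro: C.Comp_Hom)
      qed (use m n i j CA.nth_Obj in auto)
      also have "\<dots> = D.hsum (Fo (xs ! j)) (Fo (zs ! i)) (length ys) (\<lambda>k. Fa (n i k) \<cdot>\<^bsub>D\<^esub> Fa (m k j))"
        using m(4) n(3) i j unfolding CA.entries_def by (intro D.hsum_cong Fa_Comp) auto
      finally show "Fa (C.hsum (xs ! j) (zs ! i) (length ys) (\<lambda>k. n i k \<cdot>\<^bsub>C\<^esub> m k j))
        = D.hsum (map Fo xs ! j) (map Fo zs ! i) (length (map Fo ys)) (\<lambda>k. Fa (n i k) \<cdot>\<^bsub>D\<^esub> Fa (m k j))"
        using i j by simp
    qed
  qed
  show "amu xs ys \<in> Hom DA.A (TenO DA.A (map Fo xs) (map Fo ys)) (map Fo (TenO CA.A xs ys))" "iso_arr DA.A (amu xs ys)"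
    if "xs \<in> Obj CA.A" "ys \<in> Obj CA.A" for xs ys
  proof -
    have O: "set xs \<subseteq> Obj C" "set ys \<subseteq> Obj C" using that by (simp_all add: CA.A_simps)
    show "amu xs ys \<in> Hom DA.A (TenO DA.A (map Fo xs) (map Fo ys)) (map Fo (TenO CA.A xs ys))"
      unfolding CA.A_simps DA.A_simps amu_def by (rule DA.mono_Hom [OF mono_entries_amu [OF O]])
    show "iso_arr DA.A (amu xs ys)" unfolding amu_def
    proof (rule DA.mono_id_iso [OF mono_entries_amu [OF O]])
      fix j assume "j < length (list_tensor D (map Fo xs) (map Fo ys))"
      then have "j < length xs * length ys" by simp
      from less_mult_div_mod [OF this] show "iso_arr D (\<mu> (xs ! (j div length ys)) (ys ! (j mod length ys)))"
        using O by (intro mu_iso CA.nth_Obj)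
    qed simp
  qed
  show "amu xs' ys' \<cdot>\<^bsub>DA.A\<^esub> TenA DA.A (AF f) (AF g) = AF (TenA CA.A f g) \<cdot>\<^bsub>DA.A\<^esub> amu xs ys"
    if "f \<in> Hom CA.A xs xs'" "g \<in> Hom CA.A ys ys'" for f g xs xs' ys ys'
    using that by (rule amu_natural)
  show "aeta \<in> Hom DA.A (UnitO DA.A) (map Fo (UnitO CA.A))" "iso_arr DA.A aeta"
    unfolding aeta_def using DA.mono_Hom [OF mono_entries_aeta] DA.mono_id_iso [OF mono_entries_aeta] eta_iso
    by (simp_all add: CA.A_simps DA.A_simps)
  show "AF (AddA CA.A f g) = AddA DA.A (AF f) (AF g)" if hom: "f \<in> Hom CA.A xs ys" "g \<in> Hom CA.A xs ys" for f g xs ys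
  proof -
    obtain m where m: "f = matrix_arrow xs ys m" "CA.entries xs ys m" using hom(1) by (rule CA.Hom_AE)
    obtain n where n: "g = matrix_arrow xs ys n" "CA.entries xs ys n" using hom(2) by (rule CA.Hom_AE)
    show ?thesis unfolding m(1) n(1) CA.matrix_AddA AF_matrix DA.matrix_AddA DA.matrix_arrow_eq
      using m(2) n(2) unfolding CA.entries_def by simp (blast intro: Fa_AddA)
  qed
  show "AF (SmultA CA.A c f) = SmultA DA.A c (AF f)" if hom: "f \<in> Hom CA.A xs ys" for c f xs ys
  proof -
    obtain m where m: "f = matrix_arrow xs ys m" "CA.entries xs ys m" using hom(1) by (rule CA.Hom_AE)
    show ?thesis unfolding m(1) CA.matrix_SmultA AF_matrix DA.matrix_SmultA DA.matrix_arrow_eq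
      using m(2) unfolding CA.entries_def by simp (blast intro: Fa_SmultA)
  qed
qed (simp_all add: CA.A_simps DA.A_simps amu_assoc amu_unit amu_braid)

end

sublocale linear_symmetric_monoidal_functor \<subseteq> CK: karoubi_context C by unfold_locales
sublocale linear_symmetric_monoidal_functor \<subseteq> DK: karoubi_context D by unfold_locales

section \<open>The Karoubi completion of a linear symmetric monoidal functor\<close>

context linear_symmetric_monoidal_functor begin

definition KFo :: "'o1 \<times> 'a1 \<Rightarrow> 'o2 \<times> 'a2" where
  "KFo X = (Fo (fst X), Fa (snd X))"

definition KFa :: "('o1 \<times> 'a1, 'a1) arrow \<Rightarrow> ('o2 \<times> 'a2, 'a2) arrow" where
  "KFa f = Arrow (KFo (arr_dom f)) (KFo (arr_cod f)) (Fa (arr_val f))"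

text \<open>The idempotents have to be composed in for this to be an arrow of the completion;
  \<open>Kmu_res\<close> shows that it is represented by \<open>\<mu>\<close> itself.\<close>

definition Kmu :: "'o1 \<times> 'a1 \<Rightarrow> 'o1 \<times> 'a1 \<Rightarrow> ('o2 \<times> 'a2, 'a2) arrow" where
  "Kmu X Y = Arrow (DK.KT (KFo X) (KFo Y)) (KFo (CK.KT X Y)) (\<mu> (fst X) (fst Y) \<cdot>\<^bsub>D\<^esub> TenA D (Fa (snd X)) (Fa (snd Y)))"

definition Keta :: "('o2 \<times> 'a2, 'a2) arrow" where
  "Keta = Arrow DK.KU (KFo CK.KU) \<eta>"

lemma KFo_simps [simp]: "fst (KFo X) = Fo (fst X)" "snd (KFo X) = Fa (snd X)"
  by (simp_all add: KFo_def)

lemma KFo_KO: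
  assumes "X \<in> CK.KO" shows "KFo X \<in> DK.KO"
proof -
  note X = CK.KO_D [OF assms]
  show ?thesis unfolding karoubi_obj_def KFo_def
    using Fo_Obj [OF X(1)] Fa_Hom [OF X(2)] Fa_Comp [OF X(2,2)] X(3) by simp
qed

lemma inter_KF:
  assumes "CK.inter X Y s" shows "DK.inter (KFo X) (KFo Y) (Fa s)"
proof -
  note s = CK.interD [OF assms]
  note X = CK.KO_D [OF s(1)] and Y = CK.KO_D [OF s(2)]
  show ?thesis unfolding DK.inter_def
    using KFo_KO s Fa_Hom [OF s(3)] Fa_Comp [OF X(2) s(3)] Fa_Comp [OF s(3) Y(2)] by simp
qed

lemma KFa_res:
  assumes "CK.inter X Y s" shows "KFa (CK.res X Y s) = DK.res (KFo X) (KFo Y) (Fa s)"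
proof -
  note s = CK.interD [OF assms]
  note X = CK.KO_D [OF s(1)]
  show ?thesis unfolding KFa_def CK.res_def DK.res_def using Fa_Comp [OF X(2) s(3)] by simp
qed

text \<open>The commutation condition is naturality of \<open>\<mu>\<close> at the two
  idempotents.\<close>

lemma inter_Kmu:
  assumes "X \<in> CK.KO" "Y \<in> CK.KO" shows "DK.inter (DK.KT (KFo X) (KFo Y)) (KFo (CK.KT X Y)) (\<mu> (fst X) (fst Y))"
proof -
  note X = CK.KO_D [OF assms(1)] and Y = CK.KO_D [OF assms(2)]
  show ?thesis unfolding DK.inter_def
    using DK.KT_KO [OF KFo_KO [OF assms(1)] KFo_KO [OF assms(2)]] KFo_KO [OF CK.KT_KO [OF assms]]
      mu_Hom [OF X(1) Y(1)] mu_natural [OF X(2) Y(2)] by simp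
qed

lemma Kmu_res: "Kmu X Y = DK.res (DK.KT (KFo X) (KFo Y)) (KFo (CK.KT X Y)) (\<mu> (fst X) (fst Y))"
  by (simp add: Kmu_def DK.res_def)

lemma inter_Keta: "DK.inter DK.KU (KFo CK.KU) \<eta>"
  using eta_Hom DK.KU_KO KFo_KO [OF CK.KU_KO] Fa_Idn [OF C.UnitO_Obj] D.Comp_Idn [OF eta_Hom] D.Idn_Comp [OF eta_Hom]
  by (simp add: DK.inter_def)

lemma Keta_res: "Keta = DK.res DK.KU (KFo CK.KU) \<eta>"
  using D.Comp_Idn [OF eta_Hom] by (simp add: Keta_def DK.res_def)

text \<open>By \<open>KFa_res\<close>, \<open>Kmu_res\<close> and \<open>Keta_res\<close> every
  arrow in question has a representative in the base categories, so each axiom becomes the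
  corresponding axiom of the given functor.\<close>

lemma karoubi_monoidal_functor:
  "symmetric_monoidal_functor CK.K DK.K KFo KFa Kmu Keta"
proof unfold_locales
  show "KFo X \<in> Obj DK.K" if "X \<in> Obj CK.K" for X
    using that by (simp add: CK.K_simps DK.K_simps KFo_KO)
  show "KFa f \<in> Hom DK.K (KFo X) (KFo Y)" if "f \<in> Hom CK.K X Y" for f X Y
    using that by (auto elim!: CK.Hom_KE simp: KFa_res intro!: DK.res_Hom inter_KF)
  show "KFa (Idn CK.K X) = Idn DK.K (KFo X)" if "X \<in> Obj CK.K" for X
    using that by (simp add: CK.K_simps CK.res_Idn DK.res_Idn KFa_res CK.inter_Idn KFo_KO Fa_Idn CK.KO_D)
  show "KFa (g \<cdot>\<^bsub>CK.K\<^esub> f) = KFa g \<cdot>\<^bsub>DK.K\<^esub> KFa f" if hom: "f \<in> Hom CK.K X Y" "g \<in> Hom CK.K Y Z" for f g X Y Z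
  proof -
    obtain s t where s: "f = CK.res X Y s" "CK.inter X Y s" and t: "g = CK.res Y Z t" "CK.inter Y Z t"
      using hom by (auto elim!: CK.Hom_KE)
    show ?thesis unfolding s(1) t(1) CK.res_Comp [OF s(2) t(2)] KFa_res [OF s(2)] KFa_res [OF t(2)]
        KFa_res [OF CK.inter_Comp [OF s(2) t(2)]] DK.res_Comp [OF inter_KF [OF s(2)] inter_KF [OF t(2)]]
        Fa_Comp [OF CK.interD(3) [OF s(2)] CK.interD(3) [OF t(2)]] ..
  qed
  show "Kmu X Y \<in> Hom DK.K (TenO DK.K (KFo X) (KFo Y)) (KFo (TenO CK.K X Y))" "iso_arr DK.K (Kmu X Y)"
    if "X \<in> Obj CK.K" "Y \<in> Obj CK.K" for X Y
    using that by (simp_all add: CK.K_simps DK.K_simps Kmu_res DK.res_Hom inter_Kmu DK.res_iso mu_iso CK.KO_D)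
  show "Kmu X' Y' \<cdot>\<^bsub>DK.K\<^esub> TenA DK.K (KFa f) (KFa g) = KFa (TenA CK.K f g) \<cdot>\<^bsub>DK.K\<^esub> Kmu X Y"
    if hom: "f \<in> Hom CK.K X X'" "g \<in> Hom CK.K Y Y'" for f g X X' Y Y'
  proof -
    obtain s t where s: "f = CK.res X X' s" "CK.inter X X' s" and t: "g = CK.res Y Y' t" "CK.inter Y Y' t"
      using hom by (auto elim!: CK.Hom_KE)
    note a = inter_Kmu [OF CK.interD(1) [OF s(2)] CK.interD(1) [OF t(2)]] and b = inter_Kmu [OF CK.interD(2) [OF s(2)] CK.interD(2) [OF t(2)]]
    show ?thesis unfolding s(1) t(1) CK.res_TenA [OF s(2) t(2)] KFa_res [OF s(2)] KFa_res [OF t(2)]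
        KFa_res [OF CK.inter_TenA [OF s(2) t(2)]] DK.res_TenA [OF inter_KF [OF s(2)] inter_KF [OF t(2)]] Kmu_res
        DK.res_Comp [OF DK.inter_TenA [OF inter_KF [OF s(2)] inter_KF [OF t(2)]] b]
        DK.res_Comp [OF a inter_KF [OF CK.inter_TenA [OF s(2) t(2)]]]
        mu_natural [OF CK.interD(3) [OF s(2)] CK.interD(3) [OF t(2)]] ..
  qed
  show "Keta \<in> Hom DK.K (UnitO DK.K) (KFo (UnitO CK.K))" "iso_arr DK.K Keta"
    by (simp_all add: CK.K_simps DK.K_simps Keta_res DK.res_Hom inter_Keta DK.res_iso eta_iso)
  show "KFa (Assoc CK.K X Y Z) \<cdot>\<^bsub>DK.K\<^esub> Kmu (TenO CK.K X Y) Z \<cdot>\<^bsub>DK.K\<^esub> TenA DK.K (Kmu X Y) (Idn DK.K (KFo Z))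
      = Kmu X (TenO CK.K Y Z) \<cdot>\<^bsub>DK.K\<^esub> TenA DK.K (Idn DK.K (KFo X)) (Kmu Y Z) \<cdot>\<^bsub>DK.K\<^esub> Assoc DK.K (KFo X) (KFo Y) (KFo Z)"
    if "X \<in> Obj CK.K" "Y \<in> Obj CK.K" "Z \<in> Obj CK.K" for X Y Z
  proof -
    have X: "X \<in> CK.KO" and Y: "Y \<in> CK.KO" and Z: "Z \<in> CK.KO" using that by (simp_all add: CK.K_simps)
    note 1 = inter_KF [OF CK.inter_Assoc [OF X Y Z]] and 2 = inter_Kmu [OF CK.KT_KO [OF X Y] Z]
      and 3 = DK.inter_TenA [OF inter_Kmu [OF X Y] DK.inter_Idn [OF KFo_KO [OF Z]]]
    note 4 = inter_Kmu [OF X CK.KT_KO [OF Y Z]] and 5 = DK.inter_TenA [OF DK.inter_Idn [OF KFo_KO [OF X]] inter_Kmu [OF Y Z]]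
      and 6 = DK.inter_Assoc [OF KFo_KO [OF X] KFo_KO [OF Y] KFo_KO [OF Z]]
    show ?thesis unfolding CK.K_simps CK.res_structure DK.res_structure KFa_res [OF CK.inter_Assoc [OF X Y Z]] Kmu_res
        DK.res_Idn [OF KFo_KO [OF X]] DK.res_Idn [OF KFo_KO [OF Z]]
        DK.res_TenA [OF inter_Kmu [OF X Y] DK.inter_Idn [OF KFo_KO [OF Z]]]
        DK.res_TenA [OF DK.inter_Idn [OF KFo_KO [OF X]] inter_Kmu [OF Y Z]]
        DK.res_Comp [OF 2 1] DK.res_Comp [OF 3 DK.inter_Comp [OF 2 1]] DK.res_Comp [OF 5 4] DK.res_Comp [OF 6 DK.inter_Comp [OF 5 4]]
      using mu_assoc [OF CK.KO_D(1) [OF X] CK.KO_D(1) [OF Y] CK.KO_D(1) [OF Z]] by simp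
  qed
  show "KFa (LUnit CK.K X) \<cdot>\<^bsub>DK.K\<^esub> Kmu (UnitO CK.K) X \<cdot>\<^bsub>DK.K\<^esub> TenA DK.K Keta (Idn DK.K (KFo X)) = LUnit DK.K (KFo X)"
    "KFa (RUnit CK.K X) \<cdot>\<^bsub>DK.K\<^esub> Kmu X (UnitO CK.K) \<cdot>\<^bsub>DK.K\<^esub> TenA DK.K (Idn DK.K (KFo X)) Keta = RUnit DK.K (KFo X)"
    if "X \<in> Obj CK.K" for X
  proof -
    have X: "X \<in> CK.KO" using that by (simp add: CK.K_simps)
    note I = DK.inter_Idn [OF KFo_KO [OF X]]
    note 1 = inter_KF [OF CK.inter_LUnit [OF X]] and 2 = inter_Kmu [OF CK.KU_KO X] and 3 = DK.inter_TenA [OF inter_Keta I]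
    note 4 = inter_KF [OF CK.inter_RUnit [OF X]] and 5 = inter_Kmu [OF X CK.KU_KO] and 6 = DK.inter_TenA [OF I inter_Keta]
    show "KFa (LUnit CK.K X) \<cdot>\<^bsub>DK.K\<^esub> Kmu (UnitO CK.K) X \<cdot>\<^bsub>DK.K\<^esub> TenA DK.K Keta (Idn DK.K (KFo X)) = LUnit DK.K (KFo X)"
      unfolding CK.K_simps CK.res_structure DK.res_structure KFa_res [OF CK.inter_LUnit [OF X]] Kmu_res Keta_res
        DK.res_Idn [OF KFo_KO [OF X]] DK.res_TenA [OF inter_Keta I] DK.res_Comp [OF 2 1] DK.res_Comp [OF 3 DK.inter_Comp [OF 2 1]]
      using mu_lunit [OF CK.KO_D(1) [OF X]] by simp
    show "KFa (RUnit CK.K X) \<cdot>\<^bsub>DK.K\<^esub> Kmu X (UnitO CK.K) \<cdot>\<^bsub>DK.K\<^esub> TenA DK.K (Idn DK.K (KFo X)) Keta = RUnit DK.K (KFo X)"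
      unfolding CK.K_simps CK.res_structure DK.res_structure KFa_res [OF CK.inter_RUnit [OF X]] Kmu_res Keta_res
        DK.res_Idn [OF KFo_KO [OF X]] DK.res_TenA [OF I inter_Keta] DK.res_Comp [OF 5 4] DK.res_Comp [OF 6 DK.inter_Comp [OF 5 4]]
      using mu_runit [OF CK.KO_D(1) [OF X]] by simp
  qed
  show "KFa (Braid CK.K X Y) \<cdot>\<^bsub>DK.K\<^esub> Kmu X Y = Kmu Y X \<cdot>\<^bsub>DK.K\<^esub> Braid DK.K (KFo X) (KFo Y)"
    if "X \<in> Obj CK.K" "Y \<in> Obj CK.K" for X Y
  proof -
    have X: "X \<in> CK.KO" and Y: "Y \<in> CK.KO" using that by (simp_all add: CK.K_simps)
    show ?thesis unfolding CK.res_structure DK.res_structure KFa_res [OF CK.inter_Braid [OF X Y]] Kmu_res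
        DK.res_Comp [OF inter_Kmu [OF X Y] inter_KF [OF CK.inter_Braid [OF X Y]]]
        DK.res_Comp [OF DK.inter_Braid [OF KFo_KO [OF X] KFo_KO [OF Y]] inter_Kmu [OF Y X]]
      using mu_braid [OF CK.KO_D(1) [OF X] CK.KO_D(1) [OF Y]] by simp
  qed
qed

lemma karoubi_linear_functor:
  "linear_functor CK.K DK.K KFo KFa"
proof -
  interpret KF: symmetric_monoidal_functor CK.K DK.K KFo KFa Kmu Keta
    by (rule karoubi_monoidal_functor)
  show ?thesis
  proof unfold_locales
  show "KFa (AddA CK.K f g) = AddA DK.K (KFa f) (KFa g)" if hom: "f \<in> Hom CK.K X Y" "g \<in> Hom CK.K X Y" for f g X Y
    using hom by (auto elim!: CK.Hom_KE simp: CK.res_AddA KFa_res CK.inter_AddA DK.res_AddA inter_KF Fa_AddA [OF CK.interD(3) CK.interD(3)])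
  show "KFa (SmultA CK.K c f) = SmultA DK.K c (KFa f)" if hom: "f \<in> Hom CK.K X Y" for c f X Y
    using hom by (auto elim!: CK.Hom_KE simp: CK.res_SmultA KFa_res CK.inter_SmultA DK.res_SmultA inter_KF Fa_SmultA [OF CK.interD(3)])
  qed
qed

end

section \<open>The functor between categories of relations\<close>

context category begin

lemma inv_arr_unique:
  assumes "j \<cdot> i = Idn C (Dom C i)" "iso_arr C i" "j \<in> Arr C" "Dom C j = Cod C i"
  shows "inv_arr i = j"
proof -
  have "Cod C (j \<cdot> i) = Cod C j" using assms(2-4) by simp
  then have "Cod C j = Dom C i" using assms(1,2) by simp
  have "j = (j \<cdot> i) \<cdot> inv_arr i" using assms(2-4) by simp
  also have "\<dots> = inv_arr i" unfolding assms(1) using assms(2) by simp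
  finally show ?thesis by simp
qed

lemma inv_arr_Comp:
  assumes "iso_arr C i" "iso_arr C j" "Cod C j = Dom C i"
  shows "inv_arr (i \<cdot> j) = inv_arr j \<cdot> inv_arr i"
  by (rule inv_arr_unique) (use assms in \<open>simp_all add: iso_Comp\<close>)

lemma inv_arr_Idn: "x \<in> Obj C \<Longrightarrow> inv_arr (Idn C x) = Idn C x"
  by (rule inv_arr_unique) simp_all

text \<open>A commuting square with two invertible sides can be read backwards. Equations for the
  inverse comparison maps are obtained in this way from equations for the comparison maps.\<close>

lemma iso_square:
  assumes "f \<cdot> a = b \<cdot> g" "iso_arr C a" "iso_arr C b" "f \<in> Arr C" "g \<in> Arr C"
    "Dom C f = Cod C a" "Cod C g = Dom C b" "Dom C g = Dom C a"
  shows "g \<cdot> inv_arr a = inv_arr b \<cdot> f"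
proof -
  have "g \<cdot> inv_arr a = inv_arr b \<cdot> (b \<cdot> g) \<cdot> inv_arr a" using assms(2-) by simp
  also have "\<dots> = inv_arr b \<cdot> (f \<cdot> a) \<cdot> inv_arr a" by (simp only: assms(1))
  also have "\<dots> = inv_arr b \<cdot> f"
  proof -
    have "Cod C (f \<cdot> a) = Cod C (b \<cdot> g)" by (simp only: assms(1))
    then have "Cod C f = Cod C b" using assms(2-) by simp
    then show ?thesis using assms(2-) by simp
  qed
  finally show ?thesis .
qed

end

lemma (in cartesian_category) inv_prod_map:
  assumes "iso_arr C f" "iso_arr C g"
  shows "inv_arr (prod_map f g) = prod_map (inv_arr f) (inv_arr g)"
  by (rule inv_arr_unique) (use assms in \<open>simp_all add: prod_map_iso\<close>)

text \<open>The construction of the induced functor rests on these hypotheses alone; sets and vector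
  spaces enter only afterwards, when they are verified.\<close>

locale exact_degree_functor =
  degree_preserving_functor C \<delta> D \<delta>' Fo Fa + C: complete_degree_function C \<delta> + D: complete_degree_function D \<delta>'
  for C :: "('o1, 'a1, 'z1) category_scheme" and \<delta> :: "'a1 \<Rightarrow> 'k::field"
    and D :: "('o2, 'a2, 'z2) category_scheme" and \<delta>' :: "'a2 \<Rightarrow> 'k"
    and Fo :: "'o1 \<Rightarrow> 'o2" and Fa :: "'a1 \<Rightarrow> 'a2" +
  assumes pullbacks: "preserves_pullbacks C D Fa" and terminals: "preserves_terminal C D Fo"
begin

lemma Fa_simps [simp]:
  assumes "f \<in> Arr C"
  shows "Fa f \<in> Arr D" "Dom D (Fa f) = Fo (Dom C f)" "Cod D (Fa f) = Fo (Cod C f)"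
  using Fa_Hom [of f "Dom C f" "Cod C f"] assms by (simp_all add: Hom_iff)

declare Fo_Obj [simp] Fa_Idn [simp]

lemma Fa_Comp_simp:
  "\<lbrakk>f \<in> Arr C; g \<in> Arr C; Cod C f = Dom C g\<rbrakk> \<Longrightarrow> Fa (g \<cdot>\<^bsub>C\<^esub> f) = Fa g \<cdot>\<^bsub>D\<^esub> Fa f"
  by (rule Fa_Comp [of f "Dom C f" "Dom C g" g "Cod C g"]) (auto simp: Hom_iff)

lemma Fa_pullback: "is_pullback C f g p q \<Longrightarrow> is_pullback D (Fa f) (Fa g) (Fa p) (Fa q)"
  using pullbacks unfolding preserves_pullbacks_def by blast

text \<open>Monicity is a condition on a pullback square, by the kernel pair criterion.\<close>

lemma Fa_monic: "monic C m \<Longrightarrow> monic D (Fa m)"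
  using Fa_pullback [of m m "Idn C (Dom C m)" "Idn C (Dom C m)"] C.monic_iff_pullback [of m] D.monic_iff_pullback [of "Fa m"]
  by simp

text \<open>The comparison from the image of a product to the chosen product in the target.
  \<open>rel_mu\<close> is the converse of its graph, hence the graph of its inverse.\<close>

definition \<phi> :: "'o1 \<Rightarrow> 'o1 \<Rightarrow> 'a2" where
  "\<phi> x y = pair D (Fa (pr1 C x y)) (Fa (pr2 C x y))"

lemma \<phi>_simps [simp]:
  assumes "x \<in> Obj C" "y \<in> Obj C"
  shows "\<phi> x y \<in> Arr D" "Dom D (\<phi> x y) = Fo (prod_obj C x y)" "Cod D (\<phi> x y) = prod_obj D (Fo x) (Fo y)"
  using assms by (simp_all add: \<phi>_def)

text \<open>Products are pullbacks over the terminal object, and both are preserved.\<close>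

lemma \<phi>_iso [simp]:
  assumes "x \<in> Obj C" "y \<in> Obj C" shows "iso_arr D (\<phi> x y)"
proof -
  have "terminal D (Fo C.one)" using terminals C.terminal_one unfolding preserves_terminal_def by blast
  then have "is_product D (Fo x) (Fo y) (Fa (pr1 C x y)) (Fa (pr2 C x y))"
    using D.pullback_terminal_product [OF Fa_pullback [OF C.product_terminal_pullback [OF assms]]] assms by simp
  then show ?thesis unfolding \<phi>_def by (rule D.pair_monic_iso) (use assms in simp_all)
qed

lemma Fo_one_terminal: "iso_arr D (to_terminal D (Fo C.one))"
proof -
  have t: "terminal D (Fo C.one)" using terminals C.terminal_one unfolding preserves_terminal_def by blast
  then have "\<exists>f. f \<in> Hom D D.one (Fo C.one)" unfolding terminal_def using D.one_Obj by blast
  then obtain f where f: "f \<in> Arr D" "Dom D f = D.one" "Cod D f = Fo C.one" by (auto simp: Hom_iff)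
  have "f \<cdot>\<^bsub>D\<^esub> to_terminal D (Fo C.one) \<in> Hom D (Fo C.one) (Fo C.one)" "Idn D (Fo C.one) \<in> Hom D (Fo C.one) (Fo C.one)"
    using f by (simp_all add: Hom_iff)
  then have "f \<cdot>\<^bsub>D\<^esub> to_terminal D (Fo C.one) = Idn D (Fo C.one)"
    using t unfolding terminal_def by (metis C.one_Obj Fo_Obj)
  moreover have "to_terminal D (Fo C.one) \<cdot>\<^bsub>D\<^esub> f = Idn D D.one"
    by (rule D.one_unique) (use f in simp_all)
  ultimately show ?thesis by (intro D.iso_arrI [of f]) (use f in simp_all)
qed

lemma Fa_pr_pair [simp]:
  assumes "f \<in> Arr C" "g \<in> Arr C" "Dom C f = Dom C g" "x = Cod C f" "y = Cod C g"
  shows "Fa (pr1 C x y) \<cdot>\<^bsub>D\<^esub> Fa (pair C f g) = Fa f" "Fa (pr2 C x y) \<cdot>\<^bsub>D\<^esub> Fa (pair C f g) = Fa g"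
  using assms by (simp_all flip: Fa_Comp_simp)

lemma \<phi>_Comp [simp]:
  assumes "h \<in> Arr C" "Cod C h = prod_obj C x y" "x \<in> Obj C" "y \<in> Obj C"
  shows "\<phi> x y \<cdot>\<^bsub>D\<^esub> Fa h = pair D (Fa (pr1 C x y \<cdot>\<^bsub>C\<^esub> h)) (Fa (pr2 C x y \<cdot>\<^bsub>C\<^esub> h))"
  using assms by (simp add: \<phi>_def Fa_Comp_simp)

lemma \<phi>_natural:
  assumes "f \<in> Arr C" "g \<in> Arr C"
  shows "D.prod_map (Fa f) (Fa g) \<cdot>\<^bsub>D\<^esub> \<phi> (Dom C f) (Dom C g) = \<phi> (Cod C f) (Cod C g) \<cdot>\<^bsub>D\<^esub> Fa (C.prod_map f g)"
  using assms by (simp add: Fa_Comp_simp) (simp add: \<phi>_def)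

definition RF :: "'o1 \<Rightarrow> 'o1 \<Rightarrow> ('a1 set \<Rightarrow>\<^sub>0 'k) \<Rightarrow> ('a2 set \<Rightarrow>\<^sub>0 'k)" where
  "RF x y v = lin (\<lambda>r. Poly_Mapping.single (rel_map C D Fa x y r) 1) v"

lemma RF_linear [simp]: "RF x y 0 = 0" "RF x y (f + g) = RF x y f + RF x y g" "RF x y (scale c f) = scale c (RF x y f)"
  by (simp_all add: RF_def)

lemma rel_functor_RF: "rel_functor C D Fo Fa (Arrow x y v) = Arrow (Fo x) (Fo y) (RF x y v)"
  by (simp add: rel_functor_def RF_def lin_def)

text \<open>An image factorization is carried to an image factorization: the epi part stays epic
  with the same degree, and the mono part stays monic, also after composing with the invertible
  \<open>\<phi> x y\<close>. So subobject and weight are the expected ones.\<close>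

lemma RF_span:
  assumes "a \<in> Arr C" "b \<in> Arr C" "Dom C a = Dom C b" "Cod C a = x" "Cod C b = y"
  shows "RF x y (C.span a b) = D.span (Fa a) (Fa b)"
proof -
  have obj: "x \<in> Obj C" "y \<in> Obj C" using assms by auto
  obtain e m r where em: "epic C e" "monic C m" "Cod C e = Dom C m" "Cod C m = prod_obj C x y"
    "a = pr1 C x y \<cdot>\<^bsub>C\<^esub> (m \<cdot>\<^bsub>C\<^esub> e)" "b = pr2 C x y \<cdot>\<^bsub>C\<^esub> (m \<cdot>\<^bsub>C\<^esub> e)" "Dom C e = Dom C b"
    "r \<in> Sub C (prod_obj C x y)" "m = rep r" "C.span a b = scale (\<delta> e) (Poly_Mapping.single r 1)"
    using C.span_decompose [of a b] assms by metis
  let ?a = "pr1 C x y \<cdot>\<^bsub>C\<^esub> m" and ?b = "pr2 C x y \<cdot>\<^bsub>C\<^esub> m"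
  have ab: "a = ?a \<cdot>\<^bsub>C\<^esub> e" "b = ?b \<cdot>\<^bsub>C\<^esub> e" using em(5,6) em(1-4) obj by simp_all
  have "pair D (Fa ?a) (Fa ?b) = \<phi> x y \<cdot>\<^bsub>D\<^esub> Fa m" using em(2,4) obj by simp
  moreover have "monic D (\<phi> x y \<cdot>\<^bsub>D\<^esub> Fa m)"
    using em(2,4) obj by (intro D.monic_Comp D.iso_monic Fa_monic) simp_all
  ultimately have "D.span (Fa ?a) (Fa ?b) = Poly_Mapping.single (rel_map C D Fa x y r) 1"
    unfolding rel_map_def em(9) [symmetric] by (simp add: D.span_monic)
  moreover have "D.span (Fa a) (Fa b) = scale (\<delta>' (Fa e)) (D.span (Fa ?a) (Fa ?b))"
  proof -
    have "Fa a = Fa ?a \<cdot>\<^bsub>D\<^esub> Fa e" "Fa b = Fa ?b \<cdot>\<^bsub>D\<^esub> Fa e"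
      unfolding ab using em(1-4) obj by (simp_all add: Fa_Comp_simp)
    then show ?thesis using D.span_comp_epic [OF Fa_epic [OF em(1)], of "Fa ?a" "Fa ?b"] em(1-4) obj by simp
  qed
  ultimately show ?thesis unfolding em(10) by (simp add: RF_def Fa_degree [OF em(1)])
qed

lemma rel_RF:
  assumes "C.rel x y f" shows "D.rel (Fo x) (Fo y) (RF x y f)"
  using assms
proof (induct f rule: C.rel_induct)
  case zero
  then show ?case using C.rel_Obj [OF assms] by simp
next
  case (span a b)
  then show ?case by (subst RF_span) (auto intro!: D.rel_span)
qed (auto intro: D.rel_add D.rel_scale)

lemma RF_gr:
  assumes "f \<in> Arr C" "Dom C f = x" "Cod C f = y" shows "RF x y (C.gr f) = D.gr (Fa f)"
  unfolding C.gr_def D.gr_def by (subst RF_span) (use assms in auto)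

text \<open>On spans composition is a pullback, and pullbacks are preserved.\<close>

lemma RF_cmp:
  assumes "C.rel x y f" "C.rel y z g"
  shows "RF x z (C.cmp x y z g f) = D.cmp (Fo x) (Fo y) (Fo z) (RF y z g) (RF x y f)"
  using assms(1)
proof (induct f rule: C.rel_induct)
  case f: (span a b)
  show ?case using assms(2)
  proof (induct g rule: C.rel_induct)
    case g: (span c d)
    obtain p q where pb: "is_pullback C b c p q" using C.all_pullbacks [of b c] f g by auto
    note arr = C.pullback_arr [OF pb]
    have "RF x z (C.cmp x y z (C.span c d) (C.span a b)) = RF x z (C.span (a \<cdot>\<^bsub>C\<^esub> p) (d \<cdot>\<^bsub>C\<^esub> q))"
      by (subst C.cmp_span [OF pb]) (use f g in auto)
    also have "\<dots> = D.span (Fa a \<cdot>\<^bsub>D\<^esub> Fa p) (Fa d \<cdot>\<^bsub>D\<^esub> Fa q)"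
      by (subst RF_span) (use f g arr in \<open>auto simp: Fa_Comp_simp\<close>)
    also have "\<dots> = D.cmp (Fo x) (Fo y) (Fo z) (D.span (Fa c) (Fa d)) (D.span (Fa a) (Fa b))"
      by (rule D.cmp_span [OF Fa_pullback [OF pb], symmetric]) (use f g arr in auto)
    also have "\<dots> = D.cmp (Fo x) (Fo y) (Fo z) (RF y z (C.span c d)) (RF x y (C.span a b))"
      using f g by (simp add: RF_span)
    finally show ?case .
  qed simp_all
qed simp_all

lemma rel_mu_gr:
  assumes "x \<in> Obj C" "y \<in> Obj C"
  shows "rel_mu C D Fa x y = Arrow (prod_obj D (Fo x) (Fo y)) (Fo (prod_obj C x y)) (D.gr (D.inv_arr (\<phi> x y)))"
  using assms D.span_iso_gr [OF \<phi>_iso [OF assms]] unfolding rel_mu_def \<phi>_def [symmetric] by (simp add: D.cograph_span)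

lemma rel_eta_gr:
  "rel_eta C D Fo = Arrow D.one (Fo C.one) (D.gr (D.inv_arr (to_terminal D (Fo C.one))))"
  using D.span_iso_gr [OF Fo_one_terminal] unfolding rel_eta_def by (simp add: D.cograph_span)

text \<open>An instance of the general scheme for naturality, with the inverse comparison map at the
  apexes; the two squares it asks for are naturality of \<open>\<phi>\<close> read
  backwards.\<close>

lemma mu_gr_natural:
  assumes "C.rel x x' f" "C.rel y y' g"
  shows "D.cmp (prod_obj D (Fo x) (Fo y)) (prod_obj D (Fo x') (Fo y')) (Fo (prod_obj C x' y'))
      (D.gr (D.inv_arr (\<phi> x' y'))) (D.ten (Fo x) (Fo x') (Fo y) (Fo y') (RF x x' f) (RF y y' g))
    = D.cmp (prod_obj D (Fo x) (Fo y)) (Fo (prod_obj C x y)) (Fo (prod_obj C x' y'))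
      (RF (prod_obj C x y) (prod_obj C x' y') (C.ten x x' y y' f g)) (D.gr (D.inv_arr (\<phi> x y)))"
  using assms(1)
proof (induct f rule: C.rel_induct)
  case f: (span a a')
  show ?case using assms(2)
  proof (induct g rule: C.rel_induct)
    case g: (span b b')
    have nat: "Fa (C.prod_map a b) \<cdot>\<^bsub>D\<^esub> D.inv_arr (\<phi> (Dom C a) (Dom C b)) = D.inv_arr (\<phi> x y) \<cdot>\<^bsub>D\<^esub> D.prod_map (Fa a) (Fa b)"
      "Fa (C.prod_map a' b') \<cdot>\<^bsub>D\<^esub> D.inv_arr (\<phi> (Dom C a) (Dom C b)) = D.inv_arr (\<phi> x' y') \<cdot>\<^bsub>D\<^esub> D.prod_map (Fa a') (Fa b')"
    proof -
      have "x \<in> Obj C" "y \<in> Obj C" "x' \<in> Obj C" "y' \<in> Obj C" using f g by auto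
      then show "Fa (C.prod_map a b) \<cdot>\<^bsub>D\<^esub> D.inv_arr (\<phi> (Dom C a) (Dom C b)) = D.inv_arr (\<phi> x y) \<cdot>\<^bsub>D\<^esub> D.prod_map (Fa a) (Fa b)"
        "Fa (C.prod_map a' b') \<cdot>\<^bsub>D\<^esub> D.inv_arr (\<phi> (Dom C a) (Dom C b)) = D.inv_arr (\<phi> x' y') \<cdot>\<^bsub>D\<^esub> D.prod_map (Fa a') (Fa b')"
        using \<phi>_natural [of a b] \<phi>_natural [of a' b'] f g
        by (intro D.iso_square; simp del: \<phi>_Comp)+
    qed
    have obj: "x \<in> Obj C" "y \<in> Obj C" "x' \<in> Obj C" "y' \<in> Obj C" using f g by auto
    have "D.cmp (prod_obj D (Fo x) (Fo y)) (prod_obj D (Fo x') (Fo y')) (Fo (prod_obj C x' y'))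
        (D.gr (D.inv_arr (\<phi> x' y'))) (D.span (D.prod_map (Fa a) (Fa b)) (D.prod_map (Fa a') (Fa b')))
      = D.cmp (prod_obj D (Fo x) (Fo y)) (Fo (prod_obj C x y)) (Fo (prod_obj C x' y'))
        (D.span (Fa (C.prod_map a b)) (Fa (C.prod_map a' b'))) (D.gr (D.inv_arr (\<phi> x y)))"
      by (rule D.cmp_natural_iso [where k = "D.inv_arr (\<phi> (Dom C a) (Dom C b))"])
        (use f g nat obj in simp_all)
    then show ?case using f g by (simp add: RF_span C.ten_span D.ten_span)
  qed simp_all
qed simp_all

text \<open>For \<open>\<phi>\<close> itself the corresponding equation is an equality of tuples of
  images of projections. Inverting the two composite isomorphisms gives the stated form.\<close>

lemma mu_gr_assoc:
  assumes "x \<in> Obj C" "y \<in> Obj C" "z \<in> Obj C"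
  shows "Fa (C.assoc_arr x y z) \<cdot>\<^bsub>D\<^esub> (D.inv_arr (\<phi> (prod_obj C x y) z) \<cdot>\<^bsub>D\<^esub> D.prod_map (D.inv_arr (\<phi> x y)) (Idn D (Fo z)))
    = D.inv_arr (\<phi> x (prod_obj C y z)) \<cdot>\<^bsub>D\<^esub> (D.prod_map (Idn D (Fo x)) (D.inv_arr (\<phi> y z)) \<cdot>\<^bsub>D\<^esub> D.assoc_arr (Fo x) (Fo y) (Fo z))"
proof -
  let ?A = "D.prod_map (\<phi> x y) (Idn D (Fo z)) \<cdot>\<^bsub>D\<^esub> \<phi> (prod_obj C x y) z"
  let ?B = "D.prod_map (Idn D (Fo x)) (\<phi> y z) \<cdot>\<^bsub>D\<^esub> \<phi> x (prod_obj C y z)"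
  have iso: "iso_arr D ?A" "iso_arr D ?B" using assms by (auto intro!: D.iso_Comp D.prod_map_iso)
  have "D.assoc_arr (Fo x) (Fo y) (Fo z) \<cdot>\<^bsub>D\<^esub> ?A = ?B \<cdot>\<^bsub>D\<^esub> Fa (C.assoc_arr x y z)"
    using assms by (simp add: \<phi>_def D.assoc_arr_def C.assoc_arr_def Let_def D.prod_map_def Fa_Comp_simp)
  from D.iso_square [OF this iso] have "Fa (C.assoc_arr x y z) \<cdot>\<^bsub>D\<^esub> D.inv_arr ?A = D.inv_arr ?B \<cdot>\<^bsub>D\<^esub> D.assoc_arr (Fo x) (Fo y) (Fo z)"
    using assms by simp
  then show ?thesis using assms by (simp add: D.inv_arr_Comp D.prod_map_iso D.inv_prod_map D.inv_arr_Idn)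
qed

lemma mu_gr_unit:
  assumes "x \<in> Obj C"
  shows "Fa (pr2 C C.one x) \<cdot>\<^bsub>D\<^esub> (D.inv_arr (\<phi> C.one x) \<cdot>\<^bsub>D\<^esub> D.prod_map (D.inv_arr (to_terminal D (Fo C.one))) (Idn D (Fo x))) = pr2 D D.one (Fo x)"
    "Fa (pr1 C x C.one) \<cdot>\<^bsub>D\<^esub> (D.inv_arr (\<phi> x C.one) \<cdot>\<^bsub>D\<^esub> D.prod_map (Idn D (Fo x)) (D.inv_arr (to_terminal D (Fo C.one)))) = pr1 D (Fo x) D.one"
proof -
  let ?A = "D.prod_map (to_terminal D (Fo C.one)) (Idn D (Fo x)) \<cdot>\<^bsub>D\<^esub> \<phi> C.one x"
  have iso: "iso_arr D ?A" using assms Fo_one_terminal by (auto intro!: D.iso_Comp D.prod_map_iso)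
  have "pr2 D D.one (Fo x) \<cdot>\<^bsub>D\<^esub> ?A = Idn D (Fo x) \<cdot>\<^bsub>D\<^esub> Fa (pr2 C C.one x)"
    using assms by (simp add: \<phi>_def D.prod_map_def)
  from D.iso_square [OF this iso] have "Fa (pr2 C C.one x) \<cdot>\<^bsub>D\<^esub> D.inv_arr ?A = D.inv_arr (Idn D (Fo x)) \<cdot>\<^bsub>D\<^esub> pr2 D D.one (Fo x)"
    using assms by simp
  then show "Fa (pr2 C C.one x) \<cdot>\<^bsub>D\<^esub> (D.inv_arr (\<phi> C.one x) \<cdot>\<^bsub>D\<^esub> D.prod_map (D.inv_arr (to_terminal D (Fo C.one))) (Idn D (Fo x))) = pr2 D D.one (Fo x)"
    using assms Fo_one_terminal by (simp add: D.inv_arr_Comp D.prod_map_iso D.inv_prod_map D.inv_arr_Idn)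
  let ?B = "D.prod_map (Idn D (Fo x)) (to_terminal D (Fo C.one)) \<cdot>\<^bsub>D\<^esub> \<phi> x C.one"
  have iso: "iso_arr D ?B" using assms Fo_one_terminal by (auto intro!: D.iso_Comp D.prod_map_iso)
  have "pr1 D (Fo x) D.one \<cdot>\<^bsub>D\<^esub> ?B = Idn D (Fo x) \<cdot>\<^bsub>D\<^esub> Fa (pr1 C x C.one)"
    using assms by (simp add: \<phi>_def D.prod_map_def)
  from D.iso_square [OF this iso] have "Fa (pr1 C x C.one) \<cdot>\<^bsub>D\<^esub> D.inv_arr ?B = D.inv_arr (Idn D (Fo x)) \<cdot>\<^bsub>D\<^esub> pr1 D (Fo x) D.one"
    using assms by simp
  then show "Fa (pr1 C x C.one) \<cdot>\<^bsub>D\<^esub> (D.inv_arr (\<phi> x C.one) \<cdot>\<^bsub>D\<^esub> D.prod_map (Idn D (Fo x)) (D.inv_arr (to_terminal D (Fo C.one)))) = pr1 D (Fo x) D.one"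
    using assms Fo_one_terminal by (simp add: D.inv_arr_Comp D.prod_map_iso D.inv_prod_map D.inv_arr_Idn)
qed

lemma mu_gr_braid:
  assumes "x \<in> Obj C" "y \<in> Obj C"
  shows "Fa (C.braid_arr x y) \<cdot>\<^bsub>D\<^esub> D.inv_arr (\<phi> x y) = D.inv_arr (\<phi> y x) \<cdot>\<^bsub>D\<^esub> D.braid_arr (Fo x) (Fo y)"
proof (rule D.iso_square)
  show "D.braid_arr (Fo x) (Fo y) \<cdot>\<^bsub>D\<^esub> \<phi> x y = \<phi> y x \<cdot>\<^bsub>D\<^esub> Fa (C.braid_arr x y)"
    using assms by (simp add: \<phi>_def D.braid_arr_def C.braid_arr_def)
qed (use assms in simp_all)

lemma relation_functor:
  "linear_symmetric_monoidal_functor C.T D.T Fo (rel_functor C D Fo Fa) (rel_mu C D Fa) (rel_eta C D Fo)"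
proof unfold_locales
  let ?R = "rel_functor C D Fo Fa" and ?\<mu> = "rel_mu C D Fa" and ?\<eta> = "rel_eta C D Fo"
  note S = C.relation_category_simps D.relation_category_simps C.Hom_relation_category D.Hom_relation_category
    C.graph_gr D.graph_gr rel_functor_RF rel_mu_gr rel_eta_gr
  show "Fo x \<in> Obj D.T" if "x \<in> Obj C.T" for x using that by (simp add: S)
  show "?R f \<in> Hom D.T (Fo x) (Fo y)" if "f \<in> Hom C.T x y" for f x y
    using that by (auto simp: S rel_RF)
  show "?R (Idn C.T x) = Idn D.T (Fo x)" if "x \<in> Obj C.T" for x
    using that by (simp add: S RF_gr)
  show "?R (g \<cdot>\<^bsub>C.T\<^esub> f) = ?R g \<cdot>\<^bsub>D.T\<^esub> ?R f" if "f \<in> Hom C.T x y" "g \<in> Hom C.T y z" for f g x y z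
    using that by (auto simp: S RF_cmp)
  show "?\<mu> x y \<in> Hom D.T (TenO D.T (Fo x) (Fo y)) (Fo (TenO C.T x y))" "iso_arr D.T (?\<mu> x y)"
    if "x \<in> Obj C.T" "y \<in> Obj C.T" for x y
    using that D.iso_graph [OF D.iso_inv_arr [OF \<phi>_iso [of x y]]] by (simp_all add: S D.rel_gr)
  show "?\<mu> x' y' \<cdot>\<^bsub>D.T\<^esub> TenA D.T (?R f) (?R g) = ?R (TenA C.T f g) \<cdot>\<^bsub>D.T\<^esub> ?\<mu> x y"
    if "f \<in> Hom C.T x x'" "g \<in> Hom C.T y y'" for f g x x' y y'
    using that by (auto simp: S mu_gr_natural)
  show "?\<eta> \<in> Hom D.T (UnitO D.T) (Fo (UnitO C.T))" "iso_arr D.T ?\<eta>"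
    using D.iso_graph [OF D.iso_inv_arr [OF Fo_one_terminal]] Fo_one_terminal by (simp_all add: S D.rel_gr)
  show "?R (Assoc C.T x y z) \<cdot>\<^bsub>D.T\<^esub> ?\<mu> (TenO C.T x y) z \<cdot>\<^bsub>D.T\<^esub> TenA D.T (?\<mu> x y) (Idn D.T (Fo z))
      = ?\<mu> x (TenO C.T y z) \<cdot>\<^bsub>D.T\<^esub> TenA D.T (Idn D.T (Fo x)) (?\<mu> y z) \<cdot>\<^bsub>D.T\<^esub> Assoc D.T (Fo x) (Fo y) (Fo z)"
    if "x \<in> Obj C.T" "y \<in> Obj C.T" "z \<in> Obj C.T" for x y z
    using that mu_gr_assoc [of x y z] by (simp add: S RF_gr D.ten_gr D.cmp_gr)
  show "?R (LUnit C.T x) \<cdot>\<^bsub>D.T\<^esub> ?\<mu> (UnitO C.T) x \<cdot>\<^bsub>D.T\<^esub> TenA D.T ?\<eta> (Idn D.T (Fo x)) = LUnit D.T (Fo x)"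
    "?R (RUnit C.T x) \<cdot>\<^bsub>D.T\<^esub> ?\<mu> x (UnitO C.T) \<cdot>\<^bsub>D.T\<^esub> TenA D.T (Idn D.T (Fo x)) ?\<eta> = RUnit D.T (Fo x)"
    if "x \<in> Obj C.T" for x
    using that mu_gr_unit [of x] Fo_one_terminal by (simp_all add: S RF_gr D.ten_gr D.cmp_gr)
  show "?R (Braid C.T x y) \<cdot>\<^bsub>D.T\<^esub> ?\<mu> x y = ?\<mu> y x \<cdot>\<^bsub>D.T\<^esub> Braid D.T (Fo x) (Fo y)"
    if "x \<in> Obj C.T" "y \<in> Obj C.T" for x y
    using that mu_gr_braid [of x y] by (simp add: S RF_gr D.cmp_gr)
  show "?R (AddA C.T f g) = AddA D.T (?R f) (?R g)" if "f \<in> Hom C.T x y" "g \<in> Hom C.T x y" for f g x y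
    using that by (auto simp: S)
  show "?R (SmultA C.T c f) = SmultA D.T c (?R f)" if "f \<in> Hom C.T x y" for c f x y
    using that by (auto simp: S)
qed

end

lemma product_map_map: "List.product (map f xs) (map g ys) = map (\<lambda>(x, y). (f x, g y)) (List.product xs ys)"
  by (induct xs) (simp_all add: comp_def)

context exact_degree_functor begin

text \<open>The two completions are applied in turn to the functor on relations. What remains is to
  recognise the resulting data as the explicit ones, notably the comparison matrices, which are
  written there over mapped lists of pairs.\<close>

lemma tensor_envelope_functor:
  "symmetric_monoidal_functor (tensor_envelope C \<delta>) (tensor_envelope D \<delta>') (env_functor_obj C D Fo Fa)
     (env_functor C D Fo Fa) (env_mu C \<delta> D \<delta>' Fo Fa) (env_eta C \<delta> D \<delta>' Fo Fa)"
  "linear_functor (tensor_envelope C \<delta>) (tensor_envelope D \<delta>') (env_functor_obj C D Fo Fa) (env_functor C D Fo Fa)"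
proof -
  interpret R: linear_symmetric_monoidal_functor C.T D.T Fo "rel_functor C D Fo Fa" "rel_mu C D Fa" "rel_eta C D Fo"
    by (rule relation_functor)
  interpret A: linear_symmetric_monoidal_functor R.CA.A R.DA.A "map Fo" R.AF R.amu R.aeta
    by (rule R.additive_functor)
  have K: "A.CK.K = tensor_envelope C \<delta>" "A.DK.K = tensor_envelope D \<delta>'"
    by (simp_all add: tensor_envelope_def)
  have Fo: "A.KFo = env_functor_obj C D Fo Fa"
    by (rule ext) (simp add: A.KFo_def env_functor_obj_def)
  have Fa: "A.KFa = env_functor C D Fo Fa"
    by (rule ext) (simp add: A.KFa_def env_functor_def Fo)
  have amu: "R.amu xs ys = add_mu C D \<delta>' Fo Fa xs ys" for xs ys
    unfolding R.amu_def add_mu_def list_tensor_def product_map_map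
    by (simp add: C.relation_category_simps D.relation_category_simps comp_def split_def)
  have aeta: "R.aeta = matrix_arrow [D.one] [Fo C.one] (\<lambda>_ _. rel_eta C D Fo)"
    unfolding R.aeta_def monomial_arrow_def by (simp add: R.DA.matrix_arrow_eq C.relation_category_simps D.relation_category_simps)
  have \<mu>: "A.Kmu = env_mu C \<delta> D \<delta>' Fo Fa"
  proof (intro ext)
    fix X Y
    show "A.Kmu X Y = env_mu C \<delta> D \<delta>' Fo Fa X Y"
      unfolding A.Kmu_def env_mu_def Let_def amu Fo K [symmetric] A.CK.K_simps A.DK.K_simps
      by (simp add: env_functor_obj_def)
  qed
  have \<eta>: "A.Keta = env_eta C \<delta> D \<delta>' Fo Fa"
    unfolding A.Keta_def unfolding env_eta_def aeta Fo K [symmetric] A.CK.K_simps A.DK.K_simps ..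
  show "symmetric_monoidal_functor (tensor_envelope C \<delta>) (tensor_envelope D \<delta>') (env_functor_obj C D Fo Fa)
     (env_functor C D Fo Fa) (env_mu C \<delta> D \<delta>' Fo Fa) (env_eta C \<delta> D \<delta>' Fo Fa)"
    using A.karoubi_monoidal_functor unfolding K Fo Fa \<mu> \<eta> .
  show "linear_functor (tensor_envelope C \<delta>) (tensor_envelope D \<delta>') (env_functor_obj C D Fo Fa) (env_functor C D Fo Fa)"
    using A.karoubi_linear_functor unfolding K Fo Fa .
qed

end

section \<open>Finite sets\<close>

text \<open>Any finite construction finds room in an infinite type; this is how pushouts and fibre
  products are brought back into the type of the given objects.\<close>

lemma finite_inj_infinite:
  assumes "finite (A :: 'a set)" "infinite (UNIV :: 'b set)"
  shows "\<exists>\<iota> :: 'a \<Rightarrow> 'b. inj_on \<iota> A"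
proof -
  obtain B :: "'b set" where "finite B" "card B = card A"
    using infinite_arbitrarily_large [OF assms(2)] by metis
  then obtain \<iota> where "bij_betw \<iota> A B" using finite_same_card_bij [OF assms(1)] by metis
  then show ?thesis unfolding bij_betw_def by blast
qed

text \<open>A lift in one direction for every ordered pair of factorizations suffices: the two lifts
  are mutually inverse because the epi parts can be cancelled, and the same cancellation gives
  compatibility with the mono parts.\<close>

lemma (in category) image_unique_from_lift:
  assumes lift: "\<And>f e m e' m'. \<lbrakk>image_fact C f e m; image_fact C f e' m'\<rbrakk> \<Longrightarrow> \<exists>d \<in> Hom C (Cod C e) (Cod C e'). d \<cdot> e = e'"
    and em: "image_fact C f e m" and em': "image_fact C f e' m'"
  shows "\<exists>i \<in> Hom C (Cod C e) (Cod C e'). iso_arr C i \<and> i \<cdot> e = e' \<and> m' \<cdot> i = m"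
proof -
  have e: "epic C e" "monic C m" "Cod C e = Dom C m" "m \<cdot> e = f" and e': "epic C e'" "monic C m'" "Cod C e' = Dom C m'" "m' \<cdot> e' = f"
    using em em' by (auto simp: image_fact_def)
  obtain d where d: "d \<in> Arr C" "Dom C d = Cod C e" "Cod C d = Cod C e'" "d \<cdot> e = e'"
    using lift [OF em em'] by (auto simp: Hom_iff)
  obtain d' where d': "d' \<in> Arr C" "Dom C d' = Cod C e'" "Cod C d' = Cod C e" "d' \<cdot> e' = e"
    using lift [OF em' em] by (auto simp: Hom_iff)
  have "(d' \<cdot> d) \<cdot> e = Idn C (Cod C e) \<cdot> e" using d d' e by simp
  then have 1: "d' \<cdot> d = Idn C (Cod C e)" by (rule epicD [OF e(1)]) (use d d' e in simp_all)
  have "(d \<cdot> d') \<cdot> e' = Idn C (Cod C e') \<cdot> e'" using d d' e' by simp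
  then have 2: "d \<cdot> d' = Idn C (Cod C e')" by (rule epicD [OF e'(1)]) (use d d' e' in simp_all)
  have "Cod C (m \<cdot> e) = Cod C (m' \<cdot> e')" using e(4) e'(4) by simp
  then have c: "Cod C m = Cod C m'" using e(1-3) e'(1-3) by simp
  have "(m' \<cdot> d) \<cdot> e = m \<cdot> e" using d e e' by simp
  then have "m' \<cdot> d = m" by (rule epicD [OF e(1)]) (use d e e' c in simp_all)
  moreover have "iso_arr C d" by (rule iso_arrI [OF _ _ d(1) d'(1)]) (use 1 2 d d' in simp_all)
  ultimately show ?thesis using d by (auto simp: Hom_iff)
qed

lemma FinSet_op_simps:
  "Obj FinSet_op = {X. finite X}" "Dom FinSet_op = arr_dom" "Cod FinSet_op = arr_cod"
  "Idn FinSet_op X = Arrow X X (\<lambda>x\<in>X. x)"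
  "Comp FinSet_op (Arrow Y' Z g) (Arrow X Y f) = Arrow X Z (compose Z f g)"
  by (simp_all add: FinSet_op_def)

lemma compose_PiE: "\<lbrakk>f \<in> Y \<rightarrow>\<^sub>E X; g \<in> Z \<rightarrow>\<^sub>E Y\<rbrakk> \<Longrightarrow> compose Z f g \<in> Z \<rightarrow>\<^sub>E X"
  by (auto simp: compose_def PiE_iff)

lemma Arr_FinSet_op: "Arrow X Y f \<in> Arr FinSet_op \<longleftrightarrow> finite X \<and> finite Y \<and> f \<in> Y \<rightarrow>\<^sub>E X"
  by (simp add: FinSet_op_def)

lemma Hom_FinSet_op: "Hom FinSet_op X Y = Arrow X Y ` {f. finite X \<and> finite Y \<and> f \<in> Y \<rightarrow>\<^sub>E X}"
  by (auto simp: Hom_def FinSet_op_def)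

interpretation FinSet: category "FinSet_op :: ('u::infinite set, ('u set, 'u \<Rightarrow> 'u) arrow) category"
proof
  show "f \<in> Arr FinSet_op \<Longrightarrow> Dom FinSet_op f \<in> Obj FinSet_op" "f \<in> Arr FinSet_op \<Longrightarrow> Cod FinSet_op f \<in> Obj FinSet_op" for f :: "('u set, 'u \<Rightarrow> 'u) arrow"
    by (cases f; simp add: Arr_FinSet_op FinSet_op_simps)+
  show "X \<in> Obj FinSet_op \<Longrightarrow> Idn FinSet_op X \<in> Hom FinSet_op X X" for X :: "'u set"
    by (simp add: FinSet_op_simps Hom_FinSet_op)
  show "g \<cdot>\<^bsub>FinSet_op\<^esub> f \<in> Hom FinSet_op X Z" if "f \<in> Hom FinSet_op X Y" "g \<in> Hom FinSet_op Y Z" for f g and X Y Z :: "'u set"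
    using that by (auto simp: Hom_FinSet_op FinSet_op_simps compose_PiE)
  show "f \<cdot>\<^bsub>FinSet_op\<^esub> Idn FinSet_op X = f" "Idn FinSet_op Y \<cdot>\<^bsub>FinSet_op\<^esub> f = f" if "f \<in> Hom FinSet_op X Y" for f and X Y :: "'u set"
    using that by (auto simp: Hom_FinSet_op FinSet_op_simps PiE_def Id_compose compose_Id)
  show "(h \<cdot>\<^bsub>FinSet_op\<^esub> g) \<cdot>\<^bsub>FinSet_op\<^esub> f = h \<cdot>\<^bsub>FinSet_op\<^esub> (g \<cdot>\<^bsub>FinSet_op\<^esub> f)"
    if "f \<in> Hom FinSet_op W X" "g \<in> Hom FinSet_op X Y" "h \<in> Hom FinSet_op Y Z" for f g h and W X Y Z :: "'u set"
    using that by (auto simp: Hom_FinSet_op FinSet_op_simps PiE_def compose_assoc)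
qed

lemma Arr_FinSet_opE:
  assumes "f \<in> Arr FinSet_op"
  obtains X Y h where "f = Arrow X Y h" "finite X" "finite Y" "h \<in> Y \<rightarrow>\<^sub>E X"
  using assms by (cases f) (auto simp: Arr_FinSet_op)

lemma infinite_two_elements:
  assumes "finite (A :: 'u::infinite set)"
  obtains a b :: "'u::infinite" where "a \<noteq> b" "a \<notin> A" "b \<notin> A"
proof -
  have "infinite (UNIV - A)" using assms infinite_UNIV by (rule Diff_infinite_finite)
  then obtain a where "a \<in> UNIV - A" using infinite_imp_nonempty by blast
  moreover have "infinite (UNIV - insert a A)" by (rule Diff_infinite_finite) (use assms infinite_UNIV in auto)
  then obtain b where "b \<in> UNIV - insert a A" using infinite_imp_nonempty by blast
  ultimately show thesis using that by blast
qed

text \<open>Elements of \<open>Y\<close> are functions from a singleton, and cancelling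
  \<open>h\<close> after two of them says that \<open>h\<close> separates elements.\<close>

lemma epic_FinSet_op:
  assumes "finite X" "finite (Y :: 'u::infinite set)" "h \<in> Y \<rightarrow>\<^sub>E X"
  shows "epic FinSet_op (Arrow X Y h) \<longleftrightarrow> inj_on h Y"
proof
  assume e: "epic FinSet_op (Arrow X Y h)"
  show "inj_on h Y"
  proof (rule inj_onI)
    fix a b assume ab: "a \<in> Y" "b \<in> Y" "h a = h b"
    \<comment> \<open>\<open>undefined\<close> merely supplies the point of some singleton.\<close>
    let ?f = "Arrow Y {undefined} (\<lambda>x\<in>{undefined :: 'u}. a)" and ?g = "Arrow Y {undefined} (\<lambda>x\<in>{undefined :: 'u}. b)"
    have "?f = ?g"
      by (rule FinSet.epicD [OF e]) (use assms ab in \<open>auto simp: FinSet_op_simps Arr_FinSet_op compose_def fun_eq_iff\<close>)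
    then have "(\<lambda>x\<in>{undefined :: 'u}. a) = (\<lambda>x\<in>{undefined :: 'u}. b)" by simp
    from fun_cong [OF this, of undefined] show "a = b" by simp
  qed
next
  assume inj: "inj_on h Y"
  show "epic FinSet_op (Arrow X Y h)"
  proof (rule FinSet.epicI)
    fix f g assume *: "f \<in> Arr FinSet_op" "g \<in> Arr FinSet_op" "Cod FinSet_op f = Cod FinSet_op g"
      "Dom FinSet_op f = Cod FinSet_op (Arrow X Y h)" "Dom FinSet_op g = Cod FinSet_op (Arrow X Y h)"
      "f \<cdot>\<^bsub>FinSet_op\<^esub> Arrow X Y h = g \<cdot>\<^bsub>FinSet_op\<^esub> Arrow X Y h"
    obtain Z f' where f: "f = Arrow Y Z f'" "f' \<in> Z \<rightarrow>\<^sub>E Y" using *(1,4) by (auto elim!: Arr_FinSet_opE simp: FinSet_op_simps)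
    obtain g' where g: "g = Arrow Y Z g'" "g' \<in> Z \<rightarrow>\<^sub>E Y" using *(2,3,5) f by (auto elim!: Arr_FinSet_opE simp: FinSet_op_simps)
    have "compose Z h f' = compose Z h g'" using *(6) f g by (simp add: FinSet_op_simps)
    then have "h (f' z) = h (g' z)" if "z \<in> Z" for z using that by (metis compose_eq)
    then have "f' z = g' z" if "z \<in> Z" for z using that f(2) g(2) inj by (meson PiE_mem inj_onD)
    then show "f = g" using f g by (auto intro: PiE_ext)
  qed (use assms in \<open>simp add: Arr_FinSet_op\<close>)
qed

lemma monic_FinSet_op:
  assumes "finite X" "finite (Y :: 'u::infinite set)" "h \<in> Y \<rightarrow>\<^sub>E X"
  shows "monic FinSet_op (Arrow X Y h) \<longleftrightarrow> h ` Y = X"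
proof
  assume m: "monic FinSet_op (Arrow X Y h)"
  obtain p q :: 'u where pq: "p \<noteq> q" using infinite_two_elements [of "{}"] by auto
  \<comment> \<open>A constant function and one that changes its value off the image of
    \<open>h\<close> cannot be told apart after composing with \<open>h\<close>.\<close>
  let ?f = "Arrow {p, q} X (\<lambda>x\<in>X. p)" and ?g = "Arrow {p, q} X (\<lambda>x\<in>X. if x \<in> h ` Y then p else q)"
  have "?f = ?g"
    by (rule FinSet.monicD [OF m]) (use assms in \<open>auto simp: FinSet_op_simps Arr_FinSet_op compose_def fun_eq_iff PiE_iff\<close>)
  then have eq: "(\<lambda>x\<in>X. p) = (\<lambda>x\<in>X. if x \<in> h ` Y then p else q)" by simp
  have "x \<in> h ` Y" if "x \<in> X" for x using fun_cong [OF eq, of x] that pq by (simp split: if_splits)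
  then have "X \<subseteq> h ` Y" by blast
  then show "h ` Y = X" using assms by auto
next
  assume surj: "h ` Y = X"
  show "monic FinSet_op (Arrow X Y h)"
  proof (rule FinSet.monicI)
    fix f g assume *: "f \<in> Arr FinSet_op" "g \<in> Arr FinSet_op" "Dom FinSet_op f = Dom FinSet_op g"
      "Cod FinSet_op f = Dom FinSet_op (Arrow X Y h)" "Cod FinSet_op g = Dom FinSet_op (Arrow X Y h)"
      "Arrow X Y h \<cdot>\<^bsub>FinSet_op\<^esub> f = Arrow X Y h \<cdot>\<^bsub>FinSet_op\<^esub> g"
    obtain Z f' where f: "f = Arrow Z X f'" "f' \<in> X \<rightarrow>\<^sub>E Z" using *(1,4) by (auto elim!: Arr_FinSet_opE simp: FinSet_op_simps)
    obtain g' where g: "g = Arrow Z X g'" "g' \<in> X \<rightarrow>\<^sub>E Z" using *(2,3,5) f by (auto elim!: Arr_FinSet_opE simp: FinSet_op_simps)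
    have "compose Y f' h = compose Y g' h" using *(6) f g by (simp add: FinSet_op_simps)
    then have "f' (h y) = g' (h y)" if "y \<in> Y" for y using that by (metis compose_eq)
    then have "f' x = g' x" if "x \<in> X" for x using that surj by blast
    then show "f = g" using f g by (auto intro: PiE_ext)
  qed (use assms in \<open>simp add: Arr_FinSet_op\<close>)
qed

text \<open>In terms of functions this is initiality; two different constant functions distinguish a
  nonempty set from the empty one.\<close>

lemma terminal_FinSet_op: "terminal FinSet_op (X :: 'u::infinite set) \<longleftrightarrow> X = {}"
proof
  assume t: "terminal FinSet_op X"
  then have fin: "finite X" by (simp add: terminal_def FinSet_op_simps)
  obtain p q :: 'u where pq: "p \<noteq> q" using infinite_two_elements [of "{}"] by auto
  have "\<exists>!f. f \<in> Hom FinSet_op {p, q} X" using t by (simp add: terminal_def FinSet_op_simps)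
  moreover have "Arrow {p, q} X (\<lambda>x\<in>X. p) \<in> Hom FinSet_op {p, q} X" "Arrow {p, q} X (\<lambda>x\<in>X. q) \<in> Hom FinSet_op {p, q} X"
    using fin by (auto simp: Hom_FinSet_op)
  ultimately have "Arrow {p, q} X (\<lambda>x\<in>X. p) = Arrow {p, q} X (\<lambda>x\<in>X. q)" by blast
  then have eq: "(\<lambda>x\<in>X. p) = (\<lambda>x\<in>X. q)" by simp
  have "p = q" if "x \<in> X" for x using fun_cong [OF eq, of x] that by simp
  with pq show "X = {}" by blast
next
  assume "X = {}"
  then show "terminal FinSet_op X"
    by (auto simp: terminal_def FinSet_op_simps Hom_FinSet_op)
qed

section \<open>Pushouts of finite sets as pullbacks in the opposite category\<close>

lemma commuting_square_FinSet_op: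
  "commuting_square FinSet_op f g p q \<longleftrightarrow> (\<exists>X Y Z P f' g' p' q'. f = Arrow X Z f' \<and> g = Arrow Y Z g' \<and> p = Arrow P X p' \<and> q = Arrow P Y q' \<and>
     finite X \<and> finite Y \<and> finite Z \<and> finite P \<and> f' \<in> Z \<rightarrow>\<^sub>E X \<and> g' \<in> Z \<rightarrow>\<^sub>E Y \<and> p' \<in> X \<rightarrow>\<^sub>E P \<and> q' \<in> Y \<rightarrow>\<^sub>E P \<and>
     (\<forall>z\<in>Z. p' (f' z) = q' (g' z)))" (is "?L \<longleftrightarrow> ?R")
proof
  assume ?L
  then have *: "f \<in> Arr FinSet_op" "g \<in> Arr FinSet_op" "p \<in> Arr FinSet_op" "q \<in> Arr FinSet_op"
    "arr_cod f = arr_cod g" "arr_dom p = arr_dom q" "arr_cod p = arr_dom f" "arr_cod q = arr_dom g"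
    "f \<cdot>\<^bsub>FinSet_op\<^esub> p = g \<cdot>\<^bsub>FinSet_op\<^esub> q"
    unfolding commuting_square_def by (simp_all add: FinSet_op_simps)
  obtain X Z f' where f: "f = Arrow X Z f'" "finite X" "finite Z" "f' \<in> Z \<rightarrow>\<^sub>E X" using *(1) by (rule Arr_FinSet_opE)
  obtain Y g' where g: "g = Arrow Y Z g'" "finite Y" "g' \<in> Z \<rightarrow>\<^sub>E Y" using *(2) by (rule Arr_FinSet_opE) (use *(5) f in auto)
  obtain P p' where p: "p = Arrow P X p'" "finite P" "p' \<in> X \<rightarrow>\<^sub>E P" using *(3) by (rule Arr_FinSet_opE) (use *(7) f in auto)
  obtain q' where q: "q = Arrow P Y q'" "q' \<in> Y \<rightarrow>\<^sub>E P" using *(4) by (rule Arr_FinSet_opE) (use *(6,8) g p in auto)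
  have "compose Z p' f' = compose Z q' g'" using *(9) f g p q by (simp add: FinSet_op_simps)
  then have "\<forall>z\<in>Z. p' (f' z) = q' (g' z)" by (metis compose_eq)
  with f g p q show ?R by blast
next
  assume ?R
  then show ?L unfolding commuting_square_def
    by (auto simp: FinSet_op_simps Arr_FinSet_op compose_def fun_eq_iff)
qed

text \<open>Coding points by the pairs that contain them avoids generating an equivalence relation.
  Only finitely many codes occur, so they embed into the infinite type of elements. Targets are
  taken in that same type here; \<open>pullback_FinSet_opE\<close> treats finite targets of any
  type.\<close>

lemma pushout_exists:
  fixes f :: "'u::infinite \<Rightarrow> 'u" and g :: "'u \<Rightarrow> 'u"
  assumes fin: "finite X" "finite Y"
  obtains P :: "'u set" and p q where "p \<in> X \<rightarrow>\<^sub>E P" "q \<in> Y \<rightarrow>\<^sub>E P" "P = p ` X \<union> q ` Y" "finite P"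
    "\<forall>z\<in>Z. f z \<in> X \<longrightarrow> g z \<in> Y \<longrightarrow> p (f z) = q (g z)"
    "\<forall>(h :: 'u \<Rightarrow> 'u) k A. h \<in> X \<rightarrow> A \<longrightarrow> k \<in> Y \<rightarrow> A \<longrightarrow> (\<forall>z\<in>Z. h (f z) = k (g z)) \<longrightarrow>
      (\<exists>u \<in> P \<rightarrow>\<^sub>E A. (\<forall>x\<in>X. u (p x) = h x) \<and> (\<forall>y\<in>Y. u (q y) = k y))"
proof -
  \<comment> \<open>Points of the pushout are separated by the compatible pairs of subsets of \<open>X\<close> and \<open>Y\<close>.\<close>
  define compat where "compat = (\<lambda>(H, K). \<forall>z\<in>Z. f z \<in> H \<longleftrightarrow> g z \<in> K)"
  define \<phi> where "\<phi> x = {(H, K). compat (H, K) \<and> x \<in> H}" for x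
  define \<psi> where "\<psi> y = {(H, K). compat (H, K) \<and> y \<in> K}" for y
  have "finite (\<phi> ` X \<union> \<psi> ` Y)" using fin by simp
  from finite_inj_infinite [OF this infinite_UNIV]
  obtain \<iota> :: "('u set \<times> 'u set) set \<Rightarrow> 'u" where \<iota>: "inj_on \<iota> (\<phi> ` X \<union> \<psi> ` Y)" by blast
  define p where "p = (\<lambda>x\<in>X. \<iota> (\<phi> x))"
  define q where "q = (\<lambda>y\<in>Y. \<iota> (\<psi> y))"
  define P where "P = p ` X \<union> q ` Y"
  have pp: "p x = p x' \<Longrightarrow> \<phi> x = \<phi> x'" if "x \<in> X" "x' \<in> X" for x x'
    using that \<iota> by (auto simp: p_def dest!: inj_onD)
  have pq: "p x = q y \<Longrightarrow> \<phi> x = \<psi> y" if "x \<in> X" "y \<in> Y" for x y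
    using that \<iota> by (auto simp: p_def q_def dest!: inj_onD)
  have qq: "q y = q y' \<Longrightarrow> \<psi> y = \<psi> y'" if "y \<in> Y" "y' \<in> Y" for y y'
    using that \<iota> by (auto simp: q_def dest!: inj_onD)
  show thesis
  proof (rule that [of p P q])
    show "p \<in> X \<rightarrow>\<^sub>E P" "q \<in> Y \<rightarrow>\<^sub>E P" "P = p ` X \<union> q ` Y" "finite P"
      using fin by (auto simp: P_def p_def q_def)
    show "\<forall>z\<in>Z. f z \<in> X \<longrightarrow> g z \<in> Y \<longrightarrow> p (f z) = q (g z)"
    proof (intro ballI impI)
      fix z assume that: "z \<in> Z" "f z \<in> X" "g z \<in> Y"
      have "\<phi> (f z) = \<psi> (g z)" unfolding \<phi>_def \<psi>_def compat_def using that(1) by auto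
      then show "p (f z) = q (g z)" using that by (simp add: p_def q_def)
    qed
    show "\<forall>(h :: 'u \<Rightarrow> 'u) k A. h \<in> X \<rightarrow> A \<longrightarrow> k \<in> Y \<rightarrow> A \<longrightarrow> (\<forall>z\<in>Z. h (f z) = k (g z)) \<longrightarrow>
      (\<exists>u \<in> P \<rightarrow>\<^sub>E A. (\<forall>x\<in>X. u (p x) = h x) \<and> (\<forall>y\<in>Y. u (q y) = k y))"
    proof (intro allI impI)
    fix h k :: "'u \<Rightarrow> 'u" and A
    assume h: "h \<in> X \<rightarrow> A" and k: "k \<in> Y \<rightarrow> A" and hk: "\<forall>z\<in>Z. h (f z) = k (g z)"
    \<comment> \<open>The fibres of \<open>h\<close> and \<open>k\<close> over one value form a
      compatible pair. Hence the code of a point determines the value there, and equal codes receive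
      equal values.\<close>
    have compat: "compat ({x. h x = a}, {y. k y = a})" for a by (auto simp: compat_def hk)
    have \<phi>: "({x'. h x' = a}, {y. k y = a}) \<in> \<phi> x \<longleftrightarrow> h x = a" for a x
      using compat [of a] by (simp add: \<phi>_def)
    have \<psi>: "({x'. h x' = a}, {y. k y = a}) \<in> \<psi> y \<longleftrightarrow> k y = a" for a y
      using compat [of a] by (simp add: \<psi>_def)
    have hh: "h x' = h x" if "x \<in> X" "x' \<in> X" "p x' = p x" for x x'
      using \<phi> [of "h x" x'] unfolding pp [OF that(2,1,3)] \<phi> by simp
    have hk': "h x = k y" if "x \<in> X" "y \<in> Y" "p x = q y" for x y
      using \<phi> [of "k y" x] unfolding pq [OF that] \<psi> by simp
    have kk: "k y' = k y" if "y \<in> Y" "y' \<in> Y" "q y' = q y" for y y'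
      using \<psi> [of "k y" y'] unfolding qq [OF that(2,1,3)] \<psi> by simp
    have "\<forall>w\<in>P. \<exists>a\<in>A. (\<forall>x\<in>X. p x = w \<longrightarrow> h x = a) \<and> (\<forall>y\<in>Y. q y = w \<longrightarrow> k y = a)"
    proof
      fix w assume "w \<in> P"
      then consider x where "x \<in> X" "w = p x" | y where "y \<in> Y" "w = q y" unfolding P_def by blast
      then show "\<exists>a\<in>A. (\<forall>x\<in>X. p x = w \<longrightarrow> h x = a) \<and> (\<forall>y\<in>Y. q y = w \<longrightarrow> k y = a)"
      proof cases
        case 1
        show ?thesis
          by (rule bexI [of _ "h x"]) (use 1 h in \<open>auto intro: hh hk' [symmetric]\<close>)
      next
        case 2
        show ?thesis
          by (rule bexI [of _ "k y"]) (use 2 k in \<open>auto intro: kk hk'\<close>)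
      qed
    qed
    from bchoice [OF this [unfolded Bex_def]] obtain u where
      u: "\<forall>w\<in>P. u w \<in> A \<and> (\<forall>x\<in>X. p x = w \<longrightarrow> h x = u w) \<and> (\<forall>y\<in>Y. q y = w \<longrightarrow> k y = u w)" by blast
    show "\<exists>u \<in> P \<rightarrow>\<^sub>E A. (\<forall>x\<in>X. u (p x) = h x) \<and> (\<forall>y\<in>Y. u (q y) = k y)"
    proof (rule bexI [of _ "restrict u P"])
      show "(\<forall>x\<in>X. restrict u P (p x) = h x) \<and> (\<forall>y\<in>Y. restrict u P (q y) = k y)"
        using u unfolding P_def by (simp add: ball_Un)
    qed (use u in auto)
    qed
  qed
qed

lemma ex_pullback_FinSet_op:
  assumes "f \<in> Arr FinSet_op" "g \<in> Arr FinSet_op" "Cod FinSet_op f = Cod FinSet_op g"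
  shows "\<exists>p q. is_pullback FinSet_op f (g :: ('u::infinite set, 'u \<Rightarrow> 'u) arrow) p q"
proof -
  obtain X Z f' where f: "f = Arrow X Z f'" "finite X" "finite Z" "f' \<in> Z \<rightarrow>\<^sub>E X" using assms(1) by (rule Arr_FinSet_opE)
  obtain Y g' where g: "g = Arrow Y Z g'" "finite Y" "g' \<in> Z \<rightarrow>\<^sub>E Y"
    using assms(2) by (rule Arr_FinSet_opE) (use assms(3) f in \<open>auto simp: FinSet_op_simps\<close>)
  obtain P :: "'u set" and p q where P: "p \<in> X \<rightarrow>\<^sub>E P" "q \<in> Y \<rightarrow>\<^sub>E P" "P = p ` X \<union> q ` Y" "finite P"
    "\<forall>z\<in>Z. f' z \<in> X \<longrightarrow> g' z \<in> Y \<longrightarrow> p (f' z) = q (g' z)"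
    and univ: "\<forall>(h :: 'u \<Rightarrow> 'u) k A. h \<in> X \<rightarrow> A \<longrightarrow> k \<in> Y \<rightarrow> A \<longrightarrow> (\<forall>z\<in>Z. h (f' z) = k (g' z)) \<longrightarrow>
      (\<exists>u \<in> P \<rightarrow>\<^sub>E A. (\<forall>x\<in>X. u (p x) = h x) \<and> (\<forall>y\<in>Y. u (q y) = k y))"
    using f(2) g(2) by (rule pushout_exists [where Z = Z and f = f' and g = g'])
  have "is_pullback FinSet_op f g (Arrow P X p) (Arrow P Y q)"
    unfolding is_pullback_def
  proof (intro conjI allI impI)
    show "commuting_square FinSet_op f g (Arrow P X p) (Arrow P Y q)"
      unfolding commuting_square_FinSet_op using f g P(1,2,4,5) by (auto simp: PiE_iff)
    fix p' q' assume "commuting_square FinSet_op f g p' q'"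
    then obtain Q h k where Q: "p' = Arrow Q X h" "q' = Arrow Q Y k" "finite Q" "h \<in> X \<rightarrow>\<^sub>E Q" "k \<in> Y \<rightarrow>\<^sub>E Q"
      "\<And>z. z \<in> Z \<Longrightarrow> h (f' z) = k (g' z)"
      unfolding commuting_square_FinSet_op using f g by auto
    have "\<exists>u \<in> P \<rightarrow>\<^sub>E Q. (\<forall>x\<in>X. u (p x) = h x) \<and> (\<forall>y\<in>Y. u (q y) = k y)"
      by (rule univ [rule_format]) (use Q in \<open>auto simp: PiE_iff\<close>)
    then obtain u where u: "u \<in> P \<rightarrow>\<^sub>E Q" "\<forall>x\<in>X. u (p x) = h x" "\<forall>y\<in>Y. u (q y) = k y" by blast
    have hk: "compose X u p = h" "compose Y u q = k"
      by (rule PiE_ext [of _ X "\<lambda>_. Q"] PiE_ext [of _ Y "\<lambda>_. Q"]; use u P(1,2) Q in \<open>auto simp: compose_def PiE_iff\<close>)+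
    show "\<exists>!u. u \<in> Hom FinSet_op (Dom FinSet_op p') (Dom FinSet_op (Arrow P X p)) \<and>
       Arrow P X p \<cdot>\<^bsub>FinSet_op\<^esub> u = p' \<and> Arrow P Y q \<cdot>\<^bsub>FinSet_op\<^esub> u = q'"
    proof (rule ex1I [of _ "Arrow Q P u"])
      show "Arrow Q P u \<in> Hom FinSet_op (Dom FinSet_op p') (Dom FinSet_op (Arrow P X p)) \<and>
         Arrow P X p \<cdot>\<^bsub>FinSet_op\<^esub> Arrow Q P u = p' \<and> Arrow P Y q \<cdot>\<^bsub>FinSet_op\<^esub> Arrow Q P u = q'"
        using u hk Q P by (auto simp: FinSet_op_simps Hom_FinSet_op)
      fix v assume v: "v \<in> Hom FinSet_op (Dom FinSet_op p') (Dom FinSet_op (Arrow P X p)) \<and>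
       Arrow P X p \<cdot>\<^bsub>FinSet_op\<^esub> v = p' \<and> Arrow P Y q \<cdot>\<^bsub>FinSet_op\<^esub> v = q'"
      then obtain v' where v': "v = Arrow Q P v'" "v' \<in> P \<rightarrow>\<^sub>E Q" using Q by (auto simp: FinSet_op_simps Hom_FinSet_op)
      have c: "compose X v' p = h" "compose Y v' q = k" using v v' Q by (auto simp: FinSet_op_simps)
      \<comment> \<open>\<open>P\<close> is covered by the two images, so the composites with the
        legs determine the function.\<close>
      have "v' w = u w" if "w \<in> P" for w
        using that unfolding P(3) using u(2,3) c by (auto simp: compose_def)
      then have "v' = u" using PiE_ext [OF v'(2) u(1)] by blast
      then show "v = Arrow Q P u" using v' by simp
    qed
  qed
  then show ?thesis by blast
qed

text \<open>The universal property of an abstract pullback glues functions into finite sets of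
  elements of \<open>'u\<close> only. A finite target of another type is first embedded into
  \<open>'u\<close>; this is needed for values in the field and for the disjoint sum in the degree
  computation. That the two images exhaust \<open>P\<close> is seen by testing with a function that
  changes its value off them.\<close>

lemma pullback_FinSet_opE:
  assumes "is_pullback FinSet_op f g p (q :: ('u::infinite set, 'u \<Rightarrow> 'u) arrow)"
  obtains X Y Z P f' g' p' q' where "f = Arrow X Z f'" "g = Arrow Y Z g'" "p = Arrow P X p'" "q = Arrow P Y q'"
    "finite X" "finite Y" "finite Z" "finite P" "f' \<in> Z \<rightarrow>\<^sub>E X" "g' \<in> Z \<rightarrow>\<^sub>E Y" "p' \<in> X \<rightarrow>\<^sub>E P" "q' \<in> Y \<rightarrow>\<^sub>E P"
    "\<forall>z\<in>Z. p' (f' z) = q' (g' z)" "P = p' ` X \<union> q' ` Y"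
    "\<forall>(h :: 'u \<Rightarrow> 'c) k A. finite A \<longrightarrow> h \<in> X \<rightarrow> A \<longrightarrow> k \<in> Y \<rightarrow> A \<longrightarrow> (\<forall>z\<in>Z. h (f' z) = k (g' z)) \<longrightarrow>
      (\<exists>u \<in> P \<rightarrow>\<^sub>E A. (\<forall>x\<in>X. u (p' x) = h x) \<and> (\<forall>y\<in>Y. u (q' y) = k y))"
proof -
  have "commuting_square FinSet_op f g p q" using assms by (simp add: is_pullback_def)
  then obtain X Y Z P f' g' p' q' where *: "f = Arrow X Z f'" "g = Arrow Y Z g'" "p = Arrow P X p'" "q = Arrow P Y q'"
    "finite X" "finite Y" "finite Z" "finite P" "f' \<in> Z \<rightarrow>\<^sub>E X" "g' \<in> Z \<rightarrow>\<^sub>E Y" "p' \<in> X \<rightarrow>\<^sub>E P" "q' \<in> Y \<rightarrow>\<^sub>E P"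
    "\<forall>z\<in>Z. p' (f' z) = q' (g' z)"
    unfolding commuting_square_FinSet_op by blast
  obtain a b :: 'u where ab: "a \<noteq> b" using infinite_two_elements [of "{}"] by auto
  have "Arrow {a, b} P (\<lambda>w\<in>P. a) = Arrow {a, b} P (\<lambda>w\<in>P. if w \<in> p' ` X \<union> q' ` Y then a else b)"
    by (rule FinSet.pullback_unique [OF assms])
      (use * in \<open>auto simp: Arr_FinSet_op FinSet_op_simps compose_def fun_eq_iff PiE_iff\<close>)
  then have eq: "(\<lambda>w\<in>P. a) = (\<lambda>w\<in>P. if w \<in> p' ` X \<union> q' ` Y then a else b)" by simp
  have "w \<in> p' ` X \<union> q' ` Y" if "w \<in> P" for w using fun_cong [OF eq, of w] that ab by (simp split: if_splits)
  then have P: "P = p' ` X \<union> q' ` Y" using * by blast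
  have glue: "\<exists>u \<in> P \<rightarrow>\<^sub>E A. (\<forall>x\<in>X. u (p' x) = h x) \<and> (\<forall>y\<in>Y. u (q' y) = k y)"
    if A: "finite A" and hk: "h \<in> X \<rightarrow> A" "k \<in> Y \<rightarrow> A" "\<And>z. z \<in> Z \<Longrightarrow> h (f' z) = k (g' z)" for h k :: "'u \<Rightarrow> 'c" and A
  proof -
    \<comment> \<open>Glue the encoded functions, then decode by the inverse of
      \<open>\<iota>\<close> on \<open>A\<close>.\<close>
    obtain \<iota> :: "'c \<Rightarrow> 'u" where \<iota>: "inj_on \<iota> A" using finite_inj_infinite [OF A infinite_UNIV] by blast
    obtain u where u: "u \<in> Arr FinSet_op" "Dom FinSet_op u = \<iota> ` A" "Cod FinSet_op u = P"
      "p \<cdot>\<^bsub>FinSet_op\<^esub> u = Arrow (\<iota> ` A) X (\<lambda>x\<in>X. \<iota> (h x))" "q \<cdot>\<^bsub>FinSet_op\<^esub> u = Arrow (\<iota> ` A) Y (\<lambda>y\<in>Y. \<iota> (k y))"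
    proof (rule FinSet.pullback_ex [OF assms, of "Arrow (\<iota> ` A) X (\<lambda>x\<in>X. \<iota> (h x))" "Arrow (\<iota> ` A) Y (\<lambda>y\<in>Y. \<iota> (k y))"])
      show "f \<cdot>\<^bsub>FinSet_op\<^esub> Arrow (\<iota> ` A) X (\<lambda>x\<in>X. \<iota> (h x)) = g \<cdot>\<^bsub>FinSet_op\<^esub> Arrow (\<iota> ` A) Y (\<lambda>y\<in>Y. \<iota> (k y))"
        using * hk by (auto simp: FinSet_op_simps compose_def fun_eq_iff)
    qed (use * A hk in \<open>auto simp: Arr_FinSet_op FinSet_op_simps\<close>)
    obtain u' where u': "u = Arrow (\<iota> ` A) P u'" "u' \<in> P \<rightarrow>\<^sub>E \<iota> ` A"
      using u(1-3) by (auto elim!: Arr_FinSet_opE simp: FinSet_op_simps)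
    have c: "compose X u' p' = (\<lambda>x\<in>X. \<iota> (h x))" "compose Y u' q' = (\<lambda>y\<in>Y. \<iota> (k y))"
      using u(4,5) u' * by (auto simp: FinSet_op_simps)
    have u1: "u' (p' x) = \<iota> (h x)" if "x \<in> X" for x using fun_cong [OF c(1), of x] that by (simp add: compose_def)
    have u2: "u' (q' y) = \<iota> (k y)" if "y \<in> Y" for y using fun_cong [OF c(2), of y] that by (simp add: compose_def)
    have inv: "inv_into A \<iota> (\<iota> a) = a" if "a \<in> A" for a using \<iota> that by (rule inv_into_f_f)
    show ?thesis
    proof (rule bexI [of _ "\<lambda>w\<in>P. inv_into A \<iota> (u' w)"])
      have "p' x \<in> P" if "x \<in> X" for x using * that by auto
      moreover have "q' y \<in> P" if "y \<in> Y" for y using * that by auto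
      moreover have "h x \<in> A" if "x \<in> X" for x using hk that by auto
      moreover have "k y \<in> A" if "y \<in> Y" for y using hk that by auto
      ultimately show "(\<forall>x\<in>X. (\<lambda>w\<in>P. inv_into A \<iota> (u' w)) (p' x) = h x) \<and> (\<forall>y\<in>Y. (\<lambda>w\<in>P. inv_into A \<iota> (u' w)) (q' y) = k y)"
        by (simp add: u1 u2 inv)
      show "(\<lambda>w\<in>P. inv_into A \<iota> (u' w)) \<in> P \<rightarrow>\<^sub>E A" using u'(2) by (auto simp: PiE_iff intro!: inv_into_into)
    qed
  qed
  show thesis by (rule that [OF * P]) (use glue in blast)+
qed

text \<open>The pushout along an injection is modelled by \<open>Y\<close> together with the points
  of \<open>X\<close> outside the image of \<open>f'\<close>. A map from \<open>P\<close> into this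
  model shows that \<open>q'\<close> is injective and that \<open>p'\<close> identifies the two
  complements.\<close>

lemma pullback_degree_FinSet_op:
  assumes e: "epic FinSet_op f" and pb: "is_pullback FinSet_op f g p (q :: ('u::infinite set, 'u \<Rightarrow> 'u) arrow)"
  shows "epic FinSet_op q" "set_degree t q = set_degree t f"
proof -
  obtain X Y Z P f' g' p' q' where *: "f = Arrow X Z f'" "g = Arrow Y Z g'" "p = Arrow P X p'" "q = Arrow P Y q'"
    "finite X" "finite Y" "finite Z" "finite P" "f' \<in> Z \<rightarrow>\<^sub>E X" "g' \<in> Z \<rightarrow>\<^sub>E Y" "p' \<in> X \<rightarrow>\<^sub>E P" "q' \<in> Y \<rightarrow>\<^sub>E P"
    "\<forall>z\<in>Z. p' (f' z) = q' (g' z)" "P = p' ` X \<union> q' ` Y"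
    and glue: "\<forall>(h :: 'u \<Rightarrow> 'u + 'u) k A. finite A \<longrightarrow> h \<in> X \<rightarrow> A \<longrightarrow> k \<in> Y \<rightarrow> A \<longrightarrow> (\<forall>z\<in>Z. h (f' z) = k (g' z)) \<longrightarrow>
      (\<exists>u \<in> P \<rightarrow>\<^sub>E A. (\<forall>x\<in>X. u (p' x) = h x) \<and> (\<forall>y\<in>Y. u (q' y) = k y))"
    by (rule pullback_FinSet_opE [OF pb])
  have inj: "inj_on f' Z" using e unfolding *(1) epic_FinSet_op [OF *(5,7,9)] .
  \<comment> \<open>The map from \<open>X\<close> into the model: points of the image of
    \<open>f'\<close> are sent to the copy of \<open>Y\<close>, all others stay apart.\<close>
  define h where "h x = (if x \<in> f' ` Z then Inl (g' (inv_into Z f' x)) else Inr x)" for x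
  have "\<exists>u \<in> P \<rightarrow>\<^sub>E Inl ` Y \<union> Inr ` X. (\<forall>x\<in>X. u (p' x) = h x) \<and> (\<forall>y\<in>Y. u (q' y) = Inl y)"
  proof (rule glue [rule_format])
    show "h \<in> X \<rightarrow> Inl ` Y \<union> Inr ` X" using *(10) inj by (auto simp: h_def PiE_iff)
    show "h (f' z) = Inl (g' z)" if "z \<in> Z" for z using that inj by (simp add: h_def)
  qed (use * in auto)
  then obtain u where u: "\<And>x. x \<in> X \<Longrightarrow> u (p' x) = h x" "\<And>y. y \<in> Y \<Longrightarrow> u (q' y) = Inl y" by blast
  have "inj_on q' Y" by (rule inj_onI) (metis u(2) sum.inject(1))
  then show "epic FinSet_op q" unfolding *(4) epic_FinSet_op [OF *(8,6,12)] .
  have h: "h x = Inr x" if "x \<in> X - f' ` Z" for x using that by (simp add: h_def)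
  have "bij_betw p' (X - f' ` Z) (P - q' ` Y)"
    unfolding bij_betw_def
  proof
    show "inj_on p' (X - f' ` Z)"
    proof (rule inj_onI)
      fix x y assume xy: "x \<in> X - f' ` Z" "y \<in> X - f' ` Z" "p' x = p' y"
      then have "h x = h y" using u(1) [of x] u(1) [of y] by simp
      then show "x = y" using h xy by simp
    qed
    have 1: "p' x \<noteq> q' y" if "x \<in> X - f' ` Z" "y \<in> Y" for x y
    proof
      assume "p' x = q' y"
      then have "h x = Inl y" using u that by force
      then show False using h that by simp
    qed
    have 2: "w \<in> p' ` (X - f' ` Z)" if w: "w \<in> P - q' ` Y" for w
    proof -
      obtain x where x: "x \<in> X" "w = p' x" using w *(14) by blast
      \<comment> \<open>A point of the form \<open>f' z\<close> is identified with
        \<open>q' (g' z)\<close> and would lie in the image of \<open>q'\<close>.\<close>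
      have "x \<notin> f' ` Z" using x w *(10,13) by (auto simp: PiE_iff)
      with x show ?thesis by blast
    qed
    show "p' ` (X - f' ` Z) = P - q' ` Y" using 1 2 *(11) by auto
  qed
  then show "set_degree t q = set_degree t f" using * by (simp add: set_degree_def bij_betw_same_card)
qed

lemma complete_degree_function_FinSet_op:
  "complete_degree_function (FinSet_op :: ('u::infinite set, ('u set, 'u \<Rightarrow> 'u) arrow) category) (set_degree t)"
proof
  let ?S = "FinSet_op :: ('u set, ('u set, 'u \<Rightarrow> 'u) arrow) category"
  show "\<exists>X. terminal ?S X" using terminal_FinSet_op by blast
  show "\<exists>e m. image_fact ?S f e m" if f_Arr: "f \<in> Arr ?S" for f
  proof -
    obtain X Y f' where f: "f = Arrow X Y f'" "finite X" "finite Y" "f' \<in> Y \<rightarrow>\<^sub>E X" using f_Arr by (rule Arr_FinSet_opE)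
    \<comment> \<open>The usual factorization with the roles exchanged: the inclusion of the image
      is the epi part, the surjection onto it the mono part.\<close>
    have "image_fact ?S f (Arrow X (f' ` Y) (\<lambda>x\<in>f' ` Y. x)) (Arrow (f' ` Y) Y f')"
      unfolding image_fact_def
    proof (intro conjI)
      show "epic ?S (Arrow X (f' ` Y) (\<lambda>x\<in>f' ` Y. x))"
        by (rule epic_FinSet_op [THEN iffD2]) (use f in \<open>auto simp: inj_on_def\<close>)
      show "monic ?S (Arrow (f' ` Y) Y f')"
        by (rule monic_FinSet_op [THEN iffD2]) (use f in \<open>auto simp: PiE_iff\<close>)
      show "Arrow (f' ` Y) Y f' \<cdot>\<^bsub>?S\<^esub> Arrow X (f' ` Y) (\<lambda>x\<in>f' ` Y. x) = f"
        using f by (auto simp: FinSet_op_simps compose_def fun_eq_iff PiE_iff extensional_def)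
    qed (simp add: FinSet_op_simps)
    then show ?thesis by blast
  qed
  show "\<exists>i \<in> Hom ?S (Cod ?S e) (Cod ?S e'). iso_arr ?S i \<and> i \<cdot>\<^bsub>?S\<^esub> e = e' \<and> m' \<cdot>\<^bsub>?S\<^esub> i = m"
    if "image_fact ?S f e m" "image_fact ?S f e' m'" for f e m e' m'
  proof (rule FinSet.image_unique_from_lift [OF _ that])
    fix f e m e' m' assume em: "image_fact ?S f e m" and em': "image_fact ?S f e' m'"
    obtain X I e1 where e: "e = Arrow X I e1" "finite X" "finite I" "e1 \<in> I \<rightarrow>\<^sub>E X" "inj_on e1 I"
      using em epic_FinSet_op unfolding image_fact_def by (metis Arr_FinSet_opE FinSet.epic_arr)
    obtain Y m1 where m: "m = Arrow I Y m1" "finite Y" "m1 \<in> Y \<rightarrow>\<^sub>E I" "m1 ` Y = I"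
      using em monic_FinSet_op e(1) unfolding image_fact_def
      by (metis Arr_FinSet_opE FinSet.monic_arr FinSet_op_simps(2,3) arrow.sel(1,2))
    obtain X' I' e2 where e': "e' = Arrow X' I' e2" "finite X'" "finite I'" "e2 \<in> I' \<rightarrow>\<^sub>E X'" "inj_on e2 I'"
      using em' epic_FinSet_op unfolding image_fact_def by (metis Arr_FinSet_opE FinSet.epic_arr)
    obtain Y' m2 where m': "m' = Arrow I' Y' m2" "finite Y'" "m2 \<in> Y' \<rightarrow>\<^sub>E I'" "m2 ` Y' = I'"
      using em' monic_FinSet_op e'(1) unfolding image_fact_def
      by (metis Arr_FinSet_opE FinSet.monic_arr FinSet_op_simps(2,3) arrow.sel(1,2))
    have "m \<cdot>\<^bsub>?S\<^esub> e = m' \<cdot>\<^bsub>?S\<^esub> e'" using em em' by (simp add: image_fact_def)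
    then have eq: "X' = X" "Y' = Y" "compose Y e1 m1 = compose Y e2 m2" using e m e' m' by (auto simp: FinSet_op_simps)
    have "e1 (m1 y) = e2 (m2 y)" if "y \<in> Y" for y using fun_cong [OF eq(3), of y] that by (simp add: compose_def)
    then have "(\<lambda>y. e1 (m1 y)) ` Y = (\<lambda>y. e2 (m2 y)) ` Y" by (rule image_cong [OF refl])
    \<comment> \<open>The mono parts are surjective functions and drop out, so both injections have
      the same image.\<close>
    then have im: "e1 ` I = e2 ` I'" using m(4) m'(4) eq(2) by (metis image_image)
    have d: "inv_into I e1 (e2 i) \<in> I" "e1 (inv_into I e1 (e2 i)) = e2 i" if "i \<in> I'" for i
      using that im inv_into_into [of "e2 i" e1 I] f_inv_into_f [of "e2 i" e1 I] by blast+
    show "\<exists>d \<in> Hom ?S (Cod ?S e) (Cod ?S e'). d \<cdot>\<^bsub>?S\<^esub> e = e'"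
    \<comment> \<open>An arrow from \<open>I\<close> to \<open>I'\<close> is a function in the
      opposite direction: lift a point through the common image.\<close>
    proof (rule bexI [of _ "Arrow I I' (\<lambda>i\<in>I'. inv_into I e1 (e2 i))"])
      show "Arrow I I' (\<lambda>i\<in>I'. inv_into I e1 (e2 i)) \<cdot>\<^bsub>?S\<^esub> e = e'"
        using e e' eq d by (auto simp: FinSet_op_simps compose_def fun_eq_iff PiE_iff extensional_def)
    qed (use e e' d in \<open>auto simp: Hom_FinSet_op FinSet_op_simps\<close>)
  qed
  show pb: "\<exists>p q. is_pullback ?S f g p q" if "f \<in> Arr ?S" "g \<in> Arr ?S" "Cod ?S f = Cod ?S g" for f g
    using that by (rule ex_pullback_FinSet_op)
  show "\<exists>p q. is_pullback ?S f g p q" if "commuting_square ?S f g p q" for f g p q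
    using pb [of f g] that by (auto simp: commuting_square_def)
  show "\<exists>p q. is_pullback ?S f g p q" if "epic ?S f" "g \<in> Arr ?S" "Cod ?S f = Cod ?S g" for f g
    using pb [of f g] that by simp
  show "epic ?S q" "set_degree t q = set_degree t f" if "epic ?S f" "is_pullback ?S f g p q" for f g p q
    using pullback_degree_FinSet_op [OF that] .
  show "set_degree t (Idn ?S X) = 1" if "X \<in> Obj ?S" for X
    by (simp add: FinSet_op_simps set_degree_def image_def)
  show "set_degree t (g \<cdot>\<^bsub>?S\<^esub> f) = set_degree t g * set_degree t f" if ef: "epic ?S f" and eg: "epic ?S g" and fg: "Cod ?S f = Dom ?S g" for f g
  proof -
    obtain X Y f' where f: "f = Arrow X Y f'" "finite X" "finite Y" "f' \<in> Y \<rightarrow>\<^sub>E X" "inj_on f' Y"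
      using ef epic_FinSet_op by (metis Arr_FinSet_opE FinSet.epic_arr)
    obtain Z g' where g: "g = Arrow Y Z g'" "finite Z" "g' \<in> Z \<rightarrow>\<^sub>E Y" "inj_on g' Z"
      using eg epic_FinSet_op fg f by (metis Arr_FinSet_opE FinSet.epic_arr FinSet_op_simps(2,3) arrow.sel(1,2))
    have sub: "f' ` Y \<subseteq> X" "g' ` Z \<subseteq> Y" using f g by auto
    \<comment> \<open>The complement of the composite image splits into what \<open>f'\<close>
      misses and the image of what \<open>g'\<close> misses, so the exponents of \<open>t\<close>
      add.\<close>
    have "f' ` (Y - g' ` Z) = f' ` Y - f' ` (g' ` Z)"
      by (rule inj_on_image_set_diff [OF f(5)]) (use sub in auto)
    then have "X - f' ` (g' ` Z) = (X - f' ` Y) \<union> f' ` (Y - g' ` Z)" using sub by auto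
    moreover have "(X - f' ` Y) \<inter> f' ` (Y - g' ` Z) = {}" using f by auto
    moreover have "card (f' ` (Y - g' ` Z)) = card (Y - g' ` Z)"
      by (rule card_image) (use f(5) inj_on_subset in blast)
    ultimately have "card (X - f' ` (g' ` Z)) = card (X - f' ` Y) + card (Y - g' ` Z)"
      using f by (simp add: card_Un_disjoint)
    moreover have "compose Z f' g' ` Z = f' ` (g' ` Z)" by (simp add: compose_def image_image)
    ultimately show ?thesis using f g by (simp add: FinSet_op_simps set_degree_def power_add mult.commute)
  qed
qed

section \<open>Vector spaces over a finite field\<close>

locale finite_field = field F for F :: "'f ring" (structure) +
  assumes finite_carrier: "finite (carrier F)"
begin

abbreviation linear_maps where "linear_maps \<equiv> LinearCombinations.module_hom F"

lemma card_carrier_gt_1: "card (carrier F) > 1"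
proof -
  have "card {\<zero>, \<one>} \<le> card (carrier F)" by (rule card_mono) (use finite_carrier in auto)
  then show ?thesis by simp
qed

text \<open>Coordinates with respect to a finite basis identify vectors with scalar-valued functions
  on that basis.\<close>

lemma fin_dim_card:
  assumes "vectorspace F V" "vectorspace.fin_dim F V"
  shows "finite (carrier V)" "card (carrier V) = card (carrier F) ^ vectorspace.dim F V"
proof -
  interpret V: vectorspace F V by fact
  obtain \<beta> where \<beta>: "finite \<beta>" "V.basis \<beta>" using V.finite_basis_exists [OF assms(2)] by blast
  then have sub: "\<beta> \<subseteq> carrier V" by (simp add: V.basis_def)
  have u: "\<exists>!a. a \<in> \<beta> \<rightarrow>\<^sub>E carrier F \<and> V.lincomb a \<beta> = v" if "v \<in> carrier V" for v
    using V.basis_criterion [OF \<beta>(1) sub] \<beta>(2) that by blast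
  have c: "V.lincomb a \<beta> \<in> carrier V" if "a \<in> \<beta> \<rightarrow>\<^sub>E carrier F" for a
    by (rule V.lincomb_closed [OF sub]) (use that in auto)
  have bij: "bij_betw (\<lambda>a. V.lincomb a \<beta>) (\<beta> \<rightarrow>\<^sub>E carrier F) (carrier V)"
    unfolding bij_betw_def inj_on_def using u c by blast
  have fin: "finite (\<beta> \<rightarrow>\<^sub>E carrier F)" using \<beta>(1) finite_carrier by (simp add: finite_PiE)
  then show "finite (carrier V)" using bij bij_betw_finite by blast
  show "card (carrier V) = card (carrier F) ^ V.dim"
    using bij_betw_same_card [OF bij] \<beta> by (simp add: card_funcsetE V.dim_basis)
qed

text \<open>Over a finite field finite dimension may be replaced by finiteness of the carrier, which
  passes to subspaces, images and direct sums without choosing bases.\<close>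

lemma fin_dim_iff_finite:
  assumes "vectorspace F V"
  shows "vectorspace.fin_dim F V \<longleftrightarrow> finite (carrier V)"
proof
  interpret V: vectorspace F V by fact
  assume "finite (carrier V)"
  moreover have "V.span (carrier V) = carrier V"
    using V.in_own_span [of "carrier V"] V.span_is_subset2 [of "carrier V"] by blast
  ultimately show V.fin_dim unfolding V.fin_dim_def by blast
qed (use fin_dim_card [OF assms] in blast)

text \<open>Both cardinalities are powers of the number of scalars, which exceeds 1. A mere
  bijection between two kernels is therefore enough to compare their dimensions.\<close>

lemma dim_eq_if_card_eq:
  assumes "vectorspace F V" "finite (carrier V)" "vectorspace F W" "card (carrier W) = card (carrier V)"
  shows "vectorspace.dim F W = vectorspace.dim F V"
proof -
  \<comment> \<open>An infinite carrier would have cardinality 0, whereas that of \<open>V\<close>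
    is positive.\<close>
  have "finite (carrier W)"
  proof (rule card_ge_0_finite)
    interpret V: vectorspace F V by fact
    have "carrier V \<noteq> {}" using V.M.zero_closed by blast
    then show "0 < card (carrier W)" using assms(2,4) by (simp add: card_gt_0_iff)
  qed
  then have "card (carrier F) ^ vectorspace.dim F W = card (carrier F) ^ vectorspace.dim F V"
    using fin_dim_card(2) [OF assms(1)] fin_dim_card(2) [OF assms(3)] assms(2,4)
    by (simp add: fin_dim_iff_finite [OF assms(1)] fin_dim_iff_finite [OF assms(3)])
  then show ?thesis using card_carrier_gt_1 by simp
qed

lemma linear_map_iff: "linear_map F V W T \<longleftrightarrow> vectorspace F V \<and> vectorspace F W \<and> T \<in> linear_maps V W"
  by (auto simp: linear_map_def mod_hom_def mod_hom_axioms_def vectorspace_def)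

lemma module_hom_iff:
  "T \<in> linear_maps V W \<longleftrightarrow> T \<in> carrier V \<rightarrow> carrier W \<and>
     (\<forall>a\<in>carrier V. \<forall>b\<in>carrier V. T (a \<oplus>\<^bsub>V\<^esub> b) = T a \<oplus>\<^bsub>W\<^esub> T b) \<and>
     (\<forall>c\<in>carrier F. \<forall>a\<in>carrier V. T (c \<odot>\<^bsub>V\<^esub> a) = c \<odot>\<^bsub>W\<^esub> T a)"
  by (auto simp: LinearCombinations.module_hom_def)

lemma vectorspace_closed:
  assumes "vectorspace F V"
  shows "\<zero>\<^bsub>V\<^esub> \<in> carrier V" "\<lbrakk>a \<in> carrier V; b \<in> carrier V\<rbrakk> \<Longrightarrow> a \<oplus>\<^bsub>V\<^esub> b \<in> carrier V"
    "\<lbrakk>c \<in> carrier F; a \<in> carrier V\<rbrakk> \<Longrightarrow> c \<odot>\<^bsub>V\<^esub> a \<in> carrier V"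
proof -
  interpret V: vectorspace F V by fact
  show "\<zero>\<^bsub>V\<^esub> \<in> carrier V" "\<lbrakk>a \<in> carrier V; b \<in> carrier V\<rbrakk> \<Longrightarrow> a \<oplus>\<^bsub>V\<^esub> b \<in> carrier V"
    "\<lbrakk>c \<in> carrier F; a \<in> carrier V\<rbrakk> \<Longrightarrow> c \<odot>\<^bsub>V\<^esub> a \<in> carrier V" by auto
qed

lemma module_hom_zero:
  assumes "vectorspace F V" "vectorspace F W" "T \<in> linear_maps V W"
  shows "T \<zero>\<^bsub>V\<^esub> = \<zero>\<^bsub>W\<^esub>"
proof -
  interpret T: linear_map F V W T using assms by (simp add: linear_map_iff)
  show ?thesis by simp
qed

lemma module_hom_eq_iff:
  assumes "vectorspace F V" "vectorspace F W" "T \<in> linear_maps V W" "a \<in> carrier V" "b \<in> carrier V"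
  shows "T a = T b \<longleftrightarrow> T (a \<ominus>\<^bsub>V\<^esub> b) = \<zero>\<^bsub>W\<^esub>"
proof -
  interpret W: vectorspace F W by fact
  interpret T: linear_map F V W T using assms by (simp add: linear_map_iff)
  have T: "T a \<in> carrier W" "T b \<in> carrier W" using assms(4,5) by auto
  have "T a \<oplus>\<^bsub>W\<^esub> \<ominus>\<^bsub>W\<^esub> T b = \<zero>\<^bsub>W\<^esub> \<longleftrightarrow> T a = T b"
  proof
    assume "T a \<oplus>\<^bsub>W\<^esub> \<ominus>\<^bsub>W\<^esub> T b = \<zero>\<^bsub>W\<^esub>"
    then have "(T a \<oplus>\<^bsub>W\<^esub> \<ominus>\<^bsub>W\<^esub> T b) \<oplus>\<^bsub>W\<^esub> T b = \<zero>\<^bsub>W\<^esub> \<oplus>\<^bsub>W\<^esub> T b" by simp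
    then show "T a = T b" using T by (simp add: W.M.a_assoc W.M.l_neg)
  qed (use T W.M.r_neg in simp)
  then show ?thesis using assms(4,5) by (simp add: a_minus_def)
qed

lemma zero_module_hom:
  assumes "vectorspace F V" "vectorspace F W"
  shows "(\<lambda>v\<in>carrier V. \<zero>\<^bsub>W\<^esub>) \<in> linear_maps V W"
proof -
  interpret V: vectorspace F V by fact
  interpret W: vectorspace F W by fact
  show ?thesis by (auto simp: module_hom_iff)
qed

lemma restrict_module_hom:
  assumes "vectorspace F V" "T \<in> linear_maps V W"
  shows "restrict T (carrier V) \<in> linear_maps V W"
  using assms vectorspace_closed [OF assms(1)] by (auto simp: module_hom_iff)

lemma submodule_vectorspace:
  assumes "vectorspace F V" "submodule F N V"
  shows "vectorspace F (V\<lparr>carrier := N\<rparr>)"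
  using vectorspace.subspace_is_vs [OF assms(1)] assms by (simp add: VectorSpace.subspace_def)

lemma kernel_submodule:
  assumes "vectorspace F V" "vectorspace F W" "T \<in> linear_maps V W"
  shows "submodule F {v \<in> carrier V. T v = \<zero>\<^bsub>W\<^esub>} V"
proof -
  interpret T: linear_map F V W T using assms by (simp add: linear_map_iff)
  show ?thesis using T.ker_is_submodule unfolding T.ker_def .
qed

lemma image_submodule:
  assumes "vectorspace F V" "vectorspace F W" "T \<in> linear_maps V W"
  shows "submodule F (T ` carrier V) W"
proof -
  interpret T: linear_map F V W T using assms by (simp add: linear_map_iff)
  show ?thesis using T.im_is_submodule unfolding T.im_def .
qed

lemma rank_nullity_surj:
  assumes "vectorspace F V" "finite (carrier V)" "vectorspace F W" "T \<in> linear_maps V W" "T ` carrier V = carrier W"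
  shows "vectorspace.dim F W + vectorspace.dim F (V\<lparr>carrier := {v \<in> carrier V. T v = \<zero>\<^bsub>W\<^esub>}\<rparr>) = vectorspace.dim F V"
proof -
  interpret T: linear_map F V W T using assms by (simp add: linear_map_iff)
  have "T.im = carrier W" using assms(5) by (simp add: T.im_def)
  then have "W\<lparr>carrier := T.im\<rparr> = W" by simp
  then show ?thesis using T.rank_nullity assms(2) unfolding T.ker_def fin_dim_iff_finite [OF assms(1)] by simp
qed

text \<open>Transport of structure along \<open>\<phi>\<close>, possibly into another type of
  vectors. Applied to a choice of coset representatives it yields quotients, applied to an injective
  coding it yields a copy inside a prescribed type.\<close>

lemma quotient_by_congruence:
  assumes V: "vectorspace F V"
    and add: "\<And>a b a' b'. \<lbrakk>a \<in> carrier V; b \<in> carrier V; a' \<in> carrier V; b' \<in> carrier V; \<phi> a = \<phi> a'; \<phi> b = \<phi> b'\<rbrakk>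
      \<Longrightarrow> \<phi> (a \<oplus>\<^bsub>V\<^esub> b) = \<phi> (a' \<oplus>\<^bsub>V\<^esub> b')"
    and smult: "\<And>c a a'. \<lbrakk>c \<in> carrier F; a \<in> carrier V; a' \<in> carrier V; \<phi> a = \<phi> a'\<rbrakk> \<Longrightarrow> \<phi> (c \<odot>\<^bsub>V\<^esub> a) = \<phi> (c \<odot>\<^bsub>V\<^esub> a')"
  obtains Q :: "('f, 'v) module" where "vectorspace F Q" "carrier Q = \<phi> ` carrier V" "\<phi> \<in> linear_maps V Q"
proof -
  interpret V: vectorspace F V by fact
  define \<sigma> where "\<sigma> = inv_into (carrier V) \<phi>"
  \<comment> \<open>The multiplicative fields of the record stay arbitrary; being a vector space
    refers only to the four that are set.\<close>
  define Q :: "('f, 'v) module" where "Q = undefined\<lparr>carrier := \<phi> ` carrier V,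
    zero := \<phi> \<zero>\<^bsub>V\<^esub>, add := \<lambda>a b. \<phi> (\<sigma> a \<oplus>\<^bsub>V\<^esub> \<sigma> b), smult := \<lambda>c a. \<phi> (c \<odot>\<^bsub>V\<^esub> \<sigma> a)\<rparr>"
  have \<sigma>: "\<sigma> (\<phi> a) \<in> carrier V" "\<phi> (\<sigma> (\<phi> a)) = \<phi> a" if "a \<in> carrier V" for a
    using that unfolding \<sigma>_def by (auto intro: inv_into_into f_inv_into_f)
  have Q: "carrier Q = \<phi> ` carrier V" "\<zero>\<^bsub>Q\<^esub> = \<phi> \<zero>\<^bsub>V\<^esub>" by (simp_all add: Q_def)
  have Qadd: "\<phi> a \<oplus>\<^bsub>Q\<^esub> \<phi> b = \<phi> (a \<oplus>\<^bsub>V\<^esub> b)" if "a \<in> carrier V" "b \<in> carrier V" for a b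
    using add [of "\<sigma> (\<phi> a)" "\<sigma> (\<phi> b)" a b] \<sigma> that by (simp add: Q_def)
  have Qsmult: "c \<odot>\<^bsub>Q\<^esub> \<phi> a = \<phi> (c \<odot>\<^bsub>V\<^esub> a)" if "c \<in> carrier F" "a \<in> carrier V" for a c
    using smult [of c "\<sigma> (\<phi> a)" a] \<sigma> that by (simp add: Q_def)
  have "vectorspace F Q"
  proof (rule vs_criteria)
    show "field F" by unfold_locales
    show "\<forall>v\<in>carrier Q. \<exists>w\<in>carrier Q. v \<oplus>\<^bsub>Q\<^esub> w = \<zero>\<^bsub>Q\<^esub>"
      unfolding Q
    proof safe
      fix a assume a: "a \<in> carrier V"
      show "\<exists>w\<in>\<phi> ` carrier V. \<phi> a \<oplus>\<^bsub>Q\<^esub> w = \<phi> \<zero>\<^bsub>V\<^esub>"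
        by (rule bexI [of _ "\<phi> (\<ominus>\<^bsub>V\<^esub> a)"]) (use a in \<open>simp_all add: Qadd V.M.r_neg\<close>)
    qed
  qed (auto simp: Q Qadd Qsmult V.M.a_ac V.smult_assoc1 V.smult_l_distr V.smult_r_distr)
  moreover have "\<phi> \<in> linear_maps V Q" by (auto simp: module_hom_iff Q Qadd Qsmult)
  ultimately show thesis using that Q(1) by blast
qed

text \<open>Cosets are sets of vectors and would leave the type. One chosen vector per coset serves
  instead, so the quotient is an object of the same category and can be used as a test object
  there.\<close>

lemma quotient_vectorspace:
  fixes V :: "('f, 'v) module"
  assumes V: "vectorspace F V" and I: "submodule F I V"
  obtains Q :: "('f, 'v) module" and \<phi> where "vectorspace F Q" "carrier Q = \<phi> ` carrier V" "\<phi> \<in> linear_maps V Q"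
    "\<forall>v\<in>carrier V. \<phi> v = \<zero>\<^bsub>Q\<^esub> \<longleftrightarrow> v \<in> I"
proof -
  interpret V: vectorspace F V by fact
  interpret I: submodule F I V by fact
  have sub: "v \<in> carrier V" if "v \<in> I" for v using I.subset that by blast
  define r where "r a b \<longleftrightarrow> (\<exists>i\<in>I. a = b \<oplus>\<^bsub>V\<^esub> i)" for a b
  \<comment> \<open>Negation is multiplication by the scalar -1, so closure under scalars
    suffices.\<close>
  have neg: "\<ominus>\<^bsub>V\<^esub> i \<in> I" if "i \<in> I" for i
    using I.smult_closed [of "\<ominus> \<one>" i] that sub V.smult_minus_1 by simp
  have refl: "r a a" if "a \<in> carrier V" for a
    unfolding r_def by (rule bexI [of _ "\<zero>\<^bsub>V\<^esub>"]) (use that in simp_all)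
  have sym: "r b a" if ab: "r a b" "b \<in> carrier V" for a b
  proof -
    obtain i where i: "i \<in> I" "a = b \<oplus>\<^bsub>V\<^esub> i" using ab r_def by blast
    show ?thesis unfolding r_def
      by (rule bexI [of _ "\<ominus>\<^bsub>V\<^esub> i"]) (use i ab sub neg in \<open>simp_all add: V.M.a_assoc V.M.r_neg\<close>)
  qed
  have trans: "r a c" if abc: "r a b" "r b c" "c \<in> carrier V" for a b c
  proof -
    obtain i where i1: "i \<in> I" "a = b \<oplus>\<^bsub>V\<^esub> i" using abc(1) unfolding r_def by blast
    obtain j where j1: "j \<in> I" "b = c \<oplus>\<^bsub>V\<^esub> j" using abc(2) unfolding r_def by blast
    note i = i1(1) j1(1) i1(2) j1(2)
    have "a = c \<oplus>\<^bsub>V\<^esub> (j \<oplus>\<^bsub>V\<^esub> i)" unfolding i(3,4) by (rule V.M.a_assoc) (use i(1,2) abc(3) sub in simp_all)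
    then show ?thesis unfolding r_def using i(1,2) by blast
  qed
  have add: "r (a \<oplus>\<^bsub>V\<^esub> b) (a' \<oplus>\<^bsub>V\<^esub> b')" if *: "r a a'" "r b b'" "a' \<in> carrier V" "b' \<in> carrier V" for a b a' b'
  proof -
    obtain i where i1: "i \<in> I" "a = a' \<oplus>\<^bsub>V\<^esub> i" using *(1) unfolding r_def by blast
    obtain j where j1: "j \<in> I" "b = b' \<oplus>\<^bsub>V\<^esub> j" using *(2) unfolding r_def by blast
    note i = i1(1) j1(1) i1(2) j1(2)
    have "a \<oplus>\<^bsub>V\<^esub> b = (a' \<oplus>\<^bsub>V\<^esub> b') \<oplus>\<^bsub>V\<^esub> (i \<oplus>\<^bsub>V\<^esub> j)"
      unfolding i(3,4) using i(1,2) *(3,4) sub by (simp add: V.M.a_ac)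
    then show ?thesis unfolding r_def using i(1,2) by blast
  qed
  have smult: "r (c \<odot>\<^bsub>V\<^esub> a) (c \<odot>\<^bsub>V\<^esub> b)" if *: "r a b" "b \<in> carrier V" "c \<in> carrier F" for a b c
  proof -
    obtain i where i: "i \<in> I" "a = b \<oplus>\<^bsub>V\<^esub> i" using * r_def by blast
    have "c \<odot>\<^bsub>V\<^esub> a = c \<odot>\<^bsub>V\<^esub> b \<oplus>\<^bsub>V\<^esub> c \<odot>\<^bsub>V\<^esub> i"
      unfolding i(2) using i(1) *(2,3) sub by (simp add: V.smult_r_distr)
    then show ?thesis unfolding r_def using i(1) *(3) by blast
  qed
  define \<phi> where "\<phi> a = (SOME x. x \<in> carrier V \<and> r x a)" for a
  have \<phi>: "\<phi> a \<in> carrier V" "r (\<phi> a) a" if "a \<in> carrier V" for a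
    using someI [of "\<lambda>x. x \<in> carrier V \<and> r x a" a] that refl unfolding \<phi>_def by blast+
  have \<phi>_eq: "\<phi> a = \<phi> b \<longleftrightarrow> r a b" if ab: "a \<in> carrier V" "b \<in> carrier V" for a b
  proof
    assume "\<phi> a = \<phi> b"
    then have "r (\<phi> a) b" using \<phi>(2) [OF ab(2)] by simp
    moreover have "r a (\<phi> a)" by (rule sym [OF \<phi>(2) ab(1)]) (rule ab)
    ultimately show "r a b" using trans ab by blast
  next
    assume "r a b"
    \<comment> \<open>Related vectors have the same candidates for a representative, so the choice
      operator returns the same one.\<close>
    then have "x \<in> carrier V \<and> r x a \<longleftrightarrow> x \<in> carrier V \<and> r x b" for x using trans sym ab by blast
    then show "\<phi> a = \<phi> b" unfolding \<phi>_def by simp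
  qed
  obtain Q :: "('f, 'v) module" where Q: "vectorspace F Q" "carrier Q = \<phi> ` carrier V" "\<phi> \<in> linear_maps V Q"
  proof (rule quotient_by_congruence [OF V, of \<phi>])
    show "\<phi> (a \<oplus>\<^bsub>V\<^esub> b) = \<phi> (a' \<oplus>\<^bsub>V\<^esub> b')"
      if "a \<in> carrier V" "b \<in> carrier V" "a' \<in> carrier V" "b' \<in> carrier V" "\<phi> a = \<phi> a'" "\<phi> b = \<phi> b'" for a b a' b'
      using that add by (simp add: \<phi>_eq)
    show "\<phi> (c \<odot>\<^bsub>V\<^esub> a) = \<phi> (c \<odot>\<^bsub>V\<^esub> a')" if "c \<in> carrier F" "a \<in> carrier V" "a' \<in> carrier V" "\<phi> a = \<phi> a'" for a a' c
      using that smult by (simp add: \<phi>_eq)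
  qed
  have "\<phi> v = \<zero>\<^bsub>Q\<^esub> \<longleftrightarrow> v \<in> I" if v: "v \<in> carrier V" for v
  proof -
    have "\<phi> v = \<zero>\<^bsub>Q\<^esub> \<longleftrightarrow> r v \<zero>\<^bsub>V\<^esub>" using \<phi>_eq [OF v V.M.zero_closed] module_hom_zero [OF V Q(1,3)] by simp
    also have "\<dots> \<longleftrightarrow> v \<in> I" unfolding r_def using v sub by (metis V.M.l_zero)
    finally show ?thesis .
  qed
  with Q that show thesis by blast
qed

end

section \<open>The category of finite-dimensional vector spaces\<close>

context finite_field begin

lemma FinVect_simps:
  "Dom (FinVect F) = arr_dom" "Cod (FinVect F) = arr_cod" "Idn (FinVect F) V = Arrow V V (\<lambda>v\<in>carrier V. v)"
  "Comp (FinVect F) (Arrow W' U S) (Arrow V W T) = Arrow V U (compose (carrier V) S T)"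
  by (simp_all add: FinVect_def)

lemma Obj_FinVect: "V \<in> Obj (FinVect F) \<longleftrightarrow> vectorspace F V \<and> finite (carrier V)"
  using fin_dim_iff_finite by (auto simp: FinVect_def)

lemma Arr_FinVect: "Arrow V W T \<in> Arr (FinVect F) \<longleftrightarrow> vectorspace F V \<and> finite (carrier V) \<and> vectorspace F W \<and> finite (carrier W) \<and>
    T \<in> linear_maps V W \<and> T \<in> extensional (carrier V)"
  using fin_dim_iff_finite by (auto simp: FinVect_def linear_map_iff)

lemma Arr_FinVectE:
  assumes "f \<in> Arr (FinVect F)"
  obtains V W T where "f = Arrow V W T" "vectorspace F V" "finite (carrier V)" "vectorspace F W" "finite (carrier W)"
    "T \<in> linear_maps V W" "T \<in> extensional (carrier V)"
  using assms by (cases f) (simp add: Arr_FinVect)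

lemma Hom_FinVect: "Hom (FinVect F) V W = Arrow V W ` {T. vectorspace F V \<and> finite (carrier V) \<and> vectorspace F W \<and> finite (carrier W) \<and>
    T \<in> linear_maps V W \<and> T \<in> extensional (carrier V)}"
proof (rule Set.set_eqI)
  fix f show "f \<in> Hom (FinVect F) V W \<longleftrightarrow> f \<in> Arrow V W ` {T. vectorspace F V \<and> finite (carrier V) \<and> vectorspace F W \<and> finite (carrier W) \<and>
    T \<in> linear_maps V W \<and> T \<in> extensional (carrier V)}"
    by (cases f) (auto simp: Hom_iff FinVect_simps Arr_FinVect)
qed

lemma module_hom_closed: "\<lbrakk>T \<in> linear_maps V W; v \<in> carrier V\<rbrakk> \<Longrightarrow> T v \<in> carrier W"
  by (auto simp: module_hom_iff)

lemma compose_module_hom: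
  assumes "vectorspace F V" "T \<in> linear_maps V W" "S \<in> linear_maps W U"
  shows "compose (carrier V) S T \<in> linear_maps V U"
  using assms vectorspace_closed [OF assms(1)] by (auto simp: module_hom_iff compose_def Pi_iff)

lemma module_hom_eqI:
  assumes "S \<in> extensional (carrier V)" "T \<in> extensional (carrier V)" "\<And>v. v \<in> carrier V \<Longrightarrow> S v = T v"
  shows "S = T"
  using assms by (rule extensionalityI)

lemma Idn_module_hom: "vectorspace F V \<Longrightarrow> (\<lambda>v\<in>carrier V. v) \<in> linear_maps V V"
  by (simp add: module_hom_iff vectorspace_closed)

sublocale FV: category "FinVect F :: (('f, 'v) module, (('f, 'v) module, 'v \<Rightarrow> 'v) arrow) category"
proof
  let ?C = "FinVect F :: (('f, 'v) module, (('f, 'v) module, 'v \<Rightarrow> 'v) arrow) category"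
  show "f \<in> Arr ?C \<Longrightarrow> Dom ?C f \<in> Obj ?C" "f \<in> Arr ?C \<Longrightarrow> Cod ?C f \<in> Obj ?C" for f
    by (cases f; simp add: Arr_FinVect FinVect_simps Obj_FinVect)+
  show "V \<in> Obj ?C \<Longrightarrow> Idn ?C V \<in> Hom ?C V V" for V
    by (simp add: FinVect_simps Hom_FinVect Obj_FinVect Idn_module_hom)
  show "g \<cdot>\<^bsub>?C\<^esub> f \<in> Hom ?C X Z" if "f \<in> Hom ?C X Y" "g \<in> Hom ?C Y Z" for f g X Y Z
    using that by (auto simp: Hom_FinVect FinVect_simps compose_module_hom)
  show "f \<cdot>\<^bsub>?C\<^esub> Idn ?C X = f" "Idn ?C Y \<cdot>\<^bsub>?C\<^esub> f = f" if "f \<in> Hom ?C X Y" for f X Y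
    using that by (auto simp: Hom_FinVect FinVect_simps Id_compose compose_Id module_hom_iff)
  show "(h \<cdot>\<^bsub>?C\<^esub> g) \<cdot>\<^bsub>?C\<^esub> f = h \<cdot>\<^bsub>?C\<^esub> (g \<cdot>\<^bsub>?C\<^esub> f)"
    if "f \<in> Hom ?C W X" "g \<in> Hom ?C X Y" "h \<in> Hom ?C Y Z" for f g h W X Y Z
    using that by (auto simp: Hom_FinVect FinVect_simps compose_def module_hom_iff Pi_iff fun_eq_iff)
qed

text \<open>The quotient map by the image and the zero map agree after \<open>T\<close>. If
  \<open>T\<close> can be cancelled, the quotient map is zero and nothing lies outside the
  image.\<close>

lemma epic_FinVect:
  fixes V W :: "('f, 'v) module"
  assumes T: "Arrow V W T \<in> Arr (FinVect F)"
  shows "epic (FinVect F) (Arrow V W T) \<longleftrightarrow> T ` carrier V = carrier W"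
proof
  have *: "vectorspace F V" "vectorspace F W" "T \<in> linear_maps V W" "finite (carrier W)" using T by (auto simp: Arr_FinVect)
  note TW = module_hom_closed [OF *(3)]
  assume e: "epic (FinVect F) (Arrow V W T)"
  obtain Q :: "('f, 'v) module" and \<phi> where Q: "vectorspace F Q" "carrier Q = \<phi> ` carrier W" "\<phi> \<in> linear_maps W Q"
    "\<forall>w\<in>carrier W. \<phi> w = \<zero>\<^bsub>Q\<^esub> \<longleftrightarrow> w \<in> T ` carrier V"
    by (rule quotient_vectorspace [OF *(2) image_submodule [OF *(1-3)]])
  have "Arrow W Q (restrict \<phi> (carrier W)) = Arrow W Q (\<lambda>w\<in>carrier W. \<zero>\<^bsub>Q\<^esub>)"
  proof (rule FV.epicD [OF e])
    show "Arrow W Q (restrict \<phi> (carrier W)) \<cdot>\<^bsub>FinVect F\<^esub> Arrow V W T = Arrow W Q (\<lambda>w\<in>carrier W. \<zero>\<^bsub>Q\<^esub>) \<cdot>\<^bsub>FinVect F\<^esub> Arrow V W T"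
      using Q(4) TW by (auto simp: FinVect_simps compose_def fun_eq_iff)
  qed (use * Q(1-3) in \<open>simp_all add: FinVect_simps Arr_FinVect zero_module_hom restrict_module_hom\<close>)
  then have eq: "restrict \<phi> (carrier W) = (\<lambda>w\<in>carrier W. \<zero>\<^bsub>Q\<^esub>)" by simp
  have "w \<in> T ` carrier V" if "w \<in> carrier W" for w
    using fun_cong [OF eq, of w] that Q(4) by simp
  then show "T ` carrier V = carrier W" using TW by auto
next
  assume surj: "T ` carrier V = carrier W"
  show "epic (FinVect F) (Arrow V W T)"
  proof (rule FV.epicI [OF T])
    fix f g assume *: "f \<in> Arr (FinVect F)" "g \<in> Arr (FinVect F)" "Cod (FinVect F) f = Cod (FinVect F) g"
      "Dom (FinVect F) f = Cod (FinVect F) (Arrow V W T)" "Dom (FinVect F) g = Cod (FinVect F) (Arrow V W T)"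
      "f \<cdot>\<^bsub>FinVect F\<^esub> Arrow V W T = g \<cdot>\<^bsub>FinVect F\<^esub> Arrow V W T"
    obtain U f' where f: "f = Arrow W U f'" "f' \<in> extensional (carrier W)" using *(1,4) by (auto elim!: Arr_FinVectE simp: FinVect_simps)
    obtain g' where g: "g = Arrow W U g'" "g' \<in> extensional (carrier W)" using *(2,3,5) f by (auto elim!: Arr_FinVectE simp: FinVect_simps)
    have eq: "compose (carrier V) f' T = compose (carrier V) g' T" using *(6) f g by (simp add: FinVect_simps)
    have T_eq: "f' (T v) = g' (T v)" if "v \<in> carrier V" for v using fun_cong [OF eq, of v] that by (simp add: compose_def)
    have "f' w = g' w" if "w \<in> carrier W" for w
    proof -
      have "w \<in> T ` carrier V" using that surj by simp
      then show ?thesis by (rule imageE) (simp add: T_eq)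
    qed
    then show "f = g" using f g module_hom_eqI by blast
  qed
qed

text \<open>The inclusion of the kernel is compared with the zero map; cancelling \<open>T\<close>
  makes the kernel trivial.\<close>

lemma monic_FinVect:
  assumes T: "Arrow V W T \<in> Arr (FinVect F)"
  shows "monic (FinVect F) (Arrow V W T) \<longleftrightarrow> inj_on T (carrier V)"
proof
  have *: "vectorspace F V" "vectorspace F W" "T \<in> linear_maps V W" "finite (carrier V)" using T by (auto simp: Arr_FinVect)
  interpret V: vectorspace F V by (rule *)
  note TW = module_hom_closed [OF *(3)]
  assume m: "monic (FinVect F) (Arrow V W T)"
  define N where "N = V\<lparr>carrier := {v \<in> carrier V. T v = \<zero>\<^bsub>W\<^esub>}\<rparr>"
  have N: "vectorspace F N" unfolding N_def by (rule submodule_vectorspace [OF *(1) kernel_submodule [OF *(1-3)]])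
  have "Arrow N V (\<lambda>v\<in>carrier N. v) = Arrow N V (\<lambda>v\<in>carrier N. \<zero>\<^bsub>V\<^esub>)"
  proof (rule FV.monicD [OF m])
    show "Arrow V W T \<cdot>\<^bsub>FinVect F\<^esub> Arrow N V (\<lambda>v\<in>carrier N. v) = Arrow V W T \<cdot>\<^bsub>FinVect F\<^esub> Arrow N V (\<lambda>v\<in>carrier N. \<zero>\<^bsub>V\<^esub>)"
      using module_hom_zero [OF *(1-3)] by (auto simp: FinVect_simps compose_def fun_eq_iff N_def)
    show "Arrow N V (\<lambda>v\<in>carrier N. v) \<in> Arr (FinVect F)" "Arrow N V (\<lambda>v\<in>carrier N. \<zero>\<^bsub>V\<^esub>) \<in> Arr (FinVect F)"
      using * N vectorspace_closed [OF N] zero_module_hom [OF N *(1)]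
      by (auto simp: Arr_FinVect module_hom_iff N_def)
  qed (simp_all add: FinVect_simps)
  then have eq: "(\<lambda>v\<in>carrier N. v) = (\<lambda>v\<in>carrier N. \<zero>\<^bsub>V\<^esub>)" by simp
  have ker: "v = \<zero>\<^bsub>V\<^esub>" if "v \<in> carrier V" "T v = \<zero>\<^bsub>W\<^esub>" for v using fun_cong [OF eq, of v] that by (simp add: N_def)
  show "inj_on T (carrier V)"
  proof (rule inj_onI)
    fix a b assume ab: "a \<in> carrier V" "b \<in> carrier V" "T a = T b"
    then have "T (a \<ominus>\<^bsub>V\<^esub> b) = \<zero>\<^bsub>W\<^esub>" using module_hom_eq_iff [OF *(1-3)] by blast
    then have "a \<ominus>\<^bsub>V\<^esub> b = \<zero>\<^bsub>V\<^esub>" using ker ab by simp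
    then have "(a \<ominus>\<^bsub>V\<^esub> b) \<oplus>\<^bsub>V\<^esub> b = b" using ab by simp
    then show "a = b" using ab by (simp add: a_minus_def V.M.a_assoc V.M.l_neg)
  qed
next
  assume inj: "inj_on T (carrier V)"
  show "monic (FinVect F) (Arrow V W T)"
  proof (rule FV.monicI [OF T])
    fix f g assume *: "f \<in> Arr (FinVect F)" "g \<in> Arr (FinVect F)" "Dom (FinVect F) f = Dom (FinVect F) g"
      "Cod (FinVect F) f = Dom (FinVect F) (Arrow V W T)" "Cod (FinVect F) g = Dom (FinVect F) (Arrow V W T)"
      "Arrow V W T \<cdot>\<^bsub>FinVect F\<^esub> f = Arrow V W T \<cdot>\<^bsub>FinVect F\<^esub> g"
    obtain U f' where f: "f = Arrow U V f'" "f' \<in> extensional (carrier U)" "f' \<in> linear_maps U V"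
      using *(1,4) by (auto elim!: Arr_FinVectE simp: FinVect_simps)
    obtain g' where g: "g = Arrow U V g'" "g' \<in> extensional (carrier U)" "g' \<in> linear_maps U V"
      using *(2,3,5) f by (auto elim!: Arr_FinVectE simp: FinVect_simps)
    have eq: "compose (carrier U) T f' = compose (carrier U) T g'" using *(6) f g by (simp add: FinVect_simps)
    have "T (f' v) = T (g' v)" if "v \<in> carrier U" for v using fun_cong [OF eq, of v] that by (simp add: compose_def)
    then have "f' v = g' v" if "v \<in> carrier U" for v
      using inj_onD [OF inj, of "f' v" "g' v"] that module_hom_closed [OF f(3)] module_hom_closed [OF g(3)] by simp
    then show "f = g" using f g module_hom_eqI by blast
  qed
qed

lemma terminal_FinVect_if:
  assumes "vectorspace F V" "carrier V = {z}"
  shows "terminal (FinVect F) V"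
proof -
  have z: "\<zero>\<^bsub>V\<^esub> = z" using vectorspace_closed(1) [OF assms(1)] assms(2) by simp
  have "\<exists>!f. f \<in> Hom (FinVect F) U V" if U: "U \<in> Obj (FinVect F)" for U
  proof (rule ex1I [of _ "Arrow U V (\<lambda>u\<in>carrier U. \<zero>\<^bsub>V\<^esub>)"])
    show "Arrow U V (\<lambda>u\<in>carrier U. \<zero>\<^bsub>V\<^esub>) \<in> Hom (FinVect F) U V"
      using U assms zero_module_hom [of U V] by (simp add: Hom_FinVect Obj_FinVect)
    fix f assume "f \<in> Hom (FinVect F) U V"
    then obtain T where T: "f = Arrow U V T" "T \<in> linear_maps U V" "T \<in> extensional (carrier U)"
      by (auto simp: Hom_FinVect)
    have "T = (\<lambda>u\<in>carrier U. \<zero>\<^bsub>V\<^esub>)"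
      by (rule module_hom_eqI [OF T(3)]) (use module_hom_closed [OF T(2)] assms(2) z in auto)
    then show "f = Arrow U V (\<lambda>u\<in>carrier U. \<zero>\<^bsub>V\<^esub>)" using T by simp
  qed
  then show ?thesis using assms unfolding terminal_def by (auto simp: Obj_FinVect)
qed

lemma ex_zero_space:
  obtains V :: "('f, 'v) module" and z where "vectorspace F V" "carrier V = {z}"
proof -
  define V :: "('f, 'v) module" where
    "V = undefined\<lparr>carrier := {undefined}, zero := undefined, add := \<lambda>_ _. undefined, smult := \<lambda>_ _. undefined\<rparr>"
  have "vectorspace F V"
  proof (rule vs_criteria)
    show "field F" by unfold_locales
  qed (simp_all add: V_def)
  moreover have "carrier V = {undefined}" by (simp add: V_def)
  ultimately show thesis by (rule that)
qed

text \<open>A fibre product on the level of elements is one of vector spaces: uniqueness of the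
  lifted element makes the mediating function additive and homogeneous.\<close>

lemma is_pullback_FinVectI:
  assumes f: "Arrow V U f \<in> Arr (FinVect F)" and g: "Arrow W U g \<in> Arr (FinVect F)"
    and p: "Arrow P V p \<in> Arr (FinVect F)" and q: "Arrow P W q \<in> Arr (FinVect F)"
    and comm: "\<And>z. z \<in> carrier P \<Longrightarrow> f (p z) = g (q z)"
    and ex1: "\<And>x y. \<lbrakk>x \<in> carrier V; y \<in> carrier W; f x = g y\<rbrakk> \<Longrightarrow> \<exists>!z. z \<in> carrier P \<and> p z = x \<and> q z = y"
  shows "is_pullback (FinVect F) (Arrow V U f) (Arrow W U g) (Arrow P V p) (Arrow P W q)"
proof (rule FV.is_pullbackI [OF f g p q])
  have hom: "p \<in> linear_maps P V" "q \<in> linear_maps P W" "vectorspace F P" "finite (carrier P)"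
    "vectorspace F V" "vectorspace F W" "f \<in> linear_maps V U" "g \<in> linear_maps W U"
    using f g p q by (auto simp: Arr_FinVect)
  note P = vectorspace_closed [OF hom(3)]
  have uniq: "z = z'" if z: "z \<in> carrier P" "z' \<in> carrier P" "p z = p z'" "q z = q z'" for z z'
  proof -
    have "\<exists>!w. w \<in> carrier P \<and> p w = p z' \<and> q w = q z'"
      by (rule ex1 [OF module_hom_closed [OF hom(1) z(2)] module_hom_closed [OF hom(2) z(2)] comm [OF z(2)]])
    then show ?thesis using z by blast
  qed
  show "Arrow V U f \<cdot>\<^bsub>FinVect F\<^esub> Arrow P V p = Arrow W U g \<cdot>\<^bsub>FinVect F\<^esub> Arrow P W q"
    using comm by (auto simp: FinVect_simps compose_def fun_eq_iff)
  fix p' q' assume *: "p' \<in> Arr (FinVect F)" "q' \<in> Arr (FinVect F)" "Dom (FinVect F) q' = Dom (FinVect F) p'"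
    "Cod (FinVect F) p' = Dom (FinVect F) (Arrow V U f)" "Cod (FinVect F) q' = Dom (FinVect F) (Arrow W U g)"
    "Arrow V U f \<cdot>\<^bsub>FinVect F\<^esub> p' = Arrow W U g \<cdot>\<^bsub>FinVect F\<^esub> q'"
  obtain Q h where h: "p' = Arrow Q V h" "vectorspace F Q" "finite (carrier Q)" "h \<in> linear_maps Q V" "h \<in> extensional (carrier Q)"
    using *(1,4) by (auto elim!: Arr_FinVectE simp: FinVect_simps)
  obtain k where k: "q' = Arrow Q W k" "k \<in> linear_maps Q W" "k \<in> extensional (carrier Q)"
    using *(2,3,5) h(1) by (auto elim!: Arr_FinVectE simp: FinVect_simps)
  note hC = module_hom_closed [OF h(4)] and kC = module_hom_closed [OF k(2)] and Q = vectorspace_closed [OF h(2)]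
  have eq: "compose (carrier Q) f h = compose (carrier Q) g k" using *(6) h k by (simp add: FinVect_simps)
  have fh: "f (h v) = g (k v)" if "v \<in> carrier Q" for v using fun_cong [OF eq, of v] that by (simp add: compose_def)
  define u where "u = (\<lambda>v\<in>carrier Q. THE z. z \<in> carrier P \<and> p z = h v \<and> q z = k v)"
  have u: "u v \<in> carrier P" "p (u v) = h v" "q (u v) = k v" if "v \<in> carrier Q" for v
    using theI' [OF ex1 [OF hC [OF that] kC [OF that] fh [OF that]]] that by (auto simp: u_def)
  have "u \<in> linear_maps Q P"
    unfolding module_hom_iff
  proof (intro conjI ballI)
    show "u \<in> carrier Q \<rightarrow> carrier P" using u by auto
    show "u (a \<oplus>\<^bsub>Q\<^esub> b) = u a \<oplus>\<^bsub>P\<^esub> u b" if "a \<in> carrier Q" "b \<in> carrier Q" for a b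
      by (rule uniq) (use that u P Q hom(1,2) h(4) k(2) in \<open>simp_all add: module_hom_iff\<close>)
    show "u (c \<odot>\<^bsub>Q\<^esub> a) = c \<odot>\<^bsub>P\<^esub> u a" if "c \<in> carrier F" "a \<in> carrier Q" for c a
      by (rule uniq) (use that u P Q hom(1,2) h(4) k(2) in \<open>simp_all add: module_hom_iff\<close>)
  qed
  then have "Arrow Q P u \<in> Arr (FinVect F)" using hom h by (simp add: Arr_FinVect u_def)
  moreover have "compose (carrier Q) p u = h" "compose (carrier Q) q u = k"
    by (rule extensionalityI [of _ "carrier Q"]; use u h k in \<open>simp add: compose_def\<close>)+
  ultimately show "\<exists>u. u \<in> Arr (FinVect F) \<and> Dom (FinVect F) u = Dom (FinVect F) p' \<and> Cod (FinVect F) u = Dom (FinVect F) (Arrow P V p) \<and>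
     Arrow P V p \<cdot>\<^bsub>FinVect F\<^esub> u = p' \<and> Arrow P W q \<cdot>\<^bsub>FinVect F\<^esub> u = q'"
    using h k by (intro exI [of _ "Arrow Q P u"]) (simp add: FinVect_simps)
next
  fix u v assume *: "u \<in> Arr (FinVect F)" "v \<in> Arr (FinVect F)" "Dom (FinVect F) u = Dom (FinVect F) v"
    "Cod (FinVect F) u = Dom (FinVect F) (Arrow P V p)" "Cod (FinVect F) v = Dom (FinVect F) (Arrow P V p)"
    "Arrow P V p \<cdot>\<^bsub>FinVect F\<^esub> u = Arrow P V p \<cdot>\<^bsub>FinVect F\<^esub> v" "Arrow P W q \<cdot>\<^bsub>FinVect F\<^esub> u = Arrow P W q \<cdot>\<^bsub>FinVect F\<^esub> v"
  obtain Q h where h: "u = Arrow Q P h" "h \<in> linear_maps Q P" "h \<in> extensional (carrier Q)"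
    using *(1,4) by (auto elim!: Arr_FinVectE simp: FinVect_simps)
  obtain k where k: "v = Arrow Q P k" "k \<in> linear_maps Q P" "k \<in> extensional (carrier Q)"
    using *(2,3,5) h(1) by (auto elim!: Arr_FinVectE simp: FinVect_simps)
  have hom: "p \<in> linear_maps P V" "q \<in> linear_maps P W"
    using p q by (auto simp: Arr_FinVect)
  have eq: "compose (carrier Q) p h = compose (carrier Q) p k" "compose (carrier Q) q h = compose (carrier Q) q k"
    using *(6,7) h k by (simp_all add: FinVect_simps)
  have "h w = k w" if w: "w \<in> carrier Q" for w
  proof -
    have pq: "p (h w) = p (k w)" "q (h w) = q (k w)"
      using fun_cong [OF eq(1), of w] fun_cong [OF eq(2), of w] w by (simp_all add: compose_def)
    have P: "h w \<in> carrier P" "k w \<in> carrier P" using module_hom_closed [OF h(2) w] module_hom_closed [OF k(2) w] .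
    have "\<exists>!z. z \<in> carrier P \<and> p z = p (k w) \<and> q z = q (k w)"
      by (rule ex1 [OF module_hom_closed [OF hom(1) P(2)] module_hom_closed [OF hom(2) P(2)] comm [OF P(2)]])
    then show ?thesis using pq P by blast
  qed
  then show "u = v" using h k module_hom_eqI by blast
qed (simp_all add: FinVect_simps)

text \<open>The fibre product is a subspace of the direct sum, whose vectors are pairs. Being
  finite, it embeds into the infinite type \<open>'v\<close>, and its structure is transported
  there.\<close>

lemma ex_pullback_FinVect:
  assumes inf: "infinite (UNIV :: 'v set)"
    and f: "Arrow V U f \<in> Arr (FinVect F)" and g: "Arrow W U g \<in> Arr (FinVect F :: (('f, 'v) module, (('f, 'v) module, 'v \<Rightarrow> 'v) arrow) category)"
  obtains P p q where "Arrow P V p \<in> Arr (FinVect F)" "Arrow P W q \<in> Arr (FinVect F)"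
    "is_pullback (FinVect F) (Arrow V U f) (Arrow W U g) (Arrow P V p) (Arrow P W q)"
    "\<forall>x\<in>carrier V. \<forall>y\<in>carrier W. f x = g y \<longrightarrow> (\<exists>!z. z \<in> carrier P \<and> p z = x \<and> q z = y)"
proof -
  have hom: "vectorspace F V" "vectorspace F W" "vectorspace F U" "f \<in> linear_maps V U" "g \<in> linear_maps W U"
    "finite (carrier V)" "finite (carrier W)"
    using f g by (auto simp: Arr_FinVect)
  define D where "D = direct_sum V W"
  have D: "vectorspace F D" unfolding D_def by (rule direct_sum_is_vs [OF hom(1,2)])
  have Ds: "carrier D = carrier V \<times> carrier W" "\<zero>\<^bsub>D\<^esub> = (\<zero>\<^bsub>V\<^esub>, \<zero>\<^bsub>W\<^esub>)"
    "\<And>a b. a \<oplus>\<^bsub>D\<^esub> b = (fst a \<oplus>\<^bsub>V\<^esub> fst b, snd a \<oplus>\<^bsub>W\<^esub> snd b)" "\<And>c a. c \<odot>\<^bsub>D\<^esub> a = (c \<odot>\<^bsub>V\<^esub> fst a, c \<odot>\<^bsub>W\<^esub> snd a)"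
    by (simp_all add: D_def direct_sum_def split_def)
  define N where "N = {(x, y). x \<in> carrier V \<and> y \<in> carrier W \<and> f x = g y}"
  have "submodule F N D"
  proof (rule LinearCombinations.submodule.intro)
    show "Module.module F D" using D by (simp add: vectorspace_def)
    show "N \<subseteq> carrier D" by (auto simp: N_def Ds)
    show "\<zero>\<^bsub>D\<^esub> \<in> N" using module_hom_zero [OF hom(1,3,4)] module_hom_zero [OF hom(2,3,5)] vectorspace_closed(1) [OF hom(1)] vectorspace_closed(1) [OF hom(2)] by (simp add: N_def Ds)
    show "a \<oplus>\<^bsub>D\<^esub> b \<in> N" if "a \<in> N" "b \<in> N" for a b
      using that hom vectorspace_closed [OF hom(1)] vectorspace_closed [OF hom(2)] by (auto simp: N_def Ds module_hom_iff)
    show "c \<odot>\<^bsub>D\<^esub> a \<in> N" if "c \<in> carrier F" "a \<in> N" for a c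
      using that hom vectorspace_closed [OF hom(1)] vectorspace_closed [OF hom(2)] by (auto simp: N_def Ds module_hom_iff)
  qed
  from submodule_vectorspace [OF D this] have N: "vectorspace F (D\<lparr>carrier := N\<rparr>)" .
  have finN: "finite N" by (rule finite_subset [of _ "carrier V \<times> carrier W"]) (use hom in \<open>auto simp: N_def\<close>)
  obtain \<iota> :: "'v \<times> 'v \<Rightarrow> 'v" where \<iota>: "inj_on \<iota> N" using finite_inj_infinite [OF finN inf] by blast
  obtain P :: "('f, 'v) module" where P: "vectorspace F P" "carrier P = \<iota> ` carrier (D\<lparr>carrier := N\<rparr>)"
    "\<iota> \<in> linear_maps (D\<lparr>carrier := N\<rparr>) P"
  proof (rule quotient_by_congruence [OF N, of \<iota>])
    let ?N = "D\<lparr>carrier := N\<rparr>"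
    have eqD: "a = b" if "a \<in> carrier ?N" "b \<in> carrier ?N" "\<iota> a = \<iota> b" for a b
      using inj_onD [OF \<iota> that(3)] that by simp
    show "\<iota> (a \<oplus>\<^bsub>?N\<^esub> b) = \<iota> (a' \<oplus>\<^bsub>?N\<^esub> b')"
      if "a \<in> carrier ?N" "b \<in> carrier ?N" "a' \<in> carrier ?N" "b' \<in> carrier ?N" "\<iota> a = \<iota> a'" "\<iota> b = \<iota> b'" for a b a' b'
      using eqD [OF that(1,3,5)] eqD [OF that(2,4,6)] by simp
    show "\<iota> (c \<odot>\<^bsub>?N\<^esub> a) = \<iota> (c \<odot>\<^bsub>?N\<^esub> a')" if "c \<in> carrier F" "a \<in> carrier ?N" "a' \<in> carrier ?N" "\<iota> a = \<iota> a'" for a a' c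
      using eqD [OF that(2,3,4)] by simp
  qed
  define \<kappa> where "\<kappa> = inv_into N \<iota>"
  have \<kappa>\<iota>: "\<kappa> (\<iota> n) = n" if "n \<in> N" for n unfolding \<kappa>_def using \<iota> that by (rule inv_into_f_f)
  have PN: "carrier P = \<iota> ` N" using P(2) by simp
  have Padd: "\<iota> a \<oplus>\<^bsub>P\<^esub> \<iota> b = \<iota> (a \<oplus>\<^bsub>D\<^esub> b)" "a \<oplus>\<^bsub>D\<^esub> b \<in> N" if "a \<in> N" "b \<in> N" for a b
    using P(3) that vectorspace_closed(2) [OF N] by (simp_all add: module_hom_iff)
  have Psmult: "c \<odot>\<^bsub>P\<^esub> \<iota> a = \<iota> (c \<odot>\<^bsub>D\<^esub> a)" "c \<odot>\<^bsub>D\<^esub> a \<in> N" if "a \<in> N" "c \<in> carrier F" for a c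
    using P(3) that vectorspace_closed(3) [OF N] by (simp_all add: module_hom_iff)
  define p where "p = (\<lambda>z\<in>carrier P. fst (\<kappa> z))"
  define q where "q = (\<lambda>z\<in>carrier P. snd (\<kappa> z))"
  have pq: "p (\<iota> n) = fst n" "q (\<iota> n) = snd n" if "n \<in> N" for n using that by (simp_all add: p_def q_def PN \<kappa>\<iota>)
  have "p \<in> linear_maps P V" "q \<in> linear_maps P W"
    unfolding module_hom_iff PN by (auto simp: pq Padd Psmult) (auto simp: N_def Ds)
  then have arr: "Arrow P V p \<in> Arr (FinVect F)" "Arrow P W q \<in> Arr (FinVect F)"
    using hom P(1) finN by (simp_all add: Arr_FinVect PN p_def q_def)
  have comm: "f (p z) = g (q z)" if "z \<in> carrier P" for z using that pq by (auto simp: PN N_def)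
  have ex1: "\<exists>!z. z \<in> carrier P \<and> p z = x \<and> q z = y" if xy: "x \<in> carrier V" "y \<in> carrier W" "f x = g y" for x y
  proof (rule ex1I [of _ "\<iota> (x, y)"])
    have "(x, y) \<in> N" using xy by (simp add: N_def)
    then show "\<iota> (x, y) \<in> carrier P \<and> p (\<iota> (x, y)) = x \<and> q (\<iota> (x, y)) = y" by (simp add: PN pq)
    fix z assume "z \<in> carrier P \<and> p z = x \<and> q z = y"
    then show "z = \<iota> (x, y)" using pq by (auto simp: PN)
  qed
  show thesis by (rule that [OF arr is_pullback_FinVectI [OF f g arr comm ex1]]) (use ex1 in blast)+
qed

text \<open>Any pullback is isomorphic to the constructed one over the two legs, and an isomorphism,
  being monic and epic, is bijective. So the description by elements carries over.\<close>

lemma pullback_FinVectE: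
  fixes f' :: "(('f, 'v) module, 'v \<Rightarrow> 'v) arrow"
  assumes inf: "infinite (UNIV :: 'v set)" and pb: "is_pullback (FinVect F) f' g' p' q'"
  obtains V W U P f g p q where "f' = Arrow V U f" "g' = Arrow W U g" "p' = Arrow P V p" "q' = Arrow P W q"
    "Arrow V U f \<in> Arr (FinVect F)" "Arrow W U g \<in> Arr (FinVect F)" "Arrow P V p \<in> Arr (FinVect F)" "Arrow P W q \<in> Arr (FinVect F)"
    "\<forall>z\<in>carrier P. f (p z) = g (q z)"
    "\<forall>x\<in>carrier V. \<forall>y\<in>carrier W. f x = g y \<longrightarrow> (\<exists>!z. z \<in> carrier P \<and> p z = x \<and> q z = y)"
proof -
  note arr = FV.pullback_arr [OF pb, unfolded FinVect_simps]
  obtain V U f where f: "f' = Arrow V U f" using arrow.exhaust by blast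
  obtain W g where g: "g' = Arrow W U g" using arr(5) f by (cases g') simp
  obtain P p where p: "p' = Arrow P V p" using arr(7) f by (cases p') simp
  obtain q where q: "q' = Arrow P W q" using arr(6,8) g p by (cases q') simp
  have arr': "Arrow V U f \<in> Arr (FinVect F)" "Arrow W U g \<in> Arr (FinVect F)" "Arrow P V p \<in> Arr (FinVect F)" "Arrow P W q \<in> Arr (FinVect F)"
    using arr f g p q by simp_all
  have eq: "compose (carrier P) f p = compose (carrier P) g q" using arr(9) f g p q by (simp add: FinVect_simps)
  have comm: "\<forall>z\<in>carrier P. f (p z) = g (q z)" using fun_cong [OF eq] by (metis compose_eq)
  obtain P0 p0 q0 where P0: "Arrow P0 V p0 \<in> Arr (FinVect F)" "Arrow P0 W q0 \<in> Arr (FinVect F)"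
    "is_pullback (FinVect F) (Arrow V U f) (Arrow W U g) (Arrow P0 V p0) (Arrow P0 W q0)"
    and ex1': "\<forall>x\<in>carrier V. \<forall>y\<in>carrier W. f x = g y \<longrightarrow> (\<exists>!z. z \<in> carrier P0 \<and> p0 z = x \<and> q0 z = y)"
    by (rule ex_pullback_FinVect [OF inf arr'(1,2)])
  have ex1: "\<exists>!z. z \<in> carrier P0 \<and> p0 z = x \<and> q0 z = y" if "x \<in> carrier V" "y \<in> carrier W" "f x = g y" for x y
    using ex1' that by blast
  obtain i where i: "iso_arr (FinVect F) i" "Dom (FinVect F) i = P" "Cod (FinVect F) i = P0"
    "Arrow P0 V p0 \<cdot>\<^bsub>FinVect F\<^esub> i = p'" "Arrow P0 W q0 \<cdot>\<^bsub>FinVect F\<^esub> i = q'"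
    using FV.pullback_iso [OF P0(3) pb [unfolded f g]] p by (auto simp: FinVect_simps)
  obtain i' where i': "i = Arrow P P0 i'" using i(2,3) by (cases i) (simp add: FinVect_simps)
  have iA: "Arrow P P0 i' \<in> Arr (FinVect F)" using i(1) i' by simp
  have inj: "inj_on i' (carrier P)" using FV.iso_monic [OF i(1)] monic_FinVect [OF iA] i' by simp
  have surj: "i' ` carrier P = carrier P0" using FV.iso_epic [OF i(1)] epic_FinVect [OF iA] i' by simp
  have c: "compose (carrier P) p0 i' = p" "compose (carrier P) q0 i' = q" using i(4,5) i' p q by (simp_all add: FinVect_simps)
  have pi: "p z = p0 (i' z)" "q z = q0 (i' z)" if "z \<in> carrier P" for z
    using fun_cong [OF c(1), of z] fun_cong [OF c(2), of z] that by (simp_all add: compose_def)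
  have "\<exists>!z. z \<in> carrier P \<and> p z = x \<and> q z = y" if xy: "x \<in> carrier V" "y \<in> carrier W" "f x = g y" for x y
  proof -
    obtain z0 where z0: "z0 \<in> carrier P0" "p0 z0 = x" "q0 z0 = y" using ex1 [OF xy] by blast
    have "z0 \<in> i' ` carrier P" using z0(1) surj by simp
    then obtain z where z: "z0 = i' z" "z \<in> carrier P" by (rule imageE)
    show ?thesis
    proof (rule ex1I [of _ z])
      show "z \<in> carrier P \<and> p z = x \<and> q z = y" using z z0 pi by simp
      fix w assume w: "w \<in> carrier P \<and> p w = x \<and> q w = y"
      then have "i' w \<in> carrier P0 \<and> p0 (i' w) = x \<and> q0 (i' w) = y" using surj pi by auto
      then have "i' w = z0" using ex1 [OF xy] z0 by blast
      then show "w = z" using inj_onD [OF inj, of w z] w z by simp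
    qed
  qed
  then have "\<forall>x\<in>carrier V. \<forall>y\<in>carrier W. f x = g y \<longrightarrow> (\<exists>!z. z \<in> carrier P \<and> p z = x \<and> q z = y)" by blast
  from that [OF f g p q arr' comm this] show thesis .
qed

lemma vect_degree_Arrow:
  assumes "Arrow V W T \<in> Arr (FinVect F)"
  shows "vect_degree F t (Arrow V W T) = t ^ vectorspace.dim F (V\<lparr>carrier := {v \<in> carrier V. T v = \<zero>\<^bsub>W\<^esub>}\<rparr>)"
proof -
  interpret T: linear_map F V W T using assms by (simp add: linear_map_iff Arr_FinVect)
  show ?thesis by (simp add: vect_degree_def T.ker_def)
qed

text \<open>The kernel survives pulling back: \<open>p'\<close> maps the kernel of \<open>q'\<close>
  bijectively onto that of \<open>f'\<close>. Counting elements turns the bijection into an equality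
  of dimensions.\<close>

lemma pullback_degree_FinVect:
  fixes f :: "(('f, 'v) module, 'v \<Rightarrow> 'v) arrow"
  assumes inf: "infinite (UNIV :: 'v set)" and e: "epic (FinVect F) f" and pb: "is_pullback (FinVect F) f g p q"
  shows "epic (FinVect F) q" "vect_degree F t q = vect_degree F t f"
proof -
  obtain V W U P f' g' p' q' where *: "f = Arrow V U f'" "g = Arrow W U g'" "p = Arrow P V p'" "q = Arrow P W q'"
    "Arrow V U f' \<in> Arr (FinVect F)" "Arrow W U g' \<in> Arr (FinVect F)" "Arrow P V p' \<in> Arr (FinVect F)" "Arrow P W q' \<in> Arr (FinVect F)"
    "\<forall>z\<in>carrier P. f' (p' z) = g' (q' z)"
    and ex1: "\<forall>x\<in>carrier V. \<forall>y\<in>carrier W. f' x = g' y \<longrightarrow> (\<exists>!z. z \<in> carrier P \<and> p' z = x \<and> q' z = y)"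
    by (rule pullback_FinVectE [OF inf pb])
  have hom: "vectorspace F V" "vectorspace F W" "vectorspace F U" "vectorspace F P" "finite (carrier V)"
    "f' \<in> linear_maps V U" "g' \<in> linear_maps W U"
    "p' \<in> linear_maps P V" "q' \<in> linear_maps P W"
    using *(5-8) by (auto simp: Arr_FinVect)
  have surj: "f' ` carrier V = carrier U" using e epic_FinVect [OF *(5)] *(1) by simp
  have "q' ` carrier P = carrier W"
  proof
    show "q' ` carrier P \<subseteq> carrier W" using module_hom_closed [OF hom(9)] by auto
    show "carrier W \<subseteq> q' ` carrier P"
    proof
      fix y assume y: "y \<in> carrier W"
      then have "g' y \<in> f' ` carrier V" using surj module_hom_closed [OF hom(7)] by simp
      then obtain x where "x \<in> carrier V" "f' x = g' y" by (metis imageE)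
      then show "y \<in> q' ` carrier P" using ex1 y by blast
    qed
  qed
  then show "epic (FinVect F) q" using epic_FinVect [OF *(8)] *(4) by simp
  define Kq where "Kq = {z \<in> carrier P. q' z = \<zero>\<^bsub>W\<^esub>}"
  define Kf where "Kf = {x \<in> carrier V. f' x = \<zero>\<^bsub>U\<^esub>}"
  have g0: "g' \<zero>\<^bsub>W\<^esub> = \<zero>\<^bsub>U\<^esub>" by (rule module_hom_zero [OF hom(2,3,7)])
  have W0: "\<zero>\<^bsub>W\<^esub> \<in> carrier W" by (rule vectorspace_closed(1) [OF hom(2)])
  have "bij_betw p' Kq Kf"
    unfolding bij_betw_def
  proof
    show "inj_on p' Kq"
    proof (rule inj_onI)
      fix a b assume ab: "a \<in> Kq" "b \<in> Kq" "p' a = p' b"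
      have "p' a \<in> carrier V" "f' (p' a) = g' \<zero>\<^bsub>W\<^esub>" using ab *(9) module_hom_closed [OF hom(8)] by (auto simp: Kq_def)
      then have "\<exists>!z. z \<in> carrier P \<and> p' z = p' a \<and> q' z = \<zero>\<^bsub>W\<^esub>" using ex1 W0 by blast
      then show "a = b" using ab unfolding Kq_def by auto
    qed
    show "p' ` Kq = Kf"
    proof
      show "p' ` Kq \<subseteq> Kf" using *(9) module_hom_closed [OF hom(8)] g0 by (auto simp: Kq_def Kf_def)
      show "Kf \<subseteq> p' ` Kq"
      proof
        fix x assume "x \<in> Kf"
        then have "x \<in> carrier V" "f' x = g' \<zero>\<^bsub>W\<^esub>" using g0 by (auto simp: Kf_def)
        then obtain z where "z \<in> carrier P" "p' z = x" "q' z = \<zero>\<^bsub>W\<^esub>" using ex1 W0 by blast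
        then show "x \<in> p' ` Kq" by (auto simp: Kq_def)
      qed
    qed
  qed
  then have card: "card Kq = card Kf" by (rule bij_betw_same_card)
  have "vectorspace.dim F (P\<lparr>carrier := Kq\<rparr>) = vectorspace.dim F (V\<lparr>carrier := Kf\<rparr>)"
  proof (rule dim_eq_if_card_eq)
    show "vectorspace F (V\<lparr>carrier := Kf\<rparr>)" unfolding Kf_def
      by (rule submodule_vectorspace [OF hom(1) kernel_submodule [OF hom(1,3,6)]])
    show "vectorspace F (P\<lparr>carrier := Kq\<rparr>)" unfolding Kq_def
      by (rule submodule_vectorspace [OF hom(4) kernel_submodule [OF hom(4,2,9)]])
  qed (use hom(5) card in \<open>simp_all add: Kf_def\<close>)
  then show "vect_degree F t q = vect_degree F t f"
    unfolding *(1,4) vect_degree_Arrow [OF *(5)] vect_degree_Arrow [OF *(8)] Kf_def Kq_def by simp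
qed

lemma complete_degree_function_FinVect:
  assumes inf: "infinite (UNIV :: 'v set)"
  shows "complete_degree_function (FinVect F :: (('f, 'v) module, (('f, 'v) module, 'v \<Rightarrow> 'v) arrow) category) (vect_degree F t)"
proof
  let ?C = "FinVect F :: (('f, 'v) module, (('f, 'v) module, 'v \<Rightarrow> 'v) arrow) category"
  show "\<exists>V. terminal ?C V"
  proof -
    obtain V :: "('f, 'v) module" and z where "vectorspace F V" "carrier V = {z}" by (rule ex_zero_space)
    then have "terminal ?C V" by (rule terminal_FinVect_if)
    then show ?thesis ..
  qed
  show "\<exists>e m. image_fact ?C f e m" if f_Arr: "f \<in> Arr ?C" for f
  proof -
    obtain V W T where f: "f = Arrow V W T" "vectorspace F V" "finite (carrier V)" "vectorspace F W" "finite (carrier W)"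
      "T \<in> linear_maps V W" "T \<in> extensional (carrier V)" using f_Arr by (rule Arr_FinVectE)
    define I where "I = W\<lparr>carrier := T ` carrier V\<rparr>"
    have I: "vectorspace F I" unfolding I_def by (rule submodule_vectorspace [OF f(4) image_submodule [OF f(2,4,6)]])
    have e: "Arrow V I T \<in> Arr ?C" using f I by (auto simp: Arr_FinVect module_hom_iff I_def)
    have sub: "T ` carrier V \<subseteq> carrier W" using module_hom_closed [OF f(6)] by auto
    have m: "Arrow I W (\<lambda>w\<in>carrier I. w) \<in> Arr ?C"
      using f I sub vectorspace_closed [OF I] by (auto simp: Arr_FinVect module_hom_iff I_def)
    have "image_fact ?C f (Arrow V I T) (Arrow I W (\<lambda>w\<in>carrier I. w))"
      unfolding image_fact_def epic_FinVect [OF e] monic_FinVect [OF m]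
    proof (intro conjI)
      show "Arrow I W (\<lambda>w\<in>carrier I. w) \<cdot>\<^bsub>?C\<^esub> Arrow V I T = f"
        using f by (auto simp: FinVect_simps compose_def fun_eq_iff I_def extensional_def)
    qed (auto simp: FinVect_simps I_def inj_on_def)
    then show ?thesis by blast
  qed
  show "\<exists>i \<in> Hom ?C (Cod ?C e) (Cod ?C e'). iso_arr ?C i \<and> i \<cdot>\<^bsub>?C\<^esub> e = e' \<and> m' \<cdot>\<^bsub>?C\<^esub> i = m"
    if "image_fact ?C f e m" "image_fact ?C f e' m'" for f e m e' m'
  proof (rule FV.image_unique_from_lift [OF _ that])
    fix f e m e' m' assume em: "image_fact ?C f e m" and em': "image_fact ?C f e' m'"
    have A: "e \<in> Arr ?C" "m \<in> Arr ?C" "Cod ?C e = Dom ?C m" "e' \<in> Arr ?C" "m' \<in> Arr ?C" "Cod ?C e' = Dom ?C m'"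
      "m \<cdot>\<^bsub>?C\<^esub> e = m' \<cdot>\<^bsub>?C\<^esub> e'" using em em' by (auto simp: image_fact_def)
    obtain V I e1 where e: "e = Arrow V I e1" by (cases e)
    obtain W m1 where m: "m = Arrow I W m1" using A(3) e by (cases m) (simp add: FinVect_simps)
    obtain I' e2 where e': "e' = Arrow V I' e2" using A(7) e m by (cases e'; cases m') (simp add: FinVect_simps)
    obtain m2 where m': "m' = Arrow I' W m2" using A(6,7) e m e' by (cases m') (simp add: FinVect_simps)
    have eA: "Arrow V I e1 \<in> Arr ?C" and mA: "Arrow I W m1 \<in> Arr ?C" and eA': "Arrow V I' e2 \<in> Arr ?C" and mA': "Arrow I' W m2 \<in> Arr ?C"
      using A e m e' m' by simp_all
    have hom: "vectorspace F V" "vectorspace F I" "vectorspace F I'" "finite (carrier I)" "finite (carrier I')"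
      "e1 \<in> linear_maps V I" "m1 \<in> linear_maps I W"
      "e2 \<in> linear_maps V I'" "m2 \<in> linear_maps I' W" "e2 \<in> extensional (carrier V)"
      using eA mA eA' mA' by (auto simp: Arr_FinVect)
    have surj: "e1 ` carrier V = carrier I" and inj: "inj_on m2 (carrier I')"
      using em em' epic_FinVect [OF eA] monic_FinVect [OF mA'] e m' by (auto simp: image_fact_def)
    have eq: "compose (carrier V) m1 e1 = compose (carrier V) m2 e2" using A(7) e m e' m' by (simp add: FinVect_simps)
    have m12: "m1 (e1 v) = m2 (e2 v)" if "v \<in> carrier V" for v using fun_cong [OF eq, of v] that by (simp add: compose_def)
    \<comment> \<open>Any preimage under \<open>e1\<close> will do: \<open>d i\<close> is determined
      by its image \<open>m1 i\<close> under the injective \<open>m2\<close>. The same injectivity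
      gives linearity.\<close>
    define d where "d = (\<lambda>i\<in>carrier I. e2 (inv_into (carrier V) e1 i))"
    have dC: "d i \<in> carrier I'" and md: "m2 (d i) = m1 i" if "i \<in> carrier I" for i
    proof -
      have "inv_into (carrier V) e1 i \<in> carrier V" "e1 (inv_into (carrier V) e1 i) = i"
        using that surj inv_into_into f_inv_into_f by metis+
      then show "d i \<in> carrier I'" "m2 (d i) = m1 i" using that m12 module_hom_closed [OF hom(8)] by (force simp: d_def)+
    qed
    note I = vectorspace_closed [OF hom(2)] and I' = vectorspace_closed [OF hom(3)]
    have "d \<in> linear_maps I I'"
      unfolding module_hom_iff
    proof (intro conjI ballI)
      show "d \<in> carrier I \<rightarrow> carrier I'" using dC by auto
      show "d (a \<oplus>\<^bsub>I\<^esub> b) = d a \<oplus>\<^bsub>I'\<^esub> d b" if "a \<in> carrier I" "b \<in> carrier I" for a b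
        by (rule inj_onD [OF inj]) (use that dC md I I' hom(7,9) in \<open>simp_all add: module_hom_iff\<close>)
      show "d (c \<odot>\<^bsub>I\<^esub> a) = c \<odot>\<^bsub>I'\<^esub> d a" if "c \<in> carrier F" "a \<in> carrier I" for c a
        by (rule inj_onD [OF inj]) (use that dC md I I' hom(7,9) in \<open>simp_all add: module_hom_iff\<close>)
    qed
    moreover have "d (e1 v) = e2 v" if "v \<in> carrier V" for v
    proof -
      have "e1 v \<in> carrier I" "e2 v \<in> carrier I'"
        using module_hom_closed [OF hom(6) that] module_hom_closed [OF hom(8) that] .
      then show ?thesis using inj_onD [OF inj, of "d (e1 v)" "e2 v"] md m12 [OF that] dC by simp
    qed
    then have "compose (carrier V) d e1 = e2"
      by (intro extensionalityI [of _ "carrier V"]) (use hom(10) in \<open>simp_all add: compose_def\<close>)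
    ultimately show "\<exists>d \<in> Hom ?C (Cod ?C e) (Cod ?C e'). d \<cdot>\<^bsub>?C\<^esub> e = e'"
      by (intro bexI [of _ "Arrow I I' d"]) (use hom e e' in \<open>simp_all add: FinVect_simps Hom_FinVect d_def\<close>)
  qed
  show pb: "\<exists>p q. is_pullback ?C f g p q" if fg: "f \<in> Arr ?C" "g \<in> Arr ?C" "Cod ?C f = Cod ?C g" for f g
  proof -
    obtain V U f' where f: "f = Arrow V U f'" by (cases f)
    obtain W g' where g: "g = Arrow W U g'" using fg(3) f by (cases g) (simp add: FinVect_simps)
    show ?thesis by (rule ex_pullback_FinVect [OF inf fg(1,2) [unfolded f g]]) (use f g in blast)
  qed
  show "\<exists>p q. is_pullback ?C f g p q" if "commuting_square ?C f g p q" for f g p q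
    using pb [of f g] that by (auto simp: commuting_square_def)
  show "\<exists>p q. is_pullback ?C f g p q" if "epic ?C f" "g \<in> Arr ?C" "Cod ?C f = Cod ?C g" for f g
    using pb [of f g] that by simp
  show "epic ?C q" "vect_degree F t q = vect_degree F t f" if "epic ?C f" "is_pullback ?C f g p q" for f g p q
    using pullback_degree_FinVect [OF inf that] .
  show "vect_degree F t (Idn ?C V) = 1" if V_Obj: "V \<in> Obj ?C" for V
  proof -
    have V: "vectorspace F V" "finite (carrier V)" using V_Obj by (auto simp: Obj_FinVect)
    have A: "Arrow V V (\<lambda>v\<in>carrier V. v) \<in> Arr ?C" using V Idn_module_hom by (simp add: Arr_FinVect)
    \<comment> \<open>Rank-nullity for the identity leaves dimension 0 for its kernel.\<close>
    have "vectorspace.dim F V + vectorspace.dim F (V\<lparr>carrier := {v \<in> carrier V. (\<lambda>v\<in>carrier V. v) v = \<zero>\<^bsub>V\<^esub>}\<rparr>) = vectorspace.dim F V"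
      by (rule rank_nullity_surj [OF V V(1) Idn_module_hom [OF V(1)]]) simp
    then show ?thesis unfolding FinVect_simps vect_degree_Arrow [OF A] by simp
  qed
  show "vect_degree F t (g \<cdot>\<^bsub>?C\<^esub> f) = vect_degree F t g * vect_degree F t f"
    if ef: "epic ?C f" and eg: "epic ?C g" and fg: "Cod ?C f = Dom ?C g" for f g
  proof -
    obtain V W f' where f: "f = Arrow V W f'" by (cases f)
    obtain U g' where g: "g = Arrow W U g'" using fg f by (cases g) (simp add: FinVect_simps)
    have fA: "Arrow V W f' \<in> Arr ?C" and gA: "Arrow W U g' \<in> Arr ?C" using ef eg f g by auto
    have hom: "vectorspace F V" "vectorspace F W" "vectorspace F U" "finite (carrier V)" "finite (carrier W)" "finite (carrier U)"
      "f' \<in> linear_maps V W" "g' \<in> linear_maps W U" using fA gA by (auto simp: Arr_FinVect)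
    have surj: "f' ` carrier V = carrier W" "g' ` carrier W = carrier U"
      using ef eg f g epic_FinVect [OF fA] epic_FinVect [OF gA] by simp_all
    let ?h = "compose (carrier V) g' f'"
    have hA: "Arrow V U ?h \<in> Arr ?C" using hom compose_module_hom by (simp add: Arr_FinVect)
    have "?h ` carrier V = g' ` (f' ` carrier V)" by (simp add: compose_def image_image)
    then have hs: "?h ` carrier V = carrier U" using surj by simp
    have h: "?h \<in> linear_maps V U" using hA by (simp add: Arr_FinVect)
    have gf: "g \<cdot>\<^bsub>?C\<^esub> f = Arrow V U ?h" by (simp add: f g FinVect_simps)
    \<comment> \<open>Rank-nullity for the two maps and for their composite; the dimensions of the
      spaces themselves cancel.\<close>
    have "vectorspace.dim F (V\<lparr>carrier := {v \<in> carrier V. ?h v = \<zero>\<^bsub>U\<^esub>}\<rparr>) =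
      vectorspace.dim F (W\<lparr>carrier := {w \<in> carrier W. g' w = \<zero>\<^bsub>U\<^esub>}\<rparr>) + vectorspace.dim F (V\<lparr>carrier := {v \<in> carrier V. f' v = \<zero>\<^bsub>W\<^esub>}\<rparr>)"
      using rank_nullity_surj [OF hom(1,4,2,7) surj(1)] rank_nullity_surj [OF hom(2,5,3,8) surj(2)] rank_nullity_surj [OF hom(1,4,3) h hs]
      by linarith
    then show ?thesis
      unfolding gf unfolding f g vect_degree_Arrow [OF fA] vect_degree_Arrow [OF gA] vect_degree_Arrow [OF hA] by (simp only: power_add)
  qed
qed

end

section \<open>Functions on finite sets\<close>

context finite_field begin

lemma fun_obj_simps:
  "carrier (fun_obj F X) = X \<rightarrow>\<^sub>E carrier F" "\<zero>\<^bsub>fun_obj F X\<^esub> = (\<lambda>x\<in>X. \<zero>)"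
  "\<phi> \<oplus>\<^bsub>fun_obj F X\<^esub> \<psi> = (\<lambda>x\<in>X. \<phi> x \<oplus> \<psi> x)" "c \<odot>\<^bsub>fun_obj F X\<^esub> \<phi> = (\<lambda>x\<in>X. c \<otimes> \<phi> x)"
  by (simp_all add: fun_obj_def func_space_def)

lemma fun_obj_vectorspace: "vectorspace F (fun_obj F X)"
  using func_space_is_module by (simp add: fun_obj_def vectorspace_def field_axioms)

lemma finite_fun_obj: "finite X \<Longrightarrow> finite (carrier (fun_obj F X))"
  by (simp add: fun_obj_simps finite_PiE finite_carrier)

text \<open>Counting replaces a basis of indicator functions: the number of scalar-valued functions
  on \<open>X\<close> is the size of the field to the power \<open>card X\<close>.\<close>

lemma dim_fun_obj:
  assumes "finite X"
  shows "vectorspace.dim F (fun_obj F X) = card X"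
proof -
  have "card (carrier F) ^ vectorspace.dim F (fun_obj F X) = card (carrier F) ^ card X"
    using fin_dim_card(2) [OF fun_obj_vectorspace [of X]] finite_fun_obj [OF assms] assms
    by (simp add: fin_dim_iff_finite [OF fun_obj_vectorspace] fun_obj_simps card_funcsetE)
  then show ?thesis using card_carrier_gt_1 by simp
qed

lemma fun_arr_Arrow:
  "fun_arr F (Arrow X Y h) = Arrow (fun_obj F X) (fun_obj F Y) (\<lambda>\<phi>\<in>X \<rightarrow>\<^sub>E carrier F. compose Y \<phi> h)"
  by (simp add: fun_arr_def fun_obj_simps)

lemma fun_arr_Arr:
  assumes "finite X" "finite Y" "h \<in> Y \<rightarrow>\<^sub>E X"
  shows "Arrow (fun_obj F X) (fun_obj F Y) (\<lambda>\<phi>\<in>X \<rightarrow>\<^sub>E carrier F. compose Y \<phi> h) \<in> Arr (FinVect F)"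
proof -
  have "(\<lambda>\<phi>\<in>X \<rightarrow>\<^sub>E carrier F. compose Y \<phi> h) \<in> linear_maps (fun_obj F X) (fun_obj F Y)"
    unfolding module_hom_iff fun_obj_simps
    using assms(3) by (auto simp: compose_def PiE_iff fun_eq_iff)
  then show ?thesis
    using assms by (simp add: Arr_FinVect fun_obj_vectorspace finite_fun_obj) (simp add: fun_obj_simps)
qed

lemma cat_functor_fun:
  "cat_functor (FinSet_op :: ('u::infinite set, ('u set, 'u \<Rightarrow> 'u) arrow) category) (FinVect F) (fun_obj F) (fun_arr F)"
proof
  let ?S = "FinSet_op :: ('u set, ('u set, 'u \<Rightarrow> 'u) arrow) category"
  show "fun_obj F X \<in> Obj (FinVect F)" if "X \<in> Obj ?S" for X
    using that by (simp add: FinSet_op_simps Obj_FinVect fun_obj_vectorspace finite_fun_obj)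
  show "fun_arr F f \<in> Hom (FinVect F) (fun_obj F X) (fun_obj F Y)" if "f \<in> Hom ?S X Y" for f X Y
    using that fun_arr_Arr by (auto simp: Hom_FinSet_op fun_arr_Arrow Hom_iff FinVect_simps)
  show "fun_arr F (Idn ?S X) = Idn (FinVect F) (fun_obj F X)" if "X \<in> Obj ?S" for X
    by (auto simp: FinSet_op_simps fun_arr_Arrow FinVect_simps fun_obj_simps compose_def PiE_iff fun_eq_iff extensional_def)
  show "fun_arr F (g \<cdot>\<^bsub>?S\<^esub> f) = fun_arr F g \<cdot>\<^bsub>FinVect F\<^esub> fun_arr F f" if fg: "f \<in> Hom ?S X Y" "g \<in> Hom ?S Y Z" for f g X Y Z
  proof -
    obtain f' where f: "f = Arrow X Y f'" "f' \<in> Y \<rightarrow>\<^sub>E X" using fg(1) by (auto simp: Hom_FinSet_op)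
    obtain g' where g: "g = Arrow Y Z g'" "g' \<in> Z \<rightarrow>\<^sub>E Y" using fg(2) by (auto simp: Hom_FinSet_op)
    show ?thesis using f(2) g(2)
      by (auto simp: f(1) g(1) FinSet_op_simps fun_arr_Arrow FinVect_simps fun_obj_simps compose_def PiE_iff fun_eq_iff)
  qed
qed

lemma fun_arr_surj:
  assumes "finite X" "h \<in> Y \<rightarrow>\<^sub>E X" "inj_on h Y"
  shows "(\<lambda>\<phi>\<in>X \<rightarrow>\<^sub>E carrier F. compose Y \<phi> h) ` (X \<rightarrow>\<^sub>E carrier F) = Y \<rightarrow>\<^sub>E carrier F"
proof
  show "(\<lambda>\<phi>\<in>X \<rightarrow>\<^sub>E carrier F. compose Y \<phi> h) ` (X \<rightarrow>\<^sub>E carrier F) \<subseteq> Y \<rightarrow>\<^sub>E carrier F"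
    using assms(2) by (auto simp: compose_def PiE_iff)
  show "Y \<rightarrow>\<^sub>E carrier F \<subseteq> (\<lambda>\<phi>\<in>X \<rightarrow>\<^sub>E carrier F. compose Y \<phi> h) ` (X \<rightarrow>\<^sub>E carrier F)"
  proof
    fix \<psi> assume \<psi>: "\<psi> \<in> Y \<rightarrow>\<^sub>E carrier F"
    \<comment> \<open>A preimage of \<open>\<psi>\<close>: transport along the injection
      \<open>h\<close> and extension by zero off its image.\<close>
    let ?\<phi> = "\<lambda>x\<in>X. if x \<in> h ` Y then \<psi> (inv_into Y h x) else \<zero>"
    have "?\<phi> \<in> X \<rightarrow>\<^sub>E carrier F" using \<psi> assms(3) by (auto simp: PiE_iff)
    moreover have "compose Y ?\<phi> h = \<psi>"
      by (rule extensionalityI [of _ Y]) (use \<psi> assms(2,3) in \<open>auto simp: compose_def PiE_iff\<close>)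
    ultimately show "\<psi> \<in> (\<lambda>\<phi>\<in>X \<rightarrow>\<^sub>E carrier F. compose Y \<phi> h) ` (X \<rightarrow>\<^sub>E carrier F)"
      by (intro image_eqI [of _ _ ?\<phi>]) simp_all
  qed
qed

lemma fun_arr_epic_degree:
  assumes e: "epic (FinSet_op :: ('u::infinite set, ('u set, 'u \<Rightarrow> 'u) arrow) category) f"
  shows "epic (FinVect F) (fun_arr F f)" "vect_degree F t (fun_arr F f) = set_degree t f"
proof -
  have "f \<in> Arr FinSet_op" using e by (rule FinSet.epic_arr)
  then obtain X Y h where f: "f = Arrow X Y h" "finite X" "finite Y" "h \<in> Y \<rightarrow>\<^sub>E X" by (rule Arr_FinSet_opE)
  have inj: "inj_on h Y" using e unfolding f(1) epic_FinSet_op [OF f(2-4)] .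
  note A = fun_arr_Arr [OF f(2-4)] and surj = fun_arr_surj [OF f(2,4) inj]
  show "epic (FinVect F) (fun_arr F f)" unfolding f(1) fun_arr_Arrow epic_FinVect [OF A] using surj by (simp add: fun_obj_simps)
  let ?T = "\<lambda>\<phi>\<in>X \<rightarrow>\<^sub>E carrier F. compose Y \<phi> h"
  have T: "?T \<in> linear_maps (fun_obj F X) (fun_obj F Y)" using A by (simp add: Arr_FinVect)
  have "vectorspace.dim F (fun_obj F Y) + vectorspace.dim F (fun_obj F X\<lparr>carrier := {v \<in> carrier (fun_obj F X). ?T v = \<zero>\<^bsub>fun_obj F Y\<^esub>}\<rparr>)
      = vectorspace.dim F (fun_obj F X)"
    by (rule rank_nullity_surj [OF fun_obj_vectorspace finite_fun_obj [OF f(2)] fun_obj_vectorspace T])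
      (use surj in \<open>simp add: fun_obj_simps\<close>)
  then have "vectorspace.dim F (fun_obj F X\<lparr>carrier := {v \<in> carrier (fun_obj F X). ?T v = \<zero>\<^bsub>fun_obj F Y\<^esub>}\<rparr>) = card X - card Y"
    unfolding dim_fun_obj [OF f(2)] dim_fun_obj [OF f(3)] by linarith
  moreover have "card (X - h ` Y) = card X - card Y"
    using card_Diff_subset [of "h ` Y" X] f card_image [OF inj] by auto
  ultimately show "vect_degree F t (fun_arr F f) = set_degree t f"
    unfolding f(1) fun_arr_Arrow vect_degree_Arrow [OF A] by (simp add: set_degree_def)
qed

text \<open>Gluing functions with values in the finite set \<open>carrier F\<close> is the
  elementwise criterion for a pullback of vector spaces; uniqueness holds because \<open>P\<close>
  is covered by the two images.\<close>

lemma fun_arr_pullback: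
  assumes pb: "is_pullback (FinSet_op :: ('u::infinite set, ('u set, 'u \<Rightarrow> 'u) arrow) category) f g p q"
  shows "is_pullback (FinVect F) (fun_arr F f) (fun_arr F g) (fun_arr F p) (fun_arr F q)"
proof -
  obtain X Y Z P f' g' p' q' where *: "f = Arrow X Z f'" "g = Arrow Y Z g'" "p = Arrow P X p'" "q = Arrow P Y q'"
    "finite X" "finite Y" "finite Z" "finite P" "f' \<in> Z \<rightarrow>\<^sub>E X" "g' \<in> Z \<rightarrow>\<^sub>E Y" "p' \<in> X \<rightarrow>\<^sub>E P" "q' \<in> Y \<rightarrow>\<^sub>E P"
    "\<forall>z\<in>Z. p' (f' z) = q' (g' z)" "P = p' ` X \<union> q' ` Y"
    and glue: "\<forall>(h :: 'u \<Rightarrow> 'f) k A. finite A \<longrightarrow> h \<in> X \<rightarrow> A \<longrightarrow> k \<in> Y \<rightarrow> A \<longrightarrow> (\<forall>z\<in>Z. h (f' z) = k (g' z)) \<longrightarrow>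
      (\<exists>u \<in> P \<rightarrow>\<^sub>E A. (\<forall>x\<in>X. u (p' x) = h x) \<and> (\<forall>y\<in>Y. u (q' y) = k y))"
    by (rule pullback_FinSet_opE [OF pb])
  have mem: "f' z \<in> X" "g' z \<in> Y" if "z \<in> Z" for z using that *(9,10) by auto
  have mem': "p' x \<in> P" if "x \<in> X" for x using that *(11) by auto
  have mem'': "q' y \<in> P" if "y \<in> Y" for y using that *(12) by auto
  show ?thesis
    unfolding *(1-4) fun_arr_Arrow
  proof (rule is_pullback_FinVectI [OF fun_arr_Arr fun_arr_Arr fun_arr_Arr fun_arr_Arr], unfold fun_obj_simps)
    fix \<phi> assume \<phi>: "\<phi> \<in> P \<rightarrow>\<^sub>E carrier F"
    then have "compose X \<phi> p' \<in> X \<rightarrow>\<^sub>E carrier F" "compose Y \<phi> q' \<in> Y \<rightarrow>\<^sub>E carrier F"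
      using compose_PiE *(11,12) by blast+
    then show "(\<lambda>\<phi>\<in>X \<rightarrow>\<^sub>E carrier F. compose Z \<phi> f') ((\<lambda>\<phi>\<in>P \<rightarrow>\<^sub>E carrier F. compose X \<phi> p') \<phi>) =
      (\<lambda>\<phi>\<in>Y \<rightarrow>\<^sub>E carrier F. compose Z \<phi> g') ((\<lambda>\<phi>\<in>P \<rightarrow>\<^sub>E carrier F. compose Y \<phi> q') \<phi>)"
      using \<phi> *(13) mem by (simp add: compose_def fun_eq_iff)
  next
    fix h k assume h: "h \<in> X \<rightarrow>\<^sub>E carrier F" and k: "k \<in> Y \<rightarrow>\<^sub>E carrier F"
      and eq: "(\<lambda>\<phi>\<in>X \<rightarrow>\<^sub>E carrier F. compose Z \<phi> f') h = (\<lambda>\<phi>\<in>Y \<rightarrow>\<^sub>E carrier F. compose Z \<phi> g') k"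
    have eq': "compose Z h f' = compose Z k g'" using eq h k by simp
    have hk: "h (f' z) = k (g' z)" if "z \<in> Z" for z using fun_cong [OF eq', of z] that by (simp add: compose_def)
    have "\<exists>u \<in> P \<rightarrow>\<^sub>E carrier F. (\<forall>x\<in>X. u (p' x) = h x) \<and> (\<forall>y\<in>Y. u (q' y) = k y)"
      by (rule glue [rule_format]) (use h k hk finite_carrier in auto)
    then obtain u where u: "u \<in> P \<rightarrow>\<^sub>E carrier F" "\<forall>x\<in>X. u (p' x) = h x" "\<forall>y\<in>Y. u (q' y) = k y" by blast
    have uh: "compose X u p' = h" by (rule extensionalityI [of _ X]) (use u(2) h in \<open>auto simp: compose_def PiE_iff\<close>)
    have uk: "compose Y u q' = k" by (rule extensionalityI [of _ Y]) (use u(3) k in \<open>auto simp: compose_def PiE_iff\<close>)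
    show "\<exists>!u. u \<in> P \<rightarrow>\<^sub>E carrier F \<and> (\<lambda>\<phi>\<in>P \<rightarrow>\<^sub>E carrier F. compose X \<phi> p') u = h \<and> (\<lambda>\<phi>\<in>P \<rightarrow>\<^sub>E carrier F. compose Y \<phi> q') u = k"
    proof (rule ex1I [of _ u])
      show "u \<in> P \<rightarrow>\<^sub>E carrier F \<and> (\<lambda>\<phi>\<in>P \<rightarrow>\<^sub>E carrier F. compose X \<phi> p') u = h \<and> (\<lambda>\<phi>\<in>P \<rightarrow>\<^sub>E carrier F. compose Y \<phi> q') u = k"
        using u(1) uh uk by simp
      fix v assume "v \<in> P \<rightarrow>\<^sub>E carrier F \<and> (\<lambda>\<phi>\<in>P \<rightarrow>\<^sub>E carrier F. compose X \<phi> p') v = h \<and> (\<lambda>\<phi>\<in>P \<rightarrow>\<^sub>E carrier F. compose Y \<phi> q') v = k"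
      then have v: "v \<in> P \<rightarrow>\<^sub>E carrier F" "compose X v p' = h" "compose Y v q' = k" by auto
      have v1: "v (p' x) = u (p' x)" if "x \<in> X" for x using fun_cong [OF v(2), of x] that u(2) by (simp add: compose_def)
      have v2: "v (q' y) = u (q' y)" if "y \<in> Y" for y using fun_cong [OF v(3), of y] that u(3) by (simp add: compose_def)
      show "v = u"
      proof (rule PiE_ext [OF v(1) u(1)])
        fix w assume "w \<in> P"
        then have "w \<in> p' ` X \<union> q' ` Y" using *(14) by simp
        then show "v w = u w" using v1 v2 by auto
      qed
    qed
  qed (use * in simp_all)
qed

text \<open>The hypothesis concerns the type of vectors, in which fibre products have to find
  room.\<close>

lemma exact_degree_functor_fun:
  assumes "infinite (UNIV :: ('u::infinite \<Rightarrow> 'f) set)"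
  shows "exact_degree_functor (FinSet_op :: ('u set, ('u set, 'u \<Rightarrow> 'u) arrow) category) (set_degree t) (FinVect F) (vect_degree F t)
    (fun_obj F) (fun_arr F)"
proof -
  interpret cat_functor "FinSet_op :: ('u set, ('u set, 'u \<Rightarrow> 'u) arrow) category" "FinVect F" "fun_obj F" "fun_arr F"
    by (rule cat_functor_fun)
  interpret S: complete_degree_function "FinSet_op :: ('u set, ('u set, 'u \<Rightarrow> 'u) arrow) category" "set_degree t"
    by (rule complete_degree_function_FinSet_op)
  interpret V: complete_degree_function "FinVect F :: (('f, 'u \<Rightarrow> 'f) module, (('f, 'u \<Rightarrow> 'f) module, ('u \<Rightarrow> 'f) \<Rightarrow> ('u \<Rightarrow> 'f)) arrow) category" "vect_degree F t"
    by (rule complete_degree_function_FinVect [OF assms])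
  show ?thesis
  proof
    show "preserves_terminal (FinSet_op :: ('u set, ('u set, 'u \<Rightarrow> 'u) arrow) category) (FinVect F) (fun_obj F)"
      unfolding preserves_terminal_def terminal_FinSet_op
      using terminal_FinVect_if [OF fun_obj_vectorspace [of "{}"]] by (simp add: fun_obj_simps)
  qed (simp_all add: fun_arr_epic_degree preserves_pullbacks_def fun_arr_pullback)
qed

end

theorem lemma4p2p1:
  fixes F :: "'f ring" and t :: "'k::field"
    and S :: "('u::infinite set, ('u set, 'u \<Rightarrow> 'u) arrow) category"
    and V :: "(('f, 'u \<Rightarrow> 'f) module, (('f, 'u \<Rightarrow> 'f) module, ('u \<Rightarrow> 'f) \<Rightarrow> ('u \<Rightarrow> 'f)) arrow) category"
  assumes "field F" and "finite (carrier F)"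
  defines "S \<equiv> FinSet_op" and "V \<equiv> FinVect F"
  shows "degree_preserving_functor S (set_degree t) V (vect_degree F t) (fun_obj F) (fun_arr F)
    \<and> preserves_pullbacks S V (fun_arr F)
    \<and> preserves_terminal S V (fun_obj F)
    \<and> symmetric_monoidal_functor (Rep_S t) (Rep_GL F t)
        (env_functor_obj S V (fun_obj F) (fun_arr F))
        (env_functor S V (fun_obj F) (fun_arr F))
        (env_mu S (set_degree t) V (vect_degree F t) (fun_obj F) (fun_arr F))
        (env_eta S (set_degree t) V (vect_degree F t) (fun_obj F) (fun_arr F))
    \<and> linear_functor (Rep_S t) (Rep_GL F t)
        (env_functor_obj S V (fun_obj F) (fun_arr F))
        (env_functor S V (fun_obj F) (fun_arr F))"
proof -
  interpret F: finite_field F using assms(1,2) by (simp add: finite_field_def finite_field_axioms_def)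
  \<comment> \<open>Indicator functions of points embed \<open>'u\<close> into the type of vectors,
    which is therefore infinite, as the construction of pullbacks of vector spaces requires.\<close>
  have "inj (\<lambda>(a :: 'u) b. if b = a then \<one>\<^bsub>F\<^esub> else \<zero>\<^bsub>F\<^esub>)"
  proof (rule injI)
    fix a b :: 'u
    assume "(\<lambda>c. if c = a then \<one>\<^bsub>F\<^esub> else \<zero>\<^bsub>F\<^esub>) = (\<lambda>c. if c = b then \<one>\<^bsub>F\<^esub> else \<zero>\<^bsub>F\<^esub>)"
    from fun_cong [OF this, of a] show "a = b" by (simp split: if_splits)
  qed
  then have "infinite (UNIV :: ('u \<Rightarrow> 'f) set)"
    using finite_imageD [of _ "UNIV :: 'u set"] finite_subset [OF subset_UNIV] infinite_UNIV by blast
  then interpret E: exact_degree_functor S "set_degree t" V "vect_degree F t" "fun_obj F" "fun_arr F"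
    unfolding S_def V_def by (rule F.exact_degree_functor_fun)
  show ?thesis
    using E.degree_preserving_functor_axioms E.pullbacks E.terminals E.tensor_envelope_functor
    by (simp add: S_def V_def)
qed

end
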